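(* Let $\mathscr{V}$ be a symmetric monoidal closed category and let $j:\mathscr{J}\to\underline{\mathscr{V}}$ be an eleutheric system of arities. Then there is an equivalence of categories $$\mathrm{Th}_{\mathscr{J}}\;\simeq\;\mathrm{Mnd}_{\mathscr{J}}(\underline{\mathscr{V}})$$ between the category $\mathrm{Th}_{\mathscr{J}}$ of $\mathscr{J}$-theories and the category $\mathrm{Mnd}_{\mathscr{J}}(\underline{\mathscr{V}})$ of $\mathscr{J}$-ary $\mathscr{V}$-monads on $\underline{\mathscr{V}}$.
   Context: $\mathscr{V}$ has unit $I$ and product $\otimes$; no completeness or cocompleteness is assumed. $\underline{\mathscr{V}}$ is $\mathscr{V}$ regarded as a $\mathscr{V}$-category. $\mathscr{V}$-categories may be large; (co)limits and Kan extensions are enriched (Kan extensions pointwise). System of arities: a fully faithful strong symmetric monoidal $\mathscr{V}$-functor $j:\mathscr{J}\to\underline{\mathscr{V}}$, with $\mathscr{J}$ a (possibly large) symmetric monoidal $\mathscr{V}$-category; we write $J$ for $j(J)$. A weight $W:\mathscr{B}^{\mathrm{op}}\to\underline{\mathscr{V}}$ is $\mathscr{J}$-flat if all $W$-weighted colimits that exist in $\underline{\mathscr{V}}$ are preserved by each $\underline{\mathscr{V}}(J,-):\underline{\mathscr{V}}\to\underline{\mathscr{V}}$, $J\in\mathrm{ob}\,\mathscr{J}$. The system $j$ is eleutheric if, for every object $V$ of $\mathscr{V}$, $\underline{\mathscr{V}}$ has all colimits weighted by $\underline{\mathscr{V}}(j-,V):\mathscr{J}^{\mathrm{op}}\to\underline{\mathscr{V}}$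 and this weight is $\mathscr{J}$-flat. A $\mathscr{J}$-cotensor in a $\mathscr{V}$-category $\mathscr{C}$ is a cotensor $[J,C]$ (characterized by $\mathscr{C}(D,[J,C])\cong\underline{\mathscr{V}}(J,\mathscr{C}(D,C))$, $\mathscr{V}$-naturally in $D$) by an object $J$ of $\mathscr{J}$. A $\mathscr{J}$-theory is a $\mathscr{V}$-category $\mathscr{T}$ with an identity-on-objects $\mathscr{V}$-functor $\tau:\mathscr{J}^{\mathrm{op}}\to\mathscr{T}$ preserving $\mathscr{J}$-cotensors. A morphism of $\mathscr{J}$-theories $(\mathscr{T},\tau)\to(\mathscr{U},\upsilon)$ is a $\mathscr{V}$-functor $M:\mathscr{T}\to\mathscr{U}$ with $M\circ\tau=\upsilon$. These form the category $\mathrm{Th}_{\mathscr{J}}$. A $\mathscr{J}$-ary $\mathscr{V}$-functor is a $\mathscr{V}$-functor that preserves left Kan extensions along $j$. A $\mathscr{J}$-ary $\mathscr{V}$-monad on $\underline{\mathscr{V}}$ is a $\mathscr{V}$-monad $(T,\eta,\mu)$ on $\underline{\mathscr{V}}$ whose underlying $\mathscr{V}$-functor $T:\underline{\mathscr{V}}\to\underline{\mathscr{V}}$ is $\mathscr{J}$-ary. $\mathrm{Mnd}_{\mathscr{J}}(\underline{\mathscr{V}})$ is the category of such, with morphisms the $\mathscr{V}$-natural transformations compatible with units and multiplications (i.e. monoid morphisms in the monoidal category of $\mathscr{J}$-ary endo-$\mathscr{V}$-functors on $\underline{\mathscr{V}}$). *)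

theory Defs
  imports Main
begin

section \<open>Ordinary categories\<close>

text \<open>Hom-sets need not be disjoint; composition does not take the objects as arguments. The arrow
  part of an ordinary functor is therefore indexed by domain and codomain.\<close>

record ('o, 'm) cat =
  Obj :: "'o set"
  Hom :: "'o \<Rightarrow> 'o \<Rightarrow> 'm set"
  Idn :: "'o \<Rightarrow> 'm"
  Comp :: "'m \<Rightarrow> 'm \<Rightarrow> 'm" (infixr "\<cdot>\<index>" 55)

definition category :: "('o, 'm, 'z) cat_scheme \<Rightarrow> bool" where
  "category C \<longleftrightarrow>
     (\<forall>A\<in>Obj C. Idn C A \<in> Hom C A A) \<and>
     (\<forall>A\<in>Obj C. \<forall>B\<in>Obj C. \<forall>D\<in>Obj C. \<forall>f\<in>Hom C A B. \<forall>g\<in>Hom C B D. g \<cdot>\<^bsub>C\<^esub> f \<in> Hom C A D) \<and>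
     (\<forall>A\<in>Obj C. \<forall>B\<in>Obj C. \<forall>f\<in>Hom C A B. f \<cdot>\<^bsub>C\<^esub> Idn C A = f \<and> Idn C B \<cdot>\<^bsub>C\<^esub> f = f) \<and>
     (\<forall>A\<in>Obj C. \<forall>B\<in>Obj C. \<forall>D\<in>Obj C. \<forall>E\<in>Obj C.
        \<forall>f\<in>Hom C A B. \<forall>g\<in>Hom C B D. \<forall>h\<in>Hom C D E.
          (h \<cdot>\<^bsub>C\<^esub> g) \<cdot>\<^bsub>C\<^esub> f = h \<cdot>\<^bsub>C\<^esub> (g \<cdot>\<^bsub>C\<^esub> f))"

definition inverse_arrows :: "('o, 'm, 'z) cat_scheme \<Rightarrow> 'o \<Rightarrow> 'o \<Rightarrow> 'm \<Rightarrow> 'm \<Rightarrow> bool" where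
  "inverse_arrows C A B f g \<longleftrightarrow>
     f \<in> Hom C A B \<and> g \<in> Hom C B A \<and> g \<cdot>\<^bsub>C\<^esub> f = Idn C A \<and> f \<cdot>\<^bsub>C\<^esub> g = Idn C B"

definition iso_arrow :: "('o, 'm, 'z) cat_scheme \<Rightarrow> 'o \<Rightarrow> 'o \<Rightarrow> 'm \<Rightarrow> bool" where
  "iso_arrow C A B f \<longleftrightarrow> (\<exists>g. inverse_arrows C A B f g)"

definition inv_arrow :: "('o, 'm, 'z) cat_scheme \<Rightarrow> 'o \<Rightarrow> 'o \<Rightarrow> 'm \<Rightarrow> 'm" where
  "inv_arrow C A B f = (THE g. inverse_arrows C A B f g)"

record ('a, 'm, 'b, 'n) ofun =
  oob :: "'a \<Rightarrow> 'b"
  omap :: "'a \<Rightarrow> 'a \<Rightarrow> 'm \<Rightarrow> 'n"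

definition ordinary_functor ::
    "('a, 'm, 'y) cat_scheme \<Rightarrow> ('b, 'n, 'z) cat_scheme \<Rightarrow> ('a, 'm, 'b, 'n) ofun \<Rightarrow> bool" where
  "ordinary_functor C D F \<longleftrightarrow>
     category C \<and> category D \<and>
     (\<forall>A\<in>Obj C. oob F A \<in> Obj D) \<and>
     (\<forall>A\<in>Obj C. \<forall>B\<in>Obj C. \<forall>f\<in>Hom C A B. omap F A B f \<in> Hom D (oob F A) (oob F B)) \<and>
     (\<forall>A\<in>Obj C. omap F A A (Idn C A) = Idn D (oob F A)) \<and>
     (\<forall>A\<in>Obj C. \<forall>B\<in>Obj C. \<forall>E\<in>Obj C. \<forall>f\<in>Hom C A B. \<forall>g\<in>Hom C B E.
        omap F A E (g \<cdot>\<^bsub>C\<^esub> f) = omap F B E g \<cdot>\<^bsub>D\<^esub> omap F A B f)"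

definition ofun_id :: "('a, 'm, 'a, 'm) ofun" where
  "ofun_id = \<lparr>oob = (\<lambda>A. A), omap = (\<lambda>A B f. f)\<rparr>"

definition ofun_comp ::
    "('b, 'n, 'c, 'p) ofun \<Rightarrow> ('a, 'm, 'b, 'n) ofun \<Rightarrow> ('a, 'm, 'c, 'p) ofun" where
  "ofun_comp G F =
     \<lparr>oob = (\<lambda>A. oob G (oob F A)),
      omap = (\<lambda>A B f. omap G (oob F A) (oob F B) (omap F A B f))\<rparr>"

definition ordinary_nat_iso ::
    "('a, 'm, 'y) cat_scheme \<Rightarrow> ('b, 'n, 'z) cat_scheme \<Rightarrow>
     ('a, 'm, 'b, 'n) ofun \<Rightarrow> ('a, 'm, 'b, 'n) ofun \<Rightarrow> ('a \<Rightarrow> 'n) \<Rightarrow> bool" where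
  "ordinary_nat_iso C D F G \<theta> \<longleftrightarrow>
     (\<forall>A\<in>Obj C. iso_arrow D (oob F A) (oob G A) (\<theta> A)) \<and>
     (\<forall>A\<in>Obj C. \<forall>B\<in>Obj C. \<forall>f\<in>Hom C A B.
        \<theta> B \<cdot>\<^bsub>D\<^esub> omap F A B f = omap G A B f \<cdot>\<^bsub>D\<^esub> \<theta> A)"

definition equivalent_categories ::
    "('a, 'm, 'y) cat_scheme \<Rightarrow> ('b, 'n, 'z) cat_scheme \<Rightarrow> bool" where
  "equivalent_categories C D \<longleftrightarrow>
     (\<exists>F G \<eta> \<epsilon>.
        ordinary_functor C D F \<and> ordinary_functor D C G \<and>
        ordinary_nat_iso C C ofun_id (ofun_comp G F) \<eta> \<and>
        ordinary_nat_iso D D (ofun_comp F G) ofun_id \<epsilon>)"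


section \<open>Symmetric monoidal closed categories\<close>

text \<open>\<open>\<otimes>\<close> is the tensor product of objects, \<open>\<odot>\<close> that of arrows. The objects of a monoidal
  category form a whole type; this loses nothing, since that type is arbitrary and a monoidal
  category has at least its unit object.\<close>

record ('o, 'm) moncat = "('o, 'm) cat" +
  ten :: "'o \<Rightarrow> 'o \<Rightarrow> 'o" (infixr "\<otimes>\<index>" 70)
  tena :: "'m \<Rightarrow> 'm \<Rightarrow> 'm" (infixr "\<odot>\<index>" 70)
  unt :: "'o" ("\<one>\<index>")
  asc :: "'o \<Rightarrow> 'o \<Rightarrow> 'o \<Rightarrow> 'm"
  lun :: "'o \<Rightarrow> 'm"
  run :: "'o \<Rightarrow> 'm"
  swp :: "'o \<Rightarrow> 'o \<Rightarrow> 'm"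

definition symmetric_monoidal :: "('o, 'm, 'z) moncat_scheme \<Rightarrow> bool" where
  "symmetric_monoidal V \<longleftrightarrow>
     category V \<and> Obj V = UNIV \<and>
     \<comment> \<open>tensor product is a functor\<close>
     (\<forall>A A' B B'. \<forall>f\<in>Hom V A A'. \<forall>g\<in>Hom V B B'. f \<odot>\<^bsub>V\<^esub> g \<in> Hom V (A \<otimes>\<^bsub>V\<^esub> B) (A' \<otimes>\<^bsub>V\<^esub> B')) \<and>
     (\<forall>A B. Idn V A \<odot>\<^bsub>V\<^esub> Idn V B = Idn V (A \<otimes>\<^bsub>V\<^esub> B)) \<and>
     (\<forall>A A' A'' B B' B''. \<forall>f\<in>Hom V A A'. \<forall>f'\<in>Hom V A' A''. \<forall>g\<in>Hom V B B'. \<forall>g'\<in>Hom V B' B''.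
        (f' \<cdot>\<^bsub>V\<^esub> f) \<odot>\<^bsub>V\<^esub> (g' \<cdot>\<^bsub>V\<^esub> g) = (f' \<odot>\<^bsub>V\<^esub> g') \<cdot>\<^bsub>V\<^esub> (f \<odot>\<^bsub>V\<^esub> g)) \<and>
     \<comment> \<open>structural isomorphisms\<close>
     (\<forall>A B C. iso_arrow V ((A \<otimes>\<^bsub>V\<^esub> B) \<otimes>\<^bsub>V\<^esub> C) (A \<otimes>\<^bsub>V\<^esub> (B \<otimes>\<^bsub>V\<^esub> C)) (asc V A B C)) \<and>
     (\<forall>A. iso_arrow V (\<one>\<^bsub>V\<^esub> \<otimes>\<^bsub>V\<^esub> A) A (lun V A)) \<and>
     (\<forall>A. iso_arrow V (A \<otimes>\<^bsub>V\<^esub> \<one>\<^bsub>V\<^esub>) A (run V A)) \<and>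
     (\<forall>A B. iso_arrow V (A \<otimes>\<^bsub>V\<^esub> B) (B \<otimes>\<^bsub>V\<^esub> A) (swp V A B)) \<and>
     \<comment> \<open>naturality\<close>
     (\<forall>A A' B B' C C'. \<forall>f\<in>Hom V A A'. \<forall>g\<in>Hom V B B'. \<forall>h\<in>Hom V C C'.
        asc V A' B' C' \<cdot>\<^bsub>V\<^esub> ((f \<odot>\<^bsub>V\<^esub> g) \<odot>\<^bsub>V\<^esub> h) = (f \<odot>\<^bsub>V\<^esub> (g \<odot>\<^bsub>V\<^esub> h)) \<cdot>\<^bsub>V\<^esub> asc V A B C) \<and>
     (\<forall>A A'. \<forall>f\<in>Hom V A A'. lun V A' \<cdot>\<^bsub>V\<^esub> (Idn V \<one>\<^bsub>V\<^esub> \<odot>\<^bsub>V\<^esub> f) = f \<cdot>\<^bsub>V\<^esub> lun V A) \<and>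
     (\<forall>A A'. \<forall>f\<in>Hom V A A'. run V A' \<cdot>\<^bsub>V\<^esub> (f \<odot>\<^bsub>V\<^esub> Idn V \<one>\<^bsub>V\<^esub>) = f \<cdot>\<^bsub>V\<^esub> run V A) \<and>
     (\<forall>A A' B B'. \<forall>f\<in>Hom V A A'. \<forall>g\<in>Hom V B B'.
        swp V A' B' \<cdot>\<^bsub>V\<^esub> (f \<odot>\<^bsub>V\<^esub> g) = (g \<odot>\<^bsub>V\<^esub> f) \<cdot>\<^bsub>V\<^esub> swp V A B) \<and>
     \<comment> \<open>coherence: pentagon, triangle, hexagon, symmetry\<close>
     (\<forall>A B C D. asc V A B (C \<otimes>\<^bsub>V\<^esub> D) \<cdot>\<^bsub>V\<^esub> asc V (A \<otimes>\<^bsub>V\<^esub> B) C D =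
        (Idn V A \<odot>\<^bsub>V\<^esub> asc V B C D) \<cdot>\<^bsub>V\<^esub> asc V A (B \<otimes>\<^bsub>V\<^esub> C) D \<cdot>\<^bsub>V\<^esub> (asc V A B C \<odot>\<^bsub>V\<^esub> Idn V D)) \<and>
     (\<forall>A B. (Idn V A \<odot>\<^bsub>V\<^esub> lun V B) \<cdot>\<^bsub>V\<^esub> asc V A \<one>\<^bsub>V\<^esub> B = run V A \<odot>\<^bsub>V\<^esub> Idn V B) \<and>
     (\<forall>A B C. asc V B C A \<cdot>\<^bsub>V\<^esub> swp V A (B \<otimes>\<^bsub>V\<^esub> C) \<cdot>\<^bsub>V\<^esub> asc V A B C =
        (Idn V B \<odot>\<^bsub>V\<^esub> swp V A C) \<cdot>\<^bsub>V\<^esub> asc V B A C \<cdot>\<^bsub>V\<^esub> (swp V A B \<odot>\<^bsub>V\<^esub> Idn V C)) \<and>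
     (\<forall>A B. swp V B A \<cdot>\<^bsub>V\<^esub> swp V A B = Idn V (A \<otimes>\<^bsub>V\<^esub> B))"

record ('o, 'm) smcc = "('o, 'm) moncat" +
  ihom :: "'o \<Rightarrow> 'o \<Rightarrow> 'o"
  evl :: "'o \<Rightarrow> 'o \<Rightarrow> 'm"

text \<open>\<open>ihom V A\<close> is right adjoint to \<open>(-) \<otimes> A\<close>.\<close>

definition symmetric_monoidal_closed :: "('o, 'm) smcc \<Rightarrow> bool" where
  "symmetric_monoidal_closed V \<longleftrightarrow>
     symmetric_monoidal V \<and>
     (\<forall>A B. evl V A B \<in> Hom V (ihom V A B \<otimes>\<^bsub>V\<^esub> A) B) \<and>
     (\<forall>X A B. \<forall>f\<in>Hom V (X \<otimes>\<^bsub>V\<^esub> A) B.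
        \<exists>!g. g \<in> Hom V X (ihom V A B) \<and> evl V A B \<cdot>\<^bsub>V\<^esub> (g \<odot>\<^bsub>V\<^esub> Idn V A) = f)"

definition curried :: "('o, 'm) smcc \<Rightarrow> 'o \<Rightarrow> 'o \<Rightarrow> 'o \<Rightarrow> 'm \<Rightarrow> 'm" where
  "curried V X A B f =
     (THE g. g \<in> Hom V X (ihom V A B) \<and> evl V A B \<cdot>\<^bsub>V\<^esub> (g \<odot>\<^bsub>V\<^esub> Idn V A) = f)"

definition asc_inv :: "('o, 'm) smcc \<Rightarrow> 'o \<Rightarrow> 'o \<Rightarrow> 'o \<Rightarrow> 'm" where
  "asc_inv V A B C =
     inv_arrow V ((A \<otimes>\<^bsub>V\<^esub> B) \<otimes>\<^bsub>V\<^esub> C) (A \<otimes>\<^bsub>V\<^esub> (B \<otimes>\<^bsub>V\<^esub> C)) (asc V A B C)"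

definition lun_inv :: "('o, 'm) smcc \<Rightarrow> 'o \<Rightarrow> 'm" where
  "lun_inv V A = inv_arrow V (\<one>\<^bsub>V\<^esub> \<otimes>\<^bsub>V\<^esub> A) A (lun V A)"

definition run_inv :: "('o, 'm) smcc \<Rightarrow> 'o \<Rightarrow> 'm" where
  "run_inv V A = inv_arrow V (A \<otimes>\<^bsub>V\<^esub> \<one>\<^bsub>V\<^esub>) A (run V A)"

text \<open>The interchange \<open>(A \<otimes> B) \<otimes> (C \<otimes> D) \<rightarrow> (A \<otimes> C) \<otimes> (B \<otimes> D)\<close>.\<close>

definition interchange :: "('o, 'm) smcc \<Rightarrow> 'o \<Rightarrow> 'o \<Rightarrow> 'o \<Rightarrow> 'o \<Rightarrow> 'm" where
  "interchange V A B C D =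
     asc_inv V A C (B \<otimes>\<^bsub>V\<^esub> D) \<cdot>\<^bsub>V\<^esub>
     (Idn V A \<odot>\<^bsub>V\<^esub> (asc V C B D \<cdot>\<^bsub>V\<^esub> (swp V B C \<odot>\<^bsub>V\<^esub> Idn V D) \<cdot>\<^bsub>V\<^esub> asc_inv V B C D)) \<cdot>\<^bsub>V\<^esub>
     asc V A B (C \<otimes>\<^bsub>V\<^esub> D)"

text \<open>The bijection between arrows \<open>A \<rightarrow> B\<close> and arrows \<open>\<one> \<rightarrow> ihom A B\<close>.\<close>

definition nm :: "('o, 'm) smcc \<Rightarrow> 'o \<Rightarrow> 'o \<Rightarrow> 'm \<Rightarrow> 'm" where
  "nm V A B f = curried V \<one>\<^bsub>V\<^esub> A B (f \<cdot>\<^bsub>V\<^esub> lun V A)"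

definition unnm :: "('o, 'm) smcc \<Rightarrow> 'o \<Rightarrow> 'o \<Rightarrow> 'm \<Rightarrow> 'm" where
  "unnm V A B g = evl V A B \<cdot>\<^bsub>V\<^esub> (g \<odot>\<^bsub>V\<^esub> Idn V A) \<cdot>\<^bsub>V\<^esub> lun_inv V A"


section \<open>Enriched categories, functors and natural transformations\<close>

record ('a, 'o, 'm) vcat =
  vhom :: "'a \<Rightarrow> 'a \<Rightarrow> 'o"
  vid :: "'a \<Rightarrow> 'm"
  vcomp :: "'a \<Rightarrow> 'a \<Rightarrow> 'a \<Rightarrow> 'm"

text \<open>\<open>vcomp C A B D : C(B,D) \<otimes> C(A,B) \<rightarrow> C(A,D)\<close>. The objects form a whole type, so that
  functors and transformations are total functions on objects and equality of them is
  equality in the logic.\<close>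

definition vcategory :: "('o, 'm) smcc \<Rightarrow> ('a, 'o, 'm, 'z) vcat_scheme \<Rightarrow> bool" where
  "vcategory V C \<longleftrightarrow>
     (\<forall>A. vid C A \<in> Hom V \<one>\<^bsub>V\<^esub> (vhom C A A)) \<and>
     (\<forall>A B D. vcomp C A B D \<in> Hom V (vhom C B D \<otimes>\<^bsub>V\<^esub> vhom C A B) (vhom C A D)) \<and>
     (\<forall>A B D E.
        vcomp C A B E \<cdot>\<^bsub>V\<^esub> (vcomp C B D E \<odot>\<^bsub>V\<^esub> Idn V (vhom C A B)) =
        vcomp C A D E \<cdot>\<^bsub>V\<^esub> (Idn V (vhom C D E) \<odot>\<^bsub>V\<^esub> vcomp C A B D) \<cdot>\<^bsub>V\<^esub>
          asc V (vhom C D E) (vhom C B D) (vhom C A B)) \<and>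
     (\<forall>A B. vcomp C A B B \<cdot>\<^bsub>V\<^esub> (vid C B \<odot>\<^bsub>V\<^esub> Idn V (vhom C A B)) = lun V (vhom C A B)) \<and>
     (\<forall>A B. vcomp C A A B \<cdot>\<^bsub>V\<^esub> (Idn V (vhom C A B) \<odot>\<^bsub>V\<^esub> vid C A) = run V (vhom C A B))"

record ('a, 'b, 'm) vfun =
  fob :: "'a \<Rightarrow> 'b"
  fmap :: "'a \<Rightarrow> 'a \<Rightarrow> 'm"

definition vfunctor ::
    "('o, 'm) smcc \<Rightarrow> ('a, 'o, 'm, 'x) vcat_scheme \<Rightarrow> ('b, 'o, 'm, 'y) vcat_scheme \<Rightarrow>
     ('a, 'b, 'm, 'z) vfun_scheme \<Rightarrow> bool" where
  "vfunctor V C D F \<longleftrightarrow>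
     (\<forall>A B. fmap F A B \<in> Hom V (vhom C A B) (vhom D (fob F A) (fob F B))) \<and>
     (\<forall>A. fmap F A A \<cdot>\<^bsub>V\<^esub> vid C A = vid D (fob F A)) \<and>
     (\<forall>A B E. fmap F A E \<cdot>\<^bsub>V\<^esub> vcomp C A B E =
        vcomp D (fob F A) (fob F B) (fob F E) \<cdot>\<^bsub>V\<^esub> (fmap F B E \<odot>\<^bsub>V\<^esub> fmap F A B))"

definition vfun_id :: "('o, 'm) smcc \<Rightarrow> ('a, 'o, 'm, 'z) vcat_scheme \<Rightarrow> ('a, 'a, 'm) vfun" where
  "vfun_id V C = \<lparr>fob = (\<lambda>A. A), fmap = (\<lambda>A B. Idn V (vhom C A B))\<rparr>"

definition vfun_comp ::
    "('o, 'm) smcc \<Rightarrow> ('b, 'c, 'm, 'y) vfun_scheme \<Rightarrow> ('a, 'b, 'm, 'z) vfun_scheme \<Rightarrow>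
     ('a, 'c, 'm) vfun" where
  "vfun_comp V G F =
     \<lparr>fob = (\<lambda>A. fob G (fob F A)),
      fmap = (\<lambda>A B. fmap G (fob F A) (fob F B) \<cdot>\<^bsub>V\<^esub> fmap F A B)\<rparr>"

definition fully_faithful ::
    "('o, 'm) smcc \<Rightarrow> ('a, 'o, 'm, 'x) vcat_scheme \<Rightarrow> ('b, 'o, 'm, 'y) vcat_scheme \<Rightarrow>
     ('a, 'b, 'm, 'z) vfun_scheme \<Rightarrow> bool" where
  "fully_faithful V C D F \<longleftrightarrow>
     (\<forall>A B. iso_arrow V (vhom C A B) (vhom D (fob F A) (fob F B)) (fmap F A B))"

text \<open>The underlying ordinary category: an arrow \<open>A \<rightarrow> B\<close> is a triple \<open>(A, f, B)\<close> with
  \<open>f : \<one> \<rightarrow> C(A,B)\<close> in \<open>V\<close>.\<close>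

type_synonym ('a, 'm) uarr = "'a \<times> 'm \<times> 'a"

definition elt :: "('a, 'm) uarr \<Rightarrow> 'm" where
  "elt \<alpha> = fst (snd \<alpha>)"

definition ucat ::
    "('o, 'm) smcc \<Rightarrow> ('a, 'o, 'm, 'z) vcat_scheme \<Rightarrow> ('a, ('a, 'm) uarr) cat" where
  "ucat V C =
     \<lparr>Obj = UNIV,
      Hom = (\<lambda>A B. {(A, f, B) | f. f \<in> Hom V \<one>\<^bsub>V\<^esub> (vhom C A B)}),
      Idn = (\<lambda>A. (A, vid C A, A)),
      Comp = (\<lambda>(B, g, D) (A, f, B').
        (A, vcomp C A B D \<cdot>\<^bsub>V\<^esub> (g \<odot>\<^bsub>V\<^esub> f) \<cdot>\<^bsub>V\<^esub> lun_inv V \<one>\<^bsub>V\<^esub>, D))\<rparr>"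

definition umap ::
    "('o, 'm) smcc \<Rightarrow> ('a, 'b, 'm, 'z) vfun_scheme \<Rightarrow> ('a, 'm) uarr \<Rightarrow> ('b, 'm) uarr" where
  "umap V F = (\<lambda>(A, f, B). (fob F A, fmap F A B \<cdot>\<^bsub>V\<^esub> f, fob F B))"

definition vnat ::
    "('o, 'm) smcc \<Rightarrow> ('a, 'o, 'm, 'x) vcat_scheme \<Rightarrow> ('b, 'o, 'm, 'y) vcat_scheme \<Rightarrow>
     ('a, 'b, 'm, 'z) vfun_scheme \<Rightarrow> ('a, 'b, 'm, 'w) vfun_scheme \<Rightarrow>
     ('a \<Rightarrow> ('b, 'm) uarr) \<Rightarrow> bool" where
  "vnat V C D F G \<alpha> \<longleftrightarrow>
     (\<forall>A. \<alpha> A \<in> Hom (ucat V D) (fob F A) (fob G A)) \<and>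
     (\<forall>A B.
        vcomp D (fob F A) (fob F B) (fob G B) \<cdot>\<^bsub>V\<^esub> (elt (\<alpha> B) \<odot>\<^bsub>V\<^esub> fmap F A B) \<cdot>\<^bsub>V\<^esub>
          lun_inv V (vhom C A B) =
        vcomp D (fob F A) (fob G A) (fob G B) \<cdot>\<^bsub>V\<^esub> (fmap G A B \<odot>\<^bsub>V\<^esub> elt (\<alpha> A)) \<cdot>\<^bsub>V\<^esub>
          run_inv V (vhom C A B))"

definition vnat_iso ::
    "('o, 'm) smcc \<Rightarrow> ('a, 'o, 'm, 'x) vcat_scheme \<Rightarrow> ('b, 'o, 'm, 'y) vcat_scheme \<Rightarrow>
     ('a, 'b, 'm, 'z) vfun_scheme \<Rightarrow> ('a, 'b, 'm, 'w) vfun_scheme \<Rightarrow>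
     ('a \<Rightarrow> ('b, 'm) uarr) \<Rightarrow> bool" where
  "vnat_iso V C D F G \<alpha> \<longleftrightarrow>
     vnat V C D F G \<alpha> \<and> (\<forall>A. iso_arrow (ucat V D) (fob F A) (fob G A) (\<alpha> A))"


section \<open>Opposites, tensor products, and the enrichment of the base over itself\<close>

definition vop :: "('o, 'm) smcc \<Rightarrow> ('a, 'o, 'm, 'z) vcat_scheme \<Rightarrow> ('a, 'o, 'm) vcat" where
  "vop V C =
     \<lparr>vhom = (\<lambda>A B. vhom C B A),
      vid = vid C,
      vcomp = (\<lambda>A B D. vcomp C D B A \<cdot>\<^bsub>V\<^esub> swp V (vhom C D B) (vhom C B A))\<rparr>"

definition vfun_op :: "('a, 'b, 'm, 'z) vfun_scheme \<Rightarrow> ('a, 'b, 'm) vfun" where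
  "vfun_op F = \<lparr>fob = fob F, fmap = (\<lambda>A B. fmap F B A)\<rparr>"

definition vtensor ::
    "('o, 'm) smcc \<Rightarrow> ('a, 'o, 'm, 'y) vcat_scheme \<Rightarrow> ('b, 'o, 'm, 'z) vcat_scheme \<Rightarrow>
     ('a \<times> 'b, 'o, 'm) vcat" where
  "vtensor V C D =
     \<lparr>vhom = (\<lambda>(A, B) (A', B'). vhom C A A' \<otimes>\<^bsub>V\<^esub> vhom D B B'),
      vid = (\<lambda>(A, B). (vid C A \<odot>\<^bsub>V\<^esub> vid D B) \<cdot>\<^bsub>V\<^esub> lun_inv V \<one>\<^bsub>V\<^esub>),
      vcomp = (\<lambda>(A, B) (A', B') (A'', B'').
        (vcomp C A A' A'' \<odot>\<^bsub>V\<^esub> vcomp D B B' B'') \<cdot>\<^bsub>V\<^esub>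
        interchange V (vhom C A' A'') (vhom D B' B'') (vhom C A A') (vhom D B B'))\<rparr>"

definition vfun_tensor ::
    "('o, 'm) smcc \<Rightarrow> ('a, 'c, 'm, 'y) vfun_scheme \<Rightarrow> ('b, 'd, 'm, 'z) vfun_scheme \<Rightarrow>
     ('a \<times> 'b, 'c \<times> 'd, 'm) vfun" where
  "vfun_tensor V F G =
     \<lparr>fob = (\<lambda>(A, B). (fob F A, fob G B)),
      fmap = (\<lambda>(A, B) (A', B'). fmap F A A' \<odot>\<^bsub>V\<^esub> fmap G B B')\<rparr>"

text \<open>The canonical isomorphisms \<open>(C \<otimes> D) \<otimes> E \<rightarrow> C \<otimes> (D \<otimes> E)\<close> and \<open>C \<otimes> D \<rightarrow> D \<otimes> C\<close>, and the
  functors \<open>(U, -) : C \<rightarrow> C \<otimes> C\<close> and \<open>(-, U) : C \<rightarrow> C \<otimes> C\<close>.\<close>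

definition vfun_asc ::
    "('o, 'm) smcc \<Rightarrow> ('a, 'o, 'm, 'x) vcat_scheme \<Rightarrow> ('b, 'o, 'm, 'y) vcat_scheme \<Rightarrow>
     ('c, 'o, 'm, 'z) vcat_scheme \<Rightarrow> (('a \<times> 'b) \<times> 'c, 'a \<times> 'b \<times> 'c, 'm) vfun" where
  "vfun_asc V C D E =
     \<lparr>fob = (\<lambda>((A, B), X). (A, (B, X))),
      fmap = (\<lambda>((A, B), X) ((A', B'), X'). asc V (vhom C A A') (vhom D B B') (vhom E X X'))\<rparr>"

definition vfun_swp ::
    "('o, 'm) smcc \<Rightarrow> ('a, 'o, 'm, 'y) vcat_scheme \<Rightarrow> ('b, 'o, 'm, 'z) vcat_scheme \<Rightarrow>
     ('a \<times> 'b, 'b \<times> 'a, 'm) vfun" where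
  "vfun_swp V C D =
     \<lparr>fob = (\<lambda>(A, B). (B, A)),
      fmap = (\<lambda>(A, B) (A', B'). swp V (vhom C A A') (vhom D B B'))\<rparr>"

definition vfun_insl ::
    "('o, 'm) smcc \<Rightarrow> ('a, 'o, 'm, 'z) vcat_scheme \<Rightarrow> 'a \<Rightarrow> ('a, 'a \<times> 'a, 'm) vfun" where
  "vfun_insl V C U =
     \<lparr>fob = (\<lambda>A. (U, A)),
      fmap = (\<lambda>A B. (vid C U \<odot>\<^bsub>V\<^esub> Idn V (vhom C A B)) \<cdot>\<^bsub>V\<^esub> lun_inv V (vhom C A B))\<rparr>"

definition vfun_insr ::
    "('o, 'm) smcc \<Rightarrow> ('a, 'o, 'm, 'z) vcat_scheme \<Rightarrow> 'a \<Rightarrow> ('a, 'a \<times> 'a, 'm) vfun" where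
  "vfun_insr V C U =
     \<lparr>fob = (\<lambda>A. (A, U)),
      fmap = (\<lambda>A B. (Idn V (vhom C A B) \<odot>\<^bsub>V\<^esub> vid C U) \<cdot>\<^bsub>V\<^esub> run_inv V (vhom C A B))\<rparr>"

definition vself :: "('o, 'm) smcc \<Rightarrow> ('o, 'o, 'm) vcat" where
  "vself V =
     \<lparr>vhom = ihom V,
      vid = (\<lambda>A. nm V A A (Idn V A)),
      vcomp = (\<lambda>A B D. curried V (ihom V B D \<otimes>\<^bsub>V\<^esub> ihom V A B) A D
        (evl V B D \<cdot>\<^bsub>V\<^esub> (Idn V (ihom V B D) \<odot>\<^bsub>V\<^esub> evl V A B) \<cdot>\<^bsub>V\<^esub>
           asc V (ihom V B D) (ihom V A B) A))\<rparr>"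

definition uname :: "('o, 'm) smcc \<Rightarrow> 'o \<Rightarrow> 'o \<Rightarrow> 'm \<Rightarrow> ('o, 'm) uarr" where
  "uname V A B f = (A, nm V A B f, B)"

text \<open>The representable functor \<open>C(A, -) : C \<rightarrow> V\<close>; the contravariant one \<open>C(-, A)\<close> is
  \<open>vrep V (vop V C) A\<close>. For \<open>D : B \<rightarrow> C\<close>, \<open>vrep_along V C D X\<close> is \<open>C(D-, X) : B^op \<rightarrow> V\<close>.\<close>

definition vrep ::
    "('o, 'm) smcc \<Rightarrow> ('a, 'o, 'm, 'z) vcat_scheme \<Rightarrow> 'a \<Rightarrow> ('a, 'o, 'm) vfun" where
  "vrep V C A =
     \<lparr>fob = (\<lambda>B. vhom C A B),
      fmap = (\<lambda>B D. curried V (vhom C B D) (vhom C A B) (vhom C A D) (vcomp C A B D))\<rparr>"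

definition vrep_along ::
    "('o, 'm) smcc \<Rightarrow> ('c, 'o, 'm, 'y) vcat_scheme \<Rightarrow> ('b, 'c, 'm, 'z) vfun_scheme \<Rightarrow> 'c \<Rightarrow>
     ('b, 'o, 'm) vfun" where
  "vrep_along V C D X = vfun_comp V (vrep V (vop V C) X) (vfun_op D)"


section \<open>Symmetric monoidal enriched categories and functors\<close>

record ('a, 'o, 'm) smvcat = "('a, 'o, 'm) vcat" +
  tenF :: "('a \<times> 'a, 'a, 'm) vfun"
  vunt :: "'a"
  vasc :: "'a \<Rightarrow> 'a \<Rightarrow> 'a \<Rightarrow> ('a, 'm) uarr"
  vlun :: "'a \<Rightarrow> ('a, 'm) uarr"
  vrun :: "'a \<Rightarrow> ('a, 'm) uarr"
  vswp :: "'a \<Rightarrow> 'a \<Rightarrow> ('a, 'm) uarr"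

definition umoncat ::
    "('o, 'm) smcc \<Rightarrow> ('a, 'o, 'm) smvcat \<Rightarrow> ('a, ('a, 'm) uarr) moncat" where
  "umoncat V C =
     \<lparr>Obj = Obj (ucat V C), Hom = Hom (ucat V C), Idn = Idn (ucat V C), Comp = Comp (ucat V C),
      ten = (\<lambda>A B. fob (tenF C) (A, B)),
      tena = (\<lambda>(A, f, A') (B, g, B').
        (fob (tenF C) (A, B),
         fmap (tenF C) (A, B) (A', B') \<cdot>\<^bsub>V\<^esub> (f \<odot>\<^bsub>V\<^esub> g) \<cdot>\<^bsub>V\<^esub> lun_inv V \<one>\<^bsub>V\<^esub>,
         fob (tenF C) (A', B'))),
      unt = vunt C, asc = vasc C, lun = vlun C, run = vrun C, swp = vswp C\<rparr>"

definition symmetric_monoidal_vcategory :: "('o, 'm) smcc \<Rightarrow> ('a, 'o, 'm) smvcat \<Rightarrow> bool" where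
  "symmetric_monoidal_vcategory V C \<longleftrightarrow>
     vcategory V C \<and>
     vfunctor V (vtensor V C C) C (tenF C) \<and>
     vnat V (vtensor V (vtensor V C C) C) C
       (vfun_comp V (tenF C) (vfun_tensor V (tenF C) (vfun_id V C)))
       (vfun_comp V (tenF C)
          (vfun_comp V (vfun_tensor V (vfun_id V C) (tenF C)) (vfun_asc V C C C)))
       (\<lambda>((A, B), X). vasc C A B X) \<and>
     vnat V C C (vfun_comp V (tenF C) (vfun_insl V C (vunt C))) (vfun_id V C) (vlun C) \<and>
     vnat V C C (vfun_comp V (tenF C) (vfun_insr V C (vunt C))) (vfun_id V C) (vrun C) \<and>
     vnat V (vtensor V C C) C (tenF C) (vfun_comp V (tenF C) (vfun_swp V C C))
       (\<lambda>(A, B). vswp C A B) \<and>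
     symmetric_monoidal (umoncat V C)"

definition vself_monoidal :: "('o, 'm) smcc \<Rightarrow> ('o, 'o, 'm) smvcat" where
  "vself_monoidal V =
     \<lparr>vhom = vhom (vself V), vid = vid (vself V), vcomp = vcomp (vself V),
      tenF =
        \<lparr>fob = (\<lambda>(A, B). A \<otimes>\<^bsub>V\<^esub> B),
         fmap = (\<lambda>(A, B) (A', B').
           curried V (ihom V A A' \<otimes>\<^bsub>V\<^esub> ihom V B B') (A \<otimes>\<^bsub>V\<^esub> B) (A' \<otimes>\<^bsub>V\<^esub> B')
             ((evl V A A' \<odot>\<^bsub>V\<^esub> evl V B B') \<cdot>\<^bsub>V\<^esub> interchange V (ihom V A A') (ihom V B B') A B))\<rparr>,
      vunt = \<one>\<^bsub>V\<^esub>,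
      vasc = (\<lambda>A B C. uname V ((A \<otimes>\<^bsub>V\<^esub> B) \<otimes>\<^bsub>V\<^esub> C) (A \<otimes>\<^bsub>V\<^esub> (B \<otimes>\<^bsub>V\<^esub> C)) (asc V A B C)),
      vlun = (\<lambda>A. uname V (\<one>\<^bsub>V\<^esub> \<otimes>\<^bsub>V\<^esub> A) A (lun V A)),
      vrun = (\<lambda>A. uname V (A \<otimes>\<^bsub>V\<^esub> \<one>\<^bsub>V\<^esub>) A (run V A)),
      vswp = (\<lambda>A B. uname V (A \<otimes>\<^bsub>V\<^esub> B) (B \<otimes>\<^bsub>V\<^esub> A) (swp V A B))\<rparr>"

text \<open>\<open>mon2 A B : F A \<otimes> F B \<rightarrow> F (A \<otimes> B)\<close> and \<open>mon0 : \<one> \<rightarrow> F \<one>\<close>.\<close>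

record ('a, 'b, 'm) smvfun = "('a, 'b, 'm) vfun" +
  mon2 :: "'a \<Rightarrow> 'a \<Rightarrow> ('b, 'm) uarr"
  mon0 :: "('b, 'm) uarr"

definition strong_symmetric_monoidal_vfunctor ::
    "('o, 'm) smcc \<Rightarrow> ('a, 'o, 'm) smvcat \<Rightarrow> ('b, 'o, 'm) smvcat \<Rightarrow> ('a, 'b, 'm) smvfun \<Rightarrow> bool" where
  "strong_symmetric_monoidal_vfunctor V C D F \<longleftrightarrow>
     vfunctor V C D F \<and>
     vnat_iso V (vtensor V C C) D
       (vfun_comp V (tenF D) (vfun_tensor V F F)) (vfun_comp V F (tenF C))
       (\<lambda>(A, B). mon2 F A B) \<and>
     iso_arrow (ucat V D) (vunt D) (fob F (vunt C)) (mon0 F) \<and>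
     (let C0 = umoncat V C; D0 = umoncat V D in
       (\<forall>A B X.
          umap V F (asc C0 A B X) \<cdot>\<^bsub>D0\<^esub> mon2 F (A \<otimes>\<^bsub>C0\<^esub> B) X \<cdot>\<^bsub>D0\<^esub> (mon2 F A B \<odot>\<^bsub>D0\<^esub> Idn D0 (fob F X)) =
          mon2 F A (B \<otimes>\<^bsub>C0\<^esub> X) \<cdot>\<^bsub>D0\<^esub> (Idn D0 (fob F A) \<odot>\<^bsub>D0\<^esub> mon2 F B X) \<cdot>\<^bsub>D0\<^esub>
            asc D0 (fob F A) (fob F B) (fob F X)) \<and>
       (\<forall>A. umap V F (lun C0 A) \<cdot>\<^bsub>D0\<^esub> mon2 F \<one>\<^bsub>C0\<^esub> A \<cdot>\<^bsub>D0\<^esub> (mon0 F \<odot>\<^bsub>D0\<^esub> Idn D0 (fob F A)) =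
          lun D0 (fob F A)) \<and>
       (\<forall>A. umap V F (run C0 A) \<cdot>\<^bsub>D0\<^esub> mon2 F A \<one>\<^bsub>C0\<^esub> \<cdot>\<^bsub>D0\<^esub> (Idn D0 (fob F A) \<odot>\<^bsub>D0\<^esub> mon0 F) =
          run D0 (fob F A)) \<and>
       (\<forall>A B. umap V F (swp C0 A B) \<cdot>\<^bsub>D0\<^esub> mon2 F A B =
          mon2 F B A \<cdot>\<^bsub>D0\<^esub> swp D0 (fob F A) (fob F B)))"


section \<open>Weighted colimits, Kan extensions and cotensors\<close>

text \<open>A family \<open>\<beta> A : X \<rightarrow> D(P A, Q A)\<close> that is (extraordinarily) \<open>V\<close>-natural in \<open>A\<close>. Both sides of
  the equation are arrows \<open>C(A,B) \<otimes> X \<rightarrow> D(P A, Q B)\<close>.\<close>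

definition vnat_family ::
    "('o, 'm) smcc \<Rightarrow> ('a, 'o, 'm, 'x) vcat_scheme \<Rightarrow> ('b, 'o, 'm, 'y) vcat_scheme \<Rightarrow>
     ('a, 'b, 'm, 'z) vfun_scheme \<Rightarrow> ('a, 'b, 'm, 'w) vfun_scheme \<Rightarrow> 'o \<Rightarrow> ('a \<Rightarrow> 'm) \<Rightarrow> bool" where
  "vnat_family V C D P Q X \<beta> \<longleftrightarrow>
     (\<forall>A. \<beta> A \<in> Hom V X (vhom D (fob P A) (fob Q A))) \<and>
     (\<forall>A B.
        vcomp D (fob P A) (fob Q A) (fob Q B) \<cdot>\<^bsub>V\<^esub> (fmap Q A B \<odot>\<^bsub>V\<^esub> \<beta> A) =
        vcomp D (fob P A) (fob P B) (fob Q B) \<cdot>\<^bsub>V\<^esub> (\<beta> B \<odot>\<^bsub>V\<^esub> fmap P A B) \<cdot>\<^bsub>V\<^esub>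
          swp V (vhom C A B) X)"

text \<open>\<open>K\<close> with \<open>\<kappa>\<close> is an object of \<open>V\<close>-natural transformations, i.e. an end of \<open>D(P-, Q-)\<close> in \<open>V\<close>. No
  completeness of \<open>V\<close> is assumed, so its existence is part of the notion of a weighted colimit.\<close>

definition vnat_object ::
    "('o, 'm) smcc \<Rightarrow> ('a, 'o, 'm, 'x) vcat_scheme \<Rightarrow> ('b, 'o, 'm, 'y) vcat_scheme \<Rightarrow>
     ('a, 'b, 'm, 'z) vfun_scheme \<Rightarrow> ('a, 'b, 'm, 'w) vfun_scheme \<Rightarrow> 'o \<Rightarrow> ('a \<Rightarrow> 'm) \<Rightarrow> bool" where
  "vnat_object V C D P Q K \<kappa> \<longleftrightarrow>
     vnat_family V C D P Q K \<kappa> \<and>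
     (\<forall>X \<beta>. vnat_family V C D P Q X \<beta> \<longrightarrow>
        (\<exists>!h. h \<in> Hom V X K \<and> (\<forall>A. \<kappa> A \<cdot>\<^bsub>V\<^esub> h = \<beta> A)))"

text \<open>For a weight \<open>W : B^op \<rightarrow> V\<close> and \<open>D : B \<rightarrow> C\<close>, the object \<open>L\<close> with the cylinder
  \<open>\<lambda> : W \<rightarrow> C(D-, L)\<close> is the colimit of \<open>D\<close> weighted by \<open>W\<close>: for every \<open>X\<close> the induced family
  \<open>C(L, X) \<rightarrow> [W b, C(D b, X)]\<close> exhibits \<open>C(L, X)\<close> as the object of \<open>V\<close>-natural transformations
  \<open>W \<rightarrow> C(D-, X)\<close>.\<close>

definition weighted_colimit ::
    "('o, 'm) smcc \<Rightarrow> ('b, 'o, 'm, 'x) vcat_scheme \<Rightarrow> ('c, 'o, 'm, 'y) vcat_scheme \<Rightarrow>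
     ('b, 'o, 'm, 'w) vfun_scheme \<Rightarrow> ('b, 'c, 'm, 'z) vfun_scheme \<Rightarrow>
     'c \<Rightarrow> ('b \<Rightarrow> ('o, 'm) uarr) \<Rightarrow> bool" where
  "weighted_colimit V B C W D L cyl \<longleftrightarrow>
     vnat V (vop V B) (vself V) W (vrep_along V C D L) cyl \<and>
     (\<forall>X. vnat_object V (vop V B) (vself V) W (vrep_along V C D X) (vhom C L X)
        (\<lambda>b. vcomp (vself V) (fob W b) (vhom C (fob D b) L) (vhom C (fob D b) X) \<cdot>\<^bsub>V\<^esub>
             (fmap (vrep V C (fob D b)) L X \<odot>\<^bsub>V\<^esub> elt (cyl b)) \<cdot>\<^bsub>V\<^esub>
             run_inv V (vhom C L X)))"

definition image_cylinder ::
    "('o, 'm) smcc \<Rightarrow> ('c, 'o, 'm, 'x) vcat_scheme \<Rightarrow> ('e, 'o, 'm, 'y) vcat_scheme \<Rightarrow>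
     ('c, 'e, 'm, 'w) vfun_scheme \<Rightarrow> ('b, 'c, 'm, 'z) vfun_scheme \<Rightarrow>
     'c \<Rightarrow> ('b \<Rightarrow> ('o, 'm) uarr) \<Rightarrow> 'b \<Rightarrow> ('o, 'm) uarr" where
  "image_cylinder V C E F D L cyl =
     (\<lambda>b. uname V (vhom C (fob D b) L) (vhom E (fob F (fob D b)) (fob F L)) (fmap F (fob D b) L)
            \<cdot>\<^bsub>ucat V (vself V)\<^esub> cyl b)"

definition preserves_weighted_colimits ::
    "('o, 'm) smcc \<Rightarrow> ('b, 'o, 'm, 'x) vcat_scheme \<Rightarrow> ('c, 'o, 'm, 'y) vcat_scheme \<Rightarrow>
     ('e, 'o, 'm, 'z) vcat_scheme \<Rightarrow> ('b, 'o, 'm) vfun \<Rightarrow> ('c, 'e, 'm) vfun \<Rightarrow> bool" where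
  "preserves_weighted_colimits V B C E W F \<longleftrightarrow>
     (\<forall>(D :: ('b, 'c, 'm) vfun) L cyl.
        vfunctor V B C D \<longrightarrow> weighted_colimit V B C W D L cyl \<longrightarrow>
        weighted_colimit V B E W (vfun_comp V F D) (fob F L) (image_cylinder V C E F D L cyl))"

text \<open>Pointwise left Kan extension of \<open>S : A \<rightarrow> C\<close> along \<open>K : A \<rightarrow> B\<close>: the value \<open>L b\<close> is the colimit of
  \<open>S\<close> weighted by \<open>B(K-, b)\<close>, with cylinder
  \<open>B(K a, b) \<rightarrow> C(L (K a), L b) \<rightarrow> C(S a, L b)\<close> given by \<open>L\<close> and precomposition with \<open>\<gamma> a\<close>.\<close>

definition left_kan ::
    "('o, 'm) smcc \<Rightarrow> ('a, 'o, 'm, 'x) vcat_scheme \<Rightarrow> ('b, 'o, 'm, 'y) vcat_scheme \<Rightarrow>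
     ('c, 'o, 'm, 'z) vcat_scheme \<Rightarrow> ('a, 'b, 'm, 'w) vfun_scheme \<Rightarrow>
     ('a, 'c, 'm) vfun \<Rightarrow> ('b, 'c, 'm) vfun \<Rightarrow> ('a \<Rightarrow> ('c, 'm) uarr) \<Rightarrow> bool" where
  "left_kan V A B C K S L \<gamma> \<longleftrightarrow>
     vfunctor V B C L \<and>
     vnat V A C S (vfun_comp V L K) \<gamma> \<and>
     (\<forall>b. weighted_colimit V A C (vrep_along V B K b) S (fob L b)
        (\<lambda>a. uname V (vhom B (fob K a) b) (vhom C (fob S a) (fob L b))
           (vcomp C (fob S a) (fob L (fob K a)) (fob L b) \<cdot>\<^bsub>V\<^esub>
            (fmap L (fob K a) b \<odot>\<^bsub>V\<^esub> elt (\<gamma> a)) \<cdot>\<^bsub>V\<^esub>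
            run_inv V (vhom B (fob K a) b))))"

definition preserves_left_kan ::
    "('o, 'm) smcc \<Rightarrow> ('a, 'o, 'm, 'x) vcat_scheme \<Rightarrow> ('b, 'o, 'm, 'y) vcat_scheme \<Rightarrow>
     ('c, 'o, 'm, 'z) vcat_scheme \<Rightarrow> ('e, 'o, 'm, 'v) vcat_scheme \<Rightarrow>
     ('a, 'b, 'm, 'w) vfun_scheme \<Rightarrow> ('c, 'e, 'm) vfun \<Rightarrow> bool" where
  "preserves_left_kan V A B C E K F \<longleftrightarrow>
     (\<forall>S L \<gamma>. vfunctor V A C S \<longrightarrow> left_kan V A B C K S L \<gamma> \<longrightarrow>
        left_kan V A B E K (vfun_comp V F S) (vfun_comp V F L) (\<lambda>a. umap V F (\<gamma> a)))"

text \<open>\<open>P\<close> is a cotensor \<open>[X, A]\<close> in \<open>C\<close>: \<open>\<phi>\<close> is a \<open>V\<close>-natural isomorphism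
  \<open>C(-, P) \<cong> [X, C(-, A)]\<close> of functors \<open>C^op \<rightarrow> V\<close>. Its counit \<open>X \<rightarrow> C(P, A)\<close> is \<open>\<phi>\<close> evaluated at the
  identity of \<open>P\<close>.\<close>

definition cotensor ::
    "('o, 'm) smcc \<Rightarrow> ('c, 'o, 'm, 'z) vcat_scheme \<Rightarrow> 'o \<Rightarrow> 'c \<Rightarrow> 'c \<Rightarrow>
     ('c \<Rightarrow> ('o, 'm) uarr) \<Rightarrow> bool" where
  "cotensor V C X A P \<phi> \<longleftrightarrow>
     vnat_iso V (vop V C) (vself V)
       (vrep V (vop V C) P)
       (vfun_comp V (vrep V (vself V) X) (vrep V (vop V C) A)) \<phi>"

definition cotensor_counit ::
    "('o, 'm) smcc \<Rightarrow> ('c, 'o, 'm, 'z) vcat_scheme \<Rightarrow> 'o \<Rightarrow> 'c \<Rightarrow> 'c \<Rightarrow>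
     ('c \<Rightarrow> ('o, 'm) uarr) \<Rightarrow> ('o, 'm) uarr" where
  "cotensor_counit V C X A P \<phi> =
     (X, unnm V (vhom C P P) (ihom V X (vhom C P A)) (elt (\<phi> P)) \<cdot>\<^bsub>V\<^esub> vid C P, vhom C P A)"

definition preserves_cotensors ::
    "('o, 'm) smcc \<Rightarrow> ('c, 'o, 'm, 'y) vcat_scheme \<Rightarrow> ('e, 'o, 'm, 'z) vcat_scheme \<Rightarrow> 'o \<Rightarrow>
     ('c, 'e, 'm) vfun \<Rightarrow> bool" where
  "preserves_cotensors V C E X F \<longleftrightarrow>
     (\<forall>A P \<phi>. cotensor V C X A P \<phi> \<longrightarrow>
        (\<exists>\<psi>. cotensor V E X (fob F A) (fob F P) \<psi> \<and>
           cotensor_counit V E X (fob F A) (fob F P) \<psi> =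
             uname V (vhom C P A) (vhom E (fob F P) (fob F A)) (fmap F P A)
               \<cdot>\<^bsub>ucat V (vself V)\<^esub> cotensor_counit V C X A P \<phi>))"


section \<open>Systems of arities, theories and monads\<close>

definition system_of_arities ::
    "('o, 'm) smcc \<Rightarrow> ('j, 'o, 'm) smvcat \<Rightarrow> ('j, 'o, 'm) smvfun \<Rightarrow> bool" where
  "system_of_arities V J j \<longleftrightarrow>
     symmetric_monoidal_vcategory V J \<and>
     strong_symmetric_monoidal_vfunctor V J (vself_monoidal V) j \<and>
     fully_faithful V J (vself V) j"

definition J_flat ::
    "('o, 'm) smcc \<Rightarrow> ('j, 'o, 'm) smvfun \<Rightarrow> ('b, 'o, 'm, 'z) vcat_scheme \<Rightarrow>
     ('b, 'o, 'm) vfun \<Rightarrow> bool" where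
  "J_flat V j B W \<longleftrightarrow>
     (\<forall>X. preserves_weighted_colimits V B (vself V) (vself V) W (vrep V (vself V) (fob j X)))"

definition eleutheric ::
    "('o, 'm) smcc \<Rightarrow> ('j, 'o, 'm) smvcat \<Rightarrow> ('j, 'o, 'm) smvfun \<Rightarrow> bool" where
  "eleutheric V J j \<longleftrightarrow>
     (\<forall>Y. (\<forall>D :: ('j, 'o, 'm) vfun. vfunctor V J (vself V) D \<longrightarrow>
             (\<exists>L cyl. weighted_colimit V J (vself V) (vrep_along V (vself V) j Y) D L cyl)) \<and>
          J_flat V j J (vrep_along V (vself V) j Y))"

record ('j, 'o, 'm) jtheory =
  thcat :: "('j, 'o, 'm) vcat"
  thfun :: "('j, 'j, 'm) vfun"

definition is_jtheory ::
    "('o, 'm) smcc \<Rightarrow> ('j, 'o, 'm) smvcat \<Rightarrow> ('j, 'o, 'm) smvfun \<Rightarrow> ('j, 'o, 'm) jtheory \<Rightarrow> bool" where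
  "is_jtheory V J j T \<longleftrightarrow>
     vcategory V (thcat T) \<and>
     vfunctor V (vop V J) (thcat T) (thfun T) \<and>
     fob (thfun T) = (\<lambda>A. A) \<and>
     (\<forall>X. preserves_cotensors V (vop V J) (thcat T) (fob j X) (thfun T))"

definition Th ::
    "('o, 'm) smcc \<Rightarrow> ('j, 'o, 'm) smvcat \<Rightarrow> ('j, 'o, 'm) smvfun \<Rightarrow>
     (('j, 'o, 'm) jtheory, ('j, 'j, 'm) vfun) cat" where
  "Th V J j =
     \<lparr>Obj = {T. is_jtheory V J j T},
      Hom = (\<lambda>T U. {M. vfunctor V (thcat T) (thcat U) M \<and> vfun_comp V M (thfun T) = thfun U}),
      Idn = (\<lambda>T. vfun_id V (thcat T)),
      Comp = vfun_comp V\<rparr>"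

definition J_ary ::
    "('o, 'm) smcc \<Rightarrow> ('j, 'o, 'm) smvcat \<Rightarrow> ('j, 'o, 'm) smvfun \<Rightarrow>
     ('c, 'o, 'm, 'y) vcat_scheme \<Rightarrow> ('e, 'o, 'm, 'z) vcat_scheme \<Rightarrow> ('c, 'e, 'm) vfun \<Rightarrow> bool" where
  "J_ary V J j C E F \<longleftrightarrow> vfunctor V C E F \<and> preserves_left_kan V J (vself V) C E j F"

record ('a, 'm) vmonad =
  mfun :: "('a, 'a, 'm) vfun"
  munit :: "'a \<Rightarrow> ('a, 'm) uarr"
  mmult :: "'a \<Rightarrow> ('a, 'm) uarr"

definition is_vmonad ::
    "('o, 'm) smcc \<Rightarrow> ('a, 'o, 'm, 'z) vcat_scheme \<Rightarrow> ('a, 'm) vmonad \<Rightarrow> bool" where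
  "is_vmonad V C M \<longleftrightarrow>
     (let T = mfun M; \<eta> = munit M; \<mu> = mmult M; C0 = ucat V C in
        vfunctor V C C T \<and>
        vnat V C C (vfun_id V C) T \<eta> \<and>
        vnat V C C (vfun_comp V T T) T \<mu> \<and>
        (\<forall>A. \<mu> A \<cdot>\<^bsub>C0\<^esub> umap V T (\<mu> A) = \<mu> A \<cdot>\<^bsub>C0\<^esub> \<mu> (fob T A)) \<and>
        (\<forall>A. \<mu> A \<cdot>\<^bsub>C0\<^esub> umap V T (\<eta> A) = Idn C0 (fob T A)) \<and>
        (\<forall>A. \<mu> A \<cdot>\<^bsub>C0\<^esub> \<eta> (fob T A) = Idn C0 (fob T A)))"

definition vmonad_morphism ::
    "('o, 'm) smcc \<Rightarrow> ('a, 'o, 'm, 'z) vcat_scheme \<Rightarrow> ('a, 'm) vmonad \<Rightarrow> ('a, 'm) vmonad \<Rightarrow>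
     ('a \<Rightarrow> ('a, 'm) uarr) \<Rightarrow> bool" where
  "vmonad_morphism V C M N \<alpha> \<longleftrightarrow>
     (let C0 = ucat V C in
        vnat V C C (mfun M) (mfun N) \<alpha> \<and>
        (\<forall>A. \<alpha> A \<cdot>\<^bsub>C0\<^esub> munit M A = munit N A) \<and>
        (\<forall>A. \<alpha> A \<cdot>\<^bsub>C0\<^esub> mmult M A =
           mmult N A \<cdot>\<^bsub>C0\<^esub> \<alpha> (fob (mfun N) A) \<cdot>\<^bsub>C0\<^esub> umap V (mfun M) (\<alpha> A)))"

definition Mnd ::
    "('o, 'm) smcc \<Rightarrow> ('j, 'o, 'm) smvcat \<Rightarrow> ('j, 'o, 'm) smvfun \<Rightarrow>
     (('o, 'm) vmonad, 'o \<Rightarrow> ('o, 'm) uarr) cat" where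
  "Mnd V J j =
     \<lparr>Obj = {M. is_vmonad V (vself V) M \<and> J_ary V J j (vself V) (vself V) (mfun M)},
      Hom = (\<lambda>M N. {\<alpha>. vmonad_morphism V (vself V) M N \<alpha>}),
      Idn = (\<lambda>M A. Idn (ucat V (vself V)) (fob (mfun M) A)),
      Comp = (\<lambda>\<beta> \<alpha> A. \<beta> A \<cdot>\<^bsub>ucat V (vself V)\<^esub> \<alpha> A)\<rparr>"

end

theory Submission
  imports Defs
begin

text \<open>
The two categories are compared through a third notion. Write \<open>K a\<close> for the object of the base at
which the arity \<open>a\<close> sits. A \<^emph>\<open>relative monad\<close> along \<open>K\<close> consists of objects \<open>S a\<close>, units
\<open>K a \<rightarrow> S a\<close>, and an extension of every arrow \<open>X \<otimes> K a \<rightarrow> S b\<close> to an arrow \<open>X \<otimes> S a \<rightarrow> S b\<close>, natural in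
\<open>X\<close> and subject to the three laws of a Kleisli triple. The parameter \<open>X\<close> carries the enrichment.

Theories are relative monads along \<open>K\<close>. If \<open>D\<close> is the opposite of a theory, then in \<open>D\<close> every arity \<open>b\<close>
is the tensor of the unit arity \<open>i\<close> by \<open>K b\<close>, because it is so among the arities and tensors are
preserved. Hence \<open>D(b, c)\<close> is the internal hom from \<open>K b\<close> to \<open>S c = D(i, c)\<close>, and composition in \<open>D\<close> is an
extension operation (\<open>theory_presented\<close>). Conversely the Kleisli category of a relative monad is the
opposite of a theory (\<open>klthy\<close>): a tensor of arities is a tensor product in the base
(\<open>tensorp_arity_iso\<close>), and the hom-objects of a Kleisli category turn tensor products into internal
homs (\<open>repr_tensor\<close>).

\<open>\<J>\<close>-ary monads are relative monads along \<open>K\<close> as well. A monad on the base is a relative monad along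
the identity (\<open>vmonad_relmon\<close>, \<open>mkmonad\<close>) and restricts along \<open>K\<close>. In the other direction let \<open>T Y\<close> be
the colimit of \<open>S\<close> weighted by \<open>V(j-, Y)\<close>, which exists for an eleutheric system. Since that weight is
flat, the internal hom from \<open>K x\<close> to \<open>T Y\<close> is again a colimit, of the internal homs from \<open>K x\<close> to \<open>S b\<close>; so
an operation on arrows \<open>X \<otimes> K x \<rightarrow> T Y\<close> is determined by, and can be defined on, those that factor
through some \<open>S b\<close> (\<open>flat_eq\<close>, \<open>flat_ex\<close>). On those the extension of the relative monad is available.
This extends arrows from \<open>K x\<close> to \<open>S x\<close>, and the universal property of \<open>T A\<close> then extends arrows from an
arbitrary \<open>A\<close> to \<open>T A\<close> (\<open>relmon_T\<close>). Flatness also shows that \<open>T\<close> preserves left Kan extensions along the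
arities (\<open>T_ary\<close>, \<open>J_ary_T\<close>), and \<open>T\<close> agrees with \<open>S\<close> on arities (\<open>theta_iso\<close>).

The arities are dense, and a \<open>\<J>\<close>-ary functor preserves the left Kan extension that says so
(\<open>dense\<close>, \<open>ary_colim\<close>). Hence a morphism out of a \<open>\<J>\<close>-ary monad is determined by its components at
arities (\<open>morphism_eq\<close>), and each compatible family of such components extends (\<open>morphism_ext\<close>). So the
functor that sends a monad to the theory of its restriction to the arities is faithful, full and
essentially surjective.

Everything is calculated with arrows of the base rather than with hom-objects. An arrow out of an
internal hom is the same as an operation on arrows in an arbitrary context, natural in the context;
a colimit weighted by \<open>V(j-, Y)\<close> becomes an ordinary universal property for cocones with a parameter.
In this form functors, transformations, cotensors, weighted colimits and Kan extensions are conditions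
on operations, and the ends in their definitions disappear.
\<close>

section \<open>Arrows that know their source and target\<close>

text \<open>Composition in an ordinary category is not told the objects, and hom-sets may overlap.
Arrows are therefore packaged with their source and target.\<close>

type_synonym ('o, 'm) tarr = "('o \<times> 'm \<times> 'o) option"

type_synonym ('o, 'm) oper = "'o list \<Rightarrow> ('o, 'm) tarr \<Rightarrow> ('o, 'm) tarr"

definition mk :: "'o \<Rightarrow> 'm \<Rightarrow> 'o \<Rightarrow> ('o, 'm) tarr" where
 "mk A f B = Some (A, f, B)"
definition dm :: "('o, 'm) tarr \<Rightarrow> 'o" where "dm f = fst (the f)"
definition cd :: "('o, 'm) tarr \<Rightarrow> 'o" where "cd f = snd (snd (the f))"
definition raw :: "('o, 'm) tarr \<Rightarrow> 'm" where "raw f = fst (snd (the f))"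

lemma dm_mk [simp]: "dm (mk A f B) = A" and cd_mk [simp]: "cd (mk A f B) = B"
 and raw_mk [simp]: "raw (mk A f B) = f"
 by (auto simp: dm_def cd_def raw_def mk_def)

lemma mk_eq_iff [simp]: "mk A f B = mk A' f' B' \<longleftrightarrow> A = A' \<and> f = f' \<and> B = B'"
 by (auto simp: mk_def)

locale smclosed =
 fixes V :: "('o, 'm) smcc" (structure)
 assumes smc: "symmetric_monoidal_closed V"
begin

definition vl :: "('o, 'm) tarr \<Rightarrow> bool" where
 "vl f \<longleftrightarrow> (\<exists>A m B. f = mk A m B \<and> m \<in> Hom V A B)"

definition cmp :: "('o, 'm) tarr \<Rightarrow> ('o, 'm) tarr \<Rightarrow> ('o, 'm) tarr" (infixr "**" 60) where
 "g ** f = (if vl g \<and> vl f \<and> cd f = dm g then mk (dm f) (raw g \<cdot> raw f) (cd g) else None)"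

definition tns :: "('o, 'm) tarr \<Rightarrow> ('o, 'm) tarr \<Rightarrow> ('o, 'm) tarr" (infixr "\<boxtimes>" 75) where
 "f \<boxtimes> g = (if vl f \<and> vl g then mk (dm f \<otimes> dm g) (raw f \<odot> raw g) (cd f \<otimes> cd g) else None)"

definition idt :: "'o \<Rightarrow> ('o, 'm) tarr" where "idt A = mk A (Idn V A) A"

abbreviation hm :: "'o \<Rightarrow> 'o \<Rightarrow> 'o" where "hm \<equiv> ihom V"

abbreviation VV :: "('o, 'o, 'm) vcat" where "VV \<equiv> vself V"

abbreviation endo :: "('o, 'o, 'm) vfun \<Rightarrow> bool" where "endo \<equiv> vfunctor V VV VV"
abbreviation monad :: "('o, 'm) vmonad \<Rightarrow> bool" where "monad \<equiv> is_vmonad V VV"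
abbreviation mmor :: "('o, 'm) vmonad \<Rightarrow> ('o, 'm) vmonad \<Rightarrow> ('o \<Rightarrow> ('o, 'm) uarr) \<Rightarrow> bool" where "mmor \<equiv> vmonad_morphism V VV"

abbreviation whr :: "('o, 'm) tarr \<Rightarrow> 'o \<Rightarrow> ('o, 'm) tarr" (infixr "\<lhd>" 75) where "f\<lhd>A \<equiv> f \<boxtimes> idt A"

definition Ar :: "'o \<Rightarrow> 'o \<Rightarrow> ('o, 'm) tarr set" (infix "\<leadsto>" 54) where
 "A \<leadsto> B = {f. vl f \<and> dm f = A \<and> cd f = B}"

lemma Ar_iff [simp]: "f \<in> A \<leadsto> B \<longleftrightarrow> vl f \<and> dm f = A \<and> cd f = B"
 by (simp add: Ar_def)

lemma vl_mk [simp]: "vl (mk A m B) \<longleftrightarrow> m \<in> Hom V A B"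
 by (auto simp: vl_def)

lemma not_vl_None [simp]: "\<not> vl None"
 by (auto simp: vl_def mk_def)

lemma mk_raw: "vl f \<Longrightarrow> mk (dm f) (raw f) (cd f) = f"
 by (auto simp: vl_def)

lemma raw_Hom: "vl f \<Longrightarrow> raw f \<in> Hom V (dm f) (cd f)"
 by (auto simp: vl_def)

lemma tarr_eqI: "\<lbrakk>vl f; vl g; dm f = dm g; cd f = cd g; raw f = raw g\<rbrakk> \<Longrightarrow> f = g"
 by (metis mk_raw)

lemma cat_V: "category V" and Obj_V: "Obj V = UNIV" and sm_V: "symmetric_monoidal V"
 using smc by (auto simp: symmetric_monoidal_closed_def symmetric_monoidal_def)

lemma raw_comp: "\<lbrakk>f \<in> Hom V A B; g \<in> Hom V B C\<rbrakk> \<Longrightarrow> g \<cdot> f \<in> Hom V A C"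
 using cat_V unfolding category_def Obj_V by blast

lemma raw_assoc: "\<lbrakk>f \<in> Hom V A B; g \<in> Hom V B C; h \<in> Hom V C D\<rbrakk> \<Longrightarrow> (h \<cdot> g) \<cdot> f = h \<cdot> (g \<cdot> f)"
 using cat_V unfolding category_def Obj_V by (metis UNIV_I)

lemmas sm0 = sm_V[unfolded symmetric_monoidal_def, THEN conjunct2, THEN conjunct2]
lemmas raw_ten = sm0[THEN conjunct1, rule_format]
lemmas raw_ten_id = sm0[THEN conjunct2, THEN conjunct1, rule_format]
lemmas raw_ten_comp = sm0[THEN conjunct2, THEN conjunct2, THEN conjunct1, rule_format]
lemmas raw_asc_iso = sm0[THEN conjunct2, THEN conjunct2, THEN conjunct2, THEN conjunct1, rule_format]
lemmas sm1 = sm0[THEN conjunct2, THEN conjunct2, THEN conjunct2, THEN conjunct2]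
lemmas raw_lun_iso = sm1[THEN conjunct1, rule_format]
lemmas raw_run_iso = sm1[THEN conjunct2, THEN conjunct1, rule_format]
lemmas raw_swp_iso = sm1[THEN conjunct2, THEN conjunct2, THEN conjunct1, rule_format]
lemmas raw_asc_nat = sm1[THEN conjunct2, THEN conjunct2, THEN conjunct2, THEN conjunct1, rule_format]
lemmas sm2 = sm1[THEN conjunct2, THEN conjunct2, THEN conjunct2, THEN conjunct2]
lemmas raw_lun_nat = sm2[THEN conjunct1, rule_format]
lemmas raw_run_nat = sm2[THEN conjunct2, THEN conjunct1, rule_format]
lemmas raw_swp_nat = sm2[THEN conjunct2, THEN conjunct2, THEN conjunct1, rule_format]
lemmas raw_pent = sm2[THEN conjunct2, THEN conjunct2, THEN conjunct2, THEN conjunct1, rule_format]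
lemmas sm3 = sm2[THEN conjunct2, THEN conjunct2, THEN conjunct2, THEN conjunct2]
lemmas raw_tri = sm3[THEN conjunct1, rule_format]
lemmas raw_hex = sm3[THEN conjunct2, THEN conjunct1, rule_format]
lemmas raw_symm = sm3[THEN conjunct2, THEN conjunct2, rule_format]

lemma raw_id: "Idn V A \<in> Hom V A A"
 using cat_V unfolding category_def Obj_V by blast

lemma raw_idl: "f \<in> Hom V A B \<Longrightarrow> Idn V B \<cdot> f = f"
 and raw_idr: "f \<in> Hom V A B \<Longrightarrow> f \<cdot> Idn V A = f"
 using cat_V unfolding category_def Obj_V by auto

lemma vl_cmp [simp]: "vl (g ** f) \<longleftrightarrow> vl g \<and> vl f \<and> cd f = dm g"
 by (metis (no_types, lifting) cmp_def not_vl_None raw_Hom raw_comp vl_mk)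

lemma dm_cmp [simp]: "\<lbrakk>vl g; vl f; cd f = dm g\<rbrakk> \<Longrightarrow> dm (g ** f) = dm f"
 and cd_cmp [simp]: "\<lbrakk>vl g; vl f; cd f = dm g\<rbrakk> \<Longrightarrow> cd (g ** f) = cd g"
 and raw_cmp: "\<lbrakk>vl g; vl f; cd f = dm g\<rbrakk> \<Longrightarrow> raw (g ** f) = raw g \<cdot> raw f"
 by (simp_all add: cmp_def)

lemma vl_tns [simp]: "vl (f \<boxtimes> g) \<longleftrightarrow> vl f \<and> vl g"
 by (metis (no_types, lifting) tns_def not_vl_None raw_Hom raw_ten vl_mk)

lemma dm_tns [simp]: "\<lbrakk>vl f; vl g\<rbrakk> \<Longrightarrow> dm (f \<boxtimes> g) = dm f \<otimes> dm g"
 and cd_tns [simp]: "\<lbrakk>vl f; vl g\<rbrakk> \<Longrightarrow> cd (f \<boxtimes> g) = cd f \<otimes> cd g"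
 and raw_tns: "\<lbrakk>vl f; vl g\<rbrakk> \<Longrightarrow> raw (f \<boxtimes> g) = raw f \<odot> raw g"
 by (simp_all add: tns_def)

lemma idt_simps [simp]: "vl (idt A)" "dm (idt A) = A" "cd (idt A) = A" "raw (idt A) = Idn V A"
 by (simp_all add: idt_def raw_id)

lemma cmp_mk: "\<lbrakk>f \<in> Hom V A B; g \<in> Hom V B C\<rbrakk> \<Longrightarrow> mk B g C ** mk A f B = mk A (g \<cdot> f) C"
 by (simp add: cmp_def)

lemma tns_mk: "\<lbrakk>f \<in> Hom V A A'; g \<in> Hom V B B'\<rbrakk> \<Longrightarrow> mk A f A' \<boxtimes> mk B g B' = mk (A \<otimes> B) (f \<odot> g) (A' \<otimes> B')"
 by (simp add: tns_def)

text \<open>An ill-typed composite is the value \<open>None\<close>, which makes associativity unconditional.\<close>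

lemma cmp_assoc [simp]: "(h ** g) ** f = h ** g ** f"
proof (cases "vl h \<and> vl g \<and> vl f \<and> cd f = dm g \<and> cd g = dm h")
 case True
 then show ?thesis
  by (intro tarr_eqI) (auto simp: raw_cmp intro!: raw_assoc dest: raw_Hom)
next
 case False
 then have "\<not> vl ((h ** g) ** f)" "\<not> vl (h ** g ** f)" by auto
 then show ?thesis by (metis cmp_def dm_mk vl_cmp)
qed

lemma cmp_re: "a ** b = c \<Longrightarrow> a ** b ** x = c ** x"
 by (metis cmp_assoc)

lemma cmp_idl [simp]: "\<lbrakk>vl f; cd f = A\<rbrakk> \<Longrightarrow> idt A ** f = f"
 and cmp_idr [simp]: "\<lbrakk>vl f; dm f = A\<rbrakk> \<Longrightarrow> f ** idt A = f"
 by (auto intro!: tarr_eqI simp: raw_cmp raw_idl raw_idr dest: raw_Hom)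
  (metis raw_Hom raw_idl raw_idr)+

lemma tns_idt [simp]: "idt A\<lhd>B = idt (A \<otimes> B)"
 by (auto intro!: tarr_eqI simp: raw_tns raw_ten_id)

lemma tns_cmp:
 "\<lbrakk>vl f; vl f'; vl g; vl g'; cd f = dm f'; cd g = dm g'\<rbrakk> \<Longrightarrow>
  (f' \<boxtimes> g') ** (f \<boxtimes> g) = (f' ** f) \<boxtimes> (g' ** g)"
proof (rule tarr_eqI)
 assume a: "vl f" "vl f'" "vl g" "vl g'" "cd f = dm f'" "cd g = dm g'"
 have "(raw f' \<cdot> raw f) \<odot> (raw g' \<cdot> raw g) = (raw f' \<odot> raw g') \<cdot> (raw f \<odot> raw g)"
  using raw_ten_comp[OF raw_Hom[OF a(1)] _ raw_Hom[OF a(3)], of "raw f'" "cd f'" "raw g'" "cd g'"]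
   raw_Hom[OF a(2)] raw_Hom[OF a(4)] a(5,6) by simp
 then show "raw ((f' \<boxtimes> g') ** (f \<boxtimes> g)) = raw ((f' ** f) \<boxtimes> (g' ** g))"
  using a by (simp add: raw_cmp raw_tns)
qed auto

lemma tns_cmpR: "\<lbrakk>vl f; vl g; cd f = dm g\<rbrakk> \<Longrightarrow> idt X \<boxtimes> (g ** f) = (idt X \<boxtimes> g) ** (idt X \<boxtimes> f)"
 and tns_cmpL: "\<lbrakk>vl f; vl g; cd f = dm g\<rbrakk> \<Longrightarrow> (g ** f)\<lhd>X = (g\<lhd>X) ** (f\<lhd>X)"
 by (simp_all add: tns_cmp)

lemmas tns_cmp_re = tns_cmp[THEN cmp_re, unfolded cmp_assoc]

definition alp :: "'o \<Rightarrow> 'o \<Rightarrow> 'o \<Rightarrow> ('o, 'm) tarr" where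
 "alp A B C = mk ((A \<otimes> B) \<otimes> C) (asc V A B C) (A \<otimes> (B \<otimes> C))"
definition alpi :: "'o \<Rightarrow> 'o \<Rightarrow> 'o \<Rightarrow> ('o, 'm) tarr" where
 "alpi A B C = mk (A \<otimes> (B \<otimes> C)) (asc_inv V A B C) ((A \<otimes> B) \<otimes> C)"
definition lu :: "'o \<Rightarrow> ('o, 'm) tarr" where "lu A = mk (\<one> \<otimes> A) (lun V A) A"
definition lui :: "'o \<Rightarrow> ('o, 'm) tarr" where "lui A = mk A (lun_inv V A) (\<one> \<otimes> A)"
definition ru :: "'o \<Rightarrow> ('o, 'm) tarr" where "ru A = mk (A \<otimes> \<one>) (run V A) A"
definition rui :: "'o \<Rightarrow> ('o, 'm) tarr" where "rui A = mk A (run_inv V A) (A \<otimes> \<one>)"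
definition sw :: "'o \<Rightarrow> 'o \<Rightarrow> ('o, 'm) tarr" where "sw A B = mk (A \<otimes> B) (swp V A B) (B \<otimes> A)"

lemma inv_arrow_eq:
 assumes "iso_arrow V A B f" shows "inverse_arrows V A B f (inv_arrow V A B f)"
proof -
 obtain g where g: "inverse_arrows V A B f g" using assms by (auto simp: iso_arrow_def)
 have "h = g" if "inverse_arrows V A B f h" for h
 proof -
  note gh = g[unfolded inverse_arrows_def] that[unfolded inverse_arrows_def]
  have "h = h \<cdot> (f \<cdot> g)" using gh by (simp add: raw_idr[of h B A])
  also have "\<dots> = (h \<cdot> f) \<cdot> g" using raw_assoc[of g B A f B h A] gh by simp
  also have "\<dots> = g" using gh by (simp add: raw_idl[of g B A])
  finally show ?thesis .
 qed
 then show ?thesis unfolding inv_arrow_def using g theI[of "inverse_arrows V A B f"] by blast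
qed

lemma struct_isos:
 "inverse_arrows V ((A \<otimes> B) \<otimes> C) (A \<otimes> (B \<otimes> C)) (asc V A B C) (asc_inv V A B C)"
 "inverse_arrows V (\<one> \<otimes> A) A (lun V A) (lun_inv V A)"
 "inverse_arrows V (A \<otimes> \<one>) A (run V A) (run_inv V A)"
 unfolding asc_inv_def lun_inv_def run_inv_def
 by (rule inv_arrow_eq[OF raw_asc_iso], rule inv_arrow_eq[OF raw_lun_iso],
   rule inv_arrow_eq[OF raw_run_iso])

lemma swp_Hom: "swp V A B \<in> Hom V (A \<otimes> B) (B \<otimes> A)"
 using raw_swp_iso[of A B] unfolding iso_arrow_def inverse_arrows_def by blast

lemma struct_simps [simp]:
 "vl (alp A B C)" "dm (alp A B C) = (A \<otimes> B) \<otimes> C" "cd (alp A B C) = A \<otimes> (B \<otimes> C)"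
 "vl (alpi A B C)" "cd (alpi A B C) = (A \<otimes> B) \<otimes> C" "dm (alpi A B C) = A \<otimes> (B \<otimes> C)"
 "vl (lu A)" "dm (lu A) = \<one> \<otimes> A" "cd (lu A) = A"
 "vl (lui A)" "cd (lui A) = \<one> \<otimes> A" "dm (lui A) = A"
 "vl (ru A)" "dm (ru A) = A \<otimes> \<one>" "cd (ru A) = A"
 "vl (rui A)" "cd (rui A) = A \<otimes> \<one>" "dm (rui A) = A"
 "vl (sw A B)" "dm (sw A B) = A \<otimes> B" "cd (sw A B) = B \<otimes> A"
 using struct_isos(1)[of A B C] struct_isos(2,3)[of A] swp_Hom[of A B]
 by (auto simp: alp_def alpi_def lu_def lui_def ru_def rui_def sw_def inverse_arrows_def)

lemma struct_invs [simp]: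
 "alp A B C ** alpi A B C = idt (A \<otimes> (B \<otimes> C))" "alpi A B C ** alp A B C = idt ((A \<otimes> B) \<otimes> C)"
 "lu A ** lui A = idt A" "lui A ** lu A = idt (\<one> \<otimes> A)"
 "ru A ** rui A = idt A" "rui A ** ru A = idt (A \<otimes> \<one>)"
 "sw B A ** sw A B = idt (A \<otimes> B)"
 using struct_isos(1)[of A B C] struct_isos(2,3)[of A] swp_Hom[of A B] swp_Hom[of B A] raw_symm[of B A]
 by (auto simp: alp_def alpi_def lu_def lui_def ru_def rui_def sw_def inverse_arrows_def idt_def
   cmp_mk)

lemmas struct_invs_re [simp] = struct_invs[THEN cmp_re]

lemma alp_nat:
 assumes "vl f" "vl g" "vl h" "dm f = A" "dm g = B" "dm h = C" "cd f = A'" "cd g = B'" "cd h = C'"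
 shows "alp A' B' C' ** ((f \<boxtimes> g) \<boxtimes> h) = (f \<boxtimes> (g \<boxtimes> h)) ** alp A B C"
proof (rule tarr_eqI)
 have "asc V A' B' C' \<cdot> ((raw f \<odot> raw g) \<odot> raw h) = (raw f \<odot> (raw g \<odot> raw h)) \<cdot> asc V A B C"
  using raw_asc_nat[OF raw_Hom[OF assms(1)] raw_Hom[OF assms(2)] raw_Hom[OF assms(3)]] assms by simp
 then show "raw (alp A' B' C' ** ((f \<boxtimes> g) \<boxtimes> h)) = raw ((f \<boxtimes> (g \<boxtimes> h)) ** alp A B C)"
  using assms by (simp add: raw_cmp raw_tns) (simp add: alp_def)
qed (use assms in auto)

lemma lu_nat: assumes "vl f" "dm f = A" "cd f = A'"
 shows "lu A' ** (idt \<one> \<boxtimes> f) = f ** lu A"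
proof (rule tarr_eqI)
 have "lun V A' \<cdot> (Idn V \<one> \<odot> raw f) = raw f \<cdot> lun V A"
  using raw_lun_nat[OF raw_Hom[OF assms(1)]] assms by simp
 then show "raw (lu A' ** (idt \<one> \<boxtimes> f)) = raw (f ** lu A)"
  using assms by (simp add: raw_cmp raw_tns) (simp add: lu_def)
qed (use assms in auto)

lemma ru_nat: assumes "vl f" "dm f = A" "cd f = A'"
 shows "ru A' ** (f\<lhd>\<one>) = f ** ru A"
proof (rule tarr_eqI)
 have "run V A' \<cdot> (raw f \<odot> Idn V \<one>) = raw f \<cdot> run V A"
  using raw_run_nat[OF raw_Hom[OF assms(1)]] assms by simp
 then show "raw (ru A' ** (f\<lhd>\<one>)) = raw (f ** ru A)"
  using assms by (simp add: raw_cmp raw_tns) (simp add: ru_def)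
qed (use assms in auto)

lemma sw_nat: assumes "vl f" "dm f = A" "cd f = A'" "vl g" "dm g = B" "cd g = B'"
 shows "sw A' B' ** (f \<boxtimes> g) = (g \<boxtimes> f) ** sw A B"
proof (rule tarr_eqI)
 have "swp V A' B' \<cdot> (raw f \<odot> raw g) = (raw g \<odot> raw f) \<cdot> swp V A B"
  using raw_swp_nat[OF raw_Hom[OF assms(1)] raw_Hom[OF assms(4)]] assms by simp
 then show "raw (sw A' B' ** (f \<boxtimes> g)) = raw ((g \<boxtimes> f) ** sw A B)"
  using assms by (simp add: raw_cmp raw_tns) (simp add: sw_def)
qed (use assms in auto)

lemma pentagon:
 "alp A B (C \<otimes> D) ** alp (A \<otimes> B) C D =
  (idt A \<boxtimes> alp B C D) ** alp A (B \<otimes> C) D ** (alp A B C\<lhd>D)"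
 by (rule tarr_eqI) (simp_all add: raw_cmp raw_tns, simp_all add: alp_def raw_pent)

lemma triangle: "(idt A \<boxtimes> lu B) ** alp A \<one> B = ru A\<lhd>B"
 by (rule tarr_eqI) (simp_all add: raw_cmp raw_tns, simp_all add: alp_def lu_def ru_def raw_tri)

lemma hexagon:
 "alp B C A ** sw A (B \<otimes> C) ** alp A B C = (idt B \<boxtimes> sw A C) ** alp B A C ** (sw A B\<lhd>C)"
 by (rule tarr_eqI) (simp_all add: raw_cmp raw_tns, simp_all add: alp_def sw_def raw_hex)

lemma iso_epi: "\<lbrakk>f ** p = g ** p; p ** q = idt A; vl f; vl g; dm f = A; dm g = A\<rbrakk> \<Longrightarrow> f = g"
 by (metis cmp_assoc cmp_idr)

lemma iso_mono: "\<lbrakk>p ** f = p ** g; q ** p = idt A; vl f; vl g; cd f = A; cd g = A\<rbrakk> \<Longrightarrow> f = g"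
 by (metis cmp_assoc cmp_idl)

section \<open>Contexts\<close>

text \<open>A list \<open>\<Xi>\<close> of objects acts on objects and arrows by tensoring on the left.\<close>

definition wo :: "'o list \<Rightarrow> 'o \<Rightarrow> 'o" (infixr "|>" 80) where
 "\<Xi>|>A = foldr (ten V) \<Xi> A"
definition wa :: "'o list \<Rightarrow> ('o, 'm) tarr \<Rightarrow> ('o, 'm) tarr" (infixr "\<rhd>" 80) where
 "\<Xi>\<rhd>f = foldr (\<lambda>X h. idt X \<boxtimes> h) \<Xi> f"

lemma wo_simps [simp]: "[]|>A = A" "(X # \<Xi>)|>A = X \<otimes> (\<Xi>|>A)" "(\<Xi> @ \<Delta>)|>A = \<Xi>|>\<Delta>|>A"
 by (simp_all add: wo_def)

lemma wa_Nil [simp]: "[]\<rhd>f = f" and wa_append [simp]: "(\<Xi> @ \<Delta>)\<rhd>f = \<Xi>\<rhd>\<Delta>\<rhd>f"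
 by (simp_all add: wa_def)

lemma wa_Cons: "(X # \<Xi>)\<rhd>f = [X]\<rhd>\<Xi>\<rhd>f"
 by (simp add: wa_def)

lemma wa_one: "[X]\<rhd>f = idt X \<boxtimes> f"
 by (simp add: wa_def)

lemma vl_wa [simp]: "vl (\<Xi>\<rhd>f) = vl f"
 by (induction \<Xi>) (simp_all add: wa_def)

lemma dm_wa [simp]: "vl f \<Longrightarrow> dm (\<Xi>\<rhd>f) = \<Xi>|>dm f" and cd_wa [simp]: "vl f \<Longrightarrow> cd (\<Xi>\<rhd>f) = \<Xi>|>cd f"
proof -
 assume f: "vl f"
 show "dm (\<Xi>\<rhd>f) = \<Xi>|>dm f"
  by (induction \<Xi>) (simp_all add: wa_def wo_def f vl_wa[unfolded wa_def])
 show "cd (\<Xi>\<rhd>f) = \<Xi>|>cd f"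
  by (induction \<Xi>) (simp_all add: wa_def wo_def f vl_wa[unfolded wa_def])
qed

lemma wa_idt [simp]: "\<Xi>\<rhd>idt A = idt (\<Xi>|>A)"
 by (induction \<Xi>) (simp_all add: wa_def wo_def)

lemma wa_cmp [simp]: "\<lbrakk>vl g; vl f; cd f = dm g\<rbrakk> \<Longrightarrow> \<Xi>\<rhd>(g ** f) = \<Xi>\<rhd>g ** \<Xi>\<rhd>f"
proof (induction \<Xi>)
 case (Cons X \<Xi>)
 then show ?case
  by (simp add: wa_Cons[of X \<Xi>] wa_one tns_cmp)
qed simp

lemma tns_wa: "\<lbrakk>vl f; vl h; dm f = X; cd f = Y; dm h = A; cd h = B\<rbrakk> \<Longrightarrow>
  (f\<lhd>B) ** [X]\<rhd>h = [Y]\<rhd>h ** (f\<lhd>A)"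
 by (simp add: wa_one tns_cmp)

lemmas tns_wa_re = tns_wa[THEN cmp_re, unfolded cmp_assoc]

lemma iso_inv_nat:
 assumes "p ** f = g ** q" "p' ** p = idt P" "q ** q' = idt Q"
  "vl f" "vl g" "cd f = P" "dm g = Q"
 shows "f ** q' = p' ** g"
proof -
 have "p' ** g = p' ** g ** q ** q'" using assms by simp
 also have "\<dots> = p' ** p ** f ** q'" using assms(1) by (metis cmp_assoc)
 also have "\<dots> = f ** q'" using assms(2,4,6) by (metis cmp_assoc cmp_idl)
 finally show ?thesis by simp
qed

lemma alpi_nat:
 assumes "vl f" "vl g" "vl h" "dm f = A" "dm g = B" "dm h = C" "cd f = A'" "cd g = B'" "cd h = C'"
 shows "((f \<boxtimes> g) \<boxtimes> h) ** alpi A B C = alpi A' B' C' ** (f \<boxtimes> (g \<boxtimes> h))"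
 by (rule iso_inv_nat[OF alp_nat[OF assms]]) (use assms in auto)

subsection \<open>Coherence of the units\<close>

lemma one_wa_inject:
 assumes "[\<one>]\<rhd>f = [\<one>]\<rhd>g" "vl f" "vl g" "dm f = dm g" "cd f = cd g"
 shows "f = g"
proof -
 have "f ** lu (dm f) = g ** lu (dm f)"
  using assms lu_nat[of f "dm f" "cd f"] lu_nat[of g "dm g" "cd g"] by (simp add: wa_one)
 then show ?thesis by (rule iso_epi[where q = "lui (dm f)"]) (use assms in auto)
qed

text \<open>The coherence of the left unit with tensor products follows from pentagon and triangle.
It is checked after tensoring with \<open>\<one>\<close>, which is faithful.\<close>

lemma lu_tns: "lu (X \<otimes> A) ** alp \<one> X A = lu X\<lhd>A"
proof (rule one_wa_inject)
 let ?q = "alp \<one> (\<one> \<otimes> X) A ** (alp \<one> \<one> X\<lhd>A)"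
 have "[\<one>]\<rhd>(lu (X \<otimes> A) ** alp \<one> X A) ** ?q = [\<one>]\<rhd>lu (X \<otimes> A) ** alp \<one> \<one> (X \<otimes> A) ** alp (\<one> \<otimes> \<one>) X A"
  by (simp add: wa_one pentagon tns_cmpR)
 also have "\<dots> = (ru \<one>\<lhd>(X \<otimes> A)) ** alp (\<one> \<otimes> \<one>) X A"
  using triangle[of \<one> "X \<otimes> A", THEN cmp_re] by (simp add: wa_one)
 also have "\<dots> = alp \<one> X A ** ((ru \<one>\<lhd>X)\<lhd>A)"
  by (subst alp_nat[where A = "\<one> \<otimes> \<one>" and B = X and C = A]) simp_all
 also have "\<dots> = alp \<one> X A ** (((idt \<one> \<boxtimes> lu X) ** alp \<one> \<one> X)\<lhd>A)"
  by (simp add: triangle)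
 also have "\<dots> = alp \<one> X A ** ((idt \<one> \<boxtimes> lu X)\<lhd>A) ** (alp \<one> \<one> X\<lhd>A)"
  by (simp add: tns_cmp)
 also have "\<dots> = [\<one>]\<rhd>(lu X\<lhd>A) ** ?q"
  using alp_nat[of "idt \<one>" "lu X" "idt A" \<one> "\<one> \<otimes> X" A \<one> X A, THEN cmp_re]
  by (simp add: wa_one)
 finally have *: "[\<one>]\<rhd>(lu (X \<otimes> A) ** alp \<one> X A) ** ?q = [\<one>]\<rhd>(lu X\<lhd>A) ** ?q" .
 show "[\<one>]\<rhd>(lu (X \<otimes> A) ** alp \<one> X A) = [\<one>]\<rhd>(lu X\<lhd>A)"
  by (rule iso_epi[OF *, where q = "(alpi \<one> \<one> X\<lhd>A) ** alpi \<one> (\<one> \<otimes> X) A"])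
   (simp_all add: tns_cmp_re)
qed simp_all

text \<open>Likewise for the right unit.\<close>

lemma wa_ru: "ru (X \<otimes> A) = [X]\<rhd>ru A ** alp X A \<one>"
proof -
 have inj: "f = g" if e: "f\<lhd>\<one> = g\<lhd>\<one>" and v: "vl f" "vl g" "dm f = dm g" "cd f = cd g" for f g
 proof -
  have "f ** ru (dm f) = g ** ru (dm f)"
   using e v ru_nat[of f "dm f" "cd f"] ru_nat[of g "dm g" "cd g"] by simp
  then show ?thesis by (rule iso_epi[where q = "rui (dm f)"]) (use v in auto)
 qed
 have "alp X A \<one> ** (ru (X \<otimes> A)\<lhd>\<one>) = alp X A \<one> ** [X \<otimes> A]\<rhd>lu \<one> ** alp (X \<otimes> A) \<one> \<one>"
  by (simp add: triangle wa_one)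
 also have "\<dots> = (idt X \<boxtimes> (idt A \<boxtimes> lu \<one>)) ** alp X A (\<one> \<otimes> \<one>) ** alp (X \<otimes> A) \<one> \<one>"
  using alp_nat[of "idt X" "idt A" "lu \<one>" X A "\<one> \<otimes> \<one>" X A \<one>, THEN cmp_re]
  by (simp add: wa_one)
 also have "\<dots> = (idt X \<boxtimes> ((idt A \<boxtimes> lu \<one>) ** alp A \<one> \<one>)) ** alp X (A \<otimes> \<one>) \<one> ** (alp X A \<one>\<lhd>\<one>)"
  by (simp add: pentagon tns_cmp_re)
 also have "\<dots> = (idt X \<boxtimes> (ru A\<lhd>\<one>)) ** alp X (A \<otimes> \<one>) \<one> ** (alp X A \<one>\<lhd>\<one>)"
  by (simp add: triangle)
 also have "\<dots> = alp X A \<one> ** (([X]\<rhd>ru A ** alp X A \<one>)\<lhd>\<one>)"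
  using alp_nat[of "idt X" "ru A" "idt \<one>" X "A \<otimes> \<one>" \<one> X A \<one>, THEN cmp_re]
  by (simp add: wa_one tns_cmpL)
 finally have "ru (X \<otimes> A)\<lhd>\<one> = ([X]\<rhd>ru A ** alp X A \<one>)\<lhd>\<one>"
  by (rule iso_mono[where q = "alpi X A \<one>"]) simp_all
 then show ?thesis by (rule inj) simp_all
qed

lemma wa_fold [simp]: "idt X \<boxtimes> f = [X]\<rhd>f"
 by (simp add: wa_one)

declare tns_cmpL [simp]

lemma tns_push [simp]: "\<lbrakk>vl f; vl h; dm f = X; cd h = B\<rbrakk> \<Longrightarrow>
  (f\<lhd>B) ** [X]\<rhd>h = [cd f]\<rhd>h ** (f\<lhd>(dm h))"
 by (rule tns_wa) auto

lemma tns_push_re [simp]: "\<lbrakk>vl f; vl h; dm f = X; cd h = B\<rbrakk> \<Longrightarrow>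
  (f\<lhd>B) ** [X]\<rhd>h ** x = [cd f]\<rhd>h ** (f\<lhd>(dm h)) ** x"
 by (rule tns_wa_re) auto

lemma alp_nat1 [simp]: "\<lbrakk>vl f; cd f = A'\<rbrakk> \<Longrightarrow>
  alp A' B C ** ((f\<lhd>B)\<lhd>C) = (f\<lhd>(B \<otimes> C)) ** alp (dm f) B C"
 using alp_nat[of f "idt B" "idt C" "dm f" B C A' B C] by simp

lemma alp_nat2 [simp]: "\<lbrakk>vl g; cd g = B'\<rbrakk> \<Longrightarrow>
  alp A B' C ** ([A]\<rhd>g\<lhd>C) = [A]\<rhd>(g\<lhd>C) ** alp A (dm g) C"
 using alp_nat[of "idt A" g "idt C" A "dm g" C A B' C] by simp

lemma alp_nat3 [simp]: "\<lbrakk>vl h; cd h = C'\<rbrakk> \<Longrightarrow>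
  alp A B C' ** [A \<otimes> B]\<rhd>h = [A]\<rhd>[B]\<rhd>h ** alp A B (dm h)"
 using alp_nat[of "idt A" "idt B" h A B "dm h" A B C'] by simp

lemmas alp_nat_re [simp] = alp_nat1[THEN cmp_re, unfolded cmp_assoc]
 alp_nat2[THEN cmp_re, unfolded cmp_assoc] alp_nat3[THEN cmp_re, unfolded cmp_assoc]

lemma lu_nat' [simp]: "\<lbrakk>vl f; cd f = A'\<rbrakk> \<Longrightarrow> lu A' ** [\<one>]\<rhd>f = f ** lu (dm f)"
 using lu_nat[of f] by simp

lemmas lu_nat'_re [simp] = lu_nat'[THEN cmp_re, unfolded cmp_assoc]

abbreviation mrg :: "'o list \<Rightarrow> 'o" where "mrg \<Xi> \<equiv> \<Xi>|>\<one>"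

text \<open>The canonical isomorphism \<open>(X\<^sub>1 \<otimes> \<dots> \<otimes> X\<^sub>n
\<otimes> \<one>) \<otimes> A \<rightarrow> X\<^sub>1 \<otimes> \<dots> \<otimes> X\<^sub>n
\<otimes> A\<close>.\<close>

primrec mm :: "'o list \<Rightarrow> 'o \<Rightarrow> ('o, 'm) tarr" where
 "mm [] A = lu A"
| "mm (X # \<Xi>) A = [X]\<rhd>mm \<Xi> A ** alp X (mrg \<Xi>) A"

primrec mmi :: "'o list \<Rightarrow> 'o \<Rightarrow> ('o, 'm) tarr" where
 "mmi [] A = lui A"
| "mmi (X # \<Xi>) A = alpi X (mrg \<Xi>) A ** [X]\<rhd>mmi \<Xi> A"

lemma mm_simps [simp]: "vl (mm \<Xi> A)" "dm (mm \<Xi> A) = mrg \<Xi> \<otimes> A" "cd (mm \<Xi> A) = \<Xi>|>A"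
 by (induction \<Xi>) simp_all

lemma mmi_simps [simp]: "vl (mmi \<Xi> A)" "cd (mmi \<Xi> A) = mrg \<Xi> \<otimes> A" "dm (mmi \<Xi> A) = \<Xi>|>A"
 by (induction \<Xi>) simp_all

lemma wa_inv: "\<lbrakk>p ** q = idt A; vl p; vl q; cd q = dm p\<rbrakk> \<Longrightarrow> \<Xi>\<rhd>p ** \<Xi>\<rhd>q = idt (\<Xi>|>A)"
 by (metis wa_cmp wa_idt)

lemma wa_inv_re: "\<lbrakk>p ** q = idt A; vl p; vl q; cd q = dm p; vl x; cd x = \<Xi>|>A\<rbrakk> \<Longrightarrow> \<Xi>\<rhd>p ** \<Xi>\<rhd>q ** x = x"
 by (metis cmp_assoc cmp_idl wa_inv)

lemma mm_inv [simp]: "mm \<Xi> A ** mmi \<Xi> A = idt (\<Xi>|>A)" "mmi \<Xi> A ** mm \<Xi> A = idt (mrg \<Xi> \<otimes> A)"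
proof (induction \<Xi>)
 case (Cons X \<Xi>)
 { case 1 then show ?case using Cons(1) by (simp add: wa_inv) }
 { case 2 then show ?case using Cons(2) by (simp add: wa_inv_re) }
qed simp_all

lemmas mm_inv_re [simp] = mm_inv[THEN cmp_re]

lemma mm_nat [simp]: "\<lbrakk>vl f; cd f = B\<rbrakk> \<Longrightarrow> mm \<Xi> B ** [mrg \<Xi>]\<rhd>f = \<Xi>\<rhd>f ** mm \<Xi> (dm f)"
proof (induction \<Xi>)
 case (Cons X \<Xi>)
 then show ?case
  by (simp add: wa_Cons[of X \<Xi>]) (metis (no_types, lifting) cmp_assoc mm_simps vl_wa wa_cmp dm_wa cd_wa wo_simps(1,2))
qed simp

lemmas mm_nat_re [simp] = mm_nat[THEN cmp_re, unfolded cmp_assoc]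

text \<open>Concatenating contexts is tensoring their merged objects; this makes context morphisms
stable under extending the context on the right.\<close>

lemma mm_append:
 "mm (\<Xi> @ \<Gamma>) A ** (mm \<Xi> (mrg \<Gamma>)\<lhd>A) = mm \<Xi> (\<Gamma>|>A) ** [mrg \<Xi>]\<rhd>mm \<Gamma> A ** alp (mrg \<Xi>) (mrg \<Gamma>) A"
proof (induction \<Xi>)
 case Nil
 then show ?case by (simp add: lu_tns[symmetric])
next
 case (Cons X \<Xi>)
 have "mm ((X # \<Xi>) @ \<Gamma>) A ** (mm (X # \<Xi>) (mrg \<Gamma>)\<lhd>A)
   = [X]\<rhd>mm (\<Xi> @ \<Gamma>) A ** [X]\<rhd>(mm \<Xi> (mrg \<Gamma>)\<lhd>A) ** alp X (mrg \<Xi> \<otimes> mrg \<Gamma>) A ** (alp X (mrg \<Xi>) (mrg \<Gamma>)\<lhd>A)"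
  by simp
 also have "\<dots> = [X]\<rhd>(mm (\<Xi> @ \<Gamma>) A ** (mm \<Xi> (mrg \<Gamma>)\<lhd>A)) ** alp X (mrg \<Xi> \<otimes> mrg \<Gamma>) A ** (alp X (mrg \<Xi>) (mrg \<Gamma>)\<lhd>A)"
  by simp
 also have "\<dots> = [X]\<rhd>mm \<Xi> (\<Gamma>|>A) ** [X]\<rhd>[mrg \<Xi>]\<rhd>mm \<Gamma> A ** [X]\<rhd>alp (mrg \<Xi>) (mrg \<Gamma>) A
  ** alp X (mrg \<Xi> \<otimes> mrg \<Gamma>) A ** (alp X (mrg \<Xi>) (mrg \<Gamma>)\<lhd>A)"
  unfolding Cons.IH by (simp del: mm_nat mm_nat_re)
 also have "\<dots> = [X]\<rhd>mm \<Xi> (\<Gamma>|>A) ** [X]\<rhd>[mrg \<Xi>]\<rhd>mm \<Gamma> A ** alp X (mrg \<Xi>) (mrg \<Gamma> \<otimes> A) ** alp (X \<otimes> mrg \<Xi>) (mrg \<Gamma>) A"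
  using pentagon[of X "mrg \<Xi>" "mrg \<Gamma>" A] by simp
 also have "\<dots> = mm (X # \<Xi>) (\<Gamma>|>A) ** [mrg (X # \<Xi>)]\<rhd>mm \<Gamma> A ** alp (mrg (X # \<Xi>)) (mrg \<Gamma>) A"
  by simp
 finally show ?case .
qed

text \<open>A morphism of contexts is a family \<open>u A : \<Xi>|>A \<rightarrow> \<Delta>|>A\<close> induced by a single arrow
 between the tensor products of the two lists.\<close>

definition ctx :: "'o list \<Rightarrow> 'o list \<Rightarrow> ('o \<Rightarrow> ('o, 'm) tarr) \<Rightarrow> bool" where
 "ctx \<Xi> \<Delta> u \<longleftrightarrow> (\<exists>v. v \<in> mrg \<Xi> \<leadsto> mrg \<Delta> \<and>
  (\<forall>A. u A \<in> \<Xi>|>A \<leadsto> \<Delta>|>A \<and> u A ** mm \<Xi> A = mm \<Delta> A ** (v\<lhd>A)))"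

lemma ctxI:
 assumes "v \<in> mrg \<Xi> \<leadsto> mrg \<Delta>" "\<And>A. u A \<in> \<Xi>|>A \<leadsto> \<Delta>|>A"
  "\<And>A. u A ** mm \<Xi> A = mm \<Delta> A ** (v\<lhd>A)"
 shows "ctx \<Xi> \<Delta> u"
 using assms unfolding ctx_def by blast

lemma ctxE:
 assumes "ctx \<Xi> \<Delta> u"
 obtains v where "v \<in> mrg \<Xi> \<leadsto> mrg \<Delta>" "\<And>A. u A ** mm \<Xi> A = mm \<Delta> A ** (v\<lhd>A)"
 using assms unfolding ctx_def by blast

lemma ctx_ty: "ctx \<Xi> \<Delta> u \<Longrightarrow> u A \<in> \<Xi>|>A \<leadsto> \<Delta>|>A"
 unfolding ctx_def by blast

lemma ctx_ty' [simp]: "ctx \<Xi> \<Delta> u \<Longrightarrow> vl (u A)"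
 and ctx_dm: "ctx \<Xi> \<Delta> u \<Longrightarrow> dm (u A) = \<Xi>|>A" and ctx_cd: "ctx \<Xi> \<Delta> u \<Longrightarrow> cd (u A) = \<Delta>|>A"
 using ctx_ty[of \<Xi> \<Delta> u A] by auto

lemma ctx_nat:
 assumes u: "ctx \<Xi> \<Delta> u" and f: "vl f" "dm f = A" "cd f = B"
 shows "u B ** \<Xi>\<rhd>f = \<Delta>\<rhd>f ** u A"
proof -
 obtain v where v: "v \<in> mrg \<Xi> \<leadsto> mrg \<Delta>" "\<And>A. u A ** mm \<Xi> A = mm \<Delta> A ** (v\<lhd>A)" by (rule ctxE[OF u]) (rule that; blast)
 note t = ctx_ty[OF u, simplified]
 have "(u B ** \<Xi>\<rhd>f) ** mm \<Xi> A = u B ** mm \<Xi> B ** [mrg \<Xi>]\<rhd>f"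
  using f by simp
 also have "\<dots> = mm \<Delta> B ** (v\<lhd>B) ** [mrg \<Xi>]\<rhd>f"
  using v(2)[of B, THEN cmp_re] by simp
 also have "\<dots> = (\<Delta>\<rhd>f ** u A) ** mm \<Xi> A"
  using v f by simp
 finally show ?thesis
  by (rule iso_epi[OF _ mm_inv(1)]) (use f t in simp_all)
qed

lemma ctx_id: "ctx \<Xi> \<Xi> (\<lambda>A. idt (\<Xi>|>A))"
 by (rule ctxI[of "idt (mrg \<Xi>)"]) simp_all

lemma ctx_comp:
 assumes u: "ctx \<Xi> \<Delta> u" and w: "ctx \<Delta> \<Gamma> w" shows "ctx \<Xi> \<Gamma> (\<lambda>A. w A ** u A)"
proof -
 obtain v where v: "v \<in> mrg \<Xi> \<leadsto> mrg \<Delta>" "\<And>A. u A ** mm \<Xi> A = mm \<Delta> A ** (v\<lhd>A)" by (rule ctxE[OF u]) (rule that; blast)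
 obtain v' where v': "v' \<in> mrg \<Delta> \<leadsto> mrg \<Gamma>" "\<And>A. w A ** mm \<Delta> A = mm \<Gamma> A ** (v'\<lhd>A)" by (rule ctxE[OF w]) (rule that; blast)
 show ?thesis
  by (rule ctxI[of "v' ** v"])
   (use v v' ctx_ty[OF u] ctx_ty[OF w] v'(2)[THEN cmp_re] in simp_all)
qed

lemma ctx_left1:
 assumes u: "ctx \<Xi> \<Delta> u" shows "ctx (X # \<Xi>) (X # \<Delta>) (\<lambda>A. [X]\<rhd>u A)"
proof -
 obtain v where v: "v \<in> mrg \<Xi> \<leadsto> mrg \<Delta>" "\<And>A. u A ** mm \<Xi> A = mm \<Delta> A ** (v\<lhd>A)" by (rule ctxE[OF u]) (rule that; blast)
 have "[X]\<rhd>u A ** [X]\<rhd>mm \<Xi> A = [X]\<rhd>mm \<Delta> A ** [X]\<rhd>(v\<lhd>A)" for A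
  using wa_cmp[of "u A" "mm \<Xi> A" "[X]"] wa_cmp[of "mm \<Delta> A" "v\<lhd>A" "[X]"] v ctx_ty[OF u, of A]
  by (simp del: wa_cmp)
 note e = this[THEN cmp_re]
 show ?thesis
  by (rule ctxI[of "[X]\<rhd>v"]) (use v ctx_ty[OF u] e in simp_all)
qed

lemma ctx_left: "ctx \<Xi> \<Delta> u \<Longrightarrow> ctx (\<Gamma> @ \<Xi>) (\<Gamma> @ \<Delta>) (\<lambda>A. \<Gamma>\<rhd>u A)"
proof (induction \<Gamma>)
 case (Cons X \<Gamma>)
 then have "ctx (X # \<Gamma> @ \<Xi>) (X # \<Gamma> @ \<Delta>) (\<lambda>A. [X]\<rhd>\<Gamma>\<rhd>u A)"
  using ctx_left1 by blast
 then show ?case by (simp add: wa_Cons[of X \<Gamma>])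
qed simp

lemma ctx_right:
 assumes u: "ctx \<Xi> \<Delta> u" shows "ctx (\<Xi> @ \<Gamma>) (\<Delta> @ \<Gamma>) (\<lambda>A. u (\<Gamma>|>A))"
proof -
 obtain v where v: "v \<in> mrg \<Xi> \<leadsto> mrg \<Delta>" "\<And>A. u A ** mm \<Xi> A = mm \<Delta> A ** (v\<lhd>A)" by (rule ctxE[OF u]) (rule that; blast)
 note t = ctx_ty[OF u, simplified]
 show ?thesis
 proof (rule ctxI[of "u (mrg \<Gamma>)"])
  fix A
  have "(u (\<Gamma>|>A) ** mm (\<Xi> @ \<Gamma>) A) ** (mm \<Xi> (mrg \<Gamma>)\<lhd>A)
    = u (\<Gamma>|>A) ** mm \<Xi> (\<Gamma>|>A) ** [mrg \<Xi>]\<rhd>mm \<Gamma> A ** alp (mrg \<Xi>) (mrg \<Gamma>) A"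
   by (simp add: mm_append del: mm_nat_re)
  also have "\<dots> = mm \<Delta> (\<Gamma>|>A) ** (v\<lhd>(\<Gamma>|>A)) ** [mrg \<Xi>]\<rhd>mm \<Gamma> A ** alp (mrg \<Xi>) (mrg \<Gamma>) A"
   using v(2)[of "\<Gamma>|>A", THEN cmp_re] by (simp del: mm_nat mm_nat_re)
  also have "\<dots> = mm \<Delta> (\<Gamma>|>A) ** [mrg \<Delta>]\<rhd>mm \<Gamma> A ** (v\<lhd>(mrg \<Gamma> \<otimes> A)) ** alp (mrg \<Xi>) (mrg \<Gamma>) A"
   using v(1) by (simp del: mm_nat mm_nat_re)
  also have "\<dots> = mm \<Delta> (\<Gamma>|>A) ** [mrg \<Delta>]\<rhd>mm \<Gamma> A ** alp (mrg \<Delta>) (mrg \<Gamma>) A ** ((v\<lhd>(mrg \<Gamma>))\<lhd>A)"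
   using v(1) by (simp del: mm_nat mm_nat_re)
  also have "\<dots> = mm (\<Delta> @ \<Gamma>) A ** (mm \<Delta> (mrg \<Gamma>)\<lhd>A) ** ((v\<lhd>(mrg \<Gamma>))\<lhd>A)"
   using mm_append[of \<Delta> \<Gamma> A, THEN cmp_re] by simp
  also have "\<dots> = mm (\<Delta> @ \<Gamma>) A ** ((mm \<Delta> (mrg \<Gamma>) ** (v\<lhd>(mrg \<Gamma>)))\<lhd>A)"
   using v(1) by simp
  also have "\<dots> = (mm (\<Delta> @ \<Gamma>) A ** (u (mrg \<Gamma>)\<lhd>A)) ** (mm \<Xi> (mrg \<Gamma>)\<lhd>A)"
   unfolding v(2)[symmetric] using t by simp
  finally show "u (\<Gamma>|>A) ** mm (\<Xi> @ \<Gamma>) A = mm (\<Delta> @ \<Gamma>) A ** (u (mrg \<Gamma>)\<lhd>A)"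
   by (rule iso_epi[where q = "mmi \<Xi> (mrg \<Gamma>)\<lhd>A" and A = "(\<Xi> @ \<Gamma>)|>\<one> \<otimes> A"])
    (use t in \<open>simp_all add: tns_cmp\<close>)
 qed (use t in simp_all)
qed

lemma ctx_single:
 assumes "v \<in> mrg \<Xi> \<leadsto> H" shows "ctx \<Xi> [H] (\<lambda>A. (v\<lhd>A) ** mmi \<Xi> A)"
proof (rule ctxI[of "rui H ** v"])
 fix A
 have "mm [H] A ** ((rui H ** v)\<lhd>A) = (ru H\<lhd>A) ** (rui H\<lhd>A) ** (v\<lhd>A)"
  using assms triangle[of H A, THEN cmp_re] by simp
 also have "\<dots> = v\<lhd>A"
  using assms by (simp add: tns_cmp_re)
 finally show "((v\<lhd>A) ** mmi \<Xi> A) ** mm \<Xi> A = mm [H] A ** ((rui H ** v)\<lhd>A)"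
  using assms by simp
qed (use assms in simp_all)

lemma ctx_singleE:
 assumes "ctx \<Xi> [H] u"
 obtains v where "v \<in> mrg \<Xi> \<leadsto> H" "u = (\<lambda>A. (v\<lhd>A) ** mmi \<Xi> A)"
proof -
 obtain v where v: "v \<in> mrg \<Xi> \<leadsto> mrg [H]" "\<And>A. u A ** mm \<Xi> A = mm [H] A ** (v\<lhd>A)" by (rule ctxE[OF assms]) (rule that; blast)
 have "u A = ((ru H ** v)\<lhd>A) ** mmi \<Xi> A" for A
 proof -
  have "u A = (u A ** mm \<Xi> A) ** mmi \<Xi> A" using ctx_ty[OF assms, of A] by simp
  also have "\<dots> = ((ru H ** v)\<lhd>A) ** mmi \<Xi> A"
   using v(1) triangle[of H A, THEN cmp_re] unfolding v(2) by simp
  finally show ?thesis .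
 qed
 then show ?thesis using v(1) by (intro that[of "ru H ** v"]) auto
qed

lemma ctx_arr: assumes "f \<in> X \<leadsto> Y" shows "ctx [X] [Y] (\<lambda>A. f\<lhd>A)"
proof (rule ctxI[of "f\<lhd>\<one>"])
 fix A show "(f\<lhd>A) ** mm [X] A = mm [Y] A ** ((f\<lhd>\<one>)\<lhd>A)"
  using assms by simp
qed (use assms in simp_all)

lemma ctx_alp: "ctx [X \<otimes> Y] [X, Y] (alp X Y)"
proof (rule ctxI[of "alp X Y \<one>"])
 fix A
 show "alp X Y A ** mm [X \<otimes> Y] A = mm [X, Y] A ** (alp X Y \<one>\<lhd>A)"
  using pentagon[of X Y \<one> A] by simp
qed simp_all

lemma ctx_alpi: "ctx [X, Y] [X \<otimes> Y] (alpi X Y)"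
proof (rule ctxI[of "alpi X Y \<one>"])
 fix A
 have *: "alp X Y A ** (alpi X Y A ** mm [X, Y] A) = mm [X, Y] A ** (alp X Y \<one>\<lhd>A) ** (alpi X Y \<one>\<lhd>A)"
  by (simp add: tns_cmp)
 also have "\<dots> = alp X Y A ** (mm [X \<otimes> Y] A ** (alpi X Y \<one>\<lhd>A))"
  using pentagon[of X Y \<one> A, THEN cmp_re] by simp
 finally show "alpi X Y A ** mm [X, Y] A = mm [X \<otimes> Y] A ** (alpi X Y \<one>\<lhd>A)"
  by (rule iso_mono[where q = "alpi X Y A"]) simp_all
qed simp_all

lemma ctx_lu: "ctx [\<one>] [] lu"
proof (rule ctxI[of "lu \<one>"])
 fix A
 show "lu A ** mm [\<one>] A = mm [] A ** (lu \<one>\<lhd>A)"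
  using lu_tns[of \<one> A, symmetric] by simp
qed simp_all

text \<open>The reassociation \<open>\<Xi>|>(P \<otimes> A) \<rightarrow> (\<Xi>|>P) \<otimes>
A\<close>.\<close>

primrec asl :: "'o list \<Rightarrow> 'o \<Rightarrow> 'o \<Rightarrow> ('o, 'm) tarr" where
 "asl [] P A = idt (P \<otimes> A)"
| "asl (X # \<Xi>) P A = alpi X (\<Xi>|>P) A ** [X]\<rhd>asl \<Xi> P A"

lemma asl_simps [simp]: "vl (asl \<Xi> P A)" "dm (asl \<Xi> P A) = \<Xi>|>(P \<otimes> A)" "cd (asl \<Xi> P A) = (\<Xi>|>P) \<otimes> A"
 by (induction \<Xi>) simp_all

lemma ctx_asl: "ctx (\<Xi> @ [P]) [\<Xi>|>P] (asl \<Xi> P)"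
proof (induction \<Xi>)
 case Nil
 then show ?case using ctx_id[of "[P]"] by simp
next
 case (Cons X \<Xi>)
 have "ctx (X # \<Xi> @ [P]) [X, \<Xi>|>P] (\<lambda>A. [X]\<rhd>asl \<Xi> P A)"
  using ctx_left1[OF Cons, of X] by simp
 from ctx_comp[OF this ctx_alpi] show ?case by simp
qed

text \<open>\<open>rw \<Xi> P h A\<close> is \<open>h : \<Xi>|>P \<rightarrow> H\<close> tensored on the right with \<open>A\<close>.\<close>

definition rw :: "'o list \<Rightarrow> 'o \<Rightarrow> ('o, 'm) tarr \<Rightarrow> 'o \<Rightarrow> ('o, 'm) tarr" where
 "rw \<Xi> P h A = (h\<lhd>A) ** asl \<Xi> P A"

lemma ctx_rw: "h \<in> \<Xi>|>P \<leadsto> H \<Longrightarrow> ctx (\<Xi> @ [P]) [H] (rw \<Xi> P h)"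
 using ctx_comp[OF ctx_asl ctx_arr, of h \<Xi> P H] by (simp add: rw_def[abs_def])

lemma rw_simps [simp]:
 assumes "vl h" "dm h = \<Xi>|>P"
 shows "vl (rw \<Xi> P h A)" "dm (rw \<Xi> P h A) = \<Xi>|>(P \<otimes> A)" "cd (rw \<Xi> P h A) = cd h \<otimes> A"
 using ctx_ty[OF ctx_rw, of h \<Xi> P "cd h" A] assms by auto

lemma rw_ru:
 assumes "vl h" "dm h = \<Xi>|>P" "cd h = H"
 shows "ru H ** rw \<Xi> P h \<one> = h ** \<Xi>\<rhd>ru P"
proof -
 have "ru (\<Xi>|>P) ** asl \<Xi> P \<one> = \<Xi>\<rhd>ru P"
 proof (induction \<Xi>)
  case (Cons X \<Xi>)
  have "ru ((X # \<Xi>)|>P) ** asl (X # \<Xi>) P \<one> = [X]\<rhd>(ru (\<Xi>|>P) ** asl \<Xi> P \<one>)"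
   by (simp add: wa_ru)
  then show ?case unfolding Cons by (simp add: wa_Cons[of X \<Xi>])
 qed simp
 then show ?thesis
  using assms ru_nat[of h "\<Xi>|>P" H, THEN cmp_re] unfolding rw_def by simp
qed

section \<open>Representations and natural operations\<close>

definition repr :: "'o \<Rightarrow> 'o \<Rightarrow> 'o \<Rightarrow> ('o, 'm) tarr \<Rightarrow> bool" where
 "repr H A B e \<longleftrightarrow> e \<in> H \<otimes> A \<leadsto> B \<and>
  (\<forall>X f. f \<in> X \<otimes> A \<leadsto> B \<longrightarrow> (\<exists>!g. g \<in> X \<leadsto> H \<and> e ** (g\<lhd>A) = f))"

lemma repr_ty: "repr H A B e \<Longrightarrow> e \<in> H \<otimes> A \<leadsto> B"
 by (simp add: repr_def)

lemma repr_ex: "\<lbrakk>repr H A B e; f \<in> X \<otimes> A \<leadsto> B\<rbrakk> \<Longrightarrow> \<exists>g. g \<in> X \<leadsto> H \<and> e ** (g\<lhd>A) = f"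
 unfolding repr_def by blast

lemma repr_eq: "\<lbrakk>repr H A B e; e ** (g\<lhd>A) = e ** (g'\<lhd>A); g \<in> X \<leadsto> H; g' \<in> X \<leadsto> H\<rbrakk> \<Longrightarrow> g = g'"
proof -
 assume a: "repr H A B e" "e ** (g\<lhd>A) = e ** (g'\<lhd>A)" "g \<in> X \<leadsto> H" "g' \<in> X \<leadsto> H"
 have "e ** (g\<lhd>A) \<in> X \<otimes> A \<leadsto> B" using a(3) repr_ty[OF a(1)] by simp
 then have "\<exists>!g'. g' \<in> X \<leadsto> H \<and> e ** (g'\<lhd>A) = e ** (g\<lhd>A)"
  using a(1) unfolding repr_def by blast
 then show ?thesis using a by metis
qed

lemma hat_ex:
 assumes r: "repr H A B e" and f: "f \<in> \<Xi>|>A \<leadsto> B"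
 shows "\<exists>u. ctx \<Xi> [H] u \<and> e ** u A = f"
proof -
 obtain g where g: "g \<in> mrg \<Xi> \<leadsto> H" "e ** (g\<lhd>A) = f ** mm \<Xi> A"
  using repr_ex[OF r, of "f ** mm \<Xi> A" "mrg \<Xi>"] f by auto
 have "e ** (g\<lhd>A) ** mmi \<Xi> A = f"
  using g(2)[THEN cmp_re, of "mmi \<Xi> A"] f by simp
 then show ?thesis using ctx_single[OF g(1)] by blast
qed

lemma hat_unique:
 assumes r: "repr H A B e" and u: "ctx \<Xi> [H] u" "ctx \<Xi> [H] u'" and e: "e ** u A = e ** u' A"
 shows "u = u'"
proof -
 obtain v where v: "v \<in> mrg \<Xi> \<leadsto> H" "u = (\<lambda>A. (v\<lhd>A) ** mmi \<Xi> A)" by (rule ctx_singleE[OF u(1)])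
 obtain v' where v': "v' \<in> mrg \<Xi> \<leadsto> H" "u' = (\<lambda>A. (v'\<lhd>A) ** mmi \<Xi> A)" by (rule ctx_singleE[OF u(2)])
 have "(e ** u A) ** mm \<Xi> A = (e ** u' A) ** mm \<Xi> A" using e by simp
 then have "e ** (v\<lhd>A) = e ** (v'\<lhd>A)"
  using v v' by simp
 then have "v = v'" using repr_eq[OF r] v(1) v'(1) by blast
 then show ?thesis using v v' by simp
qed

text \<open>The representing arrow of \<open>f : \<Xi>|>A \<rightarrow> B\<close>, as a context
morphism to the one-object context \<open>[H]\<close>. An arrow \<open>f\<close> is therefore the
universal arrow \<open>e\<close> precomposed with a context morphism, which is the Yoneda principle
used below.\<close>

definition hat :: "'o \<Rightarrow> 'o \<Rightarrow> ('o, 'm) tarr \<Rightarrow> 'o list \<Rightarrow> ('o, 'm) tarr \<Rightarrow> 'o \<Rightarrow> ('o, 'm) tarr" where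
 "hat H A e \<Xi> f = (SOME u. ctx \<Xi> [H] u \<and> e ** u A = f)"

lemma hat:
 assumes r: "repr H A B e" and f: "f \<in> \<Xi>|>A \<leadsto> B"
 shows "ctx \<Xi> [H] (hat H A e \<Xi> f)" "e ** hat H A e \<Xi> f A = f"
 using someI_ex[OF hat_ex[OF assms]] unfolding hat_def by auto

lemma hat_ctx:
 assumes r: "repr H A B e" and f: "f \<in> \<Delta>|>A \<leadsto> B" and u: "ctx \<Xi> \<Delta> u"
 shows "hat H A e \<Xi> (f ** u A) = (\<lambda>X. hat H A e \<Delta> f X ** u X)"
proof (rule hat_unique[OF r])
 have f': "f ** u A \<in> \<Xi>|>A \<leadsto> B" using f ctx_ty[OF u, of A] by simp
 show "ctx \<Xi> [H] (hat H A e \<Xi> (f ** u A))" by (rule hat(1)[OF r f'])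
 show "ctx \<Xi> [H] (\<lambda>X. hat H A e \<Delta> f X ** u X)" by (rule ctx_comp[OF u hat(1)[OF r f]])
 show "e ** hat H A e \<Xi> (f ** u A) A = e ** hat H A e \<Delta> f A ** u A"
  using hat(2)[OF r f'] hat(2)[OF r f, THEN cmp_re] by simp
qed

lemma hat_self:
 assumes r: "repr H A B e" shows "hat H A e [H] e = (\<lambda>X. idt (H \<otimes> X))"
 using hat_unique[OF r hat(1)[OF r] ctx_id[of "[H]", simplified]] hat(2)[OF r] repr_ty[OF r]
 by simp

text \<open>An operation turning arrows \<open>f : \<Xi>|>A \<rightarrow> B\<close> into arrows \<open>U|>\<Xi>|>A' \<rightarrow> B'\<close>, for every
 context \<open>\<Xi>\<close>, and natural in \<open>\<Xi>\<close>: the elementwise form of an arrow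
 \<open>U|>(ihom A B \<otimes> A') \<rightarrow> B'\<close>.\<close>

definition natop :: "'o list \<Rightarrow> 'o \<Rightarrow> 'o \<Rightarrow> 'o \<Rightarrow> 'o \<Rightarrow> ('o, 'm) oper \<Rightarrow> bool" where
 "natop U A B A' B' \<phi> \<longleftrightarrow>
  (\<forall>\<Xi> f. f \<in> \<Xi>|>A \<leadsto> B \<longrightarrow> \<phi> \<Xi> f \<in> U|>\<Xi>|>A' \<leadsto> B') \<and>
  (\<forall>\<Xi> \<Delta> u f. ctx \<Xi> \<Delta> u \<longrightarrow> f \<in> \<Delta>|>A \<leadsto> B \<longrightarrow> \<phi> \<Xi> (f ** u A) = \<phi> \<Delta> f ** U\<rhd>u A')"

lemma natop_ty: "\<lbrakk>natop U A B A' B' \<phi>; f \<in> \<Xi>|>A \<leadsto> B\<rbrakk> \<Longrightarrow> \<phi> \<Xi> f \<in> U|>\<Xi>|>A' \<leadsto> B'"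
 unfolding natop_def by blast

lemma natop_tys:
 assumes "natop U A B A' B' \<phi>" "vl f" "dm f = \<Xi>|>A" "cd f = B"
 shows "vl (\<phi> \<Xi> f)" "dm (\<phi> \<Xi> f) = U|>\<Xi>|>A'" "cd (\<phi> \<Xi> f) = B'"
 using natop_ty[OF assms(1), of f \<Xi>] assms(2-) by auto

lemma natop_nat: "\<lbrakk>natop U A B A' B' \<phi>; ctx \<Xi> \<Delta> u; vl f; dm f = \<Delta>|>A; cd f = B\<rbrakk> \<Longrightarrow>
  \<phi> \<Xi> (f ** u A) = \<phi> \<Delta> f ** U\<rhd>u A'"
 unfolding natop_def by simp

lemma natopI:
 assumes "\<And>\<Xi> f. \<lbrakk>vl f; dm f = \<Xi>|>A; cd f = B\<rbrakk> \<Longrightarrow> \<phi> \<Xi> f \<in> U|>\<Xi>|>A' \<leadsto> B'"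
  and "\<And>\<Xi> \<Delta> u f. \<lbrakk>ctx \<Xi> \<Delta> u; \<And>A. vl (u A); \<And>A. dm (u A) = \<Xi>|>A; \<And>A. cd (u A) = \<Delta>|>A; vl f; dm f = \<Delta>|>A; cd f = B\<rbrakk> \<Longrightarrow>
   \<phi> \<Xi> (f ** u A) = \<phi> \<Delta> f ** U\<rhd>u A'"
 shows "natop U A B A' B' \<phi>"
 unfolding natop_def using assms ctx_ty by (simp add: ctx_dm ctx_cd)

text \<open>A natural operation is determined by its value on the universal arrow, \<open>f\<close>
being a restriction of it along a context morphism.\<close>

lemma natop_eqI:
 assumes "natop U A B A' B' \<phi>" "natop U A B A' B' \<psi>" and r: "repr H A B e" and "\<phi> [H] e = \<psi> [H] e"
  and f: "f \<in> \<Xi>|>A \<leadsto> B"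
 shows "\<phi> \<Xi> f = \<psi> \<Xi> f"
proof -
 note h = hat[OF r f] and t = repr_ty[OF r]
 show ?thesis
  using natop_nat[OF assms(1) h(1), of e] natop_nat[OF assms(2) h(1), of e] t assms(4) h(2) by simp
qed

text \<open>Conversely every arrow \<open>h\<close> is the value of an operation at the universal
arrow.\<close>

definition natof :: "'o \<Rightarrow> 'o \<Rightarrow> ('o, 'm) tarr \<Rightarrow> 'o list \<Rightarrow> 'o \<Rightarrow> ('o, 'm) tarr \<Rightarrow> ('o, 'm) oper" where
 "natof H A e U A' h \<Xi> f = h ** U\<rhd>hat H A e \<Xi> f A'"

lemma natof:
 assumes r: "repr H A B e" and h: "h \<in> U|>(H \<otimes> A') \<leadsto> B'"
 shows "natop U A B A' B' (natof H A e U A' h)" "natof H A e U A' h [H] e = h"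
proof -
 show "natop U A B A' B' (natof H A e U A' h)"
 proof (rule natopI)
  fix \<Xi> f assume "vl f" "dm f = \<Xi>|>A" "cd f = B"
  then show "natof H A e U A' h \<Xi> f \<in> U|>\<Xi>|>A' \<leadsto> B'"
   unfolding natof_def using h ctx_ty[OF hat(1)[OF r], of f \<Xi> A'] by simp
 next
  fix \<Xi> \<Delta> u f assume a: "ctx \<Xi> \<Delta> u" "\<And>A. vl (u A)" "\<And>A. dm (u A) = \<Xi>|>A" "\<And>A. cd (u A) = \<Delta>|>A" "vl f" "dm f = \<Delta>|>A" "cd f = B"
  then show "natof H A e U A' h \<Xi> (f ** u A) = natof H A e U A' h \<Delta> f ** U\<rhd>u A'"
   unfolding natof_def using hat_ctx[OF r _ a(1), of f] h ctx_ty[OF hat(1)[OF r], of f \<Delta> A'] by simp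
 qed
 show "natof H A e U A' h [H] e = h"
  unfolding natof_def hat_self[OF r] using h by simp
qed

text \<open>The same for operations on two arrows. Equations between composites are reduced by it to
universal arrows, that is, to equations between arrows of hom-objects.\<close>

lemma natop2_eqI:
 fixes F G :: "'o list \<Rightarrow> ('o, 'm) tarr \<Rightarrow> ('o, 'm) oper"
 assumes r: "repr H A B e" and r': "repr H' A' B' e'"
  and F1: "\<And>\<Delta> \<Delta>' u g \<Xi> f. \<lbrakk>ctx \<Delta> \<Delta>' u; \<And>A. vl (u A); \<And>A. dm (u A) = \<Delta>|>A; \<And>A. cd (u A) = \<Delta>'|>A; g \<in> \<Delta>'|>A \<leadsto> B; f \<in> \<Xi>|>A' \<leadsto> B'\<rbrakk> \<Longrightarrow>
    F \<Delta> (g ** u A) \<Xi> f = F \<Delta>' g \<Xi> f ** U\<rhd>u (\<Xi>|>C)"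
  and G1: "\<And>\<Delta> \<Delta>' u g \<Xi> f. \<lbrakk>ctx \<Delta> \<Delta>' u; \<And>A. vl (u A); \<And>A. dm (u A) = \<Delta>|>A; \<And>A. cd (u A) = \<Delta>'|>A; g \<in> \<Delta>'|>A \<leadsto> B; f \<in> \<Xi>|>A' \<leadsto> B'\<rbrakk> \<Longrightarrow>
    G \<Delta> (g ** u A) \<Xi> f = G \<Delta>' g \<Xi> f ** U\<rhd>u (\<Xi>|>C)"
  and F2: "\<And>\<Delta> v g \<Xi> \<Xi>' f. \<lbrakk>ctx \<Xi> \<Xi>' v; \<And>A. vl (v A); \<And>A. dm (v A) = \<Xi>|>A; \<And>A. cd (v A) = \<Xi>'|>A; g \<in> \<Delta>|>A \<leadsto> B; f \<in> \<Xi>'|>A' \<leadsto> B'\<rbrakk> \<Longrightarrow>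
    F \<Delta> g \<Xi> (f ** v A') = F \<Delta> g \<Xi>' f ** U\<rhd>\<Delta>\<rhd>v C"
  and G2: "\<And>\<Delta> v g \<Xi> \<Xi>' f. \<lbrakk>ctx \<Xi> \<Xi>' v; \<And>A. vl (v A); \<And>A. dm (v A) = \<Xi>|>A; \<And>A. cd (v A) = \<Xi>'|>A; g \<in> \<Delta>|>A \<leadsto> B; f \<in> \<Xi>'|>A' \<leadsto> B'\<rbrakk> \<Longrightarrow>
    G \<Delta> g \<Xi> (f ** v A') = G \<Delta> g \<Xi>' f ** U\<rhd>\<Delta>\<rhd>v C"
  and FG: "F [H] e [H'] e' = G [H] e [H'] e'"
  and gf: "g \<in> \<Delta>|>A \<leadsto> B" "f \<in> \<Xi>|>A' \<leadsto> B'"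
 shows "F \<Delta> g \<Xi> f = G \<Delta> g \<Xi> f"
proof -
 note h = hat[OF r gf(1)] and h' = hat[OF r' gf(2)]
 let ?u = "hat H A e \<Delta> g" and ?v = "hat H' A' e' \<Xi> f"
 have f': "e' ** ?v A' \<in> \<Xi>|>A' \<leadsto> B'" using h'(2) gf(2) by simp
 note hs = h(1) ctx_ty'[OF h(1)] ctx_dm[OF h(1)] ctx_cd[OF h(1)]
 note hs' = h'(1) ctx_ty'[OF h'(1)] ctx_dm[OF h'(1)] ctx_cd[OF h'(1)]
 have "F \<Delta> (e ** ?u A) \<Xi> (e' ** ?v A') = G \<Delta> (e ** ?u A) \<Xi> (e' ** ?v A')"
  using F1[OF hs _ f', of e] G1[OF hs _ f', of e] F2[OF hs', of e "[H]" e'] G2[OF hs', of e "[H]" e']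
   repr_ty[OF r] repr_ty[OF r'] FG by simp
 then show ?thesis using h(2) h'(2) by simp
qed

lemma tns_one_inject:
 assumes e: "f\<lhd>\<one> = g\<lhd>\<one>" and v: "vl f" "vl g" "dm f = dm g" "cd f = cd g"
 shows "f = g"
proof -
 have "f ** ru (dm f) = g ** ru (dm f)"
  using e v ru_nat[of f "dm f" "cd f"] ru_nat[of g "dm g" "cd g"] by simp
 then show ?thesis by (rule iso_epi[where q = "rui (dm f)"]) (use v in auto)
qed

lemma sw_nat1 [simp]: "\<lbrakk>vl f; cd f = A'\<rbrakk> \<Longrightarrow> sw A' B ** (f\<lhd>B) = [B]\<rhd>f ** sw (dm f) B"
 using sw_nat[of f "dm f" A' "idt B" B B] by simp

lemma sw_nat2 [simp]: "\<lbrakk>vl f; cd f = B'\<rbrakk> \<Longrightarrow> sw A B' ** [A]\<rhd>f = (f\<lhd>A) ** sw A (dm f)"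
 using sw_nat[of "idt A" A A f "dm f" B'] by simp

lemmas sw_nat_re [simp] = sw_nat1[THEN cmp_re, unfolded cmp_assoc] sw_nat2[THEN cmp_re, unfolded cmp_assoc]

lemma lu_sw: "lu A ** sw A \<one> = ru A"
proof (rule tns_one_inject)
 have "sw A \<one> ** (ru A\<lhd>\<one>) = sw A \<one> ** [A]\<rhd>lu \<one> ** alp A \<one> \<one>"
  using triangle[of A \<one>] by (simp del: sw_nat_re sw_nat2)
 also have "\<dots> = (lu \<one>\<lhd>A) ** sw A (\<one> \<otimes> \<one>) ** alp A \<one> \<one>"
  by simp
 also have "\<dots> = lu (\<one> \<otimes> A) ** alp \<one> \<one> A ** sw A (\<one> \<otimes> \<one>) ** alp A \<one> \<one>"
  using lu_tns[of \<one> A, THEN cmp_re] by simp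
 also have "\<dots> = sw A \<one> ** lu (A \<otimes> \<one>) ** alp \<one> A \<one> ** (sw A \<one>\<lhd>\<one>)"
  by (simp add: hexagon)
 also have "\<dots> = sw A \<one> ** ((lu A ** sw A \<one>)\<lhd>\<one>)"
  using lu_tns[of A \<one>, THEN cmp_re] by simp
 finally have e: "sw A \<one> ** (ru A\<lhd>\<one>) = sw A \<one> ** ((lu A ** sw A \<one>)\<lhd>\<one>)" .
 show "(lu A ** sw A \<one>)\<lhd>\<one> = ru A\<lhd>\<one>"
  by (rule iso_mono[OF e[symmetric], of "sw \<one> A"]) simp_all
qed simp_all

lemma ru_sw: "ru A ** sw \<one> A = lu A"
 using lu_sw[of A, THEN cmp_re, of "sw \<one> A"] by simp

lemma sw_tns: "sw (P \<otimes> Q) R = alp R P Q ** (sw P R\<lhd>Q) ** alpi P R Q ** [P]\<rhd>sw Q R ** alp P Q R"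
proof -
 have c: "(sw P R\<lhd>Q) ** (sw R P\<lhd>Q) ** x = x" if "vl x" "cd x = (R \<otimes> P) \<otimes> Q" for x
  using that by (simp add: tns_cmp_re)
 have d: "[P]\<rhd>sw Q R ** [P]\<rhd>sw R Q ** x = x" if "vl x" "cd x = P \<otimes> (R \<otimes> Q)" for x
  using that wa_inv_re[of "sw Q R" "sw R Q" _ x "[P]"] by simp
 have c': "(sw P R\<lhd>Q) ** (sw R P\<lhd>Q) = idt ((R \<otimes> P) \<otimes> Q)"
  by (simp add: tns_cmp)
 let ?q = "sw R (P \<otimes> Q) ** alp R P Q"
 have "(alp R P Q ** (sw P R\<lhd>Q) ** alpi P R Q ** [P]\<rhd>sw Q R ** alp P Q R) ** ?q
  = alp R P Q ** (sw P R\<lhd>Q) ** alpi P R Q ** [P]\<rhd>sw Q R ** [P]\<rhd>sw R Q ** alp P R Q ** (sw R P\<lhd>Q)"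
  using hexagon[of P Q R] by simp
 also have "\<dots> = sw (P \<otimes> Q) R ** ?q"
  by (simp add: c c' d)
 finally have e: "(alp R P Q ** (sw P R\<lhd>Q) ** alpi P R Q ** [P]\<rhd>sw Q R ** alp P Q R) ** ?q = sw (P \<otimes> Q) R ** ?q" .
 show ?thesis
  by (rule iso_epi[OF e[symmetric], of "alpi R P Q ** sw (P \<otimes> Q) R"]) simp_all
qed

section \<open>The internal hom\<close>

definition ev :: "'o \<Rightarrow> 'o \<Rightarrow> ('o, 'm) tarr" where
 "ev A B = mk (hm A B \<otimes> A) (evl V A B) B"
definition cur :: "'o \<Rightarrow> 'o \<Rightarrow> ('o, 'm) tarr \<Rightarrow> ('o, 'm) tarr" where
 "cur X A f = mk X (curried V X A (cd f) (raw f)) (hm A (cd f))"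

lemma ev_simps [simp]: "vl (ev A B)" "dm (ev A B) = hm A B \<otimes> A" "cd (ev A B) = B"
 using smc by (simp_all add: ev_def symmetric_monoidal_closed_def)

lemma curried_ex1:
 assumes "f \<in> Hom V (X \<otimes> A) B"
 shows "\<exists>!g. g \<in> Hom V X (hm A B) \<and> evl V A B \<cdot> (g \<odot> Idn V A) = f"
 using smc assms unfolding symmetric_monoidal_closed_def by blast

lemma repr_ev: "repr (hm A B) A B (ev A B)"
 unfolding repr_def
proof (intro conjI allI impI)
 fix X f assume f: "f \<in> X \<otimes> A \<leadsto> B"
 have "raw f \<in> Hom V (X \<otimes> A) B" using f raw_Hom[of f] by auto
 from curried_ex1[OF this] obtain g where g: "g \<in> Hom V X (hm A B)" "evl V A B \<cdot> (g \<odot> Idn V A) = raw f"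
  and u: "\<And>g'. \<lbrakk>g' \<in> Hom V X (hm A B); evl V A B \<cdot> (g' \<odot> Idn V A) = raw f\<rbrakk> \<Longrightarrow> g' = g" by metis
 show "\<exists>!g. g \<in> X \<leadsto> hm A B \<and> ev A B ** (g\<lhd>A) = f"
 proof (rule ex1I[of _ "mk X g (hm A B)"])
  show "mk X g (hm A B) \<in> X \<leadsto> hm A B \<and> ev A B ** (mk X g (hm A B)\<lhd>A) = f"
   using f g by (auto intro!: tarr_eqI simp: raw_cmp raw_tns) (simp add: ev_def)
 next
  fix g' assume g': "g' \<in> X \<leadsto> hm A B \<and> ev A B ** (g'\<lhd>A) = f"
  then have "raw (ev A B ** (g'\<lhd>A)) = evl V A B \<cdot> (raw g' \<odot> Idn V A)"
   by (subst raw_cmp, simp_all add: raw_tns) (simp add: ev_def)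
  then have "evl V A B \<cdot> (raw g' \<odot> Idn V A) = raw f"
   using g' by simp
  then have "raw g' = g" using u raw_Hom[of g'] g' by auto
  then show "g' = mk X g (hm A B)" using g' mk_raw[of g'] by auto
 qed
qed simp

lemma curried_mk:
 assumes "f \<in> Hom V (X \<otimes> A) B"
 shows "curried V X A B f \<in> Hom V X (hm A B)" "evl V A B \<cdot> (curried V X A B f \<odot> Idn V A) = f"
 using theI'[OF curried_ex1[OF assms]] unfolding curried_def by auto

lemma cur:
 assumes "vl f" "dm f = X \<otimes> A" "cd f = B"
 shows "vl (cur X A f)" "dm (cur X A f) = X" "cd (cur X A f) = hm A B"
  "ev A B ** (cur X A f\<lhd>A) = f"
proof -
 have r: "raw f \<in> Hom V (X \<otimes> A) B" using assms raw_Hom[of f] by auto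
 note c = curried_mk[OF r]
 show t: "vl (cur X A f)" "dm (cur X A f) = X" "cd (cur X A f) = hm A B"
  unfolding cur_def using c(1) assms(3) by auto
 show "ev A B ** (cur X A f\<lhd>A) = f"
  using t c(2) assms by (auto intro!: tarr_eqI simp: raw_cmp raw_tns) (simp add: ev_def cur_def)
qed

lemma ev_eqI: "\<lbrakk>ev A B ** (f\<lhd>A) = ev A B ** (g\<lhd>A); vl f; vl g; dm f = dm g; cd f = hm A B; cd g = hm A B\<rbrakk> \<Longrightarrow> f = g"
 by (rule repr_eq[OF repr_ev, of A B f g "dm g"]) auto

lemma tarr_eq_iff: "\<lbrakk>vl f; vl g; dm f = dm g; cd f = cd g\<rbrakk> \<Longrightarrow> f = g \<longleftrightarrow> raw f = raw g"
 using tarr_eqI by blast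

lemma raw_wa: "vl f \<Longrightarrow> raw ([X]\<rhd>f) = Idn V X \<odot> raw f"
 by (simp add: wa_one raw_tns del: wa_fold)

lemmas raw_struct = alp_def alpi_def lu_def lui_def ru_def rui_def sw_def ev_def

lemma tns_split: "\<lbrakk>vl f; vl g\<rbrakk> \<Longrightarrow> f \<boxtimes> g = (f\<lhd>(cd g)) ** [dm f]\<rhd>g"
 by (simp add: tns_cmp wa_one del: wa_fold tns_push)

section \<open>Enriched categories and functors in terms of typed arrows\<close>

text \<open>Identities, composition and functor maps of enriched categories, with their types
attached.\<close>

definition cid :: "('a, 'o, 'm, 'z) vcat_scheme \<Rightarrow> 'a \<Rightarrow> ('o, 'm) tarr" where
 "cid C a = mk \<one> (vid C a) (vhom C a a)"
definition cc :: "('a, 'o, 'm, 'z) vcat_scheme \<Rightarrow> 'a \<Rightarrow> 'a \<Rightarrow> 'a \<Rightarrow> ('o, 'm) tarr" where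
 "cc C a b d = mk (vhom C b d \<otimes> vhom C a b) (vcomp C a b d) (vhom C a d)"
definition fa :: "('a, 'o, 'm, 'x) vcat_scheme \<Rightarrow> ('b, 'o, 'm, 'y) vcat_scheme \<Rightarrow> ('a, 'b, 'm, 'z) vfun_scheme \<Rightarrow> 'a \<Rightarrow> 'a \<Rightarrow> ('o, 'm) tarr" where
 "fa C D F a b = mk (vhom C a b) (fmap F a b) (vhom D (fob F a) (fob F b))"

lemma c_simps [simp]: "dm (cid C a) = \<one>" "cd (cid C a) = vhom C a a"
 "dm (cc C a b d) = vhom C b d \<otimes> vhom C a b" "cd (cc C a b d) = vhom C a d"
 "dm (fa C D F a b) = vhom C a b" "cd (fa C D F a b) = vhom D (fob F a) (fob F b)"
 "raw (cid C a) = vid C a" "raw (cc C a b d) = vcomp C a b d" "raw (fa C D F a b) = fmap F a b"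
 by (simp_all add: cid_def cc_def fa_def)

lemma vcategory_iff:
 "vcategory V C \<longleftrightarrow> (\<forall>a. vl (cid C a)) \<and> (\<forall>a b d. vl (cc C a b d)) \<and>
  (\<forall>a b d e. cc C a b e ** (cc C b d e\<lhd>(vhom C a b)) =
    cc C a d e ** [vhom C d e]\<rhd>cc C a b d ** alp (vhom C d e) (vhom C b d) (vhom C a b)) \<and>
  (\<forall>a b. cc C a b b ** (cid C b\<lhd>(vhom C a b)) = lu (vhom C a b)) \<and>
  (\<forall>a b. cc C a a b ** [vhom C a b]\<rhd>cid C a = ru (vhom C a b))"
  (is "?L \<longleftrightarrow> ?T1 \<and> ?T2 \<and> ?R")
proof -
 have t: "(\<forall>a. vl (cid C a)) \<longleftrightarrow> (\<forall>A. vid C A \<in> Hom V \<one> (vhom C A A))"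
  "(\<forall>a b d. vl (cc C a b d)) \<longleftrightarrow> (\<forall>A B D. vcomp C A B D \<in> Hom V (vhom C B D \<otimes> vhom C A B) (vhom C A D))"
  by (simp_all add: cid_def cc_def)
 show ?thesis
 proof (cases "?T1 \<and> ?T2")
  case True
  have [simp]: "raw (alp A B D) = asc V A B D" "raw (lu A) = lun V A" "raw (ru A) = run V A" for A B D
   by (simp_all add: raw_struct)
  show ?thesis
   using True unfolding vcategory_def t[symmetric]
   by (simp add: tarr_eq_iff raw_cmp raw_tns raw_wa)
 next
  case False
  then show ?thesis unfolding vcategory_def t[symmetric] by blast
 qed
qed

lemma vfunctor_typed:
 assumes C: "vcategory V C" and D: "vcategory V D"
 shows "vfunctor V C D F \<longleftrightarrow> (\<forall>a b. vl (fa C D F a b)) \<and>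
  (\<forall>a. fa C D F a a ** cid C a = cid D (fob F a)) \<and>
  (\<forall>a b e. fa C D F a e ** cc C a b e = cc D (fob F a) (fob F b) (fob F e) ** (fa C D F b e \<boxtimes> fa C D F a b))"
proof -
 have t: "(\<forall>a b. vl (fa C D F a b)) \<longleftrightarrow> (\<forall>A B. fmap F A B \<in> Hom V (vhom C A B) (vhom D (fob F A) (fob F B)))"
  by (simp add: fa_def)
 note c = C[unfolded vcategory_iff] D[unfolded vcategory_iff]
 show ?thesis
 proof (cases "\<forall>a b. vl (fa C D F a b)")
  case True
  then show ?thesis using c unfolding vfunctor_def t[symmetric]
   by (simp add: tarr_eq_iff raw_cmp raw_tns)
 next
  case False
  then show ?thesis unfolding vfunctor_def t[symmetric] by blast
 qed
qed

lemma fa_comp: "\<lbrakk>vl (fa C D F a b); vl (fa D E G (fob F a) (fob F b))\<rbrakk> \<Longrightarrow>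
  fa C E (vfun_comp V G F) a b = fa D E G (fob F a) (fob F b) ** fa C D F a b"
 by (rule tarr_eqI) (auto simp: fa_def vfun_comp_def raw_comp raw_cmp)

lemma vfun_comp_fob [simp]: "fob (vfun_comp V G F) = (\<lambda>a. fob G (fob F a))"
 and vfun_id_fob [simp]: "fob (vfun_id V C) = (\<lambda>a. a)"
 and vfun_op_fob [simp]: "fob (vfun_op F) = fob F"
 by (simp_all add: vfun_comp_def vfun_id_def vfun_op_def)

lemma vfunctor_comp:
 assumes F: "vfunctor V C D F" and G: "vfunctor V D E G" and C: "vcategory V C" "vcategory V D" "vcategory V E"
 shows "vfunctor V C E (vfun_comp V G F)"
proof -
 note f = F[unfolded vfunctor_typed[OF C(1,2)]] and g = G[unfolded vfunctor_typed[OF C(2,3)]]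
 note fs = f[THEN conjunct1, rule_format] g[THEN conjunct1, rule_format]
 note c = C[unfolded vcategory_iff]
 have e: "fa D E G A X ** cc D A B X ** x = cc E (fob G A) (fob G B) (fob G X) ** (fa D E G B X \<boxtimes> fa D E G A B) ** x" for A B X x
  using g[THEN conjunct2, THEN conjunct2, rule_format, of A X B, THEN cmp_re] by simp
 show ?thesis
  unfolding vfunctor_typed[OF C(1,3)] using f g c fs
  by (simp add: fa_comp[where D = D] tns_cmp e)
qed

lemma fa_id: "fa C C (vfun_id V C) a b = idt (vhom C a b)"
 by (simp add: fa_def vfun_id_def idt_def)

lemma vfunctor_id:
 assumes C: "vcategory V C" shows "vfunctor V C C (vfun_id V C)"
 unfolding vfunctor_typed[OF C C] using C[unfolded vcategory_iff] by (simp add: fa_id)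

subsection \<open>Opposites\<close>

lemma vop_simps [simp]: "vhom (vop V C) a b = vhom C b a" "vid (vop V C) = vid C"
 by (simp_all add: vop_def)

lemma cid_vop [simp]: "cid (vop V C) a = cid C a"
 by (simp add: cid_def)

lemma cc_vop: "vl (cc C d b a) \<Longrightarrow> cc (vop V C) a b d = cc C d b a ** sw (vhom C d b) (vhom C b a)"
 by (simp add: cc_def vop_def sw_def cmp_mk swp_Hom)

lemma fa_vop [simp]: "fa (vop V C) (vop V D) (vfun_op F) a b = fa C D F b a"
 by (simp add: fa_def vfun_op_def)

lemma vcategory_vop:
 assumes C: "vcategory V C" shows "vcategory V (vop V C)"
proof -
 note c = C[unfolded vcategory_iff]
 have [simp]: "vl (cid C a)" "vl (cc C a b d)" for a b d using c by auto
 have assoc: "cc C a b e ** (cc C b d e\<lhd>(vhom C a b)) ** x =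
    cc C a d e ** [vhom C d e]\<rhd>cc C a b d ** alp (vhom C d e) (vhom C b d) (vhom C a b) ** x" for a b d e x
  using c[THEN conjunct2, THEN conjunct2, THEN conjunct1, rule_format, of a b e d, THEN cmp_re] by simp
 have u: "cc C a b b ** (cid C b\<lhd>(vhom C a b)) ** x = lu (vhom C a b) ** x"
  "cc C a a b ** [vhom C a b]\<rhd>cid C a ** x = ru (vhom C a b) ** x" for a b x
  using c by (metis cmp_assoc)+
 show ?thesis
  unfolding vcategory_iff
 proof (intro conjI allI)
  fix a b d e
  let ?P = "vhom C e d" and ?Q = "vhom C d b" and ?R = "vhom C b a"
  have "cc (vop V C) a b e ** (cc (vop V C) b d e\<lhd>(vhom (vop V C) a b))
   = cc C e b a ** [?R]\<rhd>cc C e d b ** [?R]\<rhd>sw ?P ?Q ** sw (?P \<otimes> ?Q) ?R"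
   by (simp add: cc_vop)
  also have "\<dots> = cc C e b a ** [?R]\<rhd>cc C e d b ** [?R]\<rhd>sw ?P ?Q ** alp ?R ?P ?Q ** (sw ?P ?R\<lhd>?Q) ** alpi ?P ?R ?Q ** [?P]\<rhd>sw ?Q ?R ** alp ?P ?Q ?R"
   unfolding sw_tns ..
  also have "\<dots> = cc C e b a ** [?R]\<rhd>cc C e d b ** alp ?R ?Q ?P ** sw ?P (?R \<otimes> ?Q) ** [?P]\<rhd>sw ?Q ?R ** alp ?P ?Q ?R"
   using hexagon[of ?R ?Q ?P, symmetric, THEN cmp_re] by (simp del: sw_nat2 sw_nat_re)
  also have "\<dots> = cc (vop V C) a d e ** [vhom (vop V C) d e]\<rhd>cc (vop V C) a b d **
   alp (vhom (vop V C) d e) (vhom (vop V C) b d) (vhom (vop V C) a b)"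
   by (simp add: cc_vop assoc)
  finally show "cc (vop V C) a b e ** (cc (vop V C) b d e\<lhd>(vhom (vop V C) a b)) = cc (vop V C) a d e ** [vhom (vop V C) d e]\<rhd>cc (vop V C) a b d **
   alp (vhom (vop V C) d e) (vhom (vop V C) b d) (vhom (vop V C) a b)" .
 qed (simp_all add: cc_vop u ru_sw lu_sw)
qed

lemma vop_vop:
 assumes C: "vcategory V C"
 shows "vop V (vop V C) = \<lparr>vhom = vhom C, vid = vid C, vcomp = vcomp C\<rparr>"
proof -
 have [simp]: "vl (cc C a b d)" for a b d using C[unfolded vcategory_iff] by auto
 have [simp]: "vl (cc (vop V C) a b d)" for a b d using vcategory_vop[OF C, unfolded vcategory_iff] by auto
 have "cc (vop V (vop V C)) a b d = cc C a b d" for a b d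
  by (subst cc_vop) (simp_all add: cc_vop)
 then have "vcomp (vop V (vop V C)) a b d = vcomp C a b d" for a b d
  by (metis c_simps(8))
 then show ?thesis by (auto simp: vop_def[of V "vop V C"])
qed

lemma vfunctor_op:
 assumes C: "vcategory V C" and D: "vcategory V D" and F: "vfunctor V C D F"
 shows "vfunctor V (vop V C) (vop V D) (vfun_op F)"
proof -
 note c = C[unfolded vcategory_iff] D[unfolded vcategory_iff] F[unfolded vfunctor_typed[OF C D]]
 have [simp]: "vl (cc C a b d)" "vl (cc D a' b' d')" "vl (fa C D F a b)" for a b d a' b' d' using c by auto
 have e: "fa C D F a e ** cc C a b e ** x = cc D (fob F a) (fob F b) (fob F e) ** (fa C D F b e \<boxtimes> fa C D F a b) ** x" for a b e x
  using c(3)[THEN conjunct2, THEN conjunct2, rule_format, of a e b, THEN cmp_re] by simp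
 have s: "(fa C D F b e \<boxtimes> fa C D F a b) ** sw (vhom C a b) (vhom C b e) = sw (vhom D (fob F a) (fob F b)) (vhom D (fob F b) (fob F e)) ** (fa C D F a b \<boxtimes> fa C D F b e)" for a b e
  by (rule sw_nat[symmetric]) simp_all
 show ?thesis
  unfolding vfunctor_typed[OF vcategory_vop[OF C] vcategory_vop[OF D]]
  using c(3) by (simp add: cc_vop e s)
qed

lemma vself_simps [simp]: "vhom VV = hm"
 by (simp add: vself_def)

lemma raw_idt_lu: "Idn V A \<cdot> lun V A = lun V A"
 using struct_isos(2)[of A] raw_idl unfolding inverse_arrows_def by blast

lemma cid_vself: "cid VV A = cur \<one> A (lu A)"
 by (simp add: cid_def cur_def vself_def nm_def raw_idt_lu) (simp add: lu_def)

lemma cc_vself: "cc VV A B D = cur (hm B D \<otimes> hm A B) A (ev B D ** [hm B D]\<rhd>ev A B ** alp (hm B D) (hm A B) A)"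
 by (simp add: cc_def cur_def vself_def raw_cmp raw_wa) (simp add: raw_struct)

lemma vl_vself [simp]: "vl (cid VV A)" "vl (cc VV A B D)"
 unfolding cid_vself cc_vself by (simp_all add: cur(1))

lemma ev_cid: "ev A A ** (cid VV A\<lhd>A) = lu A"
 unfolding cid_vself by (rule cur(4)) simp_all

lemma ev_cc: "ev A D ** (cc VV A B D\<lhd>A) = ev B D ** [hm B D]\<rhd>ev A B ** alp (hm B D) (hm A B) A"
 unfolding cc_vself by (rule cur(4)) simp_all

lemmas ev_cc_re = ev_cc[THEN cmp_re, unfolded cmp_assoc]

subsection \<open>The underlying category of the base\<close>

text \<open>Arrows \<open>A \<rightarrow> B\<close> of the base and arrows of the underlying
category of its self-enrichment are named by one another: \<open>una\<close> is inverse to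
\<open>uar\<close>.\<close>

definition uar :: "('o, 'm) tarr \<Rightarrow> ('o, 'm) uarr" where
 "uar f = uname V (dm f) (cd f) (raw f)"
definition una :: "('o, 'm) uarr \<Rightarrow> ('o, 'm) tarr" where
 "una \<alpha> = mk (fst \<alpha>) (unnm V (fst \<alpha>) (snd (snd \<alpha>)) (elt \<alpha>)) (snd (snd \<alpha>))"
definition elA :: "('o, 'm) uarr \<Rightarrow> ('o, 'm) tarr" where
 "elA \<alpha> = mk \<one> (elt \<alpha>) (hm (fst \<alpha>) (snd (snd \<alpha>)))"

abbreviation UV :: "('o, ('o, 'm) uarr) cat" where "UV \<equiv> ucat V VV"

lemma UV_Hom: "\<alpha> \<in> Hom UV A B \<longleftrightarrow> vl (elA \<alpha>) \<and> fst \<alpha> = A \<and> snd (snd \<alpha>) = B"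
 by (cases \<alpha>) (auto simp: ucat_def elA_def elt_def)

lemma elA_simps [simp]: "dm (elA \<alpha>) = \<one>" "cd (elA \<alpha>) = hm (fst \<alpha>) (snd (snd \<alpha>))"
 by (simp_all add: elA_def)

lemma una_eq: "vl (elA \<alpha>) \<Longrightarrow> una \<alpha> = ev (fst \<alpha>) (snd (snd \<alpha>)) ** (elA \<alpha>\<lhd>(fst \<alpha>)) ** lui (fst \<alpha>)"
proof -
 assume a: "vl (elA \<alpha>)"
 then have m: "elt \<alpha> \<in> Hom V \<one> (hm (fst \<alpha>) (snd (snd \<alpha>)))" by (simp add: elA_def)
 show ?thesis
  by (rule tarr_eqI)
   (use a struct_isos(2)[of "fst \<alpha>"] in \<open>auto simp: una_def raw_cmp raw_tns unnm_def inverse_arrows_def intro!: raw_comp raw_ten raw_id m\<close>,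
   use smc in \<open>auto simp: raw_struct symmetric_monoidal_closed_def elA_def\<close>)
qed

lemma una_ty: "\<alpha> \<in> Hom UV A B \<Longrightarrow> una \<alpha> \<in> A \<leadsto> B"
 unfolding UV_Hom by (auto simp: una_eq)

lemma una_ev: "vl (elA \<alpha>) \<Longrightarrow> ev (fst \<alpha>) (snd (snd \<alpha>)) ** (elA \<alpha>\<lhd>(fst \<alpha>)) = una \<alpha> ** lu (fst \<alpha>)"
 by (simp add: una_eq)

lemma uar_ty: "f \<in> A \<leadsto> B \<Longrightarrow> uar f \<in> Hom UV A B"
 and elA_uar: "f \<in> A \<leadsto> B \<Longrightarrow> elA (uar f) = cur \<one> A (f ** lu A)"
 and una_uar: "f \<in> A \<leadsto> B \<Longrightarrow> una (uar f) = f"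
proof -
 assume f: "f \<in> A \<leadsto> B"
 have 1: "elA (uar f) = cur \<one> A (f ** lu A)"
  using f by (simp add: elA_def uar_def uname_def elt_def nm_def cur_def raw_cmp) (simp add: raw_struct)
 have 2: "fst (uar f) = A" "snd (snd (uar f)) = B" using f by (simp_all add: uar_def uname_def)
 note c = cur[of "f ** lu A" \<one> A B, simplified]
 show "elA (uar f) = cur \<one> A (f ** lu A)" by fact
 show "uar f \<in> Hom UV A B" unfolding UV_Hom using 1 2 c f by simp
 show "una (uar f) = f"
  using f c c(4)[THEN cmp_re] by (simp add: una_eq 1 2)
qed

lemma uarr_eqI: "\<lbrakk>\<alpha> \<in> Hom UV A B; \<beta> \<in> Hom UV A B; una \<alpha> = una \<beta>\<rbrakk> \<Longrightarrow> \<alpha> = \<beta>"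
proof -
 assume a: "\<alpha> \<in> Hom UV A B" "\<beta> \<in> Hom UV A B" "una \<alpha> = una \<beta>"
 note h = a(1,2)[unfolded UV_Hom]
 have "elA \<alpha> = elA \<beta>"
  by (rule ev_eqI[of A B]) (use h una_ev[of \<alpha>] una_ev[of \<beta>] a(3) in auto)
 then have "raw (elA \<alpha>) = raw (elA \<beta>)" by simp
 then have "elt \<alpha> = elt \<beta>" by (simp add: elA_def)
 then show "\<alpha> = \<beta>" using h by (cases \<alpha>, cases \<beta>) (auto simp: elt_def)
qed

lemma UV_Idn: "Idn UV A = uar (idt A)"
 by (simp add: ucat_def uar_def uname_def vself_def)

lemma UV_Comp:
 assumes b: "\<beta> \<in> Hom UV B D" and a: "\<alpha> \<in> Hom UV A B"
 shows "\<beta> \<cdot>\<^bsub>UV\<^esub> \<alpha> \<in> Hom UV A D" "una (\<beta> \<cdot>\<^bsub>UV\<^esub> \<alpha>) = una \<beta> ** una \<alpha>"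
proof -
 note h = a[unfolded UV_Hom] b[unfolded UV_Hom]
 obtain m where m: "\<alpha> = (A, m, B)" using h by (cases \<alpha>) auto
 obtain n where n: "\<beta> = (B, n, D)" using h by (cases \<beta>) auto
 have t: "elA (\<beta> \<cdot>\<^bsub>UV\<^esub> \<alpha>) = cc VV A B D ** (elA \<beta> \<boxtimes> elA \<alpha>) ** lui \<one>"
 proof -
  have mn: "m \<in> Hom V \<one> (hm A B)" "n \<in> Hom V \<one> (hm B D)" using h m n by (auto simp: elA_def elt_def)
  have "lun_inv V \<one> \<in> Hom V \<one> (\<one> \<otimes> \<one>)" using struct_isos(2)[of \<one>] by (simp add: inverse_arrows_def)
  moreover have "vcomp VV A B D \<in> Hom V (hm B D \<otimes> hm A B) (hm A D)"
   using vl_vself(2)[of A B D] by (simp add: cc_def)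
  ultimately show ?thesis
   using mn by (simp add: elA_def m n ucat_def elt_def cc_def lui_def tns_mk cmp_mk[OF _ raw_ten] cmp_mk[OF raw_comp[OF _ raw_ten]])
 qed
 then have v: "vl (elA (\<beta> \<cdot>\<^bsub>UV\<^esub> \<alpha>))" using h by simp
 have f: "fst (\<beta> \<cdot>\<^bsub>UV\<^esub> \<alpha>) = A" "snd (snd (\<beta> \<cdot>\<^bsub>UV\<^esub> \<alpha>)) = D" by (simp_all add: m n ucat_def)
 show "\<beta> \<cdot>\<^bsub>UV\<^esub> \<alpha> \<in> Hom UV A D" using v f by (simp add: UV_Hom)
 have ea: "ev A B ** (elA \<alpha>\<lhd>A) = una \<alpha> ** lu A" and eb: "ev B D ** (elA \<beta>\<lhd>B) = una \<beta> ** lu B"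
  using una_ev[of \<alpha>] una_ev[of \<beta>] h by auto
 note u = una_ty[OF a] una_ty[OF b]
 have "una (\<beta> \<cdot>\<^bsub>UV\<^esub> \<alpha>) = ev A D ** (cc VV A B D\<lhd>A) ** ((elA \<beta> \<boxtimes> elA \<alpha>)\<lhd>A) ** (lui \<one>\<lhd>A) ** lui A"
  using h by (simp add: una_eq[OF v] f t)
 also have "\<dots> = ev B D ** [hm B D]\<rhd>ev A B ** alp (hm B D) (hm A B) A ** ((elA \<beta> \<boxtimes> elA \<alpha>)\<lhd>A) ** (lui \<one>\<lhd>A) ** lui A"
  by (simp add: ev_cc_re)
 also have "\<dots> = ev B D ** [hm B D]\<rhd>ev A B ** (elA \<beta>\<lhd>(hm A B \<otimes> A)) ** [\<one>]\<rhd>(elA \<alpha>\<lhd>A) ** alp \<one> \<one> A ** (lui \<one>\<lhd>A) ** lui A"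
  using h tns_split[of "elA \<beta>" "elA \<alpha>"] by (simp del: tns_push tns_push_re)
 also have "\<dots> = (ev B D ** (elA \<beta>\<lhd>B)) ** [\<one>]\<rhd>(ev A B ** (elA \<alpha>\<lhd>A)) ** alp \<one> \<one> A ** (lui \<one>\<lhd>A) ** lui A"
  using h tns_push_re[of "elA \<beta>" "ev A B" \<one> B] by (simp del: tns_push tns_push_re)
 also have "\<dots> = una \<beta> ** una \<alpha> ** lu A ** lu (\<one> \<otimes> A) ** alp \<one> \<one> A ** (lui \<one>\<lhd>A) ** lui A"
  unfolding ea eb using u by simp
 also have "\<dots> = una \<beta> ** una \<alpha>"
  using lu_tns[of \<one> A, THEN cmp_re] u by (simp add: tns_cmp_re)
 finally show "una (\<beta> \<cdot>\<^bsub>UV\<^esub> \<alpha>) = una \<beta> ** una \<alpha>" .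
qed

section \<open>Relative monads and their Kleisli categories\<close>

text \<open>Relative monads along \<open>K\<close>, in the form of an extension operation. For
\<open>K\<close> the identity these are the enriched Kleisli triples on the base.\<close>

definition relmon :: "('a \<Rightarrow> 'o) \<Rightarrow> ('a \<Rightarrow> 'o) \<Rightarrow> ('a \<Rightarrow> ('o, 'm) tarr) \<Rightarrow>
  ('a \<Rightarrow> 'a \<Rightarrow> ('o, 'm) oper) \<Rightarrow> bool" where
 "relmon K S \<eta> ex \<longleftrightarrow>
  (\<forall>a. \<eta> a \<in> K a \<leadsto> S a) \<and>
  (\<forall>a b. natop [] (K a) (S b) (S a) (S b) (ex a b)) \<and>
  (\<forall>a b \<Xi> f. f \<in> \<Xi>|>K a \<leadsto> S b \<longrightarrow> ex a b \<Xi> f ** \<Xi>\<rhd>\<eta> a = f) \<and>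
  (\<forall>a. ex a a [] (\<eta> a) = idt (S a)) \<and>
  (\<forall>a b c \<Xi> \<Delta> f g. f \<in> \<Xi>|>K a \<leadsto> S b \<longrightarrow> g \<in> \<Delta>|>K b \<leadsto> S c \<longrightarrow>
    ex a c (\<Delta> @ \<Xi>) (ex b c \<Delta> g ** \<Delta>\<rhd>f) = ex b c \<Delta> g ** \<Delta>\<rhd>ex a b \<Xi> f)"

lemma relmonD:
 assumes "relmon K S \<eta> ex"
 shows "vl (\<eta> a)" "dm (\<eta> a) = K a" "cd (\<eta> a) = S a"
  "natop [] (K a) (S b) (S a) (S b) (ex a b)"
  "\<lbrakk>vl f; dm f = \<Xi>|>K a; cd f = S b\<rbrakk> \<Longrightarrow> vl (ex a b \<Xi> f)"
  "\<lbrakk>vl f; dm f = \<Xi>|>K a; cd f = S b\<rbrakk> \<Longrightarrow> dm (ex a b \<Xi> f) = \<Xi>|>S a"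
  "\<lbrakk>vl f; dm f = \<Xi>|>K a; cd f = S b\<rbrakk> \<Longrightarrow> cd (ex a b \<Xi> f) = S b"
  "\<lbrakk>vl f; dm f = \<Xi>|>K a; cd f = S b\<rbrakk> \<Longrightarrow> ex a b \<Xi> f ** \<Xi>\<rhd>\<eta> a = f"
  "\<lbrakk>vl f; dm f = \<Xi>|>K a; cd f = S b\<rbrakk> \<Longrightarrow> ex a b \<Xi> f ** \<Xi>\<rhd>\<eta> a ** x = f ** x"
  "ex a a [] (\<eta> a) = idt (S a)"
  "\<lbrakk>vl f; dm f = \<Xi>|>K a; cd f = S b; vl g; dm g = \<Delta>|>K b; cd g = S c\<rbrakk> \<Longrightarrow>
    ex a c (\<Delta> @ \<Xi>) (ex b c \<Delta> g ** \<Delta>\<rhd>f) = ex b c \<Delta> g ** \<Delta>\<rhd>ex a b \<Xi> f"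
proof -
 show *: "natop [] (K a) (S b) (S a) (S b) (ex a b)" using assms unfolding relmon_def by blast
 show "ex a a [] (\<eta> a) = idt (S a)" using assms unfolding relmon_def by blast
 { assume f: "vl f" "dm f = \<Xi>|>K a" "cd f = S b"
  show "vl (ex a b \<Xi> f)" "dm (ex a b \<Xi> f) = \<Xi>|>S a" "cd (ex a b \<Xi> f) = S b"
   using natop_tys[OF * f] by simp_all
  show 1: "ex a b \<Xi> f ** \<Xi>\<rhd>\<eta> a = f" using assms f unfolding relmon_def by simp
  show "ex a b \<Xi> f ** \<Xi>\<rhd>\<eta> a ** x = f ** x" by (rule cmp_re[OF 1])
  assume g: "vl g" "dm g = \<Delta>|>K b" "cd g = S c"
  show "ex a c (\<Delta> @ \<Xi>) (ex b c \<Delta> g ** \<Delta>\<rhd>f) = ex b c \<Delta> g ** \<Delta>\<rhd>ex a b \<Xi> f"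
   using assms f g unfolding relmon_def by simp }
qed (use assms in \<open>simp_all add: relmon_def\<close>)

lemma relmonI:
 assumes "\<And>a. \<eta> a \<in> K a \<leadsto> S a" "\<And>a b. natop [] (K a) (S b) (S a) (S b) (ex a b)"
  "\<And>a b \<Xi> f. \<lbrakk>vl f; dm f = \<Xi>|>K a; cd f = S b\<rbrakk> \<Longrightarrow> ex a b \<Xi> f ** \<Xi>\<rhd>\<eta> a = f"
  "\<And>a. ex a a [] (\<eta> a) = idt (S a)"
  "\<And>a b c \<Xi> \<Delta> f g. \<lbrakk>vl f; dm f = \<Xi>|>K a; cd f = S b; vl g; dm g = \<Delta>|>K b; cd g = S c\<rbrakk> \<Longrightarrow>
    ex a c (\<Delta> @ \<Xi>) (ex b c \<Delta> g ** \<Delta>\<rhd>f) = ex b c \<Delta> g ** \<Delta>\<rhd>ex a b \<Xi> f"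
 shows "relmon K S \<eta> ex"
 unfolding relmon_def using assms by simp

lemma natop_id: "natop [] A B A B (\<lambda>\<Xi> f. f)"
 by (rule natopI) simp_all

lemma relmon_id: "relmon K K (\<lambda>a. idt (K a)) (\<lambda>a b \<Xi> f. f)"
 by (rule relmonI) (simp_all add: natop_id)

text \<open>\<open>C\<close> is a \<open>V\<close>-category whose arrows \<open>a \<rightarrow> b\<close> are the arrows \<open>K a \<rightarrow> S b\<close> of the base, composed
 by means of the extension operation \<open>ex\<close>.\<close>

definition klc :: "('a, 'o, 'm, 'z) vcat_scheme \<Rightarrow> ('a \<Rightarrow> 'o) \<Rightarrow> ('a \<Rightarrow> 'o) \<Rightarrow> ('a \<Rightarrow> 'a \<Rightarrow> ('o, 'm) tarr) \<Rightarrow>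
  ('a \<Rightarrow> ('o, 'm) tarr) \<Rightarrow> ('a \<Rightarrow> 'a \<Rightarrow> ('o, 'm) oper) \<Rightarrow> bool" where
 "klc C K S e \<eta> ex \<longleftrightarrow> vcategory V C \<and> relmon K S \<eta> ex \<and>
  (\<forall>a b. repr (vhom C a b) (K a) (S b) (e a b)) \<and>
  (\<forall>a b d. e a d ** (cc C a b d\<lhd>(K a)) =
    ex b d [vhom C b d] (e b d) ** [vhom C b d]\<rhd>e a b ** alp (vhom C b d) (vhom C a b) (K a)) \<and>
  (\<forall>a. e a a ** (cid C a\<lhd>(K a)) = \<eta> a ** lu (K a))"

lemma klcD:
 assumes "klc C K S e \<eta> ex"
 shows "vcategory V C" "relmon K S \<eta> ex" "repr (vhom C a b) (K a) (S b) (e a b)"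
  "e a d ** (cc C a b d\<lhd>(K a)) =
    ex b d [vhom C b d] (e b d) ** [vhom C b d]\<rhd>e a b ** alp (vhom C b d) (vhom C a b) (K a)"
  "e a a ** (cid C a\<lhd>(K a)) = \<eta> a ** lu (K a)"
  "vl (e a b)" "dm (e a b) = vhom C a b \<otimes> K a" "cd (e a b) = S b" "vl (cc C a b d)" "vl (cid C a)"
proof -
 show "vcategory V C" "relmon K S \<eta> ex" and r: "repr (vhom C a b) (K a) (S b) (e a b)" for a b
  using assms unfolding klc_def by blast+
 then show "vl (cc C a b d)" "vl (cid C a)" unfolding vcategory_iff by blast+
 show "vl (e a b)" "dm (e a b) = vhom C a b \<otimes> K a" "cd (e a b) = S b"
  using repr_ty[OF r] by auto
qed (use assms in \<open>simp_all add: klc_def\<close>)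

text \<open>The axioms of a category with representing arrows \<open>e\<close> are the laws of the
relative monad, read off at universal arrows.\<close>

lemma klcI:
 assumes rm: "relmon K S \<eta> ex" and r: "\<And>a b. repr (vhom C a b) (K a) (S b) (e a b)"
  and c: "\<And>a b d. e a d ** (cc C a b d\<lhd>(K a)) =
    ex b d [vhom C b d] (e b d) ** [vhom C b d]\<rhd>e a b ** alp (vhom C b d) (vhom C a b) (K a)"
  and i: "\<And>a. e a a ** (cid C a\<lhd>(K a)) = \<eta> a ** lu (K a)"
  and v [simp]: "\<And>a b d. vl (cc C a b d)" "\<And>a. vl (cid C a)"
 shows "klc C K S e \<eta> ex"
proof -
 note rd [simp] = relmonD(1-3,5-9)[OF rm]
 have e [simp]: "vl (e a b)" "dm (e a b) = vhom C a b \<otimes> K a" "cd (e a b) = S b" for a b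
  using repr_ty[OF r] by auto
 note cr = c[THEN cmp_re, unfolded cmp_assoc] and ir = i[THEN cmp_re, unfolded cmp_assoc]
 have "vcategory V C"
  unfolding vcategory_iff
 proof (intro conjI allI)
  fix a b d f
  let ?P = "vhom C d f" and ?Q = "vhom C b d" and ?R = "vhom C a b"
  have x: "ex b f [vhom C b f] (e b f) ** (cc C b d f\<lhd>(S b)) = ex d f [?P] (e d f) ** [?P]\<rhd>ex b d [?Q] (e b d) ** alp ?P ?Q (S b)"
  proof -
   have "ex b f [vhom C b f] (e b f) ** (cc C b d f\<lhd>(S b)) = ex b f [?P \<otimes> ?Q] (e b f ** (cc C b d f\<lhd>(K b)))"
    using natop_nat[OF relmonD(4)[OF rm] ctx_arr, of "cc C b d f" "?P \<otimes> ?Q" "vhom C b f" "e b f" b f] by simp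
   also have "\<dots> = ex b f [?P \<otimes> ?Q] ((ex d f [?P] (e d f) ** [?P]\<rhd>e b d) ** alp ?P ?Q (K b))"
    unfolding c by simp
   also have "\<dots> = ex b f [?P, ?Q] (ex d f [?P] (e d f) ** [?P]\<rhd>e b d) ** alp ?P ?Q (S b)"
    using natop_nat[OF relmonD(4)[OF rm] ctx_alp, of "ex d f [?P] (e d f) ** [?P]\<rhd>e b d" ?P ?Q b f] by simp
   also have "\<dots> = ex d f [?P] (e d f) ** [?P]\<rhd>ex b d [?Q] (e b d) ** alp ?P ?Q (S b)"
    using relmonD(11)[OF rm, of "e b d" "[?Q]" b d "e d f" "[?P]" f] by simp
   finally show ?thesis .
  qed
  show "cc C a b f ** (cc C b d f\<lhd>(vhom C a b)) = cc C a d f ** [vhom C d f]\<rhd>cc C a b d ** alp (vhom C d f) (vhom C b d) (vhom C a b)"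
  proof (rule repr_eq[OF r])
   have "e a f ** ((cc C a b f ** (cc C b d f\<lhd>?R))\<lhd>(K a))
    = (ex b f [vhom C b f] (e b f) ** (cc C b d f\<lhd>(S b))) ** [?P \<otimes> ?Q]\<rhd>e a b ** alp (?P \<otimes> ?Q) ?R (K a)"
    by (simp add: cr)
   also have "\<dots> = ex d f [?P] (e d f) ** [?P]\<rhd>ex b d [?Q] (e b d) ** [?P]\<rhd>[?Q]\<rhd>e a b ** alp ?P ?Q (?R \<otimes> K a) ** alp (?P \<otimes> ?Q) ?R (K a)"
    unfolding x by simp
   also have "\<dots> = ex d f [?P] (e d f) ** [?P]\<rhd>(ex b d [?Q] (e b d) ** [?Q]\<rhd>e a b ** alp ?Q ?R (K a)) ** alp ?P (?Q \<otimes> ?R) (K a) ** (alp ?P ?Q ?R\<lhd>(K a))"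
    using pentagon[of ?P ?Q ?R "K a"] by simp
   also have "\<dots> = e a f ** ((cc C a d f ** [?P]\<rhd>cc C a b d ** alp ?P ?Q ?R)\<lhd>(K a))"
    unfolding c[symmetric] by (simp add: cr)
   finally show "e a f ** ((cc C a b f ** (cc C b d f\<lhd>?R))\<lhd>(K a)) = e a f ** ((cc C a d f ** [?P]\<rhd>cc C a b d ** alp ?P ?Q ?R)\<lhd>(K a))" .
  qed simp_all
 next
  fix a b
  show "cc C a b b ** (cid C b\<lhd>(vhom C a b)) = lu (vhom C a b)"
  proof (rule repr_eq[OF r])
   have x: "ex b b [vhom C b b] (e b b) ** (cid C b\<lhd>(S b)) = lu (S b)"
   proof -
    have "ex b b [vhom C b b] (e b b) ** (cid C b\<lhd>(S b)) = ex b b [\<one>] (e b b ** (cid C b\<lhd>(K b)))"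
     using natop_nat[OF relmonD(4)[OF rm] ctx_arr, of "cid C b" \<one> "vhom C b b" "e b b" b b] by simp
    also have "\<dots> = ex b b [] (\<eta> b) ** lu (S b)"
     unfolding i using natop_nat[OF relmonD(4)[OF rm] ctx_lu, of "\<eta> b" b b] by simp
    finally show ?thesis by (simp add: relmonD(10)[OF rm])
   qed
   have "e a b ** ((cc C a b b ** (cid C b\<lhd>(vhom C a b)))\<lhd>(K a)) = (ex b b [vhom C b b] (e b b) ** (cid C b\<lhd>(S b))) ** [\<one>]\<rhd>e a b ** alp \<one> (vhom C a b) (K a)"
    by (simp add: cr)
   also have "\<dots> = e a b ** (lu (vhom C a b)\<lhd>(K a))"
    unfolding x by (simp add: lu_tns)
   finally show "e a b ** ((cc C a b b ** (cid C b\<lhd>(vhom C a b)))\<lhd>(K a)) = e a b ** (lu (vhom C a b)\<lhd>(K a))" .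
  qed simp_all
  show "cc C a a b ** [vhom C a b]\<rhd>cid C a = ru (vhom C a b)"
  proof (rule repr_eq[OF r])
   have "e a b ** ((cc C a a b ** [vhom C a b]\<rhd>cid C a)\<lhd>(K a)) = ex a b [vhom C a b] (e a b) ** [vhom C a b]\<rhd>(e a a ** (cid C a\<lhd>(K a))) ** alp (vhom C a b) \<one> (K a)"
    by (simp add: cr)
   also have "\<dots> = (ex a b [vhom C a b] (e a b) ** [vhom C a b]\<rhd>\<eta> a) ** [vhom C a b]\<rhd>lu (K a) ** alp (vhom C a b) \<one> (K a)"
    unfolding i by simp
   also have "\<dots> = e a b ** (ru (vhom C a b)\<lhd>(K a))"
    using triangle[of "vhom C a b" "K a"] by simp
   finally show "e a b ** ((cc C a a b ** [vhom C a b]\<rhd>cid C a)\<lhd>(K a)) = e a b ** (ru (vhom C a b)\<lhd>(K a))" .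
  qed simp_all
 qed simp_all
 then show ?thesis unfolding klc_def using assms by simp
qed

lemma klc_vself: "klc VV (\<lambda>A. A) (\<lambda>A. A) ev idt (\<lambda>a b \<Xi> f. f)"
 by (rule klcI[OF relmon_id]) (simp_all add: repr_ev ev_cc ev_cid)

lemmas vcat_vself = klcD(1)[OF klc_vself]

section \<open>Enriched functors as natural operations\<close>

text \<open>Under the Yoneda principle the map of hom-objects from \<open>a\<close>,
\<open>b\<close> to \<open>F a\<close>, \<open>F b\<close> is an operation \<open>\<phi>\<close> on
Kleisli arrows. Functoriality is the equation on the right for universal arrows; for arbitrary ones
it follows by \<open>natop2_eqI\<close>.\<close>

lemma vfunctor_iff:
 assumes C: "klc C K S e \<eta> ex" and C': "klc C' K' S' e' \<eta>' ex'"
  and F [simp]: "\<And>a b. vl (fa C C' F a b)"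
  and n: "\<And>a b. natop [] (K a) (S b) (K' (fob F a)) (S' (fob F b)) (\<phi> a b)"
  and g: "\<And>a b. \<phi> a b [vhom C a b] (e a b) = e' (fob F a) (fob F b) ** (fa C C' F a b\<lhd>(K' (fob F a)))"
 shows "vfunctor V C C' F \<longleftrightarrow> (\<forall>a. \<phi> a a [] (\<eta> a) = \<eta>' (fob F a)) \<and>
  (\<forall>a b d \<Xi> \<Delta> f g. f \<in> \<Xi>|>K a \<leadsto> S b \<longrightarrow> g \<in> \<Delta>|>K b \<leadsto> S d \<longrightarrow>
   \<phi> a d (\<Delta> @ \<Xi>) (ex b d \<Delta> g ** \<Delta>\<rhd>f) = ex' (fob F b) (fob F d) \<Delta> (\<phi> b d \<Delta> g) ** \<Delta>\<rhd>\<phi> a b \<Xi> f)"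
  (is "_ \<longleftrightarrow> ?I \<and> ?M")
proof -
 note c [simp] = klcD(6-10)[OF C] klcD(6-10)[OF C']
 note rm = klcD(2)[OF C] and rm' = klcD(2)[OF C']
 note rd [simp] = relmonD(1-3,5-9)[OF rm] relmonD(1-3,5-9)[OF rm']
 note nt [simp] = natop_tys[OF n]
 have i: "fa C C' F a a ** cid C a = cid C' (fob F a) \<longleftrightarrow> \<phi> a a [] (\<eta> a) = \<eta>' (fob F a)" for a
 proof -
  have "e' (fob F a) (fob F a) ** ((fa C C' F a a ** cid C a)\<lhd>(K' (fob F a))) = \<phi> a a [vhom C a a] (e a a) ** (cid C a\<lhd>(K' (fob F a)))"
   unfolding g by simp
  also have "\<dots> = \<phi> a a [\<one>] (e a a ** (cid C a\<lhd>(K a)))"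
   using natop_nat[OF n ctx_arr, of "cid C a" \<one> "vhom C a a" "e a a" a a] by simp
  also have "\<dots> = \<phi> a a [] (\<eta> a) ** lu (K' (fob F a))"
   unfolding klcD(5)[OF C] using natop_nat[OF n ctx_lu, of "\<eta> a" a a] by simp
  finally have 1: "e' (fob F a) (fob F a) ** ((fa C C' F a a ** cid C a)\<lhd>(K' (fob F a))) = \<phi> a a [] (\<eta> a) ** lu (K' (fob F a))" .
  have 2: "e' (fob F a) (fob F a) ** (cid C' (fob F a)\<lhd>(K' (fob F a))) = \<eta>' (fob F a) ** lu (K' (fob F a))"
   by (rule klcD(5)[OF C'])
  show ?thesis
  proof
   assume "fa C C' F a a ** cid C a = cid C' (fob F a)"
   then have "\<phi> a a [] (\<eta> a) ** lu (K' (fob F a)) = \<eta>' (fob F a) ** lu (K' (fob F a))"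
    unfolding 1[symmetric] 2[symmetric] by (rule arg_cong)
   then show "\<phi> a a [] (\<eta> a) = \<eta>' (fob F a)"
    by (rule iso_epi[of _ _ _ "lui (K' (fob F a))"]) simp_all
  next
   assume "\<phi> a a [] (\<eta> a) = \<eta>' (fob F a)"
   then show "fa C C' F a a ** cid C a = cid C' (fob F a)"
    by (intro repr_eq[OF klcD(3)[OF C'] trans[OF 1 trans[OF _ 2[symmetric]]]]) simp_all
  qed
 qed
 let ?m = "\<lambda>a b d. fa C C' F a d ** cc C a b d = cc C' (fob F a) (fob F b) (fob F d) ** (fa C C' F b d \<boxtimes> fa C C' F a b)"
 let ?g = "\<lambda>a b d. \<phi> a d [vhom C b d, vhom C a b] (ex b d [vhom C b d] (e b d) ** [vhom C b d]\<rhd>e a b) =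
   ex' (fob F b) (fob F d) [vhom C b d] (\<phi> b d [vhom C b d] (e b d)) ** [vhom C b d]\<rhd>\<phi> a b [vhom C a b] (e a b)"
 have m: "?m a b d \<longleftrightarrow> ?g a b d" for a b d
 proof -
  let ?k = "K' (fob F a)" let ?P = "vhom C b d" let ?Q = "vhom C a b"
  have "e' (fob F a) (fob F d) ** ((fa C C' F a d ** cc C a b d)\<lhd>?k) = \<phi> a d [vhom C a d] (e a d) ** (cc C a b d\<lhd>?k)"
   unfolding g by simp
  also have "\<dots> = \<phi> a d [?P \<otimes> ?Q] (e a d ** (cc C a b d\<lhd>(K a)))"
   using natop_nat[OF n ctx_arr, of "cc C a b d" "?P \<otimes> ?Q" "vhom C a d" "e a d" a d] by simp
  also have "\<dots> = \<phi> a d [?P \<otimes> ?Q] ((ex b d [?P] (e b d) ** [?P]\<rhd>e a b) ** alp ?P ?Q (K a))"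
   unfolding klcD(4)[OF C] by simp
  also have "\<dots> = \<phi> a d [?P, ?Q] (ex b d [?P] (e b d) ** [?P]\<rhd>e a b) ** alp ?P ?Q ?k"
   using natop_nat[OF n ctx_alp, of "ex b d [?P] (e b d) ** [?P]\<rhd>e a b" ?P ?Q a d] by simp
  finally have 1: "e' (fob F a) (fob F d) ** ((fa C C' F a d ** cc C a b d)\<lhd>?k) = \<phi> a d [?P, ?Q] (ex b d [?P] (e b d) ** [?P]\<rhd>e a b) ** alp ?P ?Q ?k" .
  let ?P' = "vhom C' (fob F b) (fob F d)" let ?Q' = "vhom C' (fob F a) (fob F b)"
  have s: "fa C C' F b d \<boxtimes> fa C C' F a b = (fa C C' F b d\<lhd>?Q') ** [?P]\<rhd>fa C C' F a b"
   using tns_split[of "fa C C' F b d" "fa C C' F a b"] by simp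
  have "e' (fob F a) (fob F d) ** ((cc C' (fob F a) (fob F b) (fob F d) ** (fa C C' F b d \<boxtimes> fa C C' F a b))\<lhd>?k)
   = (e' (fob F a) (fob F d) ** (cc C' (fob F a) (fob F b) (fob F d)\<lhd>?k)) ** ((fa C C' F b d \<boxtimes> fa C C' F a b)\<lhd>?k)"
   by simp
  also have "\<dots> = ex' (fob F b) (fob F d) [?P'] (e' (fob F b) (fob F d)) ** [?P']\<rhd>e' (fob F a) (fob F b) ** alp ?P' ?Q' ?k ** ((fa C C' F b d \<boxtimes> fa C C' F a b)\<lhd>?k)"
   unfolding klcD(4)[OF C'] by simp
  also have "\<dots> = (ex' (fob F b) (fob F d) [?P'] (e' (fob F b) (fob F d)) ** (fa C C' F b d\<lhd>(S' (fob F b)))) ** [?P]\<rhd>(e' (fob F a) (fob F b) ** (fa C C' F a b\<lhd>?k)) ** alp ?P ?Q ?k"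
   unfolding s by simp
  also have "\<dots> = ex' (fob F b) (fob F d) [?P] (\<phi> b d [?P] (e b d)) ** [?P]\<rhd>\<phi> a b [?Q] (e a b) ** alp ?P ?Q ?k"
   unfolding g using natop_nat[OF relmonD(4)[OF rm'] ctx_arr, of "fa C C' F b d" ?P ?P' "e' (fob F b) (fob F d)" "fob F b" "fob F d"] by simp
  finally have 2: "e' (fob F a) (fob F d) ** ((cc C' (fob F a) (fob F b) (fob F d) ** (fa C C' F b d \<boxtimes> fa C C' F a b))\<lhd>?k)
   = (ex' (fob F b) (fob F d) [?P] (\<phi> b d [?P] (e b d)) ** [?P]\<rhd>\<phi> a b [?Q] (e a b)) ** alp ?P ?Q ?k" by simp
  show ?thesis
  proof
   assume a: "?m a b d"
   show "?g a b d"
    by (rule iso_epi[OF trans[OF 1[symmetric] 2[folded a]], of "alpi ?P ?Q ?k"]) simp_all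
  next
   assume a: "?g a b d"
   show "?m a b d"
    by (rule repr_eq[OF klcD(3)[OF C'] trans[OF 1 trans[OF _ 2[symmetric]]]]) (simp_all add: a)
  qed
 qed
 have M: "(\<forall>a b d. ?g a b d) \<longleftrightarrow> ?M"
 proof
  assume M: ?M
  show "\<forall>a b d. ?g a b d"
  proof (intro allI)
   fix a b d
   show "?g a b d"
    using M[rule_format, of "e a b" "[vhom C a b]" a b "e b d" "[vhom C b d]" d] by simp
  qed
 next
  assume G: "\<forall>a b d. ?g a b d"
  show ?M
  proof (intro allI impI)
   fix a b d \<Xi> \<Delta> f h
   assume f: "f \<in> \<Xi>|>K a \<leadsto> S b" and h: "h \<in> \<Delta>|>K b \<leadsto> S d"
   show "\<phi> a d (\<Delta> @ \<Xi>) (ex b d \<Delta> h ** \<Delta>\<rhd>f) = ex' (fob F b) (fob F d) \<Delta> (\<phi> b d \<Delta> h) ** \<Delta>\<rhd>\<phi> a b \<Xi> f"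
   proof (rule natop2_eqI[OF klcD(3)[OF C] klcD(3)[OF C], where U = "[]" and C = "K' (fob F a)"
      and F = "\<lambda>\<Delta> h \<Xi> f. \<phi> a d (\<Delta> @ \<Xi>) (ex b d \<Delta> h ** \<Delta>\<rhd>f)"
      and G = "\<lambda>\<Delta> h \<Xi> f. ex' (fob F b) (fob F d) \<Delta> (\<phi> b d \<Delta> h) ** \<Delta>\<rhd>\<phi> a b \<Xi> f", OF _ _ _ _ _ h f])
    fix \<Delta> \<Delta>' u g \<Xi> f assume u: "ctx \<Delta> \<Delta>' u" and us [simp]: "\<And>A. vl (u A)" "\<And>A. dm (u A) = \<Delta>|>A" "\<And>A. cd (u A) = \<Delta>'|>A"
     and a: "g \<in> \<Delta>'|>K b \<leadsto> S d" "f \<in> \<Xi>|>K a \<leadsto> S b"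
    have "\<phi> a d (\<Delta> @ \<Xi>) (ex b d \<Delta> (g ** u (K b)) ** \<Delta>\<rhd>f) = \<phi> a d (\<Delta> @ \<Xi>) ((ex b d \<Delta>' g ** \<Delta>'\<rhd>f) ** u (\<Xi>|>K a))"
     using natop_nat[OF relmonD(4)[OF rm] u, of g b d] ctx_nat[OF u, of f] a by simp
    also have "\<dots> = \<phi> a d (\<Delta>' @ \<Xi>) (ex b d \<Delta>' g ** \<Delta>'\<rhd>f) ** []\<rhd>u (\<Xi>|>K' (fob F a))"
     using natop_nat[OF n ctx_right[OF u], of "ex b d \<Delta>' g ** \<Delta>'\<rhd>f" \<Xi> a d] a by simp
    finally show "\<phi> a d (\<Delta> @ \<Xi>) (ex b d \<Delta> (g ** u (K b)) ** \<Delta>\<rhd>f) = \<phi> a d (\<Delta>' @ \<Xi>) (ex b d \<Delta>' g ** \<Delta>'\<rhd>f) ** []\<rhd>u (\<Xi>|>K' (fob F a))" .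
    show "ex' (fob F b) (fob F d) \<Delta> (\<phi> b d \<Delta> (g ** u (K b))) ** \<Delta>\<rhd>\<phi> a b \<Xi> f =
     (ex' (fob F b) (fob F d) \<Delta>' (\<phi> b d \<Delta>' g) ** \<Delta>'\<rhd>\<phi> a b \<Xi> f) ** []\<rhd>u (\<Xi>|>K' (fob F a))"
     using natop_nat[OF relmonD(4)[OF rm'] u, of "\<phi> b d \<Delta>' g" "fob F b" "fob F d"] natop_nat[OF n u, of g b d] ctx_nat[OF u, of "\<phi> a b \<Xi> f"] a by simp
   next
    fix \<Delta> v g \<Xi> \<Xi>' f assume v: "ctx \<Xi> \<Xi>' v" and vs [simp]: "\<And>A. vl (v A)" "\<And>A. dm (v A) = \<Xi>|>A" "\<And>A. cd (v A) = \<Xi>'|>A"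
     and a: "g \<in> \<Delta>|>K b \<leadsto> S d" "f \<in> \<Xi>'|>K a \<leadsto> S b"
    show "\<phi> a d (\<Delta> @ \<Xi>) (ex b d \<Delta> g ** \<Delta>\<rhd>(f ** v (K a))) = \<phi> a d (\<Delta> @ \<Xi>') (ex b d \<Delta> g ** \<Delta>\<rhd>f) ** []\<rhd>\<Delta>\<rhd>v (K' (fob F a))"
     using natop_nat[OF n ctx_left[OF v], of "ex b d \<Delta> g ** \<Delta>\<rhd>f" \<Delta> a d] a by simp
    show "ex' (fob F b) (fob F d) \<Delta> (\<phi> b d \<Delta> g) ** \<Delta>\<rhd>\<phi> a b \<Xi> (f ** v (K a)) =
     (ex' (fob F b) (fob F d) \<Delta> (\<phi> b d \<Delta> g) ** \<Delta>\<rhd>\<phi> a b \<Xi>' f) ** []\<rhd>\<Delta>\<rhd>v (K' (fob F a))"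
     using natop_nat[OF n v, of f a b] a by simp
   qed (use G in simp)
  qed
 qed
 show ?thesis
  unfolding vfunctor_typed[OF klcD(1)[OF C] klcD(1)[OF C']] M[symmetric] using F i m by simp
qed

section \<open>Enriched transformations into the base\<close>

text \<open>The arrow \<open>C(a, b) \<otimes> F a \<rightarrow> F b\<close> corresponding to the
functor map \<open>C(a, b) \<rightarrow> [F a, F b]\<close>.\<close>

definition fh :: "('a, 'o, 'm, 'x) vcat_scheme \<Rightarrow> ('a, 'o, 'm, 'z) vfun_scheme \<Rightarrow> 'a \<Rightarrow> 'a \<Rightarrow> ('o, 'm) tarr" where
 "fh C F a b = ev (fob F a) (fob F b) ** (fa C VV F a b\<lhd>(fob F a))"

lemma fh_simps:
 assumes "vl (fa C VV F a b)"
 shows "vl (fh C F a b)" "dm (fh C F a b) = vhom C a b \<otimes> fob F a" "cd (fh C F a b) = fob F b"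
 using assms by (simp_all add: fh_def)

lemma ev_cc_tns:
 assumes "vl x" "cd x = hm B D" "vl y" "cd y = hm A B"
 shows "ev A D ** ((cc VV A B D ** (x \<boxtimes> y))\<lhd>A) =
  (ev B D ** (x\<lhd>B)) ** [dm x]\<rhd>(ev A B ** (y\<lhd>A)) ** alp (dm x) (dm y) A"
proof -
 have "ev A D ** ((cc VV A B D ** (x \<boxtimes> y))\<lhd>A) = ev B D ** [hm B D]\<rhd>ev A B ** alp (hm B D) (hm A B) A ** ((x \<boxtimes> y)\<lhd>A)"
  using assms by (simp add: ev_cc_re)
 also have "\<dots> = ev B D ** [hm B D]\<rhd>ev A B ** (x\<lhd>(hm A B \<otimes> A)) ** [dm x]\<rhd>(y\<lhd>A) ** alp (dm x) (dm y) A"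
  using assms tns_split[of x y] by (simp del: tns_push tns_push_re)
 also have "\<dots> = (ev B D ** (x\<lhd>B)) ** [dm x]\<rhd>(ev A B ** (y\<lhd>A)) ** alp (dm x) (dm y) A"
  using assms by simp
 finally show ?thesis .
qed

text \<open>Naturality for functors into the base, transposed from internal homs to tensor
products.\<close>

lemma vnat_iff:
 assumes F [simp]: "\<And>a b. vl (fa C VV F a b)" and G [simp]: "\<And>a b. vl (fa C VV G a b)"
 shows "vnat V C VV F G \<alpha> \<longleftrightarrow> (\<forall>a. \<alpha> a \<in> Hom UV (fob F a) (fob G a)) \<and>
  (\<forall>a b. una (\<alpha> b) ** fh C F a b = fh C G a b ** [vhom C a b]\<rhd>una (\<alpha> a))"
proof (cases "\<forall>a. \<alpha> a \<in> Hom UV (fob F a) (fob G a)")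
 case True
 have h: "vl (elA (\<alpha> a))" "fst (\<alpha> a) = fob F a" "snd (snd (\<alpha> a)) = fob G a" for a
  using True[rule_format, of a] unfolding UV_Hom by auto
 note h [simp]
 have u [simp]: "vl (una (\<alpha> a))" "dm (una (\<alpha> a)) = fob F a" "cd (una (\<alpha> a)) = fob G a" for a
  using una_ty[OF True[rule_format, of a]] by auto
 have ue: "ev (fob F a) (fob G a) ** (elA (\<alpha> a)\<lhd>(fob F a)) = una (\<alpha> a) ** lu (fob F a)" for a
  using una_ev[of "\<alpha> a"] h[of a] by simp
 have "(vcomp VV (fob F A) (fob F B) (fob G B) \<cdot> (elt (\<alpha> B) \<odot> fmap F A B) \<cdot> lun_inv V (vhom C A B) =
    vcomp VV (fob F A) (fob G A) (fob G B) \<cdot> (fmap G A B \<odot> elt (\<alpha> A)) \<cdot> run_inv V (vhom C A B))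
  \<longleftrightarrow> una (\<alpha> B) ** fh C F A B = fh C G A B ** [vhom C A B]\<rhd>una (\<alpha> A)" (is "?L \<longleftrightarrow> ?R") for A B
 proof -
  let ?P = "vhom C A B"
  let ?x = "cc VV (fob F A) (fob F B) (fob G B) ** (elA (\<alpha> B) \<boxtimes> fa C VV F A B) ** lui ?P"
  let ?y = "cc VV (fob F A) (fob G A) (fob G B) ** (fa C VV G A B \<boxtimes> elA (\<alpha> A)) ** rui ?P"
  have "?L \<longleftrightarrow> ?x = ?y"
  proof -
   have "raw (elA (\<alpha> a)) = elt (\<alpha> a)" for a by (simp add: elA_def)
   moreover have "raw (lui ?P) = lun_inv V ?P" "raw (rui ?P) = run_inv V ?P" by (simp_all add: raw_struct)
   ultimately show ?thesis by (simp add: tarr_eq_iff raw_cmp raw_tns)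
  qed
  moreover have "ev (fob F A) (fob G B) ** (?x\<lhd>(fob F A)) = una (\<alpha> B) ** fh C F A B"
  proof -
   have "ev (fob F A) (fob G B) ** (?x\<lhd>(fob F A)) =
    (ev (fob F A) (fob G B) ** ((cc VV (fob F A) (fob F B) (fob G B) ** (elA (\<alpha> B) \<boxtimes> fa C VV F A B))\<lhd>(fob F A))) ** (lui ?P\<lhd>(fob F A))"
    by simp
   also have "\<dots> = una (\<alpha> B) ** fh C F A B ** lu (?P \<otimes> fob F A) ** alp \<one> ?P (fob F A) ** (lui ?P\<lhd>(fob F A))"
    by (subst ev_cc_tns) (simp_all add: ue fh_def[symmetric] fh_simps)
   also have "\<dots> = una (\<alpha> B) ** fh C F A B"
    using lu_tns[of ?P "fob F A", THEN cmp_re] by (simp add: tns_cmp fh_simps)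
   finally show ?thesis .
  qed
  moreover have "ev (fob F A) (fob G B) ** (?y\<lhd>(fob F A)) = fh C G A B ** [?P]\<rhd>una (\<alpha> A)"
  proof -
   have "ev (fob F A) (fob G B) ** (?y\<lhd>(fob F A)) =
    (ev (fob F A) (fob G B) ** ((cc VV (fob F A) (fob G A) (fob G B) ** (fa C VV G A B \<boxtimes> elA (\<alpha> A)))\<lhd>(fob F A))) ** (rui ?P\<lhd>(fob F A))"
    by simp
   also have "\<dots> = fh C G A B ** [?P]\<rhd>una (\<alpha> A) ** ([?P]\<rhd>lu (fob F A) ** alp ?P \<one> (fob F A)) ** (rui ?P\<lhd>(fob F A))"
    by (subst ev_cc_tns) (simp_all add: ue fh_def[symmetric] fh_simps)
   also have "\<dots> = fh C G A B ** [?P]\<rhd>una (\<alpha> A)"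
    using triangle[of ?P "fob F A"] by (simp add: tns_cmp fh_simps)
   finally show ?thesis .
  qed
  moreover have "?x = ?y \<longleftrightarrow> ev (fob F A) (fob G B) ** (?x\<lhd>(fob F A)) = ev (fob F A) (fob G B) ** (?y\<lhd>(fob F A))"
  proof
   assume "?x = ?y"
   then show "ev (fob F A) (fob G B) ** (?x\<lhd>(fob F A)) = ev (fob F A) (fob G B) ** (?y\<lhd>(fob F A))"
    by (simp only:)
  next
   assume "ev (fob F A) (fob G B) ** (?x\<lhd>(fob F A)) = ev (fob F A) (fob G B) ** (?y\<lhd>(fob F A))"
   then show "?x = ?y" by (rule ev_eqI) simp_all
  qed
  ultimately show ?thesis by simp
 qed
 then show ?thesis using True unfolding vnat_def by simp
next
 case False
 then show ?thesis unfolding vnat_def by blast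
qed

lemma UV_iso:
 "iso_arrow UV A B \<alpha> \<longleftrightarrow> \<alpha> \<in> Hom UV A B \<and> (\<exists>q. q \<in> B \<leadsto> A \<and> q ** una \<alpha> = idt A \<and> una \<alpha> ** q = idt B)"
proof
 assume "iso_arrow UV A B \<alpha>"
 then obtain \<beta> where b: "\<alpha> \<in> Hom UV A B" "\<beta> \<in> Hom UV B A" "\<beta> \<cdot>\<^bsub>UV\<^esub> \<alpha> = Idn UV A" "\<alpha> \<cdot>\<^bsub>UV\<^esub> \<beta> = Idn UV B"
  unfolding iso_arrow_def inverse_arrows_def by blast
 have "una \<beta> ** una \<alpha> = idt A" "una \<alpha> ** una \<beta> = idt B"
  using UV_Comp(2)[OF b(2,1)] UV_Comp(2)[OF b(1,2)] b(3,4) una_uar[of "idt A" A A] una_uar[of "idt B" B B]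
  by (auto simp: UV_Idn)
 then show "\<alpha> \<in> Hom UV A B \<and> (\<exists>q. q \<in> B \<leadsto> A \<and> q ** una \<alpha> = idt A \<and> una \<alpha> ** q = idt B)"
  using b una_ty[OF b(2)] by blast
next
 assume a: "\<alpha> \<in> Hom UV A B \<and> (\<exists>q. q \<in> B \<leadsto> A \<and> q ** una \<alpha> = idt A \<and> una \<alpha> ** q = idt B)"
 then obtain q where q: "q \<in> B \<leadsto> A" "q ** una \<alpha> = idt A" "una \<alpha> ** q = idt B" by blast
 have a1: "\<alpha> \<in> Hom UV A B" using a by blast
 note uq = uar_ty[OF q(1)] una_uar[OF q(1)]
 have i: "uar (idt X) \<in> Hom UV X X" "una (uar (idt X)) = idt X" for X
  using uar_ty[of "idt X" X X] una_uar[of "idt X" X X] by simp_all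
 have "uar q \<cdot>\<^bsub>UV\<^esub> \<alpha> = uar (idt A)"
  by (rule uarr_eqI[OF UV_Comp(1)[OF uq(1) a1] i(1)]) (simp add: UV_Comp(2)[OF uq(1) a1] uq q i)
 moreover have "\<alpha> \<cdot>\<^bsub>UV\<^esub> uar q = uar (idt B)"
  by (rule uarr_eqI[OF UV_Comp(1)[OF a1 uq(1)] i(1)]) (simp add: UV_Comp(2)[OF a1 uq(1)] uq q i)
 ultimately show "iso_arrow UV A B \<alpha>"
  unfolding iso_arrow_def inverse_arrows_def UV_Idn using a1 uq(1) by blast
qed

subsection \<open>Representables\<close>

lemma vrep_fob [simp]: "fob (vrep V C A) = (\<lambda>B. vhom C A B)"
 by (simp add: vrep_def)

lemma fa_vrep: "fa C VV (vrep V C A) B D = cur (vhom C B D) (vhom C A B) (cc C A B D)"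
 by (simp add: fa_def cur_def vrep_def)

lemma vl_fa_vrep: "vl (cc C A B D) \<Longrightarrow> vl (fa C VV (vrep V C A) B D)"
 by (simp add: fa_vrep cur)

lemma fh_vrep: "vl (cc C A B D) \<Longrightarrow> fh C (vrep V C A) B D = cc C A B D"
 using cur(4)[of "cc C A B D" "vhom C B D" "vhom C A B"] by (simp add: fh_def fa_vrep)

lemma fh_comp:
 assumes "vl (fa C D F a b)" "vl (fa D VV G (fob F a) (fob F b))"
 shows "fh C (vfun_comp V G F) a b = fh D G (fob F a) (fob F b) ** (fa C D F a b\<lhd>(fob G (fob F a)))"
 using assms by (simp add: fh_def fa_comp[where D = D])

lemma vfunctor_vrep:
 assumes C: "vcategory V C"
 shows "vfunctor V C VV (vrep V C A)"
proof -
 note c = C[unfolded vcategory_iff]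
 have v [simp]: "vl (cid C a)" "vl (cc C a b d)" for a b d using c by auto
 have e: "ev (vhom C A B) (vhom C A D) ** (fa C VV (vrep V C A) B D\<lhd>(vhom C A B)) = cc C A B D" for B D
  using fh_vrep[of C A B D] by (simp add: fh_def)
 note er = e[THEN cmp_re, unfolded cmp_assoc]
 have u: "cc C A B B ** (cid C B\<lhd>(vhom C A B)) = lu (vhom C A B)" for B using c by blast
 have as: "cc C A B E ** (cc C B D E\<lhd>(vhom C A B)) =
    cc C A D E ** [vhom C D E]\<rhd>cc C A B D ** alp (vhom C D E) (vhom C B D) (vhom C A B)" for B D E using c by blast
 show ?thesis
  unfolding vfunctor_typed[OF C vcat_vself]
 proof (intro conjI allI)
  fix a b show "vl (fa C VV (vrep V C A) a b)" by (rule vl_fa_vrep) simp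
  show "fa C VV (vrep V C A) a a ** cid C a = cid VV (fob (vrep V C A) a)"
   by (rule ev_eqI[of "vhom C A a" "vhom C A a"]) (simp_all add: vl_fa_vrep er u ev_cid)
 next
  fix a b d
  let ?F = "fa C VV (vrep V C A)"
  have "ev (vhom C A a) (vhom C A d) ** ((cc VV (vhom C A a) (vhom C A b) (vhom C A d) ** (?F b d \<boxtimes> ?F a b))\<lhd>(vhom C A a))
   = cc C A b d ** [vhom C b d]\<rhd>cc C A a b ** alp (vhom C b d) (vhom C a b) (vhom C A a)"
   by (subst ev_cc_tns) (simp_all add: vl_fa_vrep e)
  note 1 = this
  show "?F a d ** cc C a b d = cc VV (fob (vrep V C A) a) (fob (vrep V C A) b) (fob (vrep V C A) d) ** (?F b d \<boxtimes> ?F a b)"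
   unfolding vrep_fob
  proof (rule ev_eqI[OF trans[OF _ 1[symmetric]]])
   show "ev (vhom C A a) (vhom C A d) ** ((?F a d ** cc C a b d)\<lhd>(vhom C A a)) = cc C A b d ** [vhom C b d]\<rhd>cc C A a b ** alp (vhom C b d) (vhom C a b) (vhom C A a)"
    by (simp add: vl_fa_vrep er as)
  qed (simp_all add: vl_fa_vrep)
 qed
qed

section \<open>Cotensors and their preservation\<close>

lemma repr_iso:
 assumes r: "repr H A B e" and p: "p \<in> H' \<leadsto> H" "q \<in> H \<leadsto> H'" "q ** p = idt H'" "p ** q = idt H"
 shows "repr H' A B (e ** (p\<lhd>A))"
 unfolding repr_def
proof (intro conjI allI impI)
 note re [simp] = repr_ty[OF r, unfolded Ar_iff]
 show "e ** (p\<lhd>A) \<in> H' \<otimes> A \<leadsto> B" using p by simp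
 fix X f assume f: "f \<in> X \<otimes> A \<leadsto> B"
 then obtain g where g: "g \<in> X \<leadsto> H" "e ** (g\<lhd>A) = f" using repr_ex[OF r f] by blast
 show "\<exists>!g. g \<in> X \<leadsto> H' \<and> (e ** (p\<lhd>A)) ** (g\<lhd>A) = f"
 proof (rule ex1I[of _ "q ** g"])
  show "q ** g \<in> X \<leadsto> H' \<and> (e ** (p\<lhd>A)) ** ((q ** g)\<lhd>A) = f"
   using p g p(4)[THEN cmp_re, of g] tns_cmpL[of "q ** g" p A, symmetric] by (simp del: tns_cmpL)
  fix g' assume g': "g' \<in> X \<leadsto> H' \<and> (e ** (p\<lhd>A)) ** (g'\<lhd>A) = f"
  then have t: "vl g'" "dm g' = X" "cd g' = H'" and "(e ** (p\<lhd>A)) ** (g'\<lhd>A) = f" by auto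
  then have "e ** ((p ** g')\<lhd>A) = e ** (g\<lhd>A)" unfolding g(2) using p by simp
  then have "p ** g' = g" by (rule repr_eq[OF r]) (use t g(1) p in simp_all)
  then show "g' = q ** g" using p(3)[THEN cmp_re, of g'] t by simp
 qed
qed

lemma repr_unique_iso:
 assumes r: "repr H A B e" and r': "repr H' A B e'" and p: "p \<in> H' \<leadsto> H" "e ** (p\<lhd>A) = e'"
 shows "\<exists>q. q \<in> H \<leadsto> H' \<and> q ** p = idt H' \<and> p ** q = idt H"
proof -
 note re [simp] = repr_ty[OF r, unfolded Ar_iff] repr_ty[OF r', unfolded Ar_iff]
 obtain q where q: "q \<in> H \<leadsto> H'" "e' ** (q\<lhd>A) = e" using repr_ex[OF r', of e H] by auto
 have "q ** p = idt H'" by (rule repr_eq[OF r']) (use p q q(2)[THEN cmp_re] in simp_all)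
 moreover have "p ** q = idt H" by (rule repr_eq[OF r]) (use p q p(2)[THEN cmp_re] in simp_all)
 ultimately show ?thesis using q by blast
qed

text \<open>A cotensor in a category is a tensor in the opposite one. The unit \<open>u : X
\<rightarrow> D(A, P)\<close> is the universal element; the isomorphism \<open>D(P, B) \<cong> [X,
D(A, B)]\<close> is composition with it.\<close>

definition tensorp :: "('a, 'o, 'm, 'z) vcat_scheme \<Rightarrow> 'o \<Rightarrow> 'a \<Rightarrow> 'a \<Rightarrow> ('o, 'm) tarr \<Rightarrow> bool" where
 "tensorp D X A P u \<longleftrightarrow> u \<in> X \<leadsto> vhom D A P \<and>
  (\<forall>B. repr (vhom D P B) X (vhom D A B) (cc D A P B ** [vhom D P B]\<rhd>u))"

text \<open>By the enriched Yoneda lemma a natural isomorphism \<open>\<phi>\<close> as in the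
definition of a cotensor is composition with its counit. One direction evaluates
\<open>\<phi>\<close> at an identity, the other transposes the composition map of the
category.\<close>

lemma cotensor_tensorp:
 fixes C :: "('c, 'o, 'm) vcat"
 assumes C: "vcategory V C"
 shows "cotensor V C X A P \<phi> \<Longrightarrow> cotensor_counit V C X A P \<phi> \<in> Hom UV X (vhom C P A) \<and> tensorp (vop V C) X A P (una (cotensor_counit V C X A P \<phi>))"
  and "tensorp (vop V C) X A P u \<Longrightarrow> \<exists>\<phi>. cotensor V C X A P \<phi> \<and> una (cotensor_counit V C X A P \<phi>) = u"
proof -
 let ?D = "vop V C"
 let ?c = "\<lambda>\<phi>. cotensor_counit V C X A P \<phi>"
 let ?G = "vfun_comp V (vrep V VV X) (vrep V ?D A)"
 note c = vcategory_vop[OF C, unfolded vcategory_iff]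
 have v [simp]: "vl (cid C a)" "vl (cc ?D a b d)" for a b d using c by auto
 have D: "vcategory V ?D" by (rule vcategory_vop[OF C])
 have F1: "vl (fa ?D VV (vrep V ?D B) a b)" for B a b by (rule vl_fa_vrep) simp
 have F2: "vl (fa VV VV (vrep V VV X) a b)" for a b by (rule vl_fa_vrep) simp
 have F3: "vl (fa ?D VV ?G a b)" for a b
  using F1[of A a b] F2 by (simp add: fa_comp[where D = "VV"])
 have as: "cc ?D A B E ** (cc ?D B D E\<lhd>(vhom ?D A B)) =
    cc ?D A D E ** [vhom ?D D E]\<rhd>cc ?D A B D ** alp (vhom ?D D E) (vhom ?D B D) (vhom ?D A B)" for A B D E
  using c by blast
 note asr = as[THEN cmp_re, unfolded cmp_assoc vop_simps]
 have ur: "cc ?D A A B ** [vhom ?D A B]\<rhd>cid ?D A = ru (vhom ?D A B)" for A B using c by blast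
 have g: "ev X (vhom ?D A E) ** (fh ?D ?G B E\<lhd>X) = cc ?D A B E ** [vhom ?D B E]\<rhd>ev X (vhom ?D A B) ** alp (vhom ?D B E) (hm X (vhom ?D A B)) X" for B E
 proof -
  let ?f = "fa ?D VV (vrep V ?D A) B E"
  have "fh ?D ?G B E = cc VV X (vhom ?D A B) (vhom ?D A E) ** (?f\<lhd>(hm X (vhom ?D A B)))"
   using fh_comp[where D = "VV", OF F1 F2, of A B E] by (simp add: fh_vrep)
  then have 1: "ev X (vhom ?D A E) ** (fh ?D ?G B E\<lhd>X) = (ev (vhom ?D A B) (vhom ?D A E) ** (?f\<lhd>(vhom ?D A B))) ** [vhom ?D B E]\<rhd>ev X (vhom ?D A B) ** alp (vhom ?D B E) (hm X (vhom ?D A B)) X"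
   using F1[of A B E] by (simp add: ev_cc_tns del: tns_cmpL)
  have 2: "ev (vhom ?D A B) (vhom ?D A E) ** (?f\<lhd>(vhom ?D A B)) = cc ?D A B E"
   using fh_vrep[of ?D A B E] by (simp add: fh_def)
  show ?thesis unfolding 1 2 ..
 qed
 have cot: "cotensor V C X A P \<phi> \<longleftrightarrow>
   (\<forall>B. \<phi> B \<in> Hom UV (vhom ?D P B) (hm X (vhom ?D A B))) \<and>
   (\<forall>B E. una (\<phi> E) ** cc ?D P B E = fh ?D ?G B E ** [vhom ?D B E]\<rhd>una (\<phi> B)) \<and>
   (\<forall>B. \<exists>q. q \<in> hm X (vhom ?D A B) \<leadsto> vhom ?D P B \<and> q ** una (\<phi> B) = idt (vhom ?D P B) \<and> una (\<phi> B) ** q = idt (hm X (vhom ?D A B)))" for \<phi>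
  unfolding cotensor_def vnat_iso_def vnat_iff[where C = ?D, OF F1 F3] UV_iso by (auto simp: fh_vrep)
 have cu: "?c \<phi> \<in> Hom UV X (vhom C P A)" "elA (?c \<phi>) = una (\<phi> P) ** cid ?D P"
  if p: "\<phi> P \<in> Hom UV (vhom ?D P P) (hm X (vhom ?D A P))" for \<phi>
 proof -
  have h: "fst (\<phi> P) = vhom ?D P P" "snd (snd (\<phi> P)) = hm X (vhom ?D A P)" using p unfolding UV_Hom by auto
  show 1: "elA (?c \<phi>) = una (\<phi> P) ** cid ?D P"
   by (rule sym) (use una_ty[OF p] v(1)[of P, unfolded cid_def] in \<open>simp add: una_def h cid_def cotensor_counit_def elA_def elt_def cmp_mk\<close>)
  then show "?c \<phi> \<in> Hom UV X (vhom C P A)"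
   unfolding UV_Hom using una_ty[OF p] by (simp add: cotensor_counit_def)
 qed
 have cu2: "una (?c \<phi>) ** lu X = ev X (vhom ?D A P) ** ((una (\<phi> P) ** cid ?D P)\<lhd>X)"
  if p: "\<phi> P \<in> Hom UV (vhom ?D P P) (hm X (vhom ?D A P))" for \<phi>
  using una_ev[of "?c \<phi>"] cu[of \<phi>, OF p] by (simp add: UV_Hom)
 {
  assume a: "cotensor V C X A P \<phi>"
  note h = a[unfolded cot, THEN conjunct1, rule_format] a[unfolded cot, THEN conjunct2, THEN conjunct1, rule_format] a[unfolded cot, THEN conjunct2, THEN conjunct2, rule_format]
  let ?u = "una (?c \<phi>)"
  have u: "?u \<in> X \<leadsto> vhom ?D A P" using una_ty[OF cu(1)[of \<phi>, OF h(1)]] by simp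
  have pt [simp]: "vl (una (\<phi> B))" "dm (una (\<phi> B)) = vhom ?D P B" "cd (una (\<phi> B)) = hm X (vhom ?D A B)" for B
   using una_ty[OF h(1)[of B]] by auto
  have e: "ev X (vhom ?D A B) ** (una (\<phi> B)\<lhd>X) = cc ?D A P B ** [vhom ?D P B]\<rhd>?u" for B
  proof -
   let ?H = "vhom ?D P B"
   have "(ev X (vhom ?D A B) ** (una (\<phi> B)\<lhd>X)) ** (ru ?H\<lhd>X) = ev X (vhom ?D A B) ** ((una (\<phi> B) ** cc ?D P P B ** [?H]\<rhd>cid ?D P)\<lhd>X)"
    unfolding ur by simp
   also have "\<dots> = (ev X (vhom ?D A B) ** (fh ?D ?G P B\<lhd>X)) ** ([?H]\<rhd>una (\<phi> P)\<lhd>X) ** ([?H]\<rhd>cid ?D P\<lhd>X)"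
    using h(2)[of B P, THEN cmp_re, of "[?H]\<rhd>cid ?D P"] F3[of P B] by (simp add: fh_simps)
   also have "\<dots> = cc ?D A P B ** [?H]\<rhd>(ev X (vhom ?D A P) ** ((una (\<phi> P) ** cid ?D P)\<lhd>X)) ** alp ?H \<one> X"
    unfolding g by simp
   also have "\<dots> = cc ?D A P B ** [?H]\<rhd>(?u ** lu X) ** alp ?H \<one> X" unfolding cu2[of \<phi>, OF h(1)] ..
   also have "\<dots> = (cc ?D A P B ** [?H]\<rhd>?u) ** (ru ?H\<lhd>X)" using u triangle[of ?H X] by simp
   finally show ?thesis
    by (rule iso_epi[where q = "rui ?H\<lhd>X" and A = "?H \<otimes> X"]) (use u in \<open>simp_all add: tns_cmp\<close>)
  qed
  have "repr (vhom ?D P B) X (vhom ?D A B) (cc ?D A P B ** [vhom ?D P B]\<rhd>?u)" for B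
  proof -
   obtain q where q: "q \<in> hm X (vhom ?D A B) \<leadsto> vhom ?D P B \<and> q ** una (\<phi> B) = idt (vhom ?D P B) \<and> una (\<phi> B) ** q = idt (hm X (vhom ?D A B))"
    using h(3)[of B] ..
   show ?thesis unfolding e[symmetric]
    by (rule repr_iso[OF repr_ev, of _ _ _ _ q]) (use q in simp_all)
  qed
  then show "?c \<phi> \<in> Hom UV X (vhom C P A) \<and> tensorp ?D X A P ?u"
   unfolding tensorp_def using u cu(1)[of \<phi>, OF h(1)] by blast
 }
 {
  assume t: "tensorp ?D X A P u"
  then have u [simp]: "vl u" "dm u = X" "cd u = vhom ?D A P" and r: "repr (vhom ?D P B) X (vhom ?D A B) (cc ?D A P B ** [vhom ?D P B]\<rhd>u)" for B
   unfolding tensorp_def by auto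
  define p where "p B = cur (vhom ?D P B) X (cc ?D A P B ** [vhom ?D P B]\<rhd>u)" for B
  have p: "vl (p B)" "dm (p B) = vhom ?D P B" "cd (p B) = hm X (vhom ?D A B)"
   "ev X (vhom ?D A B) ** (p B\<lhd>X) = cc ?D A P B ** [vhom ?D P B]\<rhd>u" for B
   unfolding p_def by (intro cur; simp)+
  note [simp] = p(1-3)
  have up: "uar (p B) \<in> Hom UV (vhom ?D P B) (hm X (vhom ?D A B))" "una (uar (p B)) = p B" for B
   using uar_ty[of "p B"] una_uar[of "p B"] by simp_all
  have "cotensor V C X A P (\<lambda>B. uar (p B))"
   unfolding cot up(2)
  proof (intro conjI allI)
   fix B E
   show "p E ** cc ?D P B E = fh ?D ?G B E ** [vhom ?D B E]\<rhd>p B"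
   proof (rule ev_eqI[of X "vhom ?D A E"])
    have "ev X (vhom ?D A E) ** ((p E ** cc ?D P B E)\<lhd>X) = cc ?D A P E ** (cc ?D P B E\<lhd>(vhom ?D A P)) ** [vhom ?D B E \<otimes> vhom ?D P B]\<rhd>u"
     using p(4)[of E, THEN cmp_re] by simp
    also have "\<dots> = cc ?D A B E ** [vhom ?D B E]\<rhd>(cc ?D A P B ** [vhom ?D P B]\<rhd>u) ** alp (vhom ?D B E) (vhom ?D P B) X"
     by (simp add: asr del: tns_push tns_push_re)
    also have "\<dots> = ev X (vhom ?D A E) ** ((fh ?D ?G B E ** [vhom ?D B E]\<rhd>p B)\<lhd>X)"
     unfolding p(4)[symmetric] using g[of E B, THEN cmp_re] F3[of B E] by (simp add: fh_simps)
    finally show "ev X (vhom ?D A E) ** ((p E ** cc ?D P B E)\<lhd>X) = ev X (vhom ?D A E) ** ((fh ?D ?G B E ** [vhom ?D B E]\<rhd>p B)\<lhd>X)" .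
   qed (use F3[of B E] in \<open>simp_all add: fh_simps\<close>)
   show "uar (p B) \<in> Hom UV (vhom ?D P B) (hm X (vhom ?D A B))" by (rule up(1))
   show "\<exists>q. q \<in> hm X (vhom ?D A B) \<leadsto> vhom ?D P B \<and> q ** p B = idt (vhom ?D P B) \<and> p B ** q = idt (hm X (vhom ?D A B))"
    by (rule repr_unique_iso[OF repr_ev r[of B] _ p(4)]) simp
  qed
  moreover have "una (?c (\<lambda>B. uar (p B))) = u"
  proof -
   have x: "una (?c (\<lambda>B. uar (p B))) ** lu X = u ** lu X"
   proof -
    have "una (?c (\<lambda>B. uar (p B))) ** lu X = ev X (vhom ?D A P) ** ((p P ** cid ?D P)\<lhd>X)"
     using cu2[of "\<lambda>B. uar (p B)"] up by simp
    also have "\<dots> = cc ?D A P P ** (cid ?D P\<lhd>(vhom ?D A P)) ** [\<one>]\<rhd>u"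
     using p(4)[of P, THEN cmp_re] by simp
    also have "\<dots> = u ** lu X"
    proof -
     have "cc ?D A P P ** (cid ?D P\<lhd>(vhom ?D A P)) = lu (vhom ?D A P)" using c by blast
     from this[THEN cmp_re, of "[\<one>]\<rhd>u"] show ?thesis using lu_nat'[of u "vhom ?D A P"] by simp
    qed
    finally show ?thesis .
   qed
   have ut: "una (?c (\<lambda>B. uar (p B))) \<in> X \<leadsto> vhom C P A" by (rule una_ty[OF cu(1)[of "\<lambda>B. uar (p B)"]]) (rule up(1))
   show ?thesis by (rule iso_epi[OF x, of "lui X"]) (use ut in simp_all)
  qed
  ultimately show "\<exists>\<phi>. cotensor V C X A P \<phi> \<and> una (?c \<phi>) = u" by blast
 }
qed

text \<open>Preservation refers to counits only, so it can be stated with tensors in the opposite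
categories.\<close>

lemma preserves_cotensors_iff:
 fixes C :: "('c, 'o, 'm) vcat" and E :: "('e, 'o, 'm) vcat"
 assumes C: "vcategory V C" and E: "vcategory V E" and F: "\<And>a b. vl (fa C E F a b)"
 shows "preserves_cotensors V C E X F \<longleftrightarrow>
  (\<forall>A P u. tensorp (vop V C) X A P u \<longrightarrow> tensorp (vop V E) X (fob F A) (fob F P) (fa C E F P A ** u))"
proof -
 have f: "uname V (vhom C P A) (vhom E (fob F P) (fob F A)) (fmap F P A) = uar (fa C E F P A)" for P A
  by (simp add: uar_def)
 have ut: "uar (fa C E F P A) \<in> Hom UV (vhom C P A) (vhom E (fob F P) (fob F A))" "una (uar (fa C E F P A)) = fa C E F P A" for P A
  using F by (simp_all add: uar_ty una_uar)
 show ?thesis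
 proof (intro iffI allI impI)
  fix A P u assume p: "preserves_cotensors V C E X F" and t: "tensorp (vop V C) X A P u"
  obtain \<phi> where \<phi>: "cotensor V C X A P \<phi>" "una (cotensor_counit V C X A P \<phi>) = u"
   using cotensor_tensorp(2)[OF C t] by blast
  then obtain \<psi> where \<psi>: "cotensor V E X (fob F A) (fob F P) \<psi>" "cotensor_counit V E X (fob F A) (fob F P) \<psi> =
      uar (fa C E F P A) \<cdot>\<^bsub>UV\<^esub> cotensor_counit V C X A P \<phi>"
   using p unfolding preserves_cotensors_def f by blast
  have "una (cotensor_counit V E X (fob F A) (fob F P) \<psi>) = fa C E F P A ** u"
   unfolding \<psi>(2) using UV_Comp(2)[OF ut(1) cotensor_tensorp(1)[OF C \<phi>(1), THEN conjunct1]] \<phi>(2) ut(2) by simp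
  then show "tensorp (vop V E) X (fob F A) (fob F P) (fa C E F P A ** u)"
   using cotensor_tensorp(1)[OF E \<psi>(1)] by simp
 next
  assume p: "\<forall>A P u. tensorp (vop V C) X A P u \<longrightarrow> tensorp (vop V E) X (fob F A) (fob F P) (fa C E F P A ** u)"
  show "preserves_cotensors V C E X F"
   unfolding preserves_cotensors_def f
  proof (intro allI impI)
   fix A P \<phi> assume \<phi>: "cotensor V C X A P \<phi>"
   note t = cotensor_tensorp(1)[OF C \<phi>]
   then obtain \<psi> where \<psi>: "cotensor V E X (fob F A) (fob F P) \<psi>"
    "una (cotensor_counit V E X (fob F A) (fob F P) \<psi>) = fa C E F P A ** una (cotensor_counit V C X A P \<phi>)"
    using cotensor_tensorp(2)[OF E] p by blast
   have "cotensor_counit V E X (fob F A) (fob F P) \<psi> = uar (fa C E F P A) \<cdot>\<^bsub>UV\<^esub> cotensor_counit V C X A P \<phi>"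
    by (rule uarr_eqI[OF cotensor_tensorp(1)[OF E \<psi>(1), THEN conjunct1] UV_Comp(1)[OF ut(1) t[THEN conjunct1]]])
     (simp add: \<psi>(2) UV_Comp(2)[OF ut(1) t[THEN conjunct1]] ut(2))
   then show "\<exists>\<psi>. cotensor V E X (fob F A) (fob F P) \<psi> \<and> cotensor_counit V E X (fob F A) (fob F P) \<psi> =
      uar (fa C E F P A) \<cdot>\<^bsub>UV\<^esub> cotensor_counit V C X A P \<phi>"
    using \<psi>(1) by blast
  qed
 qed
qed

end

section \<open>Systems of arities\<close>

locale arity = smclosed V for V :: "('o, 'm) smcc" (structure) +
 fixes J :: "('j, 'o, 'm) smvcat" and j :: "('j, 'o, 'm) smvfun"
 assumes sys: "system_of_arities V J j"
begin

abbreviation K :: "'j \<Rightarrow> 'o" where "K \<equiv> fob j"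

abbreviation ary :: "('o, 'o, 'm) vfun \<Rightarrow> bool" where "ary \<equiv> J_ary V J j VV VV"
abbreviation TH :: "(('j, 'o, 'm) jtheory, ('j, 'j, 'm) vfun) cat" where "TH \<equiv> Th V J j"
abbreviation MND :: "(('o, 'm) vmonad, 'o \<Rightarrow> ('o, 'm) uarr) cat" where "MND \<equiv> Mnd V J j"

definition eJ :: "'j \<Rightarrow> 'j \<Rightarrow> ('o, 'm) tarr" where
 "eJ a b = fh J j a b"

lemma vcat_J: "vcategory V J"
 using sys by (simp add: system_of_arities_def symmetric_monoidal_vcategory_def)

lemma vself_monoidal_simps [simp]:
 "vhom (vself_monoidal V) = vhom VV" "vid (vself_monoidal V) = vid VV" "vcomp (vself_monoidal V) = vcomp VV"
 "vunt (vself_monoidal V) = \<one>" "fob (tenF (vself_monoidal V)) (A, B) = A \<otimes> B"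
 by (simp_all add: vself_monoidal_def)

lemma vfun_j: "vfunctor V J VV j"
 using sys unfolding system_of_arities_def strong_symmetric_monoidal_vfunctor_def vfunctor_def by simp

lemma ucat_vself_monoidal: "ucat V (vself_monoidal V) = UV"
 by (simp add: ucat_def)

lemma fa_j [simp]: "vl (fa J VV j a b)"
 using vfun_j[unfolded vfunctor_typed[OF vcat_J vcat_vself]] by blast

lemma eJ_simps [simp]: "vl (eJ a b)" "dm (eJ a b) = vhom J a b \<otimes> K a" "cd (eJ a b) = K b"
 by (simp_all add: eJ_def fh_simps)

lemma vl_J [simp]: "vl (cc J a b d)" "vl (cid J a)"
 using vcat_J[unfolded vcategory_iff] by blast+

text \<open>The system of arities is fully faithful: the hom-objects of \<open>J\<close> are
internal homs.\<close>

lemma repr_eJ: "repr (vhom J a b) (K a) (K b) (eJ a b)"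
proof -
 have "iso_arrow V (vhom J a b) (hm (K a) (K b)) (fmap j a b)"
  using sys by (simp add: system_of_arities_def fully_faithful_def)
 then obtain q where q: "inverse_arrows V (vhom J a b) (hm (K a) (K b)) (fmap j a b) q"
  unfolding iso_arrow_def by blast
 let ?q = "mk (hm (K a) (K b)) q (vhom J a b)"
 have "?q ** fa J VV j a b = idt (vhom J a b)" "fa J VV j a b ** ?q = idt (hm (K a) (K b))" "vl ?q"
  using q by (simp_all add: fa_def inverse_arrows_def idt_def cmp_mk)
 then show ?thesis
  unfolding eJ_def fh_def by (intro repr_iso[OF repr_ev, of _ _ _ _ ?q]) simp_all
qed

text \<open>Therefore \<open>J\<close> is the Kleisli category of the identity relative
monad.\<close>

lemma klc_J: "klc J K K eJ (\<lambda>a. idt (K a)) (\<lambda>a b \<Xi> f. f)"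
proof (rule klcI[OF relmon_id repr_eJ])
 note f = vfun_j[unfolded vfunctor_typed[OF vcat_J vcat_vself]]
 fix a b d
 have "eJ a d ** (cc J a b d\<lhd>(K a)) = ev (K a) (K d) ** ((fa J VV j a d ** cc J a b d)\<lhd>(K a))"
  by (simp add: eJ_def fh_def)
 also have "fa J VV j a d ** cc J a b d = cc VV (K a) (K b) (K d) ** (fa J VV j b d \<boxtimes> fa J VV j a b)"
  using f by blast
 finally show "eJ a d ** (cc J a b d\<lhd>(K a)) = eJ b d ** [vhom J b d]\<rhd>eJ a b ** alp (vhom J b d) (vhom J a b) (K a)"
  by (subst (asm) ev_cc_tns) (simp_all add: eJ_def fh_def)
 have "eJ a a ** (cid J a\<lhd>(K a)) = ev (K a) (K a) ** ((fa J VV j a a ** cid J a)\<lhd>(K a))"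
  by (simp add: eJ_def fh_def)
 also have "fa J VV j a a ** cid J a = cid VV (K a)" using f by blast
 finally show "eJ a a ** (cid J a\<lhd>(K a)) = idt (K a) ** lu (K a)" by (simp add: ev_cid)
qed simp_all

subsection \<open>The unit and the tensor products of arities\<close>

definition i0 :: 'j where "i0 = vunt J"

lemma unit_iso: "\<exists>p q. p \<in> \<one> \<leadsto> K i0 \<and> q \<in> K i0 \<leadsto> \<one> \<and> q ** p = idt \<one> \<and> p ** q = idt (K i0)"
proof -
 have "iso_arrow UV \<one> (K i0) (mon0 j)"
  using sys unfolding system_of_arities_def strong_symmetric_monoidal_vfunctor_def ucat_vself_monoidal i0_def by simp
 then show ?thesis unfolding UV_iso using una_ty by blast
qed

text \<open>The arities are closed under tensor products, since the functor \<open>j\<close> is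
strong monoidal.\<close>

lemma tensor_iso: "\<exists>c p q. p \<in> K a \<otimes> K b \<leadsto> K c \<and> q \<in> K c \<leadsto> K a \<otimes> K b \<and> q ** p = idt (K a \<otimes> K b) \<and> p ** q = idt (K c)"
proof -
 have "\<forall>A. iso_arrow UV (fob (vfun_comp V (tenF (vself_monoidal V)) (vfun_tensor V j j)) A)
   (fob (vfun_comp V j (tenF J)) A) ((\<lambda>(A, B). mon2 j A B) A)"
  using sys unfolding system_of_arities_def strong_symmetric_monoidal_vfunctor_def ucat_vself_monoidal vnat_iso_def by blast
 from this[rule_format, of "(a, b)"] have "iso_arrow UV (K a \<otimes> K b) (K (fob (tenF J) (a, b))) (mon2 j a b)"
  by (simp add: vfun_tensor_def)
 then show ?thesis unfolding UV_iso using una_ty by blast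
qed

text \<open>A chosen isomorphism between the unit object and the arity \<open>i0\<close>.\<close>

definition ui :: "('o, 'm) tarr" where
 "ui = (SOME p. p \<in> \<one> \<leadsto> K i0 \<and> (\<exists>q. q \<in> K i0 \<leadsto> \<one> \<and> q ** p = idt \<one> \<and> p ** q = idt (K i0)))"
definition uj :: "('o, 'm) tarr" where
 "uj = (SOME q. q \<in> K i0 \<leadsto> \<one> \<and> q ** ui = idt \<one> \<and> ui ** q = idt (K i0))"

lemma ui_uj [simp]: "vl ui" "dm ui = \<one>" "cd ui = K i0" "vl uj" "dm uj = K i0" "cd uj = \<one>"
 "uj ** ui = idt \<one>" "ui ** uj = idt (K i0)"
proof -
 have 1: "ui \<in> \<one> \<leadsto> K i0 \<and> (\<exists>q. q \<in> K i0 \<leadsto> \<one> \<and> q ** ui = idt \<one> \<and> ui ** q = idt (K i0))"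
  unfolding ui_def by (rule someI_ex) (use unit_iso in blast)
 have "uj \<in> K i0 \<leadsto> \<one> \<and> uj ** ui = idt \<one> \<and> ui ** uj = idt (K i0)"
  unfolding uj_def by (rule someI_ex) (use 1 in blast)
 with 1 show "vl ui" "dm ui = \<one>" "cd ui = K i0" "vl uj" "dm uj = K i0" "cd uj = \<one>"
  "uj ** ui = idt \<one>" "ui ** uj = idt (K i0)" by auto
qed

text \<open>The right unit isomorphism for the arity \<open>i0\<close>.\<close>

definition rr :: "'o \<Rightarrow> ('o, 'm) tarr" where "rr A = ru A ** [A]\<rhd>uj"
definition rri :: "'o \<Rightarrow> ('o, 'm) tarr" where "rri A = [A]\<rhd>ui ** rui A"

lemma rr_simps [simp]: "vl (rr A)" "dm (rr A) = A \<otimes> K i0" "cd (rr A) = A"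
 "vl (rri A)" "cd (rri A) = A \<otimes> K i0" "dm (rri A) = A" "rr A ** rri A = idt A" "rri A ** rr A = idt (A \<otimes> K i0)"
 by (simp_all add: rr_def rri_def wa_inv_re[of uj ui \<one>] wa_inv[of ui uj "K i0"])

lemmas rr_re [simp] = rr_simps(7,8)[THEN cmp_re]

text \<open>Precomposition with the invertible arrow \<open>rr\<close> reduces equations between
arrows out of \<open>P\<close> to equations between arrows out of the arity \<open>i0\<close> in a
context extended by \<open>P\<close>. This is how statements about arities reach all
objects.\<close>

lemma rr_nat:
 assumes "vl h" "dm h = \<Xi>|>P" "cd h = H"
 shows "rr H ** rw \<Xi> P h (K i0) = h ** \<Xi>\<rhd>rr P"
proof -
 have "rr H ** rw \<Xi> P h (K i0) = ru H ** rw \<Xi> P h \<one> ** (\<Xi> @ [P])\<rhd>uj"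
  using ctx_nat[OF ctx_rw, of h \<Xi> P H uj "K i0" \<one>] assms by (simp add: rr_def)
 also have "\<dots> = h ** \<Xi>\<rhd>rr P"
  using rw_ru[OF assms, THEN cmp_re] assms by (simp add: rr_def)
 finally show ?thesis .
qed

section \<open>Functors on the arities and their weighted colimits\<close>

text \<open>An enriched functor from \<open>J\<close> to the base, given on arrows in arbitrary
contexts.\<close>

definition jfun :: "('j \<Rightarrow> 'o) \<Rightarrow> ('j \<Rightarrow> 'j \<Rightarrow> ('o, 'm) oper) \<Rightarrow> bool" where
 "jfun R Rm \<longleftrightarrow> (\<forall>a b. natop [] (K a) (K b) (R a) (R b) (Rm a b)) \<and>
  (\<forall>a. Rm a a [] (idt (K a)) = idt (R a)) \<and>
  (\<forall>a b d \<Xi> \<Delta> f g. f \<in> \<Xi>|>K a \<leadsto> K b \<longrightarrow> g \<in> \<Delta>|>K b \<leadsto> K d \<longrightarrow>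
    Rm a d (\<Delta> @ \<Xi>) (g ** \<Delta>\<rhd>f) = Rm b d \<Delta> g ** \<Delta>\<rhd>Rm a b \<Xi> f)"

text \<open>A transformation \<open>V(K b, Y) \<otimes> R b \<rightarrow> Z\<close> that is
dinatural in \<open>b\<close>, with a parameter context \<open>U\<close>.\<close>

definition cocone :: "'o list \<Rightarrow> 'o \<Rightarrow> ('j \<Rightarrow> 'o) \<Rightarrow> ('j \<Rightarrow> 'j \<Rightarrow> ('o, 'm) oper) \<Rightarrow> 'o \<Rightarrow>
  ('j \<Rightarrow> ('o, 'm) oper) \<Rightarrow> bool" where
 "cocone U Y R Rm Z \<beta> \<longleftrightarrow> (\<forall>b. natop U (K b) Y (R b) Z (\<beta> b)) \<and>
  (\<forall>a b \<Xi> \<Delta> f g. f \<in> \<Xi>|>K b \<leadsto> K a \<longrightarrow> g \<in> \<Delta>|>K a \<leadsto> Y \<longrightarrow>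
    \<beta> b (\<Delta> @ \<Xi>) (g ** \<Delta>\<rhd>f) = \<beta> a \<Delta> g ** U\<rhd>\<Delta>\<rhd>Rm b a \<Xi> f)"

abbreviation factors where
 "factors Y h U lam \<beta> \<equiv> \<forall>b \<Xi> f. f \<in> \<Xi>|>K b \<leadsto> Y \<longrightarrow> \<beta> b \<Xi> f = h ** U\<rhd>lam b \<Xi> f"

text \<open>\<open>L\<close> is the colimit of \<open>R\<close> weighted by \<open>V(j-, Y)\<close>.
The parameter \<open>U\<close> makes the universal property enriched: a cocone with parameter
\<open>U\<close> and vertex \<open>Z\<close> is an arrow from \<open>U\<close> into the object of
cocones.\<close>

definition colim :: "'o \<Rightarrow> ('j \<Rightarrow> 'o) \<Rightarrow> ('j \<Rightarrow> 'j \<Rightarrow> ('o, 'm) oper) \<Rightarrow> 'o \<Rightarrow>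
  ('j \<Rightarrow> ('o, 'm) oper) \<Rightarrow> bool" where
 "colim Y R Rm L lam \<longleftrightarrow> cocone [] Y R Rm L lam \<and>
  (\<forall>U Z \<beta>. cocone U Y R Rm Z \<beta> \<longrightarrow>
   (\<exists>!h. h \<in> U|>L \<leadsto> Z \<and> factors Y h U lam \<beta>))"

text \<open>The operation on arrows given by an enriched functor.\<close>

definition Rop :: "('j, 'o, 'm, 'z) vfun_scheme \<Rightarrow> 'j \<Rightarrow> 'j \<Rightarrow> ('o, 'm) oper" where
 "Rop R a b = natof (vhom J a b) (K a) (eJ a b) [] (fob R a) (fh J R a b)"

lemma Rop:
 assumes "vl (fa J VV R a b)"
 shows "natop [] (K a) (K b) (fob R a) (fob R b) (Rop R a b)" "Rop R a b [vhom J a b] (eJ a b) = fh J R a b"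
 unfolding Rop_def using natof[OF repr_eJ, of "fh J R a b" "[]" a b "fob R a" "fob R b"] fh_simps[OF assms] by simp_all

lemma jfun_Rop: "vfunctor V J VV R \<longleftrightarrow> (\<forall>a b. vl (fa J VV R a b)) \<and> jfun (fob R) (Rop R)"
proof (cases "\<forall>a b. vl (fa J VV R a b)")
 case True
 then have t: "vl (fa J VV R a b)" for a b by blast
 show ?thesis
  unfolding vfunctor_iff[OF klc_J klc_vself t, of "Rop R", OF Rop(1)[OF t] Rop(2)[OF t, unfolded fh_def]]
  unfolding jfun_def using Rop(1)[OF t] t by simp
next
 case False
 then show ?thesis using vfunctor_typed[OF vcat_J vcat_vself] by blast
qed

text \<open>The action of the weight on internal homs.\<close>

definition Wf :: "'o \<Rightarrow> ('j, 'o, 'm, 'z) vfun_scheme \<Rightarrow> 'j \<Rightarrow> 'j \<Rightarrow> ('o, 'm) tarr" where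
 "Wf Y R a b = fh (vop V J) (vrep_along V VV R Y) a b"

lemma vrep_along_fob [simp]: "fob (vrep_along V C D X) = (\<lambda>b. vhom C (fob D b) X)"
 by (simp add: vrep_along_def)

lemma fa_along:
 assumes R: "vl (fa J VV R b a)"
 shows "vl (fa (vop V J) VV (vrep_along V VV R Y) a b)"
proof -
 have c: "vl (cc (vop V VV) Y (fob R a) (fob R b))" by (simp add: cc_vop)
 show ?thesis
  unfolding vrep_along_def
  by (subst fa_comp[where D = "vop V VV"]) (use R c in \<open>simp_all add: vl_fa_vrep\<close>)
qed

lemma Wf:
 assumes R: "vl (fa J VV R b a)"
 shows "vl (Wf Y R a b)" "dm (Wf Y R a b) = vhom J b a \<otimes> hm (fob R a) Y" "cd (Wf Y R a b) = hm (fob R b) Y"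
  "ev (fob R b) Y ** (Wf Y R a b\<lhd>(fob R b)) =
   ev (fob R a) Y ** [hm (fob R a) Y]\<rhd>fh J R b a ** alp (hm (fob R a) Y) (vhom J b a) (fob R b) **
    (sw (vhom J b a) (hm (fob R a) Y)\<lhd>(fob R b))"
proof -
 show t: "vl (Wf Y R a b)" "dm (Wf Y R a b) = vhom J b a \<otimes> hm (fob R a) Y" "cd (Wf Y R a b) = hm (fob R b) Y"
  using fh_simps[OF fa_along[OF R]] unfolding Wf_def by simp_all
 have c: "vl (cc (vop V VV) Y (fob R a) (fob R b))" by (simp add: cc_vop)
 let ?W = "hm (fob R a) Y" and ?r = "fa J VV R b a"
 have "Wf Y R a b = cc (vop V VV) Y (fob R a) (fob R b) ** (?r\<lhd>?W)"
  unfolding Wf_def vrep_along_def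
  by (subst fh_comp[where D = "vop V VV"]) (use R c in \<open>simp_all add: vl_fa_vrep fh_vrep\<close>)
 also have "\<dots> = cc VV (fob R b) (fob R a) Y ** (idt ?W \<boxtimes> ?r) ** sw (vhom J b a) ?W"
  using R by (simp add: cc_vop)
 finally have "ev (fob R b) Y ** (Wf Y R a b\<lhd>(fob R b)) =
  (ev (fob R b) Y ** ((cc VV (fob R b) (fob R a) Y ** (idt ?W \<boxtimes> ?r))\<lhd>(fob R b))) ** (sw (vhom J b a) ?W\<lhd>(fob R b))"
  using R by simp
 also have "\<dots> = ev (fob R a) Y ** [?W]\<rhd>fh J R b a ** alp ?W (vhom J b a) (fob R b) ** (sw (vhom J b a) ?W\<lhd>(fob R b))"
  by (subst ev_cc_tns) (use R in \<open>simp_all add: fh_def\<close>)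
 finally show "ev (fob R b) Y ** (Wf Y R a b\<lhd>(fob R b)) =
   ev (fob R a) Y ** [hm (fob R a) Y]\<rhd>fh J R b a ** alp (hm (fob R a) Y) (vhom J b a) (fob R b) **
    (sw (vhom J b a) (hm (fob R a) Y)\<lhd>(fob R b))" .
qed

text \<open>Dinaturality at universal arrows. The weight is a functor on the opposite of
\<open>J\<close>, whence the symmetry.\<close>

definition star :: "'o list \<Rightarrow> 'o \<Rightarrow> ('j, 'o, 'm, 'z) vfun_scheme \<Rightarrow> ('j \<Rightarrow> ('o, 'm) tarr) \<Rightarrow> bool" where
 "star U Y R h \<longleftrightarrow> (\<forall>a b. h b ** U\<rhd>(Wf Y j a b\<lhd>(fob R b)) =
  h a ** U\<rhd>([hm (K a) Y]\<rhd>fh J R b a ** alp (hm (K a) Y) (vhom J b a) (fob R b) **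
    (sw (vhom J b a) (hm (K a) Y)\<lhd>(fob R b))))"

text \<open>A cocone amounts to its values at the evaluation arrows, and by the two-variable Yoneda
principle its dinaturality to the single equation \<open>star\<close>.\<close>

lemma cocone_star:
 assumes R: "\<And>a b. vl (fa J VV R a b)"
  and n: "\<And>b. natop U (K b) Y (fob R b) Z (\<beta> b)"
 shows "cocone U Y (fob R) (Rop R) Z \<beta> \<longleftrightarrow> star U Y R (\<lambda>b. \<beta> b [hm (K b) Y] (ev (K b) Y))"
proof -
 note f [simp] = fh_simps[OF R] and nt [simp] = natop_tys[OF n] and w [simp] = Wf(1-3)[OF fa_j]
 note rn = Rop(1)[OF R]
 note rt [simp] = natop_tys[OF rn, simplified]
 let ?W = "\<lambda>b. hm (K b) Y"
 let ?g = "\<lambda>a b. \<beta> b [?W a, vhom J b a] (ev (K a) Y ** [?W a]\<rhd>eJ b a) = \<beta> a [?W a] (ev (K a) Y) ** U\<rhd>[?W a]\<rhd>fh J R b a"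
 have s: "star U Y R (\<lambda>b. \<beta> b [?W b] (ev (K b) Y)) \<longleftrightarrow> (\<forall>a b. ?g a b)"
 proof -
  have "(\<beta> b [?W b] (ev (K b) Y) ** U\<rhd>(Wf Y j a b\<lhd>(fob R b)) =
  \<beta> a [?W a] (ev (K a) Y) ** U\<rhd>([?W a]\<rhd>fh J R b a ** alp (?W a) (vhom J b a) (fob R b) **
    (sw (vhom J b a) (?W a)\<lhd>(fob R b)))) \<longleftrightarrow> ?g a b" (is "?l = ?r \<longleftrightarrow> _") for a b
  proof -
   let ?J = "vhom J b a"
   let ?s = "alp (?W a) ?J (fob R b) ** (sw ?J (?W a)\<lhd>(fob R b))"
   let ?t = "(sw (?W a) ?J\<lhd>(fob R b)) ** alpi (?W a) ?J (fob R b)"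
   have "?l = \<beta> b [?J \<otimes> ?W a] (ev (K b) Y ** (Wf Y j a b\<lhd>(K b)))"
    using natop_nat[OF n ctx_arr, of "Wf Y j a b" "?J \<otimes> ?W a" "?W b" "ev (K b) Y" b] by simp
   also have "\<dots> = \<beta> b [?J \<otimes> ?W a] (((ev (K a) Y ** [?W a]\<rhd>eJ b a) ** alp (?W a) ?J (K b)) ** (sw ?J (?W a)\<lhd>(K b)))"
    unfolding Wf(4)[OF fa_j] eJ_def by simp
   also have "\<dots> = \<beta> b [?W a \<otimes> ?J] ((ev (K a) Y ** [?W a]\<rhd>eJ b a) ** alp (?W a) ?J (K b)) ** U\<rhd>(sw ?J (?W a)\<lhd>(fob R b))"
    using natop_nat[OF n ctx_arr, of "sw ?J (?W a)" "?J \<otimes> ?W a" "?W a \<otimes> ?J" "(ev (K a) Y ** [?W a]\<rhd>eJ b a) ** alp (?W a) ?J (K b)" b] by simp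
   also have "\<dots> = \<beta> b [?W a, ?J] (ev (K a) Y ** [?W a]\<rhd>eJ b a) ** U\<rhd>?s"
    using natop_nat[OF n ctx_alp, of "ev (K a) Y ** [?W a]\<rhd>eJ b a" "?W a" ?J b] by simp
   finally have l: "?l = \<beta> b [?W a, ?J] (ev (K a) Y ** [?W a]\<rhd>eJ b a) ** U\<rhd>?s" .
   have r: "?r = (\<beta> a [?W a] (ev (K a) Y) ** U\<rhd>[?W a]\<rhd>fh J R b a) ** U\<rhd>?s"
    by simp
   have st: "?s ** ?t = idt (?W a \<otimes> (?J \<otimes> fob R b))"
    using tns_cmp[of "sw (?W a) ?J" "sw ?J (?W a)" "idt (fob R b)" "idt (fob R b)", THEN cmp_re] by simp
   show ?thesis
    unfolding l r
   proof
    assume e: "\<beta> b [?W a, ?J] (ev (K a) Y ** [?W a]\<rhd>eJ b a) ** U\<rhd>?s = (\<beta> a [?W a] (ev (K a) Y) ** U\<rhd>[?W a]\<rhd>fh J R b a) ** U\<rhd>?s"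
    show "?g a b"
     by (rule iso_epi[OF e wa_inv[OF st]]) simp_all
   qed simp
  qed
  then show ?thesis unfolding star_def by blast
 qed
 have c: "cocone U Y (fob R) (Rop R) Z \<beta> \<longleftrightarrow> (\<forall>a b. ?g a b)"
 proof
  assume a: "cocone U Y (fob R) (Rop R) Z \<beta>"
  show "\<forall>a b. ?g a b"
  proof (intro allI)
   fix a b show "?g a b"
    using a[unfolded cocone_def, THEN conjunct2, rule_format, of "eJ b a" "[vhom J b a]" b a "ev (K a) Y" "[?W a]"]
    by (simp add: Rop(2)[OF R])
  qed
 next
  assume G: "\<forall>a b. ?g a b"
  show "cocone U Y (fob R) (Rop R) Z \<beta>"
   unfolding cocone_def
  proof (intro conjI allI impI)
   fix a b \<Xi> \<Delta> f g assume f: "f \<in> \<Xi>|>K b \<leadsto> K a" and g: "g \<in> \<Delta>|>K a \<leadsto> Y"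
   show "\<beta> b (\<Delta> @ \<Xi>) (g ** \<Delta>\<rhd>f) = \<beta> a \<Delta> g ** U\<rhd>\<Delta>\<rhd>Rop R b a \<Xi> f"
   proof (rule natop2_eqI[OF repr_ev repr_eJ, where U = U and C = "fob R b"
      and F = "\<lambda>\<Delta> g \<Xi> f. \<beta> b (\<Delta> @ \<Xi>) (g ** \<Delta>\<rhd>f)"
      and G = "\<lambda>\<Delta> g \<Xi> f. \<beta> a \<Delta> g ** U\<rhd>\<Delta>\<rhd>Rop R b a \<Xi> f", OF _ _ _ _ _ g f])
    fix \<Delta> \<Delta>' u g \<Xi> f assume u: "ctx \<Delta> \<Delta>' u" and us [simp]: "\<And>A. vl (u A)" "\<And>A. dm (u A) = \<Delta>|>A" "\<And>A. cd (u A) = \<Delta>'|>A"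
     and a: "g \<in> \<Delta>'|>K a \<leadsto> Y" "f \<in> \<Xi>|>K b \<leadsto> K a"
    show "\<beta> b (\<Delta> @ \<Xi>) ((g ** u (K a)) ** \<Delta>\<rhd>f) = \<beta> b (\<Delta>' @ \<Xi>) (g ** \<Delta>'\<rhd>f) ** U\<rhd>u (\<Xi>|>fob R b)"
     using natop_nat[OF n ctx_right[OF u], of "g ** \<Delta>'\<rhd>f" \<Xi> b] ctx_nat[OF u, of f] a by simp
    have "u (fob R a) ** \<Delta>\<rhd>Rop R b a \<Xi> f = \<Delta>'\<rhd>Rop R b a \<Xi> f ** u (\<Xi>|>fob R b)"
     by (rule ctx_nat[OF u]) (use a in simp_all)
    then have "U\<rhd>u (fob R a) ** U\<rhd>\<Delta>\<rhd>Rop R b a \<Xi> f = U\<rhd>(\<Delta>'\<rhd>Rop R b a \<Xi> f ** u (\<Xi>|>fob R b))"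
     using a by (metis us vl_wa wa_cmp cd_wa rt a(2) Ar_iff)
    then show "\<beta> a \<Delta> (g ** u (K a)) ** U\<rhd>\<Delta>\<rhd>Rop R b a \<Xi> f = (\<beta> a \<Delta>' g ** U\<rhd>\<Delta>'\<rhd>Rop R b a \<Xi> f) ** U\<rhd>u (\<Xi>|>fob R b)"
     using natop_nat[OF n u, of g a] a by simp
   next
    fix \<Delta> v g \<Xi> \<Xi>' f assume v: "ctx \<Xi> \<Xi>' v" and vs [simp]: "\<And>A. vl (v A)" "\<And>A. dm (v A) = \<Xi>|>A" "\<And>A. cd (v A) = \<Xi>'|>A"
     and a: "g \<in> \<Delta>|>K a \<leadsto> Y" "f \<in> \<Xi>'|>K b \<leadsto> K a"
    show "\<beta> b (\<Delta> @ \<Xi>) (g ** \<Delta>\<rhd>(f ** v (K b))) = \<beta> b (\<Delta> @ \<Xi>') (g ** \<Delta>\<rhd>f) ** U\<rhd>\<Delta>\<rhd>v (fob R b)"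
     using natop_nat[OF n ctx_left[OF v], of "g ** \<Delta>\<rhd>f" \<Delta> b] a by simp
    show "\<beta> a \<Delta> g ** U\<rhd>\<Delta>\<rhd>Rop R b a \<Xi> (f ** v (K b)) = (\<beta> a \<Delta> g ** U\<rhd>\<Delta>\<rhd>Rop R b a \<Xi>' f) ** U\<rhd>\<Delta>\<rhd>v (fob R b)"
     using natop_nat[OF rn v, of f b a] a by simp
   qed (use G Rop(2)[OF R] in simp)
  qed (rule n)
 qed
 show ?thesis using s c by simp
qed

end

section \<open>Weighted colimits as universal cocones\<close>

lemma ex1_bij:
 assumes "\<And>h. P h \<Longrightarrow> Q (f h)" "\<And>k. Q k \<Longrightarrow> P (g k)" "\<And>h. P h \<Longrightarrow> g (f h) = h" "\<And>k. Q k \<Longrightarrow> f (g k) = k"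
 shows "(\<exists>!h. P h) \<longleftrightarrow> (\<exists>!k. Q k)"
 using assms by metis

context smclosed
begin

lemma sw_nat2L [simp]: "\<lbrakk>vl f; cd f = B'\<rbrakk> \<Longrightarrow>
  (sw A B'\<lhd>C) ** ([A]\<rhd>f\<lhd>C) = ((f\<lhd>A)\<lhd>C) ** (sw A (dm f)\<lhd>C)"
 using tns_cmpL[of "[A]\<rhd>f" "sw A B'" C] tns_cmpL[of "sw A (dm f)" "f\<lhd>A" C] by (simp del: tns_cmpL)

lemmas sw_nat2L_re [simp] = sw_nat2L[THEN cmp_re, unfolded cmp_assoc]

end

context arity
begin

text \<open>Uncurrying \<open>X \<rightarrow> [W, [R, Z]]\<close> to \<open>X \<otimes> (W \<otimes>
R) \<rightarrow> Z\<close>.\<close>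

definition un2 :: "'o \<Rightarrow> 'o \<Rightarrow> 'o \<Rightarrow> 'o \<Rightarrow> ('o, 'm) tarr \<Rightarrow> ('o, 'm) tarr" where
 "un2 X W R Z t = ev R Z ** ((ev W (hm R Z) ** (t\<lhd>W))\<lhd>R) ** alpi X W R"
definition cu2 :: "'o \<Rightarrow> 'o \<Rightarrow> 'o \<Rightarrow> ('o, 'm) tarr \<Rightarrow> ('o, 'm) tarr" where
 "cu2 X W R h = cur X W (cur (X \<otimes> W) R (h ** alp X W R))"

lemma un2_simps:
 assumes "t \<in> X \<leadsto> hm W (hm R Z)"
 shows "vl (un2 X W R Z t)" "dm (un2 X W R Z t) = X \<otimes> (W \<otimes> R)" "cd (un2 X W R Z t) = Z"
 using assms by (simp_all add: un2_def)

lemma un2_alp: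
 assumes "t \<in> X \<leadsto> hm W (hm R Z)"
 shows "un2 X W R Z t ** alp X W R = ev R Z ** ((ev W (hm R Z) ** (t\<lhd>W))\<lhd>R)"
 using assms by (simp add: un2_def)

lemma cu2:
 assumes "h \<in> X \<otimes> (W \<otimes> R) \<leadsto> Z"
 shows "cu2 X W R h \<in> X \<leadsto> hm W (hm R Z)" "un2 X W R Z (cu2 X W R h) = h"
proof -
 note c = cur[of "h ** alp X W R" "X \<otimes> W" R Z]
 have c1: "vl (cur (X \<otimes> W) R (h ** alp X W R))" "dm (cur (X \<otimes> W) R (h ** alp X W R)) = X \<otimes> W"
  "cd (cur (X \<otimes> W) R (h ** alp X W R)) = hm R Z" "ev R Z ** (cur (X \<otimes> W) R (h ** alp X W R)\<lhd>R) = h ** alp X W R"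
  using c assms by simp_all
 note d = cur[OF c1(1-3)]
 show "cu2 X W R h \<in> X \<leadsto> hm W (hm R Z)" unfolding cu2_def using d by simp
 show "un2 X W R Z (cu2 X W R h) = h"
  unfolding un2_def cu2_def d(4) using c1(4)[THEN cmp_re, of "alpi X W R"] assms by simp
qed

lemma un2_inj:
 assumes "un2 X W R Z t = un2 X W R Z t'" "t \<in> X \<leadsto> hm W (hm R Z)" "t' \<in> X \<leadsto> hm W (hm R Z)"
 shows "t = t'"
proof (rule ev_eqI[of W "hm R Z"])
 show "ev W (hm R Z) ** (t\<lhd>W) = ev W (hm R Z) ** (t'\<lhd>W)"
  by (rule ev_eqI[of R Z]) (use un2_alp[OF assms(2)] un2_alp[OF assms(3)] assms in auto)
qed (use assms in auto)

lemma un2_pre: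
 assumes "t \<in> X \<leadsto> hm W (hm R Z)" "h \<in> X' \<leadsto> X"
 shows "un2 X' W R Z (t ** h) = un2 X W R Z t ** (h\<lhd>(W \<otimes> R))"
proof -
 have "((h\<lhd>W)\<lhd>R) ** alpi X' W R = alpi X W R ** (h\<lhd>(W \<otimes> R))"
  using alpi_nat[of h "idt W" "idt R" X' W R X W R] assms by simp
 then show ?thesis using assms by (simp add: un2_def)
qed

text \<open>Families \<open>X \<rightarrow> [[K b, Y], [R b, Z]]\<close> that are natural in
\<open>b\<close> are, after uncurrying twice, the arrows \<open>X \<otimes> ([K b, Y] \<otimes> R b)
\<rightarrow> Z\<close> that satisfy \<open>star\<close>. The calculation moves the symmetries to
the same place on both sides by pentagon and hexagon.\<close>

lemma family_iff:
 fixes R :: "('j, 'o, 'm) vfun"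
 assumes R [simp]: "\<And>a b. vl (fa J VV R a b)"
 shows "vnat_family V (vop V J) VV (vrep_along V VV j Y) (vrep_along V VV R Z) X \<beta> \<longleftrightarrow>
  (\<forall>b. vl (mk X (\<beta> b) (hm (hm (K b) Y) (hm (fob R b) Z)))) \<and>
  star [X] Y R (\<lambda>b. un2 X (hm (K b) Y) (fob R b) Z (mk X (\<beta> b) (hm (hm (K b) Y) (hm (fob R b) Z))))"
proof (cases "\<forall>b. vl (mk X (\<beta> b) (hm (hm (K b) Y) (hm (fob R b) Z)))")
 case True
 define bt where "bt b = mk X (\<beta> b) (hm (hm (K b) Y) (hm (fob R b) Z))" for b
 let ?W = "\<lambda>b. hm (K b) Y" and ?Q = "\<lambda>b. hm (fob R b) Z"
 define b1 where "b1 b = ev (?W b) (?Q b) ** (bt b\<lhd>(?W b))" for b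
 define b2 where "b2 b = un2 X (?W b) (fob R b) Z (bt b)" for b
 have bt [simp]: "vl (bt b)" "dm (bt b) = X" "cd (bt b) = hm (?W b) (?Q b)" "raw (bt b) = \<beta> b" for b
  using True by (simp_all add: bt_def)
 have b1 [simp]: "vl (b1 b)" "dm (b1 b) = X \<otimes> ?W b" "cd (b1 b) = ?Q b" for b by (simp_all add: b1_def)
 have b2 [simp]: "vl (b2 b)" "dm (b2 b) = X \<otimes> (?W b \<otimes> fob R b)" "cd (b2 b) = Z" for b
  unfolding b2_def by (intro un2_simps; simp)+
 have b21: "ev (fob R b) Z ** (b1 b\<lhd>(fob R b)) = b2 b ** alp X (?W b) (fob R b)" for b
  unfolding b2_def b1_def by (rule un2_alp[symmetric]) simp
 note w [simp] = Wf(1-3)[OF fa_j] Wf(1-3)[OF R]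
 have wt [simp]: "vl (fa (vop V J) VV (vrep_along V VV j Y) a b)" "vl (fa (vop V J) VV (vrep_along V VV R Z) a b)" for a b
  by (rule fa_along; simp)+
 note f [simp] = fh_simps[OF R]
 let ?Wa = "\<lambda>a b. fa (vop V J) VV (vrep_along V VV j Y) a b"
 let ?Qa = "\<lambda>a b. fa (vop V J) VV (vrep_along V VV R Z) a b"
 have we: "ev (?W a) (?W b) ** (?Wa a b\<lhd>(?W a)) = Wf Y j a b" "ev (?Q a) (?Q b) ** (?Qa a b\<lhd>(?Q a)) = Wf Z R a b" for a b
  by (simp_all add: Wf_def fh_def)
 have "(vcomp VV (?W a) (?Q a) (?Q b) \<cdot> (fmap (vrep_along V VV R Z) a b \<odot> \<beta> a) =
    vcomp VV (?W a) (?W b) (?Q b) \<cdot> (\<beta> b \<odot> fmap (vrep_along V VV j Y) a b) \<cdot> swp V (vhom J b a) X)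
  \<longleftrightarrow> b2 b ** [X]\<rhd>(Wf Y j a b\<lhd>(fob R b)) =
  b2 a ** [X]\<rhd>([?W a]\<rhd>fh J R b a ** alp (?W a) (vhom J b a) (fob R b) ** (sw (vhom J b a) (?W a)\<lhd>(fob R b)))"
  (is "?L \<longleftrightarrow> ?R") for a b
 proof -
  let ?J = "vhom J b a" and ?Wq = "?W a" and ?Rb = "fob R b"
  let ?x = "cc VV (?W a) (?Q a) (?Q b) ** (?Qa a b \<boxtimes> bt a)"
  let ?y = "cc VV (?W a) (?W b) (?Q b) ** (bt b \<boxtimes> ?Wa a b) ** sw ?J X"
  let ?x1 = "ev (?W a) (?Q b) ** (?x\<lhd>(?W a))" and ?y1 = "ev (?W a) (?Q b) ** (?y\<lhd>(?W a))"
  let ?x2 = "ev ?Rb Z ** (?x1\<lhd>?Rb)" and ?y2 = "ev ?Rb Z ** (?y1\<lhd>?Rb)"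
  let ?i = "alp X (?J \<otimes> ?Wq) ?Rb ** ((alp X ?J ?Wq ** (sw ?J X\<lhd>?Wq))\<lhd>?Rb)"
  let ?k = "(((sw X ?J\<lhd>?Wq) ** alpi X ?J ?Wq)\<lhd>?Rb) ** alpi X (?J \<otimes> ?Wq) ?Rb"
  have 1: "?L \<longleftrightarrow> ?x = ?y"
  proof -
   have "raw (sw ?J X) = swp V ?J X" by (simp add: raw_struct)
   then show ?thesis by (simp add: tarr_eq_iff raw_cmp raw_tns)
  qed
  have 2: "?x = ?y \<longleftrightarrow> ?x1 = ?y1"
  proof
   assume "?x = ?y" then show "?x1 = ?y1" by (simp only:)
  next
   assume "?x1 = ?y1" then show "?x = ?y" by (rule ev_eqI) simp_all
  qed
  have 3: "?x1 = ?y1 \<longleftrightarrow> ?x2 = ?y2"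
  proof
   assume "?x1 = ?y1" then show "?x2 = ?y2" by (simp only:)
  next
   assume "?x2 = ?y2" then show "?x1 = ?y1" by (rule ev_eqI) simp_all
  qed
  have x1: "?x1 = Wf Z R a b ** [?J]\<rhd>b1 a ** alp ?J X ?Wq"
   by (subst ev_cc_tns) (simp_all add: we b1_def[symmetric])
  have y1: "?y1 = b1 b ** [X]\<rhd>Wf Y j a b ** alp X ?J ?Wq ** (sw ?J X\<lhd>?Wq)"
  proof -
   have "?y1 = (ev (?W a) (?Q b) ** ((cc VV (?W a) (?W b) (?Q b) ** (bt b \<boxtimes> ?Wa a b))\<lhd>(?W a))) ** (sw ?J X\<lhd>?Wq)"
    by simp
   then show ?thesis
    by (subst (asm) ev_cc_tns) (simp_all add: we b1_def[symmetric])
  qed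
  have h: "alp X ?Wq ?J ** sw ?J (X \<otimes> ?Wq) ** alp ?J X ?Wq = [X]\<rhd>sw ?J ?Wq ** alp X ?J ?Wq ** (sw ?J X\<lhd>?Wq)"
   using hexagon[of X ?Wq ?J] by simp
  have "?x2 = (ev ?Rb Z ** (Wf Z R a b\<lhd>?Rb)) ** ([?J]\<rhd>b1 a\<lhd>?Rb) ** (alp ?J X ?Wq\<lhd>?Rb)"
   unfolding x1 by simp
  also have "\<dots> = ev (fob R a) Z ** [?Q a]\<rhd>fh J R b a ** alp (?Q a) ?J ?Rb ** ((sw ?J (?Q a) ** [?J]\<rhd>b1 a)\<lhd>?Rb) ** (alp ?J X ?Wq\<lhd>?Rb)"
   unfolding Wf(4)[OF R] by simp
  also have "\<dots> = (ev (fob R a) Z ** (b1 a\<lhd>(fob R a))) ** [X \<otimes> ?Wq]\<rhd>fh J R b a ** alp (X \<otimes> ?Wq) ?J ?Rb ** ((sw ?J (X \<otimes> ?Wq) ** alp ?J X ?Wq)\<lhd>?Rb)"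
   by simp
  also have "\<dots> = b2 a ** [X]\<rhd>[?Wq]\<rhd>fh J R b a ** alp X ?Wq (?J \<otimes> ?Rb) ** alp (X \<otimes> ?Wq) ?J ?Rb ** ((sw ?J (X \<otimes> ?Wq) ** alp ?J X ?Wq)\<lhd>?Rb)"
   unfolding b21 by simp
  also have "\<dots> = b2 a ** [X]\<rhd>[?Wq]\<rhd>fh J R b a ** [X]\<rhd>alp ?Wq ?J ?Rb ** alp X (?Wq \<otimes> ?J) ?Rb ** ((alp X ?Wq ?J ** sw ?J (X \<otimes> ?Wq) ** alp ?J X ?Wq)\<lhd>?Rb)"
   using pentagon[of X ?Wq ?J ?Rb, THEN cmp_re] by simp
  also have "\<dots> = (b2 a ** [X]\<rhd>([?W a]\<rhd>fh J R b a ** alp (?W a) (vhom J b a) (fob R b) ** (sw (vhom J b a) (?W a)\<lhd>(fob R b)))) ** ?i"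
   unfolding h by simp
  finally have x2: "?x2 = (b2 a ** [X]\<rhd>([?W a]\<rhd>fh J R b a ** alp (?W a) (vhom J b a) (fob R b) ** (sw (vhom J b a) (?W a)\<lhd>(fob R b)))) ** ?i" .
  have "?y2 = (ev ?Rb Z ** (b1 b\<lhd>?Rb)) ** ([X]\<rhd>Wf Y j a b\<lhd>?Rb) ** ((alp X ?J ?Wq ** (sw ?J X\<lhd>?Wq))\<lhd>?Rb)"
   unfolding y1 by simp
  also have "\<dots> = (b2 b ** [X]\<rhd>(Wf Y j a b\<lhd>?Rb)) ** ?i"
   unfolding b21 by simp
  finally have y2: "?y2 = (b2 b ** [X]\<rhd>(Wf Y j a b\<lhd>?Rb)) ** ?i" .
  have ik: "?i ** ?k = idt (X \<otimes> ((?J \<otimes> ?Wq) \<otimes> ?Rb))"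
  proof -
   have "((alp X ?J ?Wq ** (sw ?J X\<lhd>?Wq))\<lhd>?Rb) ** (((sw X ?J\<lhd>?Wq) ** alpi X ?J ?Wq)\<lhd>?Rb) = idt ((X \<otimes> (?J \<otimes> ?Wq)) \<otimes> ?Rb)"
    by (simp add: tns_cmp tns_cmp_re del: tns_cmpL)
   from this[THEN cmp_re] show ?thesis by (simp del: tns_cmpL)
  qed
  have 4: "?x2 = ?y2 \<longleftrightarrow> ?R"
  proof
   assume e: "?x2 = ?y2"
   show ?R
    by (rule iso_epi[OF trans[OF y2[symmetric] trans[OF e[symmetric] x2]] ik]) simp_all
  next
   assume ?R
   then show "?x2 = ?y2" unfolding x2 y2 by (simp only:)
  qed
  show ?thesis using 1 2 3 4 by blast
 qed
 then show ?thesis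
  using True unfolding vnat_family_def star_def b2_def bt_def by auto
next
 case False
 then show ?thesis unfolding vnat_family_def by auto
qed

text \<open>The universal property with respect to parameters that are single objects.\<close>

definition univ1 :: "'o \<Rightarrow> ('j, 'o, 'm) vfun \<Rightarrow> 'o \<Rightarrow> ('j \<Rightarrow> ('o, 'm) tarr) \<Rightarrow> bool" where
 "univ1 Y R L lam \<longleftrightarrow> (\<forall>X Z h. (\<forall>b. h b \<in> X \<otimes> (hm (K b) Y \<otimes> fob R b) \<leadsto> Z) \<longrightarrow> star [X] Y R h \<longrightarrow>
  (\<exists>!k. k \<in> X \<otimes> L \<leadsto> Z \<and> (\<forall>b. h b = k ** [X]\<rhd>lam b)))"

lemma star_pre:
 assumes s: "star [] Y R lam" and l: "\<And>b. lam b \<in> hm (K b) Y \<otimes> fob R b \<leadsto> L" and h: "h \<in> X \<otimes> L \<leadsto> Z"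
  and R: "\<And>a b. vl (fa J VV R a b)"
 shows "star [X] Y R (\<lambda>b. h ** [X]\<rhd>lam b)"
 unfolding star_def
proof (intro allI)
 fix a b
 note [simp] = Wf(1-3)[OF fa_j] fh_simps[OF R]
 have e: "lam b ** (Wf Y j a b\<lhd>(fob R b)) = lam a ** [hm (K a) Y]\<rhd>fh J R b a ** alp (hm (K a) Y) (vhom J b a) (fob R b) ** (sw (vhom J b a) (hm (K a) Y)\<lhd>(fob R b))"
  using s[unfolded star_def, rule_format, of b a] by simp
 have "h ** [X]\<rhd>(lam b ** (Wf Y j a b\<lhd>(fob R b))) = h ** [X]\<rhd>(lam a ** [hm (K a) Y]\<rhd>fh J R b a ** alp (hm (K a) Y) (vhom J b a) (fob R b) ** (sw (vhom J b a) (hm (K a) Y)\<lhd>(fob R b)))"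
  unfolding e ..
 then show "(h ** [X]\<rhd>lam b) ** [X]\<rhd>(Wf Y j a b\<lhd>(fob R b)) =
   (h ** [X]\<rhd>lam a) ** [X]\<rhd>([hm (K a) Y]\<rhd>fh J R b a ** alp (hm (K a) Y) (vhom J b a) (fob R b) ** (sw (vhom J b a) (hm (K a) Y)\<lhd>(fob R b)))"
  using l h by simp
qed

text \<open>The end in the definition of a weighted colimit represents natural families, which are
uncurried by \<open>family_iff\<close>; arrows \<open>X \<rightarrow> [L, Z]\<close> are uncurried
to \<open>X \<otimes> L \<rightarrow> Z\<close>.\<close>

lemma weighted_colimit_univ1:
 fixes R :: "('j, 'o, 'm) vfun"
 assumes R [simp]: "\<And>a b. vl (fa J VV R a b)"
 shows "weighted_colimit V J VV (vrep_along V VV j Y) R L cyl \<longleftrightarrow>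
  (\<forall>b. cyl b \<in> Hom UV (hm (K b) Y) (hm (fob R b) L)) \<and>
  star [] Y R (\<lambda>b. ev (fob R b) L ** (una (cyl b)\<lhd>(fob R b))) \<and>
  univ1 Y R L (\<lambda>b. ev (fob R b) L ** (una (cyl b)\<lhd>(fob R b)))"
proof -
 let ?W = "\<lambda>b. hm (K b) Y"
 let ?vW = "vrep_along V VV j Y"
 note f [simp] = fh_simps[OF R]
 have wt [simp]: "vl (fa (vop V J) VV (vrep_along V VV j Y) a b)" "vl (fa (vop V J) VV (vrep_along V VV R Z) a b)" for a b Z
  by (rule fa_along; simp)+
 note w [simp] = Wf(1-3)[OF fa_j] Wf(1-3)[OF R]
 define lam where "lam b = ev (fob R b) L ** (una (cyl b)\<lhd>(fob R b))" for b
 show ?thesis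
 proof (cases "\<forall>b. cyl b \<in> Hom UV (hm (K b) Y) (hm (fob R b) L)")
  case True
  have cy: "vl (elA (cyl b))" "fst (cyl b) = ?W b" "snd (snd (cyl b)) = hm (fob R b) L" for b
   using True[rule_format, of b] unfolding UV_Hom by auto
  have cu [simp]: "vl (una (cyl b))" "dm (una (cyl b)) = ?W b" "cd (una (cyl b)) = hm (fob R b) L" for b
   using una_ty[OF True[rule_format, of b]] by auto
  have l [simp]: "vl (lam b)" "dm (lam b) = ?W b \<otimes> fob R b" "cd (lam b) = L" for b by (simp_all add: lam_def)
  have 1: "vnat V (vop V J) VV ?vW (vrep_along V VV R L) cyl \<longleftrightarrow> star [] Y R lam"
  proof -
   have "una (cyl b) ** Wf Y j a b = Wf L R a b ** [vhom J b a]\<rhd>una (cyl a) \<longleftrightarrow>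
    lam b ** []\<rhd>(Wf Y j a b\<lhd>(fob R b)) =
    lam a ** []\<rhd>([?W a]\<rhd>fh J R b a ** alp (?W a) (vhom J b a) (fob R b) ** (sw (vhom J b a) (?W a)\<lhd>(fob R b)))"
    (is "?x = ?y \<longleftrightarrow> ?x' = ?y'") for a b
   proof -
    have x: "ev (fob R b) L ** (?x\<lhd>(fob R b)) = ?x'" by (simp add: lam_def)
    have "ev (fob R b) L ** (?y\<lhd>(fob R b)) = (ev (fob R b) L ** (Wf L R a b\<lhd>(fob R b))) ** ([vhom J b a]\<rhd>una (cyl a)\<lhd>(fob R b))"
     by simp
    also have "\<dots> = ev (fob R a) L ** [hm (fob R a) L]\<rhd>fh J R b a ** alp (hm (fob R a) L) (vhom J b a) (fob R b) ** ((sw (vhom J b a) (hm (fob R a) L) ** [vhom J b a]\<rhd>una (cyl a))\<lhd>(fob R b))"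
     unfolding Wf(4)[OF R] by simp
    also have "\<dots> = ?y'" by (simp add: lam_def)
    finally have y: "ev (fob R b) L ** (?y\<lhd>(fob R b)) = ?y'" .
    show ?thesis unfolding x[symmetric] y[symmetric]
    proof
     assume "?x = ?y" then show "ev (fob R b) L ** (?x\<lhd>(fob R b)) = ev (fob R b) L ** (?y\<lhd>(fob R b))" by (simp only:)
    next
     assume "ev (fob R b) L ** (?x\<lhd>(fob R b)) = ev (fob R b) L ** (?y\<lhd>(fob R b))"
     then show "?x = ?y" by (rule ev_eqI) simp_all
    qed
   qed
   then show ?thesis
    unfolding vnat_iff[where C = "vop V J", OF wt(1) wt(2)] star_def using True by (simp add: Wf_def)
  qed
  let ?kap = "\<lambda>Z b. vcomp VV (?W b) (hm (fob R b) L) (hm (fob R b) Z) \<cdot>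
      (fmap (vrep V VV (fob R b)) L Z \<odot> elt (cyl b)) \<cdot> run_inv V (hm L Z)"
  define kt where "kt Z b = mk (hm L Z) (?kap Z b) (hm (?W b) (hm (fob R b) Z))" for Z b
  have kt: "vl (kt Z b)" "dm (kt Z b) = hm L Z" "cd (kt Z b) = hm (?W b) (hm (fob R b) Z)"
   and ku: "un2 (hm L Z) (?W b) (fob R b) Z (kt Z b) = ev L Z ** [hm L Z]\<rhd>lam b" for Z b
  proof -
   let ?v = "fa VV VV (vrep V VV (fob R b)) L Z"
   have v [simp]: "vl ?v" by (rule vl_fa_vrep) simp
   let ?t = "cc VV (?W b) (hm (fob R b) L) (hm (fob R b) Z) ** (?v \<boxtimes> elA (cyl b)) ** rui (hm L Z)"
   have e: "kt Z b = ?t"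
   proof (rule sym)
    have r: "raw (elA (cyl b)) = elt (cyl b)" "raw (rui (hm L Z)) = run_inv V (hm L Z)" by (simp_all add: elA_def raw_struct)
    have t: "vl ?t" "dm ?t = hm L Z" "cd ?t = hm (?W b) (hm (fob R b) Z)" using cy by simp_all
    have "mk (dm ?t) (raw ?t) (cd ?t) = kt Z b"
     unfolding kt_def using t cy r by (simp add: raw_cmp raw_tns)
    then show "?t = kt Z b" by (rule trans[OF mk_raw[OF t(1), symmetric]])
   qed
   show t: "vl (kt Z b)" "dm (kt Z b) = hm L Z" "cd (kt Z b) = hm (?W b) (hm (fob R b) Z)"
    unfolding e using cy by simp_all
   have "ev (?W b) (hm (fob R b) Z) ** (kt Z b\<lhd>(?W b)) = (ev (?W b) (hm (fob R b) Z) ** ((cc VV (?W b) (hm (fob R b) L) (hm (fob R b) Z) ** (?v \<boxtimes> elA (cyl b)))\<lhd>(?W b))) ** (rui (hm L Z)\<lhd>(?W b))"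
    unfolding e using cy by simp
   also have "\<dots> = (ev (hm (fob R b) L) (hm (fob R b) Z) ** (?v\<lhd>(hm (fob R b) L))) ** [hm L Z]\<rhd>(una (cyl b) ** lu (?W b)) ** alp (hm L Z) \<one> (?W b) ** (rui (hm L Z)\<lhd>(?W b))"
    using una_ev[OF cy(1), of b] by (subst ev_cc_tns) (simp_all add: cy)
   also have "\<dots> = (ev (hm (fob R b) L) (hm (fob R b) Z) ** (?v\<lhd>(hm (fob R b) L))) ** [hm L Z]\<rhd>una (cyl b)"
    using triangle[of "hm L Z" "?W b", THEN cmp_re] by (simp add: tns_cmp)
   also have "\<dots> = cc VV (fob R b) L Z ** [hm L Z]\<rhd>una (cyl b)"
    using fh_vrep[of "VV" "fob R b" L Z] by (simp add: fh_def)
   finally have k1: "ev (?W b) (hm (fob R b) Z) ** (kt Z b\<lhd>(?W b)) = cc VV (fob R b) L Z ** [hm L Z]\<rhd>una (cyl b)" .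
   show "un2 (hm L Z) (?W b) (fob R b) Z (kt Z b) = ev L Z ** [hm L Z]\<rhd>lam b"
    unfolding un2_def k1 lam_def by (simp add: ev_cc_re)
  qed
  note [simp] = kt
  have 2: "(\<forall>Z. vnat_object V (vop V J) VV ?vW (vrep_along V VV R Z) (hm L Z) (?kap Z)) \<longleftrightarrow> univ1 Y R L lam"
   if s: "star [] Y R lam"
  proof -
   have kf: "vnat_family V (vop V J) VV ?vW (vrep_along V VV R Z) (hm L Z) (?kap Z)" for Z
    unfolding family_iff[OF R] kt_def[symmetric] ku using star_pre[OF s _ _ R, of L "ev L Z" "hm L Z" Z] by simp
   have key: "(\<exists>!h. h \<in> Hom V X (hm L Z) \<and> (\<forall>b. ?kap Z b \<cdot> h = \<beta> b)) \<longleftrightarrow> (\<exists>!k. k \<in> X \<otimes> L \<leadsto> Z \<and> (\<forall>b. h2 b = k ** [X]\<rhd>lam b))"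
    if b: "\<And>b. vl (mk X (\<beta> b) (hm (?W b) (hm (fob R b) Z)))"
     and h2: "\<And>b. h2 b = un2 X (?W b) (fob R b) Z (mk X (\<beta> b) (hm (?W b) (hm (fob R b) Z)))" for X Z \<beta> h2
   proof -
    have eq: "?kap Z b \<cdot> h = \<beta> b \<longleftrightarrow> h2 b = (ev L Z ** (mk X h (hm L Z)\<lhd>L)) ** [X]\<rhd>lam b"
     if h: "h \<in> Hom V X (hm L Z)" for h b
    proof -
     have hv: "mk X h (hm L Z) \<in> X \<leadsto> hm L Z" using h by simp
     have "?kap Z b \<cdot> h = \<beta> b \<longleftrightarrow> kt Z b ** mk X h (hm L Z) = mk X (\<beta> b) (hm (?W b) (hm (fob R b) Z))"
      using h kt(1)[of Z b] unfolding kt_def by (simp add: cmp_mk)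
     also have "\<dots> \<longleftrightarrow> un2 X (?W b) (fob R b) Z (kt Z b ** mk X h (hm L Z)) = h2 b"
      unfolding h2 using un2_inj[of X "?W b" "fob R b" Z "kt Z b ** mk X h (hm L Z)"] hv b[of b] by auto
     also have "un2 X (?W b) (fob R b) Z (kt Z b ** mk X h (hm L Z)) = (ev L Z ** (mk X h (hm L Z)\<lhd>L)) ** [X]\<rhd>lam b"
      using hv by (subst un2_pre[OF _ hv]) (simp_all add: ku)
     finally show ?thesis by auto
    qed
    show ?thesis
    proof (rule ex1_bij[where f = "\<lambda>h. ev L Z ** (mk X h (hm L Z)\<lhd>L)" and g = "\<lambda>k. raw (cur X L k)"])
     fix h assume "h \<in> Hom V X (hm L Z) \<and> (\<forall>b. ?kap Z b \<cdot> h = \<beta> b)"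
     then have h: "h \<in> Hom V X (hm L Z)" and e: "\<forall>b. ?kap Z b \<cdot> h = \<beta> b" by blast+
     show "ev L Z ** (mk X h (hm L Z)\<lhd>L) \<in> X \<otimes> L \<leadsto> Z \<and> (\<forall>b. h2 b = (ev L Z ** (mk X h (hm L Z)\<lhd>L)) ** [X]\<rhd>lam b)"
      using e eq[OF h] h by simp
     have "cur X L (ev L Z ** (mk X h (hm L Z)\<lhd>L)) = mk X h (hm L Z)"
      by (rule ev_eqI[of L Z]) (use h cur[of "ev L Z ** (mk X h (hm L Z)\<lhd>L)" X L Z] in simp_all)
     then show "raw (cur X L (ev L Z ** (mk X h (hm L Z)\<lhd>L))) = h" by simp
    next
     fix k assume k: "k \<in> X \<otimes> L \<leadsto> Z \<and> (\<forall>b. h2 b = k ** [X]\<rhd>lam b)"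
     note c = cur[of k X L Z]
     have m: "mk X (raw (cur X L k)) (hm L Z) = cur X L k" using c k mk_raw[of "cur X L k"] by auto
     have h: "raw (cur X L k) \<in> Hom V X (hm L Z)" using c k raw_Hom[of "cur X L k"] by auto
     show e: "ev L Z ** (mk X (raw (cur X L k)) (hm L Z)\<lhd>L) = k" unfolding m using c k by simp
     show "raw (cur X L k) \<in> Hom V X (hm L Z) \<and> (\<forall>b. ?kap Z b \<cdot> raw (cur X L k) = \<beta> b)"
      unfolding eq[OF h] e using h k by simp
    qed
   qed
   show ?thesis
   proof
    assume a: "\<forall>Z. vnat_object V (vop V J) VV ?vW (vrep_along V VV R Z) (hm L Z) (?kap Z)"
    show "univ1 Y R L lam"
     unfolding univ1_def
    proof (intro allI impI)
     fix X Z h assume h: "\<forall>b. h b \<in> X \<otimes> (hm (K b) Y \<otimes> fob R b) \<leadsto> Z" and st: "star [X] Y R h"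
     let ?b = "\<lambda>b. raw (cu2 X (?W b) (fob R b) (h b))"
     have m: "mk X (?b b) (hm (?W b) (hm (fob R b) Z)) = cu2 X (?W b) (fob R b) (h b)" for b
      using cu2(1)[OF h[rule_format, of b]] mk_raw[of "cu2 X (?W b) (fob R b) (h b)"] by auto
     have v: "vl (mk X (?b b) (hm (?W b) (hm (fob R b) Z)))" for b
      unfolding m using cu2(1)[OF h[rule_format, of b]] by simp
     have u: "h b = un2 X (?W b) (fob R b) Z (mk X (?b b) (hm (?W b) (hm (fob R b) Z)))" for b
      unfolding m using cu2(2)[OF h[rule_format, of b]] by simp
     have "vnat_family V (vop V J) VV ?vW (vrep_along V VV R Z) X ?b"
      unfolding family_iff[OF R] u[symmetric] using v st by blast
     then show "\<exists>!k. k \<in> X \<otimes> L \<leadsto> Z \<and> (\<forall>b. h b = k ** [X]\<rhd>lam b)"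
      unfolding key[OF v u, symmetric] using a unfolding vnat_object_def by blast
    qed
   next
    assume a: "univ1 Y R L lam"
    show "\<forall>Z. vnat_object V (vop V J) VV ?vW (vrep_along V VV R Z) (hm L Z) (?kap Z)"
     unfolding vnat_object_def
    proof (intro allI conjI impI kf)
     fix Z X \<beta> assume "vnat_family V (vop V J) VV ?vW (vrep_along V VV R Z) X \<beta>"
     then have v: "vl (mk X (\<beta> b) (hm (?W b) (hm (fob R b) Z)))" and st: "star [X] Y R (\<lambda>b. un2 X (?W b) (fob R b) Z (mk X (\<beta> b) (hm (?W b) (hm (fob R b) Z))))" for b
      unfolding family_iff[OF R] by blast+
     show "\<exists>!h. h \<in> Hom V X (hm L Z) \<and> (\<forall>b. ?kap Z b \<cdot> h = \<beta> b)"
      unfolding key[OF v refl]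
     proof (rule a[unfolded univ1_def, rule_format, OF _ st])
      fix b show "un2 X (?W b) (fob R b) Z (mk X (\<beta> b) (hm (?W b) (hm (fob R b) Z))) \<in> X \<otimes> (?W b \<otimes> fob R b) \<leadsto> Z"
       using un2_simps[of "mk X (\<beta> b) (hm (?W b) (hm (fob R b) Z))" X "?W b" "fob R b" Z] v[of b] by simp
     qed
    qed
   qed
  qed
  show ?thesis
   unfolding weighted_colimit_def vself_simps vrep_along_fob lam_def[symmetric] 1 using 2 True by blast
 next
  case False
  have "vnat V (vop V J) VV ?vW (vrep_along V VV R L) cyl \<Longrightarrow> \<forall>b. cyl b \<in> Hom UV (hm (K b) Y) (hm (fob R b) L)"
   unfolding vnat_iff[where C = "vop V J", OF wt(1) wt(2)] by simp
  then show ?thesis using False unfolding weighted_colimit_def by blast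
 qed
qed

text \<open>A parameter context may be merged into a single object, and cocones are determined at
evaluation arrows, so that \<open>colim\<close> has the same content.\<close>

lemma colim_univ1:
 fixes R :: "('j, 'o, 'm) vfun"
 assumes R [simp]: "\<And>a b. vl (fa J VV R a b)"
  and n: "\<And>b. natop [] (K b) Y (fob R b) L (lam b)"
 shows "colim Y (fob R) (Rop R) L lam \<longleftrightarrow> star [] Y R (\<lambda>b. lam b [hm (K b) Y] (ev (K b) Y)) \<and>
  univ1 Y R L (\<lambda>b. lam b [hm (K b) Y] (ev (K b) Y))"
proof -
 let ?W = "\<lambda>b. hm (K b) Y"
 define l where "l b = lam b [?W b] (ev (K b) Y)" for b
 have lt [simp]: "vl (l b)" "dm (l b) = ?W b \<otimes> fob R b" "cd (l b) = L" for b
  unfolding l_def using natop_tys[OF n, of "ev (K b) Y" "[?W b]" b] by simp_all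
 note w [simp] = Wf(1-3)[OF fa_j] and f [simp] = fh_simps[OF R]
 have c: "cocone [] Y (fob R) (Rop R) L lam \<longleftrightarrow> star [] Y R l"
  unfolding cocone_star[OF R n] l_def ..
 have all: "factors Y h U lam \<beta> \<longleftrightarrow> (\<forall>b. \<beta> b [?W b] (ev (K b) Y) = h ** U\<rhd>l b)"
  if nb: "\<And>b. natop U (K b) Y (fob R b) Z (\<beta> b)" and h: "h \<in> U|>L \<leadsto> Z" for U Z \<beta> h
 proof
  assume a: "factors Y h U lam \<beta>"
  then show "\<forall>b. \<beta> b [?W b] (ev (K b) Y) = h ** U\<rhd>l b" unfolding l_def by simp
 next
  assume a: "\<forall>b. \<beta> b [?W b] (ev (K b) Y) = h ** U\<rhd>l b"
  have n': "natop U (K b) Y (fob R b) Z (\<lambda>\<Xi> f. h ** U\<rhd>lam b \<Xi> f)" for b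
  proof (rule natopI)
   fix \<Xi> f assume "vl f" "dm f = \<Xi>|>K b" "cd f = Y"
   then show "h ** U\<rhd>lam b \<Xi> f \<in> U|>\<Xi>|>fob R b \<leadsto> Z"
    using natop_tys[OF n, of f \<Xi> b] h by simp
  next
   fix \<Xi> \<Delta> u f assume u: "ctx \<Xi> \<Delta> u" and a: "\<And>A. vl (u A)" "\<And>A. dm (u A) = \<Xi>|>A" "\<And>A. cd (u A) = \<Delta>|>A" "vl f" "dm f = \<Delta>|>K b" "cd f = Y"
   then show "h ** U\<rhd>lam b \<Xi> (f ** u (K b)) = (h ** U\<rhd>lam b \<Delta> f) ** U\<rhd>u (fob R b)"
    using natop_nat[OF n u, of f b] natop_tys[OF n, of f \<Delta> b] by simp
  qed
  show "factors Y h U lam \<beta>"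
  proof (intro allI impI)
   fix b \<Xi> f assume f: "f \<in> \<Xi>|>K b \<leadsto> Y"
   show "\<beta> b \<Xi> f = h ** U\<rhd>lam b \<Xi> f"
    by (rule natop_eqI[OF nb n' repr_ev _ f]) (use a in \<open>simp add: l_def\<close>)
  qed
 qed
 have mst: "star [mrg U] Y R (\<lambda>b. g b ** mm U (?W b \<otimes> fob R b)) \<longleftrightarrow> star U Y R g"
  if g: "\<And>b. g b \<in> U|>(?W b \<otimes> fob R b) \<leadsto> Z" for U Z g
 proof -
  have e: "(g b ** mm U (?W b \<otimes> fob R b)) ** [mrg U]\<rhd>x = (g a ** mm U (?W a \<otimes> fob R a)) ** [mrg U]\<rhd>y \<longleftrightarrow>
   g b ** U\<rhd>x = g a ** U\<rhd>y" if "vl x" "vl y" "dm x = dm y" "cd x = ?W b \<otimes> fob R b" "cd y = ?W a \<otimes> fob R a" for a b x y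
  proof
   assume "(g b ** mm U (?W b \<otimes> fob R b)) ** [mrg U]\<rhd>x = (g a ** mm U (?W a \<otimes> fob R a)) ** [mrg U]\<rhd>y"
   then have e: "(g b ** U\<rhd>x) ** mm U (dm x) = (g a ** U\<rhd>y) ** mm U (dm x)"
    using that by simp
   show "g b ** U\<rhd>x = g a ** U\<rhd>y"
    by (rule iso_epi[OF e mm_inv(1)]) (use g[of a] g[of b] that in simp_all)
  next
   assume "g b ** U\<rhd>x = g a ** U\<rhd>y"
   from arg_cong[OF this, of "\<lambda>z. z ** mm U (dm x)"]
   show "(g b ** mm U (?W b \<otimes> fob R b)) ** [mrg U]\<rhd>x = (g a ** mm U (?W a \<otimes> fob R a)) ** [mrg U]\<rhd>y"
    using that by simp
  qed
  show ?thesis unfolding star_def by (intro iff_allI e) simp_all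
 qed
 have u: "(\<forall>U Z \<beta>. cocone U Y (fob R) (Rop R) Z \<beta> \<longrightarrow>
   (\<exists>!h. h \<in> U|>L \<leadsto> Z \<and> factors Y h U lam \<beta>)) \<longleftrightarrow> univ1 Y R L l"
 proof
  assume a: "\<forall>U Z \<beta>. cocone U Y (fob R) (Rop R) Z \<beta> \<longrightarrow>
   (\<exists>!h. h \<in> U|>L \<leadsto> Z \<and> factors Y h U lam \<beta>)"
  show "univ1 Y R L l"
   unfolding univ1_def
  proof (intro allI impI)
   fix X Z g assume g: "\<forall>b. g b \<in> X \<otimes> (?W b \<otimes> fob R b) \<leadsto> Z" and s: "star [X] Y R g"
   define \<beta> where "\<beta> b = natof (?W b) (K b) (ev (K b) Y) [X] (fob R b) (g b)" for b
   have b: "natop [X] (K b) Y (fob R b) Z (\<beta> b)" "\<beta> b [?W b] (ev (K b) Y) = g b" for b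
    unfolding \<beta>_def using natof[OF repr_ev, of "g b" "[X]"] g by simp_all
   have "cocone [X] Y (fob R) (Rop R) Z \<beta>" unfolding cocone_star[OF R b(1)] b(2) by (rule s)
   with a have "\<exists>!h. h \<in> [X]|>L \<leadsto> Z \<and> factors Y h [X] lam \<beta>" by blast
   moreover have "(h \<in> [X]|>L \<leadsto> Z \<and> factors Y h [X] lam \<beta>) \<longleftrightarrow>
     (h \<in> X \<otimes> L \<leadsto> Z \<and> (\<forall>b. g b = h ** [X]\<rhd>l b))" for h
    using all[OF b(1), of h] b(2) by auto
   ultimately show "\<exists>!h. h \<in> X \<otimes> L \<leadsto> Z \<and> (\<forall>b. g b = h ** [X]\<rhd>l b)" by simp
  qed
 next
  assume a: "univ1 Y R L l"
  show "\<forall>U Z \<beta>. cocone U Y (fob R) (Rop R) Z \<beta> \<longrightarrow>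
   (\<exists>!h. h \<in> U|>L \<leadsto> Z \<and> factors Y h U lam \<beta>)"
  proof (intro allI impI)
   fix U Z \<beta> assume co: "cocone U Y (fob R) (Rop R) Z \<beta>"
   then have nb: "natop U (K b) Y (fob R b) Z (\<beta> b)" for b unfolding cocone_def by blast
   define g where "g b = \<beta> b [?W b] (ev (K b) Y)" for b
   have g [simp]: "vl (g b)" "dm (g b) = U|>(?W b \<otimes> fob R b)" "cd (g b) = Z" for b
    unfolding g_def using natop_tys[OF nb, of "ev (K b) Y" "[?W b]" b] by simp_all
   have "star U Y R g" using co unfolding cocone_star[OF R nb] g_def .
   then have "star [mrg U] Y R (\<lambda>b. g b ** mm U (?W b \<otimes> fob R b))" using mst[of g U Z] by simp
   then have "\<exists>!k. k \<in> mrg U \<otimes> L \<leadsto> Z \<and> (\<forall>b. g b ** mm U (?W b \<otimes> fob R b) = k ** [mrg U]\<rhd>l b)"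
    using a unfolding univ1_def by simp
   moreover have "(\<exists>!k. k \<in> mrg U \<otimes> L \<leadsto> Z \<and> (\<forall>b. g b ** mm U (?W b \<otimes> fob R b) = k ** [mrg U]\<rhd>l b)) \<longleftrightarrow>
     (\<exists>!h. h \<in> U|>L \<leadsto> Z \<and> factors Y h U lam \<beta>)"
   proof (rule ex1_bij[where f = "\<lambda>k. k ** mmi U L" and g = "\<lambda>h. h ** mm U L"])
    fix k assume k: "k \<in> mrg U \<otimes> L \<leadsto> Z \<and> (\<forall>b. g b ** mm U (?W b \<otimes> fob R b) = k ** [mrg U]\<rhd>l b)"
    have "g b = (k ** mmi U L) ** U\<rhd>l b" for b
    proof (rule iso_epi[OF _ mm_inv(1)])
     show "g b ** mm U (?W b \<otimes> fob R b) = ((k ** mmi U L) ** U\<rhd>l b) ** mm U (?W b \<otimes> fob R b)"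
      using k mm_nat[of "l b" L U, symmetric] by (simp del: mm_nat)
    qed (use k in simp_all)
    then show "k ** mmi U L \<in> U|>L \<leadsto> Z \<and> factors Y (k ** mmi U L) U lam \<beta>"
     using all[OF nb, of "k ** mmi U L"] k unfolding g_def by simp
    show "(k ** mmi U L) ** mm U L = k" using k by simp
   next
    fix h assume h: "h \<in> U|>L \<leadsto> Z \<and> factors Y h U lam \<beta>"
    then have "g b = h ** U\<rhd>l b" for b using all[OF nb, of h] unfolding g_def by blast
    then show "h ** mm U L \<in> mrg U \<otimes> L \<leadsto> Z \<and> (\<forall>b. g b ** mm U (?W b \<otimes> fob R b) = (h ** mm U L) ** [mrg U]\<rhd>l b)"
     using h by simp
    show "(h ** mm U L) ** mmi U L = h" using h by simp
   qed
   ultimately show "\<exists>!h. h \<in> U|>L \<leadsto> Z \<and> factors Y h U lam \<beta>"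
    by simp
  qed
 qed
 show ?thesis unfolding colim_def c u l_def ..
qed

text \<open>The link between the definition by ends and the universal property for cocones.\<close>

lemma wcolim_iff:
 fixes R :: "('j, 'o, 'm) vfun"
 assumes R: "\<And>a b. vl (fa J VV R a b)"
  and n: "\<And>b. natop [] (K b) Y (fob R b) L (lam b)"
  and c: "\<And>b. cyl b \<in> Hom UV (hm (K b) Y) (hm (fob R b) L)"
  and l: "\<And>b. lam b [hm (K b) Y] (ev (K b) Y) = ev (fob R b) L ** (una (cyl b)\<lhd>(fob R b))"
 shows "weighted_colimit V J VV (vrep_along V VV j Y) R L cyl \<longleftrightarrow> colim Y (fob R) (Rop R) L lam"
 unfolding weighted_colimit_univ1[OF R] colim_univ1[OF R n] l using c by blast

end

section \<open>Flatness of the weights\<close>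

context smclosed
begin

primrec asli :: "'o list \<Rightarrow> 'o \<Rightarrow> 'o \<Rightarrow> ('o, 'm) tarr" where
 "asli [] P A = idt (P \<otimes> A)"
| "asli (X # \<Xi>) P A = [X]\<rhd>asli \<Xi> P A ** alp X (\<Xi>|>P) A"

lemma asli_simps [simp]: "vl (asli \<Xi> P A)" "cd (asli \<Xi> P A) = \<Xi>|>(P \<otimes> A)" "dm (asli \<Xi> P A) = (\<Xi>|>P) \<otimes> A"
 by (induction \<Xi>) simp_all

lemma asli_inv [simp]: "asli \<Xi> P A ** asl \<Xi> P A = idt (\<Xi>|>(P \<otimes> A))" "asl \<Xi> P A ** asli \<Xi> P A = idt ((\<Xi>|>P) \<otimes> A)"
proof (induction \<Xi>)
 case (Cons X \<Xi>)
 { case 1 then show ?case using Cons(1) by (simp add: wa_inv) }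
 { case 2 then show ?case using Cons(2) by (simp add: wa_inv_re) }
qed simp_all

text \<open>Currying in a context: arrows \<open>\<Xi>|>(P \<otimes> A) \<rightarrow> Z\<close>
become arrows \<open>\<Xi>|>P \<rightarrow> [A, Z]\<close>.\<close>

definition curl :: "'o list \<Rightarrow> 'o \<Rightarrow> 'o \<Rightarrow> ('o, 'm) tarr \<Rightarrow> ('o, 'm) tarr" where
 "curl \<Xi> P A h = cur (\<Xi>|>P) A (h ** asli \<Xi> P A)"

lemma curl:
 assumes "vl h" "dm h = \<Xi>|>(P \<otimes> A)" "cd h = Z"
 shows "vl (curl \<Xi> P A h)" "dm (curl \<Xi> P A h) = \<Xi>|>P" "cd (curl \<Xi> P A h) = hm A Z"
  "ev A Z ** rw \<Xi> P (curl \<Xi> P A h) A = h"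
 using cur[of "h ** asli \<Xi> P A" "\<Xi>|>P" A Z] cur(4)[of "h ** asli \<Xi> P A" "\<Xi>|>P" A Z, THEN cmp_re, of "asl \<Xi> P A"] assms
 unfolding curl_def rw_def by simp_all

lemma rw_eqI:
 assumes e: "ev A Z ** rw \<Xi> P h A = ev A Z ** rw \<Xi> P h' A"
  and t: "vl h" "dm h = \<Xi>|>P" "cd h = hm A Z" "vl h'" "dm h' = \<Xi>|>P" "cd h' = hm A Z"
 shows "h = h'"
proof (rule ev_eqI)
 have "(ev A Z ** (h\<lhd>A)) ** asl \<Xi> P A = (ev A Z ** (h'\<lhd>A)) ** asl \<Xi> P A" using e unfolding rw_def by simp
 then show "ev A Z ** (h\<lhd>A) = ev A Z ** (h'\<lhd>A)"
  by (rule iso_epi[OF _ asli_inv(2)]) (use t in simp_all)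
qed (use t in simp_all)

lemma ctx_one_eq:
 assumes "ctx \<Xi> [H] u" "ctx \<Xi> [H] u'" "u \<one> = u' \<one>"
 shows "u = u'"
proof -
 obtain v where v: "v \<in> mrg \<Xi> \<leadsto> H" "u = (\<lambda>A. (v\<lhd>A) ** mmi \<Xi> A)" by (rule ctx_singleE[OF assms(1)])
 obtain v' where v': "v' \<in> mrg \<Xi> \<leadsto> H" "u' = (\<lambda>A. (v'\<lhd>A) ** mmi \<Xi> A)" by (rule ctx_singleE[OF assms(2)])
 have "(v\<lhd>\<one>) ** mmi \<Xi> \<one> = (v'\<lhd>\<one>) ** mmi \<Xi> \<one>" using assms(3) v v' by simp
 then have "v\<lhd>\<one> = v'\<lhd>\<one>"
  by (rule iso_epi[OF _ mm_inv(2)]) (use v v' in simp_all)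
 then have "v = v'" by (rule tns_one_inject) (use v v' in simp_all)
 then show ?thesis using v v' by simp
qed

lemma ctx_rw_eq:
 assumes u: "ctx (\<Xi> @ [P]) [H] u" and h: "vl h" "dm h = \<Xi>|>P" "cd h = H"
  and e: "ru H ** u \<one> = h ** \<Xi>\<rhd>ru P"
 shows "u = rw \<Xi> P h"
proof (rule ctx_one_eq[OF u ctx_rw])
 have "ru H ** u \<one> = ru H ** rw \<Xi> P h \<one>" using e rw_ru[OF h] by simp
 then show "u \<one> = rw \<Xi> P h \<one>"
  by (rule iso_mono[of "ru H" _ _ "rui H"]) (use ctx_ty[OF u, of \<one>] h in simp_all)
qed (use h in simp)

lemma rw_ctx:
 assumes v: "ctx \<Xi> \<Delta> v" and k: "vl k" "dm k = \<Delta>|>P"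
 shows "rw \<Xi> P (k ** v P) A = rw \<Delta> P k A ** v (P \<otimes> A)"
proof -
 have "ctx (\<Xi> @ [P]) [cd k] (\<lambda>A. rw \<Delta> P k A ** v ([P]|>A))"
  using ctx_comp[OF ctx_right[OF v] ctx_rw, of k P "cd k"] k by simp
 then have "(\<lambda>A. rw \<Delta> P k A ** v ([P]|>A)) = rw \<Xi> P (k ** v P)"
  by (rule ctx_rw_eq) (use ctx_ty[OF v] k ctx_nat[OF v, of "ru P"] rw_ru[of k \<Delta> P, THEN cmp_re] in simp_all)
 from fun_cong[OF this, of A] show ?thesis by simp
qed

lemma rw_rw:
 assumes h: "vl h" "dm h = U|>Q" and k: "vl k" "dm k = \<Xi>|>P" "cd k = Q"
 shows "rw (U @ \<Xi>) P (h ** U\<rhd>k) A = rw U Q h A ** U\<rhd>rw \<Xi> P k A"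
proof -
 have "ctx ((U @ \<Xi>) @ [P]) [cd h] (\<lambda>A. rw U Q h A ** U\<rhd>rw \<Xi> P k A)"
  using ctx_comp[OF ctx_left[OF ctx_rw, of k \<Xi> P Q U] ctx_rw, of h "cd h"] h k by simp
 moreover have "ru (cd h) ** (rw U Q h \<one> ** U\<rhd>rw \<Xi> P k \<one>) = (h ** U\<rhd>k) ** (U @ \<Xi>)\<rhd>ru P"
 proof -
  have "ru (cd h) ** (rw U Q h \<one> ** U\<rhd>rw \<Xi> P k \<one>) = h ** U\<rhd>(ru Q ** rw \<Xi> P k \<one>)"
   using rw_ru[of h U Q, THEN cmp_re] h k by simp
  also have "\<dots> = (h ** U\<rhd>k) ** (U @ \<Xi>)\<rhd>ru P"
   unfolding rw_ru[OF k] using h k by simp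
  finally show ?thesis .
 qed
 ultimately have "(\<lambda>A. rw U Q h A ** U\<rhd>rw \<Xi> P k A) = rw (U @ \<Xi>) P (h ** U\<rhd>k)"
  by (intro ctx_rw_eq) (use h k in simp_all)
 from fun_cong[OF this, of A] show ?thesis by simp
qed

lemma rw_one: "\<lbrakk>vl h; dm h = X \<otimes> P\<rbrakk> \<Longrightarrow> rw [X] P h A = (h\<lhd>A) ** alpi X P A"
 by (simp add: rw_def)

lemma natop_rw:
 assumes n: "natop [] A B P (hm C D) \<phi>"
 shows "natop [] A B (P \<otimes> C) D (\<lambda>\<Xi> f. ev C D ** rw \<Xi> P (\<phi> \<Xi> f) C)"
proof (rule natopI)
 fix \<Xi> f assume f: "vl f" "dm f = \<Xi>|>A" "cd f = B"
 note t = natop_tys[OF n f]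
 show "ev C D ** rw \<Xi> P (\<phi> \<Xi> f) C \<in> []|>\<Xi>|>(P \<otimes> C) \<leadsto> D" using t by simp
next
 fix \<Xi> \<Delta> u f assume u: "ctx \<Xi> \<Delta> u" and a: "\<And>A. vl (u A)" "\<And>A. dm (u A) = \<Xi>|>A" "\<And>A. cd (u A) = \<Delta>|>A" "vl f" "dm f = \<Delta>|>A" "cd f = B"
 note t = natop_tys[OF n a(4-6)]
 show "ev C D ** rw \<Xi> P (\<phi> \<Xi> (f ** u A)) C = (ev C D ** rw \<Delta> P (\<phi> \<Delta> f) C) ** []\<rhd>u (P \<otimes> C)"
  using natop_nat[OF n u a(4-6)] rw_ctx[OF u, of "\<phi> \<Delta> f" P C] t by simp
qed

lemma natop_postpre:
 assumes n: "natop U A B A' B' \<phi>" and h: "vl h" "dm h = B'" "cd h = B''" and k: "vl k" "dm k = A''" "cd k = A'"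
 shows "natop U A B A'' B'' (\<lambda>\<Xi> f. h ** \<phi> \<Xi> f ** U\<rhd>\<Xi>\<rhd>k)"
proof (rule natopI)
 fix \<Xi> f assume f: "vl f" "dm f = \<Xi>|>A" "cd f = B"
 show "h ** \<phi> \<Xi> f ** U\<rhd>\<Xi>\<rhd>k \<in> U|>\<Xi>|>A'' \<leadsto> B''" using natop_tys[OF n f] h k by simp
next
 fix \<Xi> \<Delta> u f assume u: "ctx \<Xi> \<Delta> u" and a: "\<And>A. vl (u A)" "\<And>A. dm (u A) = \<Xi>|>A" "\<And>A. cd (u A) = \<Delta>|>A" "vl f" "dm f = \<Delta>|>A" "cd f = B"
 have "u A' ** \<Xi>\<rhd>k = \<Delta>\<rhd>k ** u A''" by (rule ctx_nat[OF u k])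
 then have "U\<rhd>u A' ** U\<rhd>\<Xi>\<rhd>k = U\<rhd>(\<Delta>\<rhd>k ** u A'')"
  using a k wa_cmp[of "u A'" "\<Xi>\<rhd>k" U] by simp
 then show "h ** \<phi> \<Xi> (f ** u A) ** U\<rhd>\<Xi>\<rhd>k = (h ** \<phi> \<Delta> f ** U\<rhd>\<Delta>\<rhd>k) ** U\<rhd>u A''"
  using natop_nat[OF n u a(4-6)] a k by simp
qed

end

context arity
begin

lemma jfunD:
 assumes "jfun R Rm"
 shows "natop [] (K a) (K b) (R a) (R b) (Rm a b)"
  "\<lbrakk>vl f; dm f = \<Xi>|>K a; cd f = K b\<rbrakk> \<Longrightarrow> vl (Rm a b \<Xi> f)"
  "\<lbrakk>vl f; dm f = \<Xi>|>K a; cd f = K b\<rbrakk> \<Longrightarrow> dm (Rm a b \<Xi> f) = \<Xi>|>R a"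
  "\<lbrakk>vl f; dm f = \<Xi>|>K a; cd f = K b\<rbrakk> \<Longrightarrow> cd (Rm a b \<Xi> f) = R b"
  "Rm a a [] (idt (K a)) = idt (R a)"
  "\<lbrakk>vl f; dm f = \<Xi>|>K a; cd f = K b; vl g; dm g = \<Delta>|>K b; cd g = K d\<rbrakk> \<Longrightarrow>
    Rm a d (\<Delta> @ \<Xi>) (g ** \<Delta>\<rhd>f) = Rm b d \<Delta> g ** \<Delta>\<rhd>Rm a b \<Xi> f"
proof -
 show n: "natop [] (K a) (K b) (R a) (R b) (Rm a b)" using assms unfolding jfun_def by blast
 show "Rm a a [] (idt (K a)) = idt (R a)" using assms unfolding jfun_def by blast
 { assume f: "vl f" "dm f = \<Xi>|>K a" "cd f = K b"
  show "vl (Rm a b \<Xi> f)" "dm (Rm a b \<Xi> f) = \<Xi>|>R a" "cd (Rm a b \<Xi> f) = R b"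
   using natop_tys[OF n f] by simp_all
  assume g: "vl g" "dm g = \<Delta>|>K b" "cd g = K d"
  show "Rm a d (\<Delta> @ \<Xi>) (g ** \<Delta>\<rhd>f) = Rm b d \<Delta> g ** \<Delta>\<rhd>Rm a b \<Xi> f"
   using assms f g unfolding jfun_def by simp }
qed

lemma coconeD:
 assumes "cocone U Y R Rm Z \<beta>"
 shows "natop U (K b) Y (R b) Z (\<beta> b)"
  "\<lbrakk>vl f; dm f = \<Xi>|>K b; cd f = Y\<rbrakk> \<Longrightarrow> vl (\<beta> b \<Xi> f)"
  "\<lbrakk>vl f; dm f = \<Xi>|>K b; cd f = Y\<rbrakk> \<Longrightarrow> dm (\<beta> b \<Xi> f) = U|>\<Xi>|>R b"
  "\<lbrakk>vl f; dm f = \<Xi>|>K b; cd f = Y\<rbrakk> \<Longrightarrow> cd (\<beta> b \<Xi> f) = Z"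
  "\<lbrakk>vl f; dm f = \<Xi>|>K b; cd f = K a; vl g; dm g = \<Delta>|>K a; cd g = Y\<rbrakk> \<Longrightarrow>
   \<beta> b (\<Delta> @ \<Xi>) (g ** \<Delta>\<rhd>f) = \<beta> a \<Delta> g ** U\<rhd>\<Delta>\<rhd>Rm b a \<Xi> f"
proof -
 show n: "natop U (K b) Y (R b) Z (\<beta> b)" for b using assms unfolding cocone_def by blast
 { assume f: "vl f" "dm f = \<Xi>|>K b" "cd f = Y"
  show "vl (\<beta> b \<Xi> f)" "dm (\<beta> b \<Xi> f) = U|>\<Xi>|>R b" "cd (\<beta> b \<Xi> f) = Z"
   using natop_tys[OF n f] by simp_all }
 { assume f: "vl f" "dm f = \<Xi>|>K b" "cd f = K a" and g: "vl g" "dm g = \<Delta>|>K a" "cd g = Y"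
  show "\<beta> b (\<Delta> @ \<Xi>) (g ** \<Delta>\<rhd>f) = \<beta> a \<Delta> g ** U\<rhd>\<Delta>\<rhd>Rm b a \<Xi> f"
   using assms f g unfolding cocone_def by simp }
qed

lemma coconeI:
 assumes "\<And>b. natop U (K b) Y (R b) Z (\<beta> b)"
  "\<And>a b \<Xi> \<Delta> f g. \<lbrakk>vl f; dm f = \<Xi>|>K b; cd f = K a; vl g; dm g = \<Delta>|>K a; cd g = Y\<rbrakk> \<Longrightarrow>
   \<beta> b (\<Delta> @ \<Xi>) (g ** \<Delta>\<rhd>f) = \<beta> a \<Delta> g ** U\<rhd>\<Delta>\<rhd>Rm b a \<Xi> f"
 shows "cocone U Y R Rm Z \<beta>"
 using assms unfolding cocone_def by simp

lemma colimD: "colim Y R Rm L lam \<Longrightarrow> cocone [] Y R Rm L lam"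
 by (simp add: colim_def)

lemma colim_ex:
 assumes "colim Y R Rm L lam" "cocone U Y R Rm Z \<beta>"
 shows "\<exists>h. vl h \<and> dm h = U|>L \<and> cd h = Z \<and> (\<forall>b \<Xi> f. vl f \<longrightarrow> dm f = \<Xi>|>K b \<longrightarrow> cd f = Y \<longrightarrow> \<beta> b \<Xi> f = h ** U\<rhd>lam b \<Xi> f)"
 using assms unfolding colim_def by (metis Ar_iff)

lemma cocone_post:
 assumes c: "cocone [] Y R Rm L lam" and R: "jfun R Rm" and h: "vl h" "dm h = U|>L" "cd h = Z"
 shows "cocone U Y R Rm Z (\<lambda>b \<Xi> f. h ** U\<rhd>lam b \<Xi> f)"
proof (rule coconeI)
 note [simp] = coconeD(2-4)[OF c] jfunD(2-4)[OF R]
 show "natop U (K b) Y (R b) Z (\<lambda>\<Xi> f. h ** U\<rhd>lam b \<Xi> f)" for b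
  by (rule natopI) (use h natop_nat[OF coconeD(1)[OF c]] in simp_all)
 show "h ** U\<rhd>lam b (\<Delta> @ \<Xi>) (g ** \<Delta>\<rhd>f) = (h ** U\<rhd>lam a \<Delta> g) ** U\<rhd>\<Delta>\<rhd>Rm b a \<Xi> f"
  if "vl f" "dm f = \<Xi>|>K b" "cd f = K a" "vl g" "dm g = \<Delta>|>K a" "cd g = Y" for a b \<Xi> \<Delta> f g
  using that coconeD(5)[OF c that] h by simp
qed

lemma colim_eq:
 assumes c: "colim Y R Rm L lam" and R: "jfun R Rm"
  and h: "vl h" "dm h = U|>L" "cd h = Z" "vl h'" "dm h' = U|>L" "cd h' = Z"
  and e: "\<And>b \<Xi> f. \<lbrakk>vl f; dm f = \<Xi>|>K b; cd f = Y\<rbrakk> \<Longrightarrow> h ** U\<rhd>lam b \<Xi> f = h' ** U\<rhd>lam b \<Xi> f"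
 shows "h = h'"
proof -
 have "\<exists>!k. k \<in> U|>L \<leadsto> Z \<and> (\<forall>b \<Xi> f. f \<in> \<Xi>|>K b \<leadsto> Y \<longrightarrow> h ** U\<rhd>lam b \<Xi> f = k ** U\<rhd>lam b \<Xi> f)"
  using c cocone_post[OF colimD[OF c] R h(1-3)] unfolding colim_def by blast
 moreover have "h \<in> U|>L \<leadsto> Z \<and> (\<forall>b \<Xi> f. f \<in> \<Xi>|>K b \<leadsto> Y \<longrightarrow> h ** U\<rhd>lam b \<Xi> f = h ** U\<rhd>lam b \<Xi> f)" using h by simp
 moreover have "h' \<in> U|>L \<leadsto> Z \<and> (\<forall>b \<Xi> f. f \<in> \<Xi>|>K b \<leadsto> Y \<longrightarrow> h ** U\<rhd>lam b \<Xi> f = h' ** U\<rhd>lam b \<Xi> f)" using h e by simp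
 ultimately show ?thesis by blast
qed

lemma colim_cong:
 assumes "\<And>a b \<Xi> f. \<lbrakk>vl f; dm f = \<Xi>|>K a; cd f = K b\<rbrakk> \<Longrightarrow> Rm a b \<Xi> f = Rm' a b \<Xi> f"
 shows "colim Y R Rm L lam \<longleftrightarrow> colim Y R Rm' L lam"
proof -
 have "cocone U Y R Rm Z \<beta> \<longleftrightarrow> cocone U Y R Rm' Z \<beta>" for U Z \<beta>
  unfolding cocone_def using assms by simp
 then show ?thesis unfolding colim_def by simp
qed

text \<open>Every functor in operational form comes from an enriched functor.\<close>

definition Rv :: "('j \<Rightarrow> 'o) \<Rightarrow> ('j \<Rightarrow> 'j \<Rightarrow> ('o, 'm) oper) \<Rightarrow> ('j, 'o, 'm) vfun" where
 "Rv S Sm = \<lparr>fob = S, fmap = (\<lambda>a b. raw (cur (vhom J a b) (S a) (Sm a b [vhom J a b] (eJ a b))))\<rparr>"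

lemma Rv:
 assumes "jfun S Sm"
 shows "vl (fa J VV (Rv S Sm) a b)" "fob (Rv S Sm) = S" "fh J (Rv S Sm) a b = Sm a b [vhom J a b] (eJ a b)"
  "\<lbrakk>vl f; dm f = \<Xi>|>K a; cd f = K b\<rbrakk> \<Longrightarrow> Rop (Rv S Sm) a b \<Xi> f = Sm a b \<Xi> f"
  "vfunctor V J VV (Rv S Sm)"
proof -
 show o: "fob (Rv S Sm) = S" by (simp add: Rv_def)
 have c: "vl (Sm a b [vhom J a b] (eJ a b))" "dm (Sm a b [vhom J a b] (eJ a b)) = vhom J a b \<otimes> S a" "cd (Sm a b [vhom J a b] (eJ a b)) = S b" for a b
  using jfunD(2-4)[OF assms, of "eJ a b" "[vhom J a b]" a b] by simp_all
 have e: "fa J VV (Rv S Sm) a b = cur (vhom J a b) (S a) (Sm a b [vhom J a b] (eJ a b))" for a b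
  using c[of a b] by (simp add: fa_def Rv_def cur_def)
 show v: "vl (fa J VV (Rv S Sm) a b)" for a b unfolding e by (rule cur(1)[OF c])
 show f: "fh J (Rv S Sm) a b = Sm a b [vhom J a b] (eJ a b)" for a b
  unfolding fh_def o e by (rule cur(4)[OF c])
 show r: "Rop (Rv S Sm) a b \<Xi> f = Sm a b \<Xi> f" if "vl f" "dm f = \<Xi>|>K a" "cd f = K b" for a b \<Xi> f
  by (rule natop_eqI[OF Rop(1)[OF v, unfolded o] jfunD(1)[OF assms] repr_eJ]) (use that Rop(2)[OF v] f in simp_all)
 have "jfun S (Rop (Rv S Sm))"
  unfolding jfun_def
  using Rop(1)[OF v, unfolded o] jfunD(5,6)[OF assms] jfunD(2-4)[OF assms] by (simp add: r)
 then show "vfunctor V J VV (Rv S Sm)" unfolding jfun_Rop o using v by blast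
qed

end

locale earity = arity V J j for V :: "('o, 'm) smcc" (structure) and J :: "('j, 'o, 'm) smvcat" and j :: "('j, 'o, 'm) smvfun" +
 assumes el: "eleutheric V J j"
begin

lemma colim_exists:
 assumes S: "jfun S Sm"
 shows "\<exists>L lam. colim Y S Sm L lam"
proof -
 note R = Rv[OF S]
 obtain L cyl where w: "weighted_colimit V J VV (vrep_along V VV j Y) (Rv S Sm) L cyl"
  using el R(5) unfolding eleutheric_def by blast
 then have c: "cyl b \<in> Hom UV (hm (K b) Y) (hm (S b) L)" for b
  using weighted_colimit_univ1[OF R(1), of Y L cyl] unfolding R(2) by blast
 define lam where "lam b = natof (hm (K b) Y) (K b) (ev (K b) Y) [] (S b) (ev (S b) L ** (una (cyl b)\<lhd>(S b)))" for b
 have l: "natop [] (K b) Y (S b) L (lam b)" "lam b [hm (K b) Y] (ev (K b) Y) = ev (S b) L ** (una (cyl b)\<lhd>(S b))" for b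
  unfolding lam_def using natof[OF repr_ev, of "ev (S b) L ** (una (cyl b)\<lhd>(S b))" "[]" "K b" Y "S b" L] una_ty[OF c[of b]] by simp_all
 have "colim Y S (Rop (Rv S Sm)) L lam"
  using w wcolim_iff[OF R(1), of Y L lam cyl] l c R(2) by simp
 then show ?thesis using colim_cong[of "Rop (Rv S Sm)" Sm Y S L lam] R(4) by blast
qed

text \<open>Flatness of the weight \<open>V(j-, Y)\<close>: the functor \<open>V(K x, -)\<close>
preserves the colimit. The last two clauses identify the cocone and the functor so obtained as
postcomposition, read through evaluation.\<close>

lemma colim_flat:
 assumes S: "jfun S Sm" and c: "colim Y S Sm L lam"
 shows "\<exists>Rm' lam'. jfun (\<lambda>b. hm (K x) (S b)) Rm' \<and> colim Y (\<lambda>b. hm (K x) (S b)) Rm' (hm (K x) L) lam' \<and>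
  (\<forall>b \<Xi> g. vl g \<longrightarrow> dm g = \<Xi>|>K b \<longrightarrow> cd g = Y \<longrightarrow>
    ev (K x) L ** rw \<Xi> (hm (K x) (S b)) (lam' b \<Xi> g) (K x) = lam b \<Xi> g ** \<Xi>\<rhd>ev (K x) (S b)) \<and>
  (\<forall>a b \<Xi> k. vl k \<longrightarrow> dm k = \<Xi>|>K a \<longrightarrow> cd k = K b \<longrightarrow>
    ev (K x) (S b) ** rw \<Xi> (hm (K x) (S a)) (Rm' a b \<Xi> k) (K x) = Sm a b \<Xi> k ** \<Xi>\<rhd>ev (K x) (S a))"
proof -
 note R = Rv[OF S]
 note n = coconeD(1)[OF colimD[OF c]] and lt [simp] = coconeD(2-4)[OF colimD[OF c]] and st [simp] = jfunD(2-4)[OF S]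
 let ?W = "\<lambda>b. hm (K b) Y" and ?P = "\<lambda>b. hm (K x) (S b)"
 let ?l = "\<lambda>b. lam b [?W b] (ev (K b) Y)"
 define p where "p b = cur (?W b) (S b) (?l b)" for b
 have p [simp]: "vl (p b)" "dm (p b) = ?W b" "cd (p b) = hm (S b) L" and pe: "ev (S b) L ** (p b\<lhd>(S b)) = ?l b" for b
  unfolding p_def by (intro cur; simp)+
 define cyl where "cyl b = uar (p b)" for b
 have cy: "cyl b \<in> Hom UV (?W b) (hm (S b) L)" "una (cyl b) = p b" for b
  unfolding cyl_def using uar_ty[of "p b"] una_uar[of "p b"] by simp_all
 have w: "weighted_colimit V J VV (vrep_along V VV j Y) (Rv S Sm) L cyl"
  using wcolim_iff[OF R(1), of Y L lam cyl] n cy pe R(2) c colim_cong[of "Rop (Rv S Sm)" Sm Y S L lam] R(4) by simp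
 let ?F = "vrep V VV (K x)"
 let ?R' = "vfun_comp V ?F (Rv S Sm)"
 let ?cyl' = "image_cylinder V VV VV ?F (Rv S Sm) L cyl"
 have fF [simp]: "vl (fa VV VV ?F a b)" for a b by (rule vl_fa_vrep) simp
 have R'v: "vl (fa J VV ?R' a b)" for a b
  using R(1)[of a b] by (simp add: fa_comp[where D = "VV"])
 have R'f: "vfunctor V J VV ?R'"
  by (rule vfunctor_comp[OF R(5) vfunctor_vrep[OF vcat_vself] vcat_J vcat_vself vcat_vself])
 have R'o: "fob ?R' = ?P" by (simp add: R(2))
 have w': "weighted_colimit V J VV (vrep_along V VV j Y) ?R' (hm (K x) L) ?cyl'"
 proof -
  have "preserves_weighted_colimits V J VV VV (vrep_along V VV j Y) ?F"
   using el unfolding eleutheric_def J_flat_def by blast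
  then show ?thesis using w R(5) unfolding preserves_weighted_colimits_def by simp
 qed
 have u: "uname V (hm (S b) L) (hm (?P b) (hm (K x) L)) (fmap ?F (S b) L) = uar (fa VV VV ?F (S b) L)" for b
  by (simp add: uar_def)
 have ut: "uar (fa VV VV ?F (S b) L) \<in> Hom UV (hm (S b) L) (hm (?P b) (hm (K x) L))"
  "una (uar (fa VV VV ?F (S b) L)) = fa VV VV ?F (S b) L" for b
  using uar_ty[of "fa VV VV ?F (S b) L"] una_uar[of "fa VV VV ?F (S b) L"] by simp_all
 have cyl'e: "?cyl' b = uar (fa VV VV ?F (S b) L) \<cdot>\<^bsub>UV\<^esub> cyl b" for b
  unfolding image_cylinder_def vrep_fob vself_simps R(2) u ..
 have cy': "?cyl' b \<in> Hom UV (?W b) (hm (?P b) (hm (K x) L))" "una (?cyl' b) = fa VV VV ?F (S b) L ** p b" for b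
  unfolding cyl'e using UV_Comp[OF ut(1) cy(1)] by (simp_all add: ut cy)
 have ce: "ev (?P b) (hm (K x) L) ** (una (?cyl' b)\<lhd>(?P b)) = cc VV (K x) (S b) L ** (p b\<lhd>(?P b))" for b
 proof -
  have "ev (?P b) (hm (K x) L) ** (fa VV VV ?F (S b) L\<lhd>(?P b)) = cc VV (K x) (S b) L"
   using fh_vrep[of "VV" "K x" "S b" L] by (simp add: fh_def)
  from this[THEN cmp_re, of "p b\<lhd>(?P b)"] show ?thesis unfolding cy'(2) by simp
 qed
 define lam' where "lam' b = natof (?W b) (K b) (ev (K b) Y) [] (?P b) (cc VV (K x) (S b) L ** (p b\<lhd>(?P b)))" for b
 have l': "natop [] (K b) Y (?P b) (hm (K x) L) (lam' b)" "lam' b [?W b] (ev (K b) Y) = cc VV (K x) (S b) L ** (p b\<lhd>(?P b))" for b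
  unfolding lam'_def using natof[OF repr_ev, of "cc VV (K x) (S b) L ** (p b\<lhd>(?P b))" "[]" "K b" Y "?P b" "hm (K x) L"] by simp_all
 have 1: "colim Y ?P (Rop ?R') (hm (K x) L) lam'"
  using w' wcolim_iff[OF R'v, of Y "hm (K x) L" lam' ?cyl', unfolded R'o] l' cy'(1) ce by simp
 have 2: "jfun ?P (Rop ?R')" using R'f unfolding jfun_Rop R'o by blast
 have 3: "ev (K x) L ** rw \<Xi> (?P b) (lam' b \<Xi> g) (K x) = lam b \<Xi> g ** \<Xi>\<rhd>ev (K x) (S b)"
  if g: "vl g" "dm g = \<Xi>|>K b" "cd g = Y" for b \<Xi> g
 proof (rule natop_eqI[OF natop_rw[OF l'(1)] _ repr_ev])
  show "natop [] (K b) Y (?P b \<otimes> K x) L (\<lambda>\<Xi> g. lam b \<Xi> g ** \<Xi>\<rhd>ev (K x) (S b))"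
  proof (rule natopI)
   fix \<Xi> \<Delta> u f assume u: "ctx \<Xi> \<Delta> u" and a: "\<And>A. vl (u A)" "\<And>A. dm (u A) = \<Xi>|>A" "\<And>A. cd (u A) = \<Delta>|>A" "vl f" "dm f = \<Delta>|>K b" "cd f = Y"
   show "lam b \<Xi> (f ** u (K b)) ** \<Xi>\<rhd>ev (K x) (S b) = (lam b \<Delta> f ** \<Delta>\<rhd>ev (K x) (S b)) ** []\<rhd>u (?P b \<otimes> K x)"
    using natop_nat[OF n u a(4-6)] ctx_nat[OF u, of "ev (K x) (S b)"] a by simp
  qed simp
  have "ev (K x) L ** ((cc VV (K x) (S b) L ** (p b\<lhd>(?P b)))\<lhd>(K x)) = ?l b ** [?W b]\<rhd>ev (K x) (S b) ** alp (?W b) (?P b) (K x)"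
   by (subst ev_cc_tns) (simp_all add: pe)
  from this[THEN cmp_re, of "alpi (?W b) (?P b) (K x)"]
  show "ev (K x) L ** rw [?W b] (?P b) (lam' b [?W b] (ev (K b) Y)) (K x) = ?l b ** [?W b]\<rhd>ev (K x) (S b)"
   unfolding l'(2) by (simp add: rw_one)
 qed (use g in simp)
 have 4: "ev (K x) (S b) ** rw \<Xi> (?P a) (Rop ?R' a b \<Xi> k) (K x) = Sm a b \<Xi> k ** \<Xi>\<rhd>ev (K x) (S a)"
  if k: "vl k" "dm k = \<Xi>|>K a" "cd k = K b" for a b \<Xi> k
 proof (rule natop_eqI[OF natop_rw[OF jfunD(1)[OF 2]] _ repr_eJ])
  show "natop [] (K a) (K b) (?P a \<otimes> K x) (S b) (\<lambda>\<Xi> k. Sm a b \<Xi> k ** \<Xi>\<rhd>ev (K x) (S a))"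
  proof (rule natopI)
   fix \<Xi> \<Delta> u f assume u: "ctx \<Xi> \<Delta> u" and q: "\<And>A. vl (u A)" "\<And>A. dm (u A) = \<Xi>|>A" "\<And>A. cd (u A) = \<Delta>|>A" "vl f" "dm f = \<Delta>|>K a" "cd f = K b"
   show "Sm a b \<Xi> (f ** u (K a)) ** \<Xi>\<rhd>ev (K x) (S a) = (Sm a b \<Delta> f ** \<Delta>\<rhd>ev (K x) (S a)) ** []\<rhd>u (?P a \<otimes> K x)"
    using natop_nat[OF jfunD(1)[OF S] u q(4-6)] ctx_nat[OF u, of "ev (K x) (S a)"] q by simp
  qed simp
  let ?r = "fa J VV (Rv S Sm) a b"
  note Rc [simp] = R(1)[of a b]
  have o: "dm ?r = vhom J a b" "cd ?r = hm (S a) (S b)" by (simp_all add: R(2))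
  have re: "ev (S a) (S b) ** (?r\<lhd>(S a)) = Sm a b [vhom J a b] (eJ a b)"
   using R(3)[of a b] unfolding fh_def R(2) .
  have "fh J ?R' a b = cc VV (K x) (S a) (S b) ** (?r\<lhd>(?P a))"
   using fh_comp[of J "VV" "Rv S Sm" a b ?F] by (simp add: fh_vrep R(2))
  then have "Rop ?R' a b [vhom J a b] (eJ a b) = cc VV (K x) (S a) (S b) ** (?r\<lhd>(?P a))"
   using Rop(2)[OF R'v] by simp
  moreover have "ev (K x) (S b) ** ((cc VV (K x) (S a) (S b) ** (?r\<lhd>(?P a)))\<lhd>(K x)) = Sm a b [vhom J a b] (eJ a b) ** [vhom J a b]\<rhd>ev (K x) (S a) ** alp (vhom J a b) (?P a) (K x)"
   by (subst ev_cc_tns) (simp_all add: re o R(2))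
  moreover note this[THEN cmp_re, of "alpi (vhom J a b) (?P a) (K x)"]
  ultimately show "ev (K x) (S b) ** rw [vhom J a b] (?P a) (Rop ?R' a b [vhom J a b] (eJ a b)) (K x) = Sm a b [vhom J a b] (eJ a b) ** [vhom J a b]\<rhd>ev (K x) (S a)"
   by (simp add: rw_one o R(2))
 qed (use k in simp)
 show ?thesis using 1 2 3 4 by blast
qed

text \<open>Operations on arrows \<open>\<Xi>|>K x \<rightarrow> L\<close> into a colimit agree once
they agree on the arrows \<open>lam b \<Xi> g ** \<Xi>\<rhd>f\<close>, where \<open>f\<close> goes
from \<open>K x\<close> to some \<open>S b\<close>. Transposed, they are arrows out of \<open>[K x,
L]\<close>, which is a colimit of the \<open>[K x, S b]\<close> by flatness.\<close>

lemma flat_eq: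
 assumes S: "jfun S Sm" and c: "colim Y S Sm L lam"
  and w: "natop U (K x) L A Z \<omega>" "natop U (K x) L A Z \<omega>'"
  and e: "\<And>b \<Xi> \<Delta> g f. \<lbrakk>vl g; dm g = \<Xi>|>K b; cd g = Y; vl f; dm f = \<Delta>|>K x; cd f = S b\<rbrakk> \<Longrightarrow>
   \<omega> (\<Xi> @ \<Delta>) (lam b \<Xi> g ** \<Xi>\<rhd>f) = \<omega>' (\<Xi> @ \<Delta>) (lam b \<Xi> g ** \<Xi>\<rhd>f)"
  and f: "vl f" "dm f = \<Xi>|>K x" "cd f = L"
 shows "\<omega> \<Xi> f = \<omega>' \<Xi> f"
proof (rule natop_eqI[OF w repr_ev])
 obtain Rm' lam' where R': "jfun (\<lambda>b. hm (K x) (S b)) Rm'" and c': "colim Y (\<lambda>b. hm (K x) (S b)) Rm' (hm (K x) L) lam'"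
  and l': "\<And>b \<Xi> g. \<lbrakk>vl g; dm g = \<Xi>|>K b; cd g = Y\<rbrakk> \<Longrightarrow>
    ev (K x) L ** rw \<Xi> (hm (K x) (S b)) (lam' b \<Xi> g) (K x) = lam b \<Xi> g ** \<Xi>\<rhd>ev (K x) (S b)"
  using colim_flat[OF S c, of x] by blast
 let ?P = "hm (K x) L"
 let ?Q = "\<lambda>b. hm (K x) (S b)"
 let ?h = "\<lambda>\<omega>. curl U ?P A (\<omega> [?P] (ev (K x) L))"
 note [simp] = coconeD(2-4)[OF colimD[OF c]] coconeD(2-4)[OF colimD[OF c']]
 have t: "vl (\<omega> [?P] (ev (K x) L))" "dm (\<omega> [?P] (ev (K x) L)) = U|>(?P \<otimes> A)" "cd (\<omega> [?P] (ev (K x) L)) = Z"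
  if "natop U (K x) L A Z \<omega>" for \<omega>
  using natop_tys[OF that, of "ev (K x) L" "[?P]"] by simp_all
 have ht: "vl (?h \<omega>)" "dm (?h \<omega>) = U|>?P" "cd (?h \<omega>) = hm A Z"
  and he: "ev A Z ** rw U ?P (?h \<omega>) A = \<omega> [?P] (ev (K x) L)" if "natop U (K x) L A Z \<omega>" for \<omega>
  using curl[OF t[OF that]] by simp_all
 have x: "ev A Z ** rw (U @ \<Xi>) (?Q b) (?h \<omega> ** U\<rhd>lam' b \<Xi> g) A = \<omega> (\<Xi> @ [?Q b]) (lam b \<Xi> g ** \<Xi>\<rhd>ev (K x) (S b))"
  if n: "natop U (K x) L A Z \<omega>" and g: "vl g" "dm g = \<Xi>|>K b" "cd g = Y" for \<omega> b \<Xi> g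
 proof -
  have "ev A Z ** rw (U @ \<Xi>) (?Q b) (?h \<omega> ** U\<rhd>lam' b \<Xi> g) A = (ev A Z ** rw U ?P (?h \<omega>) A) ** U\<rhd>rw \<Xi> (?Q b) (lam' b \<Xi> g) A"
   using ht[OF n] g by (subst rw_rw) simp_all
  also have "\<dots> = \<omega> (\<Xi> @ [?Q b]) (ev (K x) L ** rw \<Xi> (?Q b) (lam' b \<Xi> g) (K x))"
   unfolding he[OF n] by (rule natop_nat[OF n ctx_rw, symmetric]) (use g in simp_all)
  finally show ?thesis unfolding l'[OF g] .
 qed
 have "?h \<omega> = ?h \<omega>'"
 proof (rule colim_eq[OF c' R'])
  fix b \<Xi> g assume g: "vl g" "dm g = \<Xi>|>K b" "cd g = Y"
  show "?h \<omega> ** U\<rhd>lam' b \<Xi> g = ?h \<omega>' ** U\<rhd>lam' b \<Xi> g"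
  proof (rule rw_eqI)
   show "ev A Z ** rw (U @ \<Xi>) (?Q b) (?h \<omega> ** U\<rhd>lam' b \<Xi> g) A = ev A Z ** rw (U @ \<Xi>) (?Q b) (?h \<omega>' ** U\<rhd>lam' b \<Xi> g) A"
    unfolding x[OF w(1) g] x[OF w(2) g] by (rule e) (use g in simp_all)
  qed (use g ht[OF w(1)] ht[OF w(2)] in simp_all)
 qed (use ht[OF w(1)] ht[OF w(2)] in simp_all)
 from arg_cong[OF this, of "\<lambda>h. ev A Z ** rw U ?P h A"]
 show "\<omega> [?P] (ev (K x) L) = \<omega>' [?P] (ev (K x) L)"
  by (rule trans[OF he[OF w(1), symmetric] trans[OF _ he[OF w(2)]]])
qed (use f in simp)

text \<open>In the same way operations \<open>\<xi>\<close> on arrows \<open>K x \<rightarrow> S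
b\<close> that are compatible with \<open>S\<close>, together with a cocone, induce an operation on
arrows into the colimit.\<close>

lemma flat_ex:
 assumes S: "jfun S Sm" and c: "colim Y S Sm L lam" and Q: "jfun Q Qm" and \<beta>: "cocone U Y Q Qm Z \<beta>"
  and \<xi>: "\<And>b. natop [] (K x) (S b) A (Q b) (\<xi> b)"
  and \<xi>n: "\<And>a b \<Xi> \<Delta> k f. \<lbrakk>vl k; dm k = \<Delta>|>K a; cd k = K b; vl f; dm f = \<Xi>|>K x; cd f = S a\<rbrakk> \<Longrightarrow>
   \<xi> b (\<Delta> @ \<Xi>) (Sm a b \<Delta> k ** \<Delta>\<rhd>f) = Qm a b \<Delta> k ** \<Delta>\<rhd>\<xi> a \<Xi> f"
 shows "\<exists>\<omega>. natop U (K x) L A Z \<omega> \<and> (\<forall>b \<Xi> \<Delta> g f. vl g \<longrightarrow> dm g = \<Xi>|>K b \<longrightarrow> cd g = Y \<longrightarrow> vl f \<longrightarrow> dm f = \<Delta>|>K x \<longrightarrow> cd f = S b \<longrightarrow>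
   \<omega> (\<Xi> @ \<Delta>) (lam b \<Xi> g ** \<Xi>\<rhd>f) = \<beta> b \<Xi> g ** U\<rhd>\<Xi>\<rhd>\<xi> b \<Delta> f)"
proof -
 obtain Rm' lam' where R': "jfun (\<lambda>b. hm (K x) (S b)) Rm'" and c': "colim Y (\<lambda>b. hm (K x) (S b)) Rm' (hm (K x) L) lam'"
  and l': "\<And>b \<Xi> g. \<lbrakk>vl g; dm g = \<Xi>|>K b; cd g = Y\<rbrakk> \<Longrightarrow>
    ev (K x) L ** rw \<Xi> (hm (K x) (S b)) (lam' b \<Xi> g) (K x) = lam b \<Xi> g ** \<Xi>\<rhd>ev (K x) (S b)"
  and r': "\<And>a b \<Xi> k. \<lbrakk>vl k; dm k = \<Xi>|>K a; cd k = K b\<rbrakk> \<Longrightarrow>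
    ev (K x) (S b) ** rw \<Xi> (hm (K x) (S a)) (Rm' a b \<Xi> k) (K x) = Sm a b \<Xi> k ** \<Xi>\<rhd>ev (K x) (S a)"
  using colim_flat[OF S c, of x] by blast
 let ?P = "hm (K x) L"
 let ?P' = "\<lambda>b. hm (K x) (S b)"
 note [simp] = coconeD(2-4)[OF colimD[OF c]] coconeD(2-4)[OF colimD[OF c']] jfunD(2-4)[OF R'] jfunD(2-4)[OF S] jfunD(2-4)[OF Q] coconeD(2-4)[OF \<beta>] natop_tys[OF \<xi>]
 let ?x = "\<lambda>b. \<xi> b [?P' b] (ev (K x) (S b))"
 define B where "B b \<Xi> g = curl (U @ \<Xi>) (?P' b) A (\<beta> b \<Xi> g ** U\<rhd>\<Xi>\<rhd>?x b)" for b \<Xi> g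
 have B [simp]: "vl (B b \<Xi> g)" "dm (B b \<Xi> g) = U|>\<Xi>|>?P' b" "cd (B b \<Xi> g) = hm A Z"
  and Be: "ev A Z ** rw (U @ \<Xi>) (?P' b) (B b \<Xi> g) A = \<beta> b \<Xi> g ** U\<rhd>\<Xi>\<rhd>?x b"
  if "vl g" "dm g = \<Xi>|>K b" "cd g = Y" for b \<Xi> g
  using curl[of "\<beta> b \<Xi> g ** U\<rhd>\<Xi>\<rhd>?x b" "U @ \<Xi>" "?P' b" A Z] that unfolding B_def by simp_all
 have Bc: "cocone U Y ?P' Rm' (hm A Z) B"
 proof (rule coconeI)
  fix b show "natop U (K b) Y (?P' b) (hm A Z) (B b)"
  proof (rule natopI)
   fix \<Xi> \<Delta> u g assume u: "ctx \<Xi> \<Delta> u" and a [simp]: "\<And>A. vl (u A)" "\<And>A. dm (u A) = \<Xi>|>A" "\<And>A. cd (u A) = \<Delta>|>A" "vl g" "dm g = \<Delta>|>K b" "cd g = Y"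
   show "B b \<Xi> (g ** u (K b)) = B b \<Delta> g ** U\<rhd>u (?P' b)"
   proof (rule rw_eqI)
    have un: "U\<rhd>u (Q b) ** U\<rhd>\<Xi>\<rhd>?x b = U\<rhd>\<Delta>\<rhd>?x b ** U\<rhd>u (?P' b \<otimes> A)"
     using wa_cmp[of "u (Q b)" "\<Xi>\<rhd>?x b" U] ctx_nat[OF u, of "?x b"] by simp
    have "ev A Z ** rw (U @ \<Xi>) (?P' b) (B b \<Xi> (g ** u (K b))) A = \<beta> b \<Delta> g ** U\<rhd>u (Q b) ** U\<rhd>\<Xi>\<rhd>?x b"
     using Be[of "g ** u (K b)" \<Xi> b] natop_nat[OF coconeD(1)[OF \<beta>] u, of g b] by simp
    also have "\<dots> = (ev A Z ** rw (U @ \<Delta>) (?P' b) (B b \<Delta> g) A) ** U\<rhd>u (?P' b \<otimes> A)"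
     unfolding un using Be[of g \<Delta> b] by simp
    also have "\<dots> = ev A Z ** rw (U @ \<Xi>) (?P' b) (B b \<Delta> g ** U\<rhd>u (?P' b)) A"
     using rw_ctx[OF ctx_left[OF u], of "B b \<Delta> g" U "?P' b" A] by simp
    finally show "ev A Z ** rw (U @ \<Xi>) (?P' b) (B b \<Xi> (g ** u (K b))) A = ev A Z ** rw (U @ \<Xi>) (?P' b) (B b \<Delta> g ** U\<rhd>u (?P' b)) A" .
   qed simp_all
  qed simp
 next
  fix a b \<Xi> \<Delta> f g assume [simp]: "vl f" "dm f = \<Xi>|>K b" "cd f = K a" "vl g" "dm g = \<Delta>|>K a" "cd g = Y"
  show "B b (\<Delta> @ \<Xi>) (g ** \<Delta>\<rhd>f) = B a \<Delta> g ** U\<rhd>\<Delta>\<rhd>Rm' b a \<Xi> f"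
  proof (rule rw_eqI)
   have xx: "Qm b a \<Xi> f ** \<Xi>\<rhd>?x b = ?x a ** rw \<Xi> (?P' b) (Rm' b a \<Xi> f) A"
   proof -
    have "Qm b a \<Xi> f ** \<Xi>\<rhd>?x b = \<xi> a (\<Xi> @ [?P' b]) (ev (K x) (S a) ** rw \<Xi> (?P' b) (Rm' b a \<Xi> f) (K x))"
     using \<xi>n[of f \<Xi> b a "ev (K x) (S b)" "[?P' b]"] r'[of f \<Xi> b a] by simp
    also have "\<dots> = ?x a ** rw \<Xi> (?P' b) (Rm' b a \<Xi> f) A"
     using natop_nat[OF \<xi> ctx_rw, of "Rm' b a \<Xi> f" \<Xi> "?P' b" "?P' a" "ev (K x) (S a)" a] by simp
    finally show ?thesis .
   qed
   have "ev A Z ** rw (U @ \<Delta> @ \<Xi>) (?P' b) (B b (\<Delta> @ \<Xi>) (g ** \<Delta>\<rhd>f)) A = \<beta> a \<Delta> g ** U\<rhd>\<Delta>\<rhd>(Qm b a \<Xi> f ** \<Xi>\<rhd>?x b)"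
    using Be[of "g ** \<Delta>\<rhd>f" "\<Delta> @ \<Xi>" b] coconeD(5)[OF \<beta>, of f \<Xi> b a g \<Delta>] by simp
   also have "\<dots> = (ev A Z ** rw (U @ \<Delta>) (?P' a) (B a \<Delta> g) A) ** U\<rhd>\<Delta>\<rhd>rw \<Xi> (?P' b) (Rm' b a \<Xi> f) A"
    unfolding xx using Be[of g \<Delta> a] by simp
   also have "\<dots> = ev A Z ** rw (U @ \<Delta> @ \<Xi>) (?P' b) (B a \<Delta> g ** U\<rhd>\<Delta>\<rhd>Rm' b a \<Xi> f) A"
    using rw_rw[of "B a \<Delta> g" "U @ \<Delta>" "?P' a" "Rm' b a \<Xi> f" \<Xi> "?P' b" A] by simp
   finally show "ev A Z ** rw (U @ \<Delta> @ \<Xi>) (?P' b) (B b (\<Delta> @ \<Xi>) (g ** \<Delta>\<rhd>f)) A = ev A Z ** rw (U @ \<Delta> @ \<Xi>) (?P' b) (B a \<Delta> g ** U\<rhd>\<Delta>\<rhd>Rm' b a \<Xi> f) A" .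
  qed simp_all
 qed
 obtain h where h [simp]: "vl h" "dm h = U|>?P" "cd h = hm A Z"
  and he: "\<And>b \<Xi> g. \<lbrakk>vl g; dm g = \<Xi>|>K b; cd g = Y\<rbrakk> \<Longrightarrow> B b \<Xi> g = h ** U\<rhd>lam' b \<Xi> g"
  using colim_ex[OF c' Bc] by blast
 let ?k = "ev A Z ** rw U ?P h A"
 let ?w = "natof ?P (K x) (ev (K x) L) U A ?k"
 have w: "natop U (K x) L A Z ?w" "?w [?P] (ev (K x) L) = ?k"
  using natof[OF repr_ev, of ?k U "K x" L A Z] by simp_all
 have "?w (\<Xi> @ \<Delta>) (lam b \<Xi> g ** \<Xi>\<rhd>f) = \<beta> b \<Xi> g ** U\<rhd>\<Xi>\<rhd>\<xi> b \<Delta> f"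
  if a [simp]: "vl g" "dm g = \<Xi>|>K b" "cd g = Y" "vl f" "dm f = \<Delta>|>K x" "cd f = S b" for b \<Xi> \<Delta> g f
 proof -
  have f': "f \<in> \<Delta>|>K x \<leadsto> S b" by simp
  note u = hat[OF repr_ev f']
  let ?u = "hat (?P' b) (K x) (ev (K x) (S b)) \<Delta> f"
  have ut [simp]: "vl (?u A)" "dm (?u A) = \<Delta>|>A" "cd (?u A) = ?P' b \<otimes> A" for A
   using ctx_ty[OF u(1), of A] by simp_all
  have cx: "ctx (\<Xi> @ \<Delta>) [?P] (\<lambda>A. rw \<Xi> (?P' b) (lam' b \<Xi> g) A ** \<Xi>\<rhd>?u A)"
   by (rule ctx_comp[OF ctx_left[OF u(1)] ctx_rw]) simp
  have "lam b \<Xi> g ** \<Xi>\<rhd>f = (lam b \<Xi> g ** \<Xi>\<rhd>ev (K x) (S b)) ** \<Xi>\<rhd>?u (K x)"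
   using u(2) wa_cmp[of "ev (K x) (S b)" "?u (K x)" \<Xi>] by simp
  also have "\<dots> = ev (K x) L ** rw \<Xi> (?P' b) (lam' b \<Xi> g) (K x) ** \<Xi>\<rhd>?u (K x)"
   using l'[of g \<Xi> b, symmetric] by simp
  finally have "?w (\<Xi> @ \<Delta>) (lam b \<Xi> g ** \<Xi>\<rhd>f) = ?w [?P] (ev (K x) L) ** U\<rhd>(rw \<Xi> (?P' b) (lam' b \<Xi> g) A ** \<Xi>\<rhd>?u A)"
   using natop_nat[OF w(1) cx, of "ev (K x) L"] by simp
  also have "\<dots> = ev A Z ** (rw U ?P h A ** U\<rhd>rw \<Xi> (?P' b) (lam' b \<Xi> g) A) ** U\<rhd>\<Xi>\<rhd>?u A"
   unfolding w(2) by simp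
  also have "\<dots> = ev A Z ** rw (U @ \<Xi>) (?P' b) (B b \<Xi> g) A ** U\<rhd>\<Xi>\<rhd>?u A"
   unfolding he[of g \<Xi> b, OF a(1-3)] by (subst rw_rw[where Q = ?P]) simp_all
  also have "\<dots> = \<beta> b \<Xi> g ** U\<rhd>\<Xi>\<rhd>(?x b ** ?u A)"
   using Be[of g \<Xi> b, THEN cmp_re] by simp
  also have "?x b ** ?u A = \<xi> b \<Delta> f"
   using natop_nat[OF \<xi> u(1), of "ev (K x) (S b)" b] u(2) by simp
  finally show ?thesis .
 qed
 then show ?thesis using w(1) by blast
qed

end

section \<open>Extending a relative monad to a monad\<close>

context smclosed
begin

text \<open>Only well-typed arguments count. This serves to simplify operations obtained by
composition.\<close>

lemma natop_cong:
 assumes "\<And>\<Xi> f. \<lbrakk>vl f; dm f = \<Xi>|>A; cd f = B\<rbrakk> \<Longrightarrow> \<phi> \<Xi> f = \<psi> \<Xi> f"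
 shows "natop U A B A' B' \<phi> \<longleftrightarrow> natop U A B A' B' \<psi>"
proof -
 have "natop U A B A' B' \<psi>" if n: "natop U A B A' B' \<phi>" and e: "\<And>\<Xi> f. \<lbrakk>vl f; dm f = \<Xi>|>A; cd f = B\<rbrakk> \<Longrightarrow> \<phi> \<Xi> f = \<psi> \<Xi> f" for \<phi> \<psi>
  by (rule natopI) (use natop_ty[OF n] natop_nat[OF n] in \<open>simp_all add: e[symmetric]\<close>)
 then show ?thesis using assms by metis
qed

end

text \<open>A relative monad along the arities, to be extended to the base.\<close>

locale relext = earity V J j for V :: "('o, 'm) smcc" (structure) and J :: "('j, 'o, 'm) smvcat" and j :: "('j, 'o, 'm) smvfun" +
 fixes S :: "'j \<Rightarrow> 'o" and \<eta> :: "'j \<Rightarrow> ('o, 'm) tarr" and ex :: "'j \<Rightarrow> 'j \<Rightarrow> ('o, 'm) oper"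
 assumes rm: "relmon K S \<eta> ex"
begin

lemmas rd [simp] = relmonD(1-3,5-10)[OF rm]
lemmas ex_nat = natop_nat[OF relmonD(4)[OF rm]]
lemmas ex_ex = relmonD(11)[OF rm]

text \<open>The functor that underlies the relative monad.\<close>

definition Sm :: "'j \<Rightarrow> 'j \<Rightarrow> ('o, 'm) oper" where
 "Sm a b \<Xi> f = ex a b \<Xi> (\<eta> b ** f)"

lemma jfun_S: "jfun S Sm"
 unfolding jfun_def
proof (intro conjI allI impI)
 fix a b show "natop [] (K a) (K b) (S a) (S b) (Sm a b)"
  by (rule natopI) (simp_all add: Sm_def ex_nat[where f = "\<eta> b ** f" for f, simplified])
next
 fix a show "Sm a a [] (idt (K a)) = idt (S a)" by (simp add: Sm_def)
next
 fix a b d \<Xi> \<Delta> f g assume a: "f \<in> \<Xi>|>K a \<leadsto> K b" "g \<in> \<Delta>|>K b \<leadsto> K d"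
 then have "Sm a d (\<Delta> @ \<Xi>) (g ** \<Delta>\<rhd>f) = ex a d (\<Delta> @ \<Xi>) (ex b d \<Delta> (\<eta> d ** g) ** \<Delta>\<rhd>(\<eta> b ** f))"
  by (simp add: Sm_def)
 then show "Sm a d (\<Delta> @ \<Xi>) (g ** \<Delta>\<rhd>f) = Sm b d \<Delta> g ** \<Delta>\<rhd>Sm a b \<Xi> f"
  unfolding Sm_def using a by (subst (asm) ex_ex) simp_all
qed

lemmas Smd [simp] = jfunD(2-5)[OF jfun_S]

definition T :: "'o \<Rightarrow> 'o" where "T Y = (SOME L. \<exists>lam. colim Y S Sm L lam)"
definition lam :: "'o \<Rightarrow> 'j \<Rightarrow> ('o, 'm) oper" where
 "lam Y = (SOME l. colim Y S Sm (T Y) l)"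

lemma colim_T: "colim Y S Sm (T Y) (lam Y)"
proof -
 have "\<exists>l. colim Y S Sm (T Y) l"
  unfolding T_def by (rule someI_ex) (rule colim_exists[OF jfun_S])
 then show ?thesis unfolding lam_def by (rule someI_ex)
qed

lemmas lamd [simp] = coconeD(2-4)[OF colimD[OF colim_T]]
lemmas lam_nat = natop_nat[OF coconeD(1)[OF colimD[OF colim_T]]]
lemmas lam_din = coconeD(5)[OF colimD[OF colim_T]]
lemmas T_eq = colim_eq[OF colim_T jfun_S]
lemmas T_flat_eq = flat_eq[OF jfun_S colim_T]

text \<open>The extension of arrows \<open>\<Xi>|>K x \<rightarrow> T Y\<close> to \<open>\<Xi>|>S
x\<close>: on arrows that factor through \<open>S b\<close> it is the given extension, and
\<open>flat_ex\<close> provides the rest.\<close>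

definition sharp :: "'o \<Rightarrow> 'j \<Rightarrow> ('o, 'm) oper" where
 "sharp Y x = (SOME \<omega>. natop [] (K x) (T Y) (S x) (T Y) \<omega> \<and> (\<forall>b \<Xi> \<Delta> g f. vl g \<longrightarrow> dm g = \<Xi>|>K b \<longrightarrow> cd g = Y \<longrightarrow> vl f \<longrightarrow> dm f = \<Delta>|>K x \<longrightarrow> cd f = S b \<longrightarrow>
   \<omega> (\<Xi> @ \<Delta>) (lam Y b \<Xi> g ** \<Xi>\<rhd>f) = lam Y b \<Xi> g ** \<Xi>\<rhd>ex x b \<Delta> f))"

lemma ex_Sm:
 assumes "vl k" "dm k = \<Delta>|>K a" "cd k = K b" "vl f" "dm f = \<Xi>|>K x" "cd f = S a"
 shows "ex x b (\<Delta> @ \<Xi>) (Sm a b \<Delta> k ** \<Delta>\<rhd>f) = Sm a b \<Delta> k ** \<Delta>\<rhd>ex x a \<Xi> f"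
 unfolding Sm_def by (rule ex_ex) (use assms in simp_all)

lemma sharp_n: "natop [] (K x) (T Y) (S x) (T Y) (sharp Y x)"
 and sharp_lam: "\<lbrakk>vl g; dm g = \<Xi>|>K b; cd g = Y; vl f; dm f = \<Delta>|>K x; cd f = S b\<rbrakk> \<Longrightarrow>
   sharp Y x (\<Xi> @ \<Delta>) (lam Y b \<Xi> g ** \<Xi>\<rhd>f) = lam Y b \<Xi> g ** \<Xi>\<rhd>ex x b \<Delta> f"
proof -
 have "\<exists>\<omega>. natop [] (K x) (T Y) (S x) (T Y) \<omega> \<and> (\<forall>b \<Xi> \<Delta> g f. vl g \<longrightarrow> dm g = \<Xi>|>K b \<longrightarrow> cd g = Y \<longrightarrow> vl f \<longrightarrow> dm f = \<Delta>|>K x \<longrightarrow> cd f = S b \<longrightarrow>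
   \<omega> (\<Xi> @ \<Delta>) (lam Y b \<Xi> g ** \<Xi>\<rhd>f) = lam Y b \<Xi> g ** \<Xi>\<rhd>ex x b \<Delta> f)"
  by (rule flat_ex[OF jfun_S colim_T[of Y] jfun_S colimD[OF colim_T[of Y]] relmonD(4)[OF rm, where a = x] ex_Sm[where x = x], unfolded wa_Nil])
 then have *: "natop [] (K x) (T Y) (S x) (T Y) (sharp Y x) \<and> (\<forall>b \<Xi> \<Delta> g f. vl g \<longrightarrow> dm g = \<Xi>|>K b \<longrightarrow> cd g = Y \<longrightarrow> vl f \<longrightarrow> dm f = \<Delta>|>K x \<longrightarrow> cd f = S b \<longrightarrow>
   sharp Y x (\<Xi> @ \<Delta>) (lam Y b \<Xi> g ** \<Xi>\<rhd>f) = lam Y b \<Xi> g ** \<Xi>\<rhd>ex x b \<Delta> f)"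
  unfolding sharp_def by (rule someI_ex)
 show "natop [] (K x) (T Y) (S x) (T Y) (sharp Y x)" by (rule *[THEN conjunct1])
 show "\<lbrakk>vl g; dm g = \<Xi>|>K b; cd g = Y; vl f; dm f = \<Delta>|>K x; cd f = S b\<rbrakk> \<Longrightarrow>
   sharp Y x (\<Xi> @ \<Delta>) (lam Y b \<Xi> g ** \<Xi>\<rhd>f) = lam Y b \<Xi> g ** \<Xi>\<rhd>ex x b \<Delta> f"
  by (rule *[THEN conjunct2, rule_format])
qed

lemmas sharpd [simp] = natop_tys[OF sharp_n, simplified]
lemmas sharp_nat = natop_nat[OF sharp_n]

text \<open>By \<open>flat_eq\<close> the laws for \<open>sharp\<close> need only be verified on
arrows that factor through some \<open>S b\<close>, where they are the laws of
\<open>ex\<close>.\<close>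

lemma sharp_unit:
 assumes f: "vl f" "dm f = \<Xi>|>K x" "cd f = T Y"
 shows "sharp Y x \<Xi> f ** \<Xi>\<rhd>\<eta> x = f"
proof (rule T_flat_eq[OF _ natop_id _ f, where \<omega> = "\<lambda>\<Xi> f. sharp Y x \<Xi> f ** \<Xi>\<rhd>\<eta> x"])
 show "natop [] (K x) (T Y) (K x) (T Y) (\<lambda>\<Xi> f. sharp Y x \<Xi> f ** \<Xi>\<rhd>\<eta> x)"
  by (rule natop_cong[THEN iffD1, rotated, OF natop_postpre[OF sharp_n[where x = x and Y = Y], where h = "idt (T Y)" and B'' = "T Y" and k = "\<eta> x" and A'' = "K x"]])
   simp_all
next
 fix b \<Xi> \<Delta> g f assume a: "vl g" "dm g = \<Xi>|>K b" "cd g = Y" "vl f" "dm f = \<Delta>|>K x" "cd f = S b"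
 have "\<Xi>\<rhd>ex x b \<Delta> f ** \<Xi>\<rhd>\<Delta>\<rhd>\<eta> x = \<Xi>\<rhd>f"
  using a by (subst wa_cmp[symmetric]) simp_all
 then show "sharp Y x (\<Xi> @ \<Delta>) (lam Y b \<Xi> g ** \<Xi>\<rhd>f) ** (\<Xi> @ \<Delta>)\<rhd>\<eta> x = lam Y b \<Xi> g ** \<Xi>\<rhd>f"
  using a by (simp add: sharp_lam)
qed

lemma sharp_ex:
 assumes f: "vl f" "dm f = \<Xi>|>K x" "cd f = T Y" and k: "vl k" "dm k = \<Delta>|>K a" "cd k = S x"
 shows "sharp Y a (\<Xi> @ \<Delta>) (sharp Y x \<Xi> f ** \<Xi>\<rhd>k) = sharp Y x \<Xi> f ** \<Xi>\<rhd>ex a x \<Delta> k"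
proof (rule T_flat_eq[OF _ _ _ f, where \<omega> = "\<lambda>\<Xi> f. sharp Y a (\<Xi> @ \<Delta>) (sharp Y x \<Xi> f ** \<Xi>\<rhd>k)" and \<omega>' = "\<lambda>\<Xi> f. sharp Y x \<Xi> f ** \<Xi>\<rhd>ex a x \<Delta> k"])
 show "natop [] (K x) (T Y) (\<Delta>|>S a) (T Y) (\<lambda>\<Xi> f. sharp Y x \<Xi> f ** \<Xi>\<rhd>ex a x \<Delta> k)"
  by (rule natop_cong[THEN iffD1, rotated, OF natop_postpre[OF sharp_n[where x = x and Y = Y], where h = "idt (T Y)" and B'' = "T Y" and k = "ex a x \<Delta> k" and A'' = "\<Delta>|>S a"]])
   (use k in simp_all)
 show "natop [] (K x) (T Y) (\<Delta>|>S a) (T Y) (\<lambda>\<Xi> f. sharp Y a (\<Xi> @ \<Delta>) (sharp Y x \<Xi> f ** \<Xi>\<rhd>k))"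
 proof (rule natopI)
  fix \<Xi> \<Xi>' u f assume u: "ctx \<Xi> \<Xi>' u" and q: "\<And>A. vl (u A)" "\<And>A. dm (u A) = \<Xi>|>A" "\<And>A. cd (u A) = \<Xi>'|>A" "vl f" "dm f = \<Xi>'|>K x" "cd f = T Y"
  show "sharp Y a (\<Xi> @ \<Delta>) (sharp Y x \<Xi> (f ** u (K x)) ** \<Xi>\<rhd>k) = sharp Y a (\<Xi>' @ \<Delta>) (sharp Y x \<Xi>' f ** \<Xi>'\<rhd>k) ** []\<rhd>u (\<Delta>|>S a)"
   using sharp_nat[OF u q(4-6)] ctx_nat[OF u k(1) k(2,3)] sharp_nat[OF ctx_right[OF u], of "sharp Y x \<Xi>' f ** \<Xi>'\<rhd>k" \<Delta> a Y] q k by simp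
 qed (use k in simp)
next
 fix b \<Xi> \<Gamma> g f assume q: "vl g" "dm g = \<Xi>|>K b" "cd g = Y" "vl f" "dm f = \<Gamma>|>K x" "cd f = S b"
 have e: "ex a b (\<Gamma> @ \<Delta>) (ex x b \<Gamma> f ** \<Gamma>\<rhd>k) = ex x b \<Gamma> f ** \<Gamma>\<rhd>ex a x \<Delta> k" by (rule ex_ex) (use q k in simp_all)
 have "sharp Y a (\<Xi> @ \<Gamma> @ \<Delta>) (lam Y b \<Xi> g ** \<Xi>\<rhd>(ex x b \<Gamma> f ** \<Gamma>\<rhd>k)) = lam Y b \<Xi> g ** \<Xi>\<rhd>ex a b (\<Gamma> @ \<Delta>) (ex x b \<Gamma> f ** \<Gamma>\<rhd>k)"
  by (rule sharp_lam) (use q k in simp_all)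
 then show "sharp Y a ((\<Xi> @ \<Gamma>) @ \<Delta>) (sharp Y x (\<Xi> @ \<Gamma>) (lam Y b \<Xi> g ** \<Xi>\<rhd>f) ** (\<Xi> @ \<Gamma>)\<rhd>k) = sharp Y x (\<Xi> @ \<Gamma>) (lam Y b \<Xi> g ** \<Xi>\<rhd>f) ** (\<Xi> @ \<Gamma>)\<rhd>ex a x \<Delta> k"
  unfolding e using q k by (simp add: sharp_lam)
qed

lemma sharp_pre:
 assumes f: "vl f" "dm f = \<Xi>|>K x" "cd f = T Y" and k: "vl k" "dm k = \<Delta>|>K a" "cd k = K x"
 shows "sharp Y a (\<Xi> @ \<Delta>) (f ** \<Xi>\<rhd>k) = sharp Y x \<Xi> f ** \<Xi>\<rhd>Sm a x \<Delta> k"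
 using sharp_ex[OF f, of "\<eta> x ** k" \<Delta> a] sharp_unit[OF f, THEN cmp_re, of "\<Xi>\<rhd>k"] f k by (simp add: Sm_def)

text \<open>For fixed \<open>f : \<Xi>|>A \<rightarrow> T Y\<close> the arrows \<open>sharp\<close>
of the restrictions of \<open>f\<close> to arities form a cocone with parameter
\<open>\<Xi>\<close>; the induced arrow out of \<open>T A\<close> extends \<open>f\<close>.\<close>

definition bnd :: "'o \<Rightarrow> 'o \<Rightarrow> ('o, 'm) oper" where
 "bnd A Y \<Xi> f = (SOME h. vl h \<and> dm h = \<Xi>|>T A \<and> cd h = T Y \<and> (\<forall>b \<Delta> g. vl g \<longrightarrow> dm g = \<Delta>|>K b \<longrightarrow> cd g = A \<longrightarrow>
   sharp Y b (\<Xi> @ \<Delta>) (f ** \<Xi>\<rhd>g) = h ** \<Xi>\<rhd>lam A b \<Delta> g))"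

lemma bnd:
 assumes f: "vl f" "dm f = \<Xi>|>A" "cd f = T Y"
 shows "vl (bnd A Y \<Xi> f)" "dm (bnd A Y \<Xi> f) = \<Xi>|>T A" "cd (bnd A Y \<Xi> f) = T Y"
  "\<lbrakk>vl g; dm g = \<Delta>|>K b; cd g = A\<rbrakk> \<Longrightarrow> bnd A Y \<Xi> f ** \<Xi>\<rhd>lam A b \<Delta> g = sharp Y b (\<Xi> @ \<Delta>) (f ** \<Xi>\<rhd>g)"
proof -
 have "cocone \<Xi> A S Sm (T Y) (\<lambda>b \<Delta> g. sharp Y b (\<Xi> @ \<Delta>) (f ** \<Xi>\<rhd>g))"
 proof (rule coconeI)
  fix b show "natop \<Xi> (K b) A (S b) (T Y) (\<lambda>\<Delta> g. sharp Y b (\<Xi> @ \<Delta>) (f ** \<Xi>\<rhd>g))"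
  proof (rule natopI)
   fix \<Delta> \<Delta>' u g assume u: "ctx \<Delta> \<Delta>' u" and q: "\<And>A. vl (u A)" "\<And>A. dm (u A) = \<Delta>|>A" "\<And>A. cd (u A) = \<Delta>'|>A" "vl g" "dm g = \<Delta>'|>K b" "cd g = A"
   show "sharp Y b (\<Xi> @ \<Delta>) (f ** \<Xi>\<rhd>(g ** u (K b))) = sharp Y b (\<Xi> @ \<Delta>') (f ** \<Xi>\<rhd>g) ** \<Xi>\<rhd>u (S b)"
    using sharp_nat[OF ctx_left[OF u], of "f ** \<Xi>\<rhd>g" \<Xi> b Y] f q by simp
  qed (use f in simp)
 next
  fix a b \<Xi>' \<Delta> k g assume "vl k" "dm k = \<Xi>'|>K b" "cd k = K a" "vl g" "dm g = \<Delta>|>K a" "cd g = A"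
  then show "sharp Y b (\<Xi> @ \<Delta> @ \<Xi>') (f ** \<Xi>\<rhd>(g ** \<Delta>\<rhd>k)) = sharp Y a (\<Xi> @ \<Delta>) (f ** \<Xi>\<rhd>g) ** \<Xi>\<rhd>\<Delta>\<rhd>Sm b a \<Xi>' k"
   using sharp_pre[of "f ** \<Xi>\<rhd>g" "\<Xi> @ \<Delta>" a Y k \<Xi>' b] f by simp
 qed
 from someI_ex[OF colim_ex[OF colim_T this]] have *: "vl (bnd A Y \<Xi> f) \<and> dm (bnd A Y \<Xi> f) = \<Xi>|>T A \<and> cd (bnd A Y \<Xi> f) = T Y \<and> (\<forall>b \<Delta> g. vl g \<longrightarrow> dm g = \<Delta>|>K b \<longrightarrow> cd g = A \<longrightarrow>
   sharp Y b (\<Xi> @ \<Delta>) (f ** \<Xi>\<rhd>g) = bnd A Y \<Xi> f ** \<Xi>\<rhd>lam A b \<Delta> g)"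
  unfolding bnd_def .
 then show "vl (bnd A Y \<Xi> f)" "dm (bnd A Y \<Xi> f) = \<Xi>|>T A" "cd (bnd A Y \<Xi> f) = T Y" by auto
 from * show "\<lbrakk>vl g; dm g = \<Delta>|>K b; cd g = A\<rbrakk> \<Longrightarrow> bnd A Y \<Xi> f ** \<Xi>\<rhd>lam A b \<Delta> g = sharp Y b (\<Xi> @ \<Delta>) (f ** \<Xi>\<rhd>g)"
  by simp
qed

lemmas bndd [simp] = bnd(1-3)

lemma bnd_lam_re: "\<lbrakk>vl f; dm f = \<Xi>|>A; cd f = T Y; vl g; dm g = \<Delta>|>K b; cd g = A\<rbrakk> \<Longrightarrow>
  bnd A Y \<Xi> f ** \<Xi>\<rhd>lam A b \<Delta> g ** x = sharp Y b (\<Xi> @ \<Delta>) (f ** \<Xi>\<rhd>g) ** x"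
 by (rule cmp_re[OF bnd(4)])

text \<open>Since \<open>A\<close> is isomorphic to \<open>A \<otimes> K i0\<close>, the colimit
cocone at the unit arity \<open>i0\<close> in the context \<open>A\<close>, restricted along the
unit of the relative monad, is an arrow \<open>A \<rightarrow> T A\<close>.\<close>

definition etaT :: "'o \<Rightarrow> ('o, 'm) tarr" where
 "etaT A = lam A i0 [A] (rr A) ** [A]\<rhd>\<eta> i0 ** rri A"

lemma etaT_simps [simp]: "vl (etaT A)" "dm (etaT A) = A" "cd (etaT A) = T A"
 by (simp_all add: etaT_def)

text \<open>By dinaturality the colimit cocone at every arity, not only at \<open>i0\<close>,
restricts along the units to \<open>etaT\<close>.\<close>

lemma lam_unit:
 assumes f: "vl f" "dm f = \<Xi>|>K b" "cd f = Y"
 shows "lam Y b \<Xi> f ** \<Xi>\<rhd>\<eta> b = etaT Y ** f"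
proof -
 let ?k = "K b"
 have s: "\<eta> b ** rr ?k = Sm i0 b [?k] (rr ?k) ** [?k]\<rhd>\<eta> i0" by (simp add: Sm_def)
 have "(lam Y b \<Xi> f ** \<Xi>\<rhd>\<eta> b) ** \<Xi>\<rhd>rr ?k = lam Y b \<Xi> f ** \<Xi>\<rhd>(\<eta> b ** rr ?k)"
  using f by simp
 also have "\<dots> = lam Y i0 (\<Xi> @ [?k]) (f ** \<Xi>\<rhd>rr ?k) ** \<Xi>\<rhd>[?k]\<rhd>\<eta> i0"
  unfolding s using lam_din[of "rr ?k" "[?k]" i0 b f \<Xi> Y] f by simp
 also have "f ** \<Xi>\<rhd>rr ?k = rr Y ** rw \<Xi> ?k f (K i0)" by (rule rr_nat[symmetric]) (use f in simp_all)
 also have "lam Y i0 (\<Xi> @ [?k]) (rr Y ** rw \<Xi> ?k f (K i0)) = lam Y i0 [Y] (rr Y) ** rw \<Xi> ?k f (S i0)"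
  using lam_nat[OF ctx_rw, of f \<Xi> ?k Y "rr Y" i0 Y] f by simp
 also have "(lam Y i0 [Y] (rr Y) ** rw \<Xi> ?k f (S i0)) ** \<Xi>\<rhd>[?k]\<rhd>\<eta> i0 = lam Y i0 [Y] (rr Y) ** [Y]\<rhd>\<eta> i0 ** rw \<Xi> ?k f (K i0)"
  using ctx_nat[OF ctx_rw, of f \<Xi> ?k Y "\<eta> i0" "K i0" "S i0"] f by simp
 also have "\<dots> = etaT Y ** rr Y ** rw \<Xi> ?k f (K i0)"
  using f by (simp add: etaT_def)
 also have "\<dots> = (etaT Y ** f) ** \<Xi>\<rhd>rr ?k"
  using f by (simp add: rr_nat)
 finally show ?thesis
  by (rule iso_epi[OF _ wa_inv[OF rr_simps(7)]]) (use f in simp_all)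
qed

lemma bnd_n: "natop [] A (T Y) (T A) (T Y) (bnd A Y)"
proof (rule natopI)
 fix \<Xi> \<Delta> u f assume u: "ctx \<Xi> \<Delta> u" and q [simp]: "\<And>A. vl (u A)" "\<And>A. dm (u A) = \<Xi>|>A" "\<And>A. cd (u A) = \<Delta>|>A" "vl f" "dm f = \<Delta>|>A" "cd f = T Y"
 show "bnd A Y \<Xi> (f ** u A) = bnd A Y \<Delta> f ** []\<rhd>u (T A)"
 proof (rule T_eq)
  fix b \<Gamma> g assume g [simp]: "vl g" "dm g = \<Gamma>|>K b" "cd g = A"
  have "bnd A Y \<Xi> (f ** u A) ** \<Xi>\<rhd>lam A b \<Gamma> g = sharp Y b (\<Delta> @ \<Gamma>) (f ** \<Delta>\<rhd>g) ** u (\<Gamma>|>S b)" using bnd(4)[of "f ** u A" \<Xi> A Y g \<Gamma> b] ctx_nat[OF u, of g "\<Gamma>|>K b" A] sharp_nat[OF ctx_right[OF u], of "f ** \<Delta>\<rhd>g" \<Gamma> b Y] by simp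
  also have "\<dots> = (bnd A Y \<Delta> f ** []\<rhd>u (T A)) ** \<Xi>\<rhd>lam A b \<Gamma> g"
   using bnd(4)[of f \<Delta> A Y g \<Gamma> b, THEN cmp_re] ctx_nat[OF u, of "lam A b \<Gamma> g"] by simp
  finally show "bnd A Y \<Xi> (f ** u A) ** \<Xi>\<rhd>lam A b \<Gamma> g = (bnd A Y \<Delta> f ** []\<rhd>u (T A)) ** \<Xi>\<rhd>lam A b \<Gamma> g" .
 qed simp_all
qed simp

text \<open>Extension commutes with \<open>sharp\<close>; again both sides are operations to which
\<open>flat_eq\<close> applies.\<close>

lemma bnd_sharp:
 assumes g: "vl g" "dm g = \<Delta>|>B" "cd g = T C" and f: "vl f" "dm f = \<Xi>|>K b" "cd f = T B"
 shows "bnd B C \<Delta> g ** \<Delta>\<rhd>sharp B b \<Xi> f = sharp C b (\<Delta> @ \<Xi>) (bnd B C \<Delta> g ** \<Delta>\<rhd>f)"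
proof (rule T_flat_eq[OF _ _ _ f, where \<omega> = "\<lambda>\<Xi> f. bnd B C \<Delta> g ** \<Delta>\<rhd>sharp B b \<Xi> f" and \<omega>' = "\<lambda>\<Xi> f. sharp C b (\<Delta> @ \<Xi>) (bnd B C \<Delta> g ** \<Delta>\<rhd>f)"])
 show "natop \<Delta> (K b) (T B) (S b) (T C) (\<lambda>\<Xi> f. bnd B C \<Delta> g ** \<Delta>\<rhd>sharp B b \<Xi> f)"
  by (rule natopI) (use g in \<open>simp_all add: sharp_nat\<close>)
 show "natop \<Delta> (K b) (T B) (S b) (T C) (\<lambda>\<Xi> f. sharp C b (\<Delta> @ \<Xi>) (bnd B C \<Delta> g ** \<Delta>\<rhd>f))"
 proof (rule natopI)
  fix \<Xi> \<Xi>' u f assume u: "ctx \<Xi> \<Xi>' u" and q: "\<And>A. vl (u A)" "\<And>A. dm (u A) = \<Xi>|>A" "\<And>A. cd (u A) = \<Xi>'|>A" "vl f" "dm f = \<Xi>'|>K b" "cd f = T B"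
  show "sharp C b (\<Delta> @ \<Xi>) (bnd B C \<Delta> g ** \<Delta>\<rhd>(f ** u (K b))) = sharp C b (\<Delta> @ \<Xi>') (bnd B C \<Delta> g ** \<Delta>\<rhd>f) ** \<Delta>\<rhd>u (S b)"
   using sharp_nat[OF ctx_left[OF u], of "bnd B C \<Delta> g ** \<Delta>\<rhd>f" \<Delta> b C] g q by simp
 qed (use g in simp)
next
 fix a \<Xi> \<Gamma> h f assume q: "vl h" "dm h = \<Xi>|>K a" "cd h = B" "vl f" "dm f = \<Gamma>|>K b" "cd f = S a"
 have "bnd B C \<Delta> g ** \<Delta>\<rhd>sharp B b (\<Xi> @ \<Gamma>) (lam B a \<Xi> h ** \<Xi>\<rhd>f) = sharp C a (\<Delta> @ \<Xi>) (g ** \<Delta>\<rhd>h) ** (\<Delta> @ \<Xi>)\<rhd>ex b a \<Gamma> f"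
  using q g by (simp add: sharp_lam bnd_lam_re)
 also have "\<dots> = sharp C b ((\<Delta> @ \<Xi>) @ \<Gamma>) (sharp C a (\<Delta> @ \<Xi>) (g ** \<Delta>\<rhd>h) ** (\<Delta> @ \<Xi>)\<rhd>f)"
  by (rule sharp_ex[symmetric]) (use q g in simp_all)
 also have "\<dots> = sharp C b (\<Delta> @ \<Xi> @ \<Gamma>) (bnd B C \<Delta> g ** \<Delta>\<rhd>(lam B a \<Xi> h ** \<Xi>\<rhd>f))"
  using q g by (simp add: bnd_lam_re)
 finally show "bnd B C \<Delta> g ** \<Delta>\<rhd>sharp B b (\<Xi> @ \<Gamma>) (lam B a \<Xi> h ** \<Xi>\<rhd>f) = sharp C b (\<Delta> @ \<Xi> @ \<Gamma>) (bnd B C \<Delta> g ** \<Delta>\<rhd>(lam B a \<Xi> h ** \<Xi>\<rhd>f))" .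
qed

text \<open>The laws hold by the uniqueness half of the universal property of \<open>T A\<close>:
they are compared on the cocone, where they become laws of \<open>sharp\<close>.\<close>

lemma relmon_T: "relmon (\<lambda>A. A) T etaT bnd"
proof (rule relmonI)
 fix A B \<Xi> f assume f [simp]: "vl f" "dm f = \<Xi>|>A" "cd f = T B"
 have "bnd A B \<Xi> f ** \<Xi>\<rhd>etaT A = sharp B i0 (\<Xi> @ [A]) (f ** \<Xi>\<rhd>rr A) ** \<Xi>\<rhd>[A]\<rhd>\<eta> i0 ** \<Xi>\<rhd>rri A"
  unfolding etaT_def by (simp add: bnd_lam_re)
 also have "\<dots> = f" using sharp_unit[of "f ** \<Xi>\<rhd>rr A" "\<Xi> @ [A]" i0 B, THEN cmp_re] wa_inv[OF rr_simps(7), of A \<Xi>] by simp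
 finally show "bnd A B \<Xi> f ** \<Xi>\<rhd>etaT A = f" .
next
 fix A show "bnd A A [] (etaT A) = idt (T A)"
 proof (rule T_eq[where U = "[]"])
  fix b \<Xi> g assume g: "vl g" "dm g = \<Xi>|>K b" "cd g = A"
  have "bnd A A [] (etaT A) ** lam A b \<Xi> g = sharp A b \<Xi> (lam A b \<Xi> g ** \<Xi>\<rhd>\<eta> b)"
   using bnd(4)[of "etaT A" "[]" A A g \<Xi> b] g lam_unit[of g \<Xi> b A] by simp
  also have "\<dots> = lam A b \<Xi> g"
   using sharp_lam[of g \<Xi> b A "\<eta> b" "[]" b] g by simp
  finally show "bnd A A [] (etaT A) ** []\<rhd>lam A b \<Xi> g = idt (T A) ** []\<rhd>lam A b \<Xi> g" using g by simp
 qed simp_all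
next
 fix A B C \<Xi> \<Delta> f g assume a [simp]: "vl f" "dm f = \<Xi>|>A" "cd f = T B" "vl g" "dm g = \<Delta>|>B" "cd g = T C"
 show "bnd A C (\<Delta> @ \<Xi>) (bnd B C \<Delta> g ** \<Delta>\<rhd>f) = bnd B C \<Delta> g ** \<Delta>\<rhd>bnd A B \<Xi> f"
 proof (rule T_eq)
  fix b \<Gamma> h assume h [simp]: "vl h" "dm h = \<Gamma>|>K b" "cd h = A"
  have "bnd A C (\<Delta> @ \<Xi>) (bnd B C \<Delta> g ** \<Delta>\<rhd>f) ** (\<Delta> @ \<Xi>)\<rhd>lam A b \<Gamma> h = sharp C b ((\<Delta> @ \<Xi>) @ \<Gamma>) ((bnd B C \<Delta> g ** \<Delta>\<rhd>f) ** (\<Delta> @ \<Xi>)\<rhd>h)"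
   by (rule bnd(4)) simp_all
  also have "\<dots> = bnd B C \<Delta> g ** \<Delta>\<rhd>sharp B b (\<Xi> @ \<Gamma>) (f ** \<Xi>\<rhd>h)"
   using bnd_sharp[of g \<Delta> B C "f ** \<Xi>\<rhd>h" "\<Xi> @ \<Gamma>" b] by simp
  also have "sharp B b (\<Xi> @ \<Gamma>) (f ** \<Xi>\<rhd>h) = bnd A B \<Xi> f ** \<Xi>\<rhd>lam A b \<Gamma> h"
   by (rule bnd(4)[symmetric]) simp_all
  finally show "bnd A C (\<Delta> @ \<Xi>) (bnd B C \<Delta> g ** \<Delta>\<rhd>f) ** (\<Delta> @ \<Xi>)\<rhd>lam A b \<Gamma> h = (bnd B C \<Delta> g ** \<Delta>\<rhd>bnd A B \<Xi> f) ** (\<Delta> @ \<Xi>)\<rhd>lam A b \<Gamma> h"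
   by simp
 qed simp_all
qed (simp_all add: bnd_n)

subsection \<open>The comparison on arities\<close>

definition theta :: "'j \<Rightarrow> ('o, 'm) tarr" where "theta b = lam (K b) b [] (idt (K b))"

lemma theta_simps [simp]: "vl (theta b)" "dm (theta b) = S b" "cd (theta b) = T (K b)"
 by (simp_all add: theta_def)

lemma theta_unit: "theta b ** \<eta> b = etaT (K b)"
 using lam_unit[of "idt (K b)" "[]" b "K b"] by (simp add: theta_def)

lemma theta_ex:
 assumes f: "vl f" "dm f = \<Xi>|>K a" "cd f = S b"
 shows "theta b ** ex a b \<Xi> f = bnd (K a) (K b) \<Xi> (theta b ** f) ** \<Xi>\<rhd>theta a"
 using bnd(4)[of "theta b ** f" \<Xi> "K a" "K b" "idt (K a)" "[]" a] sharp_lam[of "idt (K b)" "[]" b "K b" f \<Xi> a] f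
 by (simp add: theta_def)

text \<open>The weight \<open>V(j-, K b)\<close> is representable, so that the colimit \<open>T (K
b)\<close> is \<open>S b\<close>: the arrows \<open>Sm a b\<close> form a cocone with vertex
\<open>S b\<close> and induce the inverse.\<close>

lemma theta_iso: "\<exists>q. vl q \<and> dm q = T (K b) \<and> cd q = S b \<and> q ** theta b = idt (S b) \<and> theta b ** q = idt (T (K b))"
proof -
 have "cocone [] (K b) S Sm (S b) (\<lambda>a. Sm a b)"
  by (rule coconeI) (simp_all add: jfunD(1)[OF jfun_S] jfunD(6)[OF jfun_S])
 from colim_ex[OF colim_T this] obtain q where q: "vl q" "dm q = T (K b)" "cd q = S b"
  and e: "\<And>a \<Xi> f. \<lbrakk>vl f; dm f = \<Xi>|>K a; cd f = K b\<rbrakk> \<Longrightarrow> Sm a b \<Xi> f = q ** lam (K b) a \<Xi> f" by auto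
 have 1: "q ** theta b = idt (S b)" using e[of "idt (K b)" "[]" b] by (simp add: theta_def)
 have 2: "theta b ** q = idt (T (K b))"
 proof (rule T_eq[where U = "[]"])
  fix a \<Xi> f assume f: "vl f" "dm f = \<Xi>|>K a" "cd f = K b"
  have "theta b ** q ** lam (K b) a \<Xi> f = theta b ** Sm a b \<Xi> f" using e[OF f] by simp
  also have "\<dots> = lam (K b) a \<Xi> f" using lam_din[of f \<Xi> a b "idt (K b)" "[]" "K b"] f by (simp add: theta_def)
  finally show "(theta b ** q) ** []\<rhd>lam (K b) a \<Xi> f = idt (T (K b)) ** []\<rhd>lam (K b) a \<Xi> f" using f by simp
 qed (use q in simp_all)
 show ?thesis using q 1 2 by blast
qed

subsection \<open>The extension preserves left Kan extensions\<close>

definition Tm :: "'o \<Rightarrow> 'o \<Rightarrow> ('o, 'm) oper" where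
 "Tm A B \<Xi> k = bnd A B \<Xi> (etaT B ** k)"

lemma Tm_simps [simp]: "\<lbrakk>vl k; dm k = \<Xi>|>A; cd k = B\<rbrakk> \<Longrightarrow> vl (Tm A B \<Xi> k)"
 "\<lbrakk>vl k; dm k = \<Xi>|>A; cd k = B\<rbrakk> \<Longrightarrow> dm (Tm A B \<Xi> k) = \<Xi>|>T A"
 "\<lbrakk>vl k; dm k = \<Xi>|>A; cd k = B\<rbrakk> \<Longrightarrow> cd (Tm A B \<Xi> k) = T B"
 by (simp_all add: Tm_def)

lemma Tm_nat: "\<lbrakk>ctx \<Xi> \<Delta> u; vl f; dm f = \<Delta>|>A; cd f = B\<rbrakk> \<Longrightarrow> Tm A B \<Xi> (f ** u A) = Tm A B \<Delta> f ** u (T A)"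
 using natop_nat[OF bnd_n, of \<Xi> \<Delta> u "etaT B ** f" A B] by (simp add: Tm_def)

lemma Tm_idt [simp]: "Tm A A [] (idt A) = idt (T A)"
 using relmonD(10)[OF relmon_T, of A] by (simp add: Tm_def)

lemma Tm_cmp:
 assumes "vl f" "dm f = \<Xi>|>A" "cd f = B" "vl g" "dm g = \<Delta>|>B" "cd g = C"
 shows "Tm A C (\<Delta> @ \<Xi>) (g ** \<Delta>\<rhd>f) = Tm B C \<Delta> g ** \<Delta>\<rhd>Tm A B \<Xi> f"
 using relmonD(11)[OF relmon_T, of "etaT B ** f" \<Xi> A B "etaT C ** g" \<Delta> C] relmonD(9)[OF relmon_T, of "etaT C ** g" \<Delta> B C] assms
 by (simp add: Tm_def)

lemma Tm_lam:
 assumes "vl k" "dm k = \<Xi>|>A" "cd k = B" "vl g" "dm g = \<Delta>|>K b" "cd g = A"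
 shows "Tm A B \<Xi> k ** \<Xi>\<rhd>lam A b \<Delta> g = lam B b (\<Xi> @ \<Delta>) (k ** \<Xi>\<rhd>g)"
proof -
 have "Tm A B \<Xi> k ** \<Xi>\<rhd>lam A b \<Delta> g = sharp B b ((\<Xi> @ \<Delta>) @ []) (lam B b (\<Xi> @ \<Delta>) (k ** \<Xi>\<rhd>g) ** (\<Xi> @ \<Delta>)\<rhd>\<eta> b)"
  using bnd(4)[of "etaT B ** k" \<Xi> A B g \<Delta> b] lam_unit[of "k ** \<Xi>\<rhd>g" "\<Xi> @ \<Delta>" b B] assms by (simp add: Tm_def)
 also have "\<dots> = lam B b (\<Xi> @ \<Delta>) (k ** \<Xi>\<rhd>g)"
  using sharp_lam[of "k ** \<Xi>\<rhd>g" "\<Xi> @ \<Delta>" b B "\<eta> b" "[]" b] assms by simp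
 finally show ?thesis .
qed

text \<open>\<open>T\<close> preserves colimits weighted by \<open>V(j-, Y)\<close>. Let
\<open>L\<close> be such a colimit of \<open>R\<close>. An arrow out of \<open>T L\<close> is given
by its composites with \<open>lam L d\<close>, that is, by operations on arrows \<open>K d
\<rightarrow> L\<close>; by flatness these are determined by, and can be defined on, arrows that
factor through some \<open>R b\<close>, where a cocone on the \<open>T (R b)\<close> supplies
them.\<close>

lemma T_ary:
 assumes R: "jfun R Rm" and c: "colim Y R Rm L rho"
 shows "colim Y (\<lambda>b. T (R b)) (\<lambda>a b \<Xi> f. Tm (R a) (R b) \<Xi> (Rm a b \<Xi> f)) (T L) (\<lambda>b \<Xi> f. Tm (R b) L \<Xi> (rho b \<Xi> f))"
proof -
 note [simp] = jfunD(2-5)[OF R] coconeD(2-4)[OF colimD[OF c]]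
 let ?TR = "\<lambda>b. T (R b)" and ?Tm = "\<lambda>a b \<Xi> f. Tm (R a) (R b) \<Xi> (Rm a b \<Xi> f)"
 let ?rho = "\<lambda>b \<Xi> f. Tm (R b) L \<Xi> (rho b \<Xi> f)"
 have TR: "jfun ?TR ?Tm"
  unfolding jfun_def
 proof (intro conjI allI impI)
  fix a b show "natop [] (K a) (K b) (T (R a)) (T (R b)) (\<lambda>\<Xi> f. Tm (R a) (R b) \<Xi> (Rm a b \<Xi> f))"
   by (rule natopI) (simp_all add: natop_nat[OF jfunD(1)[OF R]] Tm_nat)
 next
  fix a b d \<Xi> \<Delta> f g assume "f \<in> \<Xi>|>K a \<leadsto> K b" "g \<in> \<Delta>|>K b \<leadsto> K d"
  then show "Tm (R a) (R d) (\<Delta> @ \<Xi>) (Rm a d (\<Delta> @ \<Xi>) (g ** \<Delta>\<rhd>f)) = Tm (R b) (R d) \<Delta> (Rm b d \<Delta> g) ** \<Delta>\<rhd>Tm (R a) (R b) \<Xi> (Rm a b \<Xi> f)"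
   using Tm_cmp[of "Rm a b \<Xi> f" \<Xi> "R a" "R b" "Rm b d \<Delta> g" \<Delta> "R d"] jfunD(6)[OF R, of f \<Xi> a b g \<Delta> d] by simp
 qed simp
 have cc: "cocone [] Y ?TR ?Tm (T L) ?rho"
 proof (rule coconeI)
  fix b show "natop [] (K b) Y (T (R b)) (T L) (\<lambda>\<Xi> f. Tm (R b) L \<Xi> (rho b \<Xi> f))"
   by (rule natopI) (simp_all add: natop_nat[OF coconeD(1)[OF colimD[OF c]]] Tm_nat)
 next
  fix a b \<Xi> \<Delta> f g assume a: "vl f" "dm f = \<Xi>|>K b" "cd f = K a" "vl g" "dm g = \<Delta>|>K a" "cd g = Y"
  then show "Tm (R b) L (\<Delta> @ \<Xi>) (rho b (\<Delta> @ \<Xi>) (g ** \<Delta>\<rhd>f)) = Tm (R a) L \<Delta> (rho a \<Delta> g) ** []\<rhd>\<Delta>\<rhd>Tm (R b) (R a) \<Xi> (Rm b a \<Xi> f)"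
   using coconeD(5)[OF colimD[OF c] a] Tm_cmp[of "Rm b a \<Xi> f" \<Xi> "R b" "R a" "rho a \<Delta> g" \<Delta> L] by simp
 qed
 show ?thesis
  unfolding colim_def
 proof (intro conjI cc allI impI)
  fix U Z \<beta> assume \<beta>: "cocone U Y ?TR ?Tm Z \<beta>"
  note [simp] = coconeD(2-4)[OF \<beta>]
  have lamn: "natop [] (K x) (R b) (S x) (T (R b)) (lam (R b) x)" for x b by (rule coconeD(1)[OF colimD[OF colim_T]])
  have lamx: "lam (R b) x (\<Delta> @ \<Xi>) (Rm a b \<Delta> k ** \<Delta>\<rhd>f) = Tm (R a) (R b) \<Delta> (Rm a b \<Delta> k) ** \<Delta>\<rhd>lam (R a) x \<Xi> f"
   if "vl k" "dm k = \<Delta>|>K a" "cd k = K b" "vl f" "dm f = \<Xi>|>K x" "cd f = R a" for a b \<Xi> \<Delta> k f x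
   using Tm_lam[of "Rm a b \<Delta> k" \<Delta> "R a" "R b" f \<Xi> x] that by simp
  have "\<exists>\<omega>. natop U (K x) L (S x) Z \<omega> \<and> (\<forall>b \<Xi> \<Delta> g f. vl g \<longrightarrow> dm g = \<Xi>|>K b \<longrightarrow> cd g = Y \<longrightarrow> vl f \<longrightarrow> dm f = \<Delta>|>K x \<longrightarrow> cd f = R b \<longrightarrow>
   \<omega> (\<Xi> @ \<Delta>) (rho b \<Xi> g ** \<Xi>\<rhd>f) = \<beta> b \<Xi> g ** U\<rhd>\<Xi>\<rhd>lam (R b) x \<Delta> f)" for x
   by (rule flat_ex[OF R c TR \<beta> lamn lamx])
  then have "\<exists>\<gamma>. \<forall>x. natop U (K x) L (S x) Z (\<gamma> x) \<and> (\<forall>b \<Xi> \<Delta> g f. vl g \<longrightarrow> dm g = \<Xi>|>K b \<longrightarrow> cd g = Y \<longrightarrow> vl f \<longrightarrow> dm f = \<Delta>|>K x \<longrightarrow> cd f = R b \<longrightarrow>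
   \<gamma> x (\<Xi> @ \<Delta>) (rho b \<Xi> g ** \<Xi>\<rhd>f) = \<beta> b \<Xi> g ** U\<rhd>\<Xi>\<rhd>lam (R b) x \<Delta> f)" by (intro choice) blast
  then obtain \<gamma> where \<gamma>n: "\<And>x. natop U (K x) L (S x) Z (\<gamma> x)"
   and \<gamma>: "\<And>x b \<Xi> \<Delta> g f. \<lbrakk>vl g; dm g = \<Xi>|>K b; cd g = Y; vl f; dm f = \<Delta>|>K x; cd f = R b\<rbrakk> \<Longrightarrow>
   \<gamma> x (\<Xi> @ \<Delta>) (rho b \<Xi> g ** \<Xi>\<rhd>f) = \<beta> b \<Xi> g ** U\<rhd>\<Xi>\<rhd>lam (R b) x \<Delta> f" by blast
  note \<gamma>t [simp] = natop_tys[OF \<gamma>n]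
  have gc: "cocone U L S Sm Z \<gamma>"
  proof (rule coconeI[OF \<gamma>n])
   fix d x \<Xi> \<Delta> k g assume k: "vl k" "dm k = \<Xi>|>K x" "cd k = K d" and g: "vl g" "dm g = \<Delta>|>K d" "cd g = L"
   show "\<gamma> x (\<Delta> @ \<Xi>) (g ** \<Delta>\<rhd>k) = \<gamma> d \<Delta> g ** U\<rhd>\<Delta>\<rhd>Sm x d \<Xi> k"
   proof (rule flat_eq[OF R c _ _ _ g, where \<omega> = "\<lambda>\<Delta> g. \<gamma> x (\<Delta> @ \<Xi>) (g ** \<Delta>\<rhd>k)" and \<omega>' = "\<lambda>\<Delta> g. \<gamma> d \<Delta> g ** U\<rhd>\<Delta>\<rhd>Sm x d \<Xi> k"])
    show "natop U (K d) L (\<Xi>|>S x) Z (\<lambda>\<Delta> g. \<gamma> d \<Delta> g ** U\<rhd>\<Delta>\<rhd>Sm x d \<Xi> k)"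
     by (rule natop_cong[THEN iffD1, rotated, OF natop_postpre[OF \<gamma>n[of d], where h = "idt Z" and B'' = Z and k = "Sm x d \<Xi> k" and A'' = "\<Xi>|>S x"]])
      (use k in simp_all)
    show "natop U (K d) L (\<Xi>|>S x) Z (\<lambda>\<Delta> g. \<gamma> x (\<Delta> @ \<Xi>) (g ** \<Delta>\<rhd>k))"
    proof (rule natopI)
     fix \<Delta> \<Delta>' u f assume u: "ctx \<Delta> \<Delta>' u" and q: "\<And>A. vl (u A)" "\<And>A. dm (u A) = \<Delta>|>A" "\<And>A. cd (u A) = \<Delta>'|>A" "vl f" "dm f = \<Delta>'|>K d" "cd f = L"
     show "\<gamma> x (\<Delta> @ \<Xi>) ((f ** u (K d)) ** \<Delta>\<rhd>k) = \<gamma> x (\<Delta>' @ \<Xi>) (f ** \<Delta>'\<rhd>k) ** U\<rhd>u (\<Xi>|>S x)"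
      using natop_nat[OF \<gamma>n ctx_right[OF u], of "f ** \<Delta>'\<rhd>k" \<Xi> x] ctx_nat[OF u k] q k by simp
    qed (use k in simp)
   next
    fix b \<Gamma> \<Delta> g f assume q: "vl g" "dm g = \<Gamma>|>K b" "cd g = Y" "vl f" "dm f = \<Delta>|>K d" "cd f = R b"
    have "\<gamma> x (\<Gamma> @ \<Delta> @ \<Xi>) (rho b \<Gamma> g ** \<Gamma>\<rhd>(f ** \<Delta>\<rhd>k)) = \<beta> b \<Gamma> g ** U\<rhd>\<Gamma>\<rhd>lam (R b) x (\<Delta> @ \<Xi>) (f ** \<Delta>\<rhd>k)"
     by (rule \<gamma>) (use q k in simp_all)
    also have "lam (R b) x (\<Delta> @ \<Xi>) (f ** \<Delta>\<rhd>k) = lam (R b) d \<Delta> f ** []\<rhd>\<Delta>\<rhd>Sm x d \<Xi> k"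
     by (rule lam_din) (use q k in simp_all)
    finally show "\<gamma> x ((\<Gamma> @ \<Delta>) @ \<Xi>) ((rho b \<Gamma> g ** \<Gamma>\<rhd>f) ** (\<Gamma> @ \<Delta>)\<rhd>k) = \<gamma> d (\<Gamma> @ \<Delta>) (rho b \<Gamma> g ** \<Gamma>\<rhd>f) ** U\<rhd>(\<Gamma> @ \<Delta>)\<rhd>Sm x d \<Xi> k"
     using q k by (simp add: \<gamma>)
   qed
  qed
  obtain h where h [simp]: "vl h" "dm h = U|>T L" "cd h = Z"
   and he: "\<And>b \<Xi> g. \<lbrakk>vl g; dm g = \<Xi>|>K b; cd g = L\<rbrakk> \<Longrightarrow> \<gamma> b \<Xi> g = h ** U\<rhd>lam L b \<Xi> g"
   using colim_ex[OF colim_T gc] by blast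
  have TL: "Tm (R b) L \<Xi> (rho b \<Xi> f) ** \<Xi>\<rhd>lam (R b) x \<Delta> g = lam L x (\<Xi> @ \<Delta>) (rho b \<Xi> f ** \<Xi>\<rhd>g)"
   if "vl f" "dm f = \<Xi>|>K b" "cd f = Y" "vl g" "dm g = \<Delta>|>K x" "cd g = R b" for b \<Xi> f x \<Delta> g
   by (rule Tm_lam) (use that in simp_all)
  have key: "(\<forall>b \<Xi> f. f \<in> \<Xi>|>K b \<leadsto> Y \<longrightarrow> \<beta> b \<Xi> f = k ** U\<rhd>?rho b \<Xi> f) \<Longrightarrow> k = h" if k: "vl k" "dm k = U|>T L" "cd k = Z" for k
  proof -
   assume e: "\<forall>b \<Xi> f. f \<in> \<Xi>|>K b \<leadsto> Y \<longrightarrow> \<beta> b \<Xi> f = k ** U\<rhd>?rho b \<Xi> f"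
   have n: "natop U (K x) L (S x) Z (\<lambda>\<Xi> g. k ** U\<rhd>lam L x \<Xi> g)" for x
    by (rule natopI) (use k in \<open>simp_all add: lam_nat\<close>)
   show "k = h"
   proof (rule T_eq[OF k h])
    fix x \<Xi> g assume g: "vl g" "dm g = \<Xi>|>K x" "cd g = L"
    have "k ** U\<rhd>lam L x \<Xi> g = \<gamma> x \<Xi> g"
    proof (rule flat_eq[OF R c n \<gamma>n _ g])
     fix b \<Xi> \<Delta> f g assume q: "vl f" "dm f = \<Xi>|>K b" "cd f = Y" "vl g" "dm g = \<Delta>|>K x" "cd g = R b"
     have "k ** U\<rhd>lam L x (\<Xi> @ \<Delta>) (rho b \<Xi> f ** \<Xi>\<rhd>g) = (k ** U\<rhd>?rho b \<Xi> f) ** U\<rhd>\<Xi>\<rhd>lam (R b) x \<Delta> g"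
      unfolding TL[OF q, symmetric] using q k by simp
     also have "k ** U\<rhd>?rho b \<Xi> f = \<beta> b \<Xi> f" using e q by simp
     also have "\<beta> b \<Xi> f ** U\<rhd>\<Xi>\<rhd>lam (R b) x \<Delta> g = \<gamma> x (\<Xi> @ \<Delta>) (rho b \<Xi> f ** \<Xi>\<rhd>g)"
      by (rule \<gamma>[OF q, symmetric])
     finally show "k ** U\<rhd>lam L x (\<Xi> @ \<Delta>) (rho b \<Xi> f ** \<Xi>\<rhd>g) = \<gamma> x (\<Xi> @ \<Delta>) (rho b \<Xi> f ** \<Xi>\<rhd>g)" .
    qed
    then show "k ** U\<rhd>lam L x \<Xi> g = h ** U\<rhd>lam L x \<Xi> g" using he[OF g] by simp
   qed
  qed
  show "\<exists>!h. h \<in> U|>T L \<leadsto> Z \<and> (\<forall>b \<Xi> f. f \<in> \<Xi>|>K b \<leadsto> Y \<longrightarrow> \<beta> b \<Xi> f = h ** U\<rhd>?rho b \<Xi> f)"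
  proof (rule ex1I[of _ h])
   show "h \<in> U|>T L \<leadsto> Z \<and> (\<forall>b \<Xi> f. f \<in> \<Xi>|>K b \<leadsto> Y \<longrightarrow> \<beta> b \<Xi> f = h ** U\<rhd>?rho b \<Xi> f)"
   proof (intro conjI allI impI)
    fix b \<Xi> f assume "f \<in> \<Xi>|>K b \<leadsto> Y"
    then have f: "vl f" "dm f = \<Xi>|>K b" "cd f = Y" by simp_all
    show "\<beta> b \<Xi> f = h ** U\<rhd>?rho b \<Xi> f"
    proof (rule T_eq[where U = "U @ \<Xi>"])
     fix x \<Delta> g assume g: "vl g" "dm g = \<Delta>|>K x" "cd g = R b"
     have "\<beta> b \<Xi> f ** U\<rhd>\<Xi>\<rhd>lam (R b) x \<Delta> g = h ** U\<rhd>lam L x (\<Xi> @ \<Delta>) (rho b \<Xi> f ** \<Xi>\<rhd>g)"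
      using \<gamma>[OF f g] he[of "rho b \<Xi> f ** \<Xi>\<rhd>g" "\<Xi> @ \<Delta>" x] f g by simp
     then show "\<beta> b \<Xi> f ** (U @ \<Xi>)\<rhd>lam (R b) x \<Delta> g = (h ** U\<rhd>?rho b \<Xi> f) ** (U @ \<Xi>)\<rhd>lam (R b) x \<Delta> g"
      unfolding TL[OF f g, symmetric] using f g by simp
    qed (use f in simp_all)
   qed simp
  qed (use key in simp)
 qed
qed

end

context smclosed
begin

section \<open>Monads on the base as relative monads along the identity\<close>

text \<open>The operation on arrows given by an enriched endofunctor of the base.\<close>

definition Fop :: "('o, 'o, 'm, 'z) vfun_scheme \<Rightarrow> 'o \<Rightarrow> 'o \<Rightarrow> ('o, 'm) oper" where
 "Fop F A B = natof (hm A B) A (ev A B) [] (fob F A) (fh VV F A B)"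

lemma Fop_natop:
 assumes "vl (fa VV VV F A B)"
 shows "natop [] A B (fob F A) (fob F B) (Fop F A B)" "Fop F A B [hm A B] (ev A B) = fh VV F A B"
 unfolding Fop_def using natof[OF repr_ev, of "fh VV F A B" "[]" A B "fob F A" "fob F B"] fh_simps[OF assms] by simp_all

lemma vfunctor_Fop: "endo F \<longleftrightarrow> (\<forall>A B. vl (fa VV VV F A B)) \<and>
 (\<forall>A. Fop F A A [] (idt A) = idt (fob F A)) \<and>
 (\<forall>A B C \<Xi> \<Delta> f g. f \<in> \<Xi>|>A \<leadsto> B \<longrightarrow> g \<in> \<Delta>|>B \<leadsto> C \<longrightarrow> Fop F A C (\<Delta> @ \<Xi>) (g ** \<Delta>\<rhd>f) = Fop F B C \<Delta> g ** \<Delta>\<rhd>Fop F A B \<Xi> f)"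
proof (cases "\<forall>A B. vl (fa VV VV F A B)")
 case True
 then have t: "vl (fa VV VV F A B)" for A B by blast
 show ?thesis
  unfolding vfunctor_iff[OF klc_vself klc_vself t, of "Fop F", OF Fop_natop(1)[OF t] Fop_natop(2)[OF t, unfolded fh_def vself_simps[symmetric]]]
  using t by simp
next
 case False
 then show ?thesis using vfunctor_typed[OF vcat_vself vcat_vself] by blast
qed

lemma FopD:
 assumes F: "endo F"
 shows "vl (fa VV VV F A B)" "natop [] A B (fob F A) (fob F B) (Fop F A B)"
  "\<lbrakk>vl f; dm f = \<Xi>|>A; cd f = B\<rbrakk> \<Longrightarrow> vl (Fop F A B \<Xi> f)"
  "\<lbrakk>vl f; dm f = \<Xi>|>A; cd f = B\<rbrakk> \<Longrightarrow> dm (Fop F A B \<Xi> f) = \<Xi>|>fob F A"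
  "\<lbrakk>vl f; dm f = \<Xi>|>A; cd f = B\<rbrakk> \<Longrightarrow> cd (Fop F A B \<Xi> f) = fob F B"
  "Fop F A A [] (idt A) = idt (fob F A)"
  "\<lbrakk>vl f; dm f = \<Xi>|>A; cd f = B; vl g; dm g = \<Delta>|>B; cd g = C\<rbrakk> \<Longrightarrow>
   Fop F A C (\<Delta> @ \<Xi>) (g ** \<Delta>\<rhd>f) = Fop F B C \<Delta> g ** \<Delta>\<rhd>Fop F A B \<Xi> f"
  "\<lbrakk>vl f; dm f = \<Xi>|>A; cd f = B; vl g; dm g = B; cd g = C\<rbrakk> \<Longrightarrow>
   Fop F A C \<Xi> (g ** f) = Fop F B C [] g ** Fop F A B \<Xi> f"
proof -
 show v: "vl (fa VV VV F A B)" for A B using F unfolding vfunctor_Fop by blast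
 note n = Fop_natop(1)[OF v]
 show "natop [] A B (fob F A) (fob F B) (Fop F A B)" by (rule n)
 show "Fop F A A [] (idt A) = idt (fob F A)" using F unfolding vfunctor_Fop by blast
 have c: "\<lbrakk>vl f; dm f = \<Xi>|>A; cd f = B; vl g; dm g = \<Delta>|>B; cd g = C\<rbrakk> \<Longrightarrow>
   Fop F A C (\<Delta> @ \<Xi>) (g ** \<Delta>\<rhd>f) = Fop F B C \<Delta> g ** \<Delta>\<rhd>Fop F A B \<Xi> f" for f \<Xi> A B g \<Delta> C
  using F unfolding vfunctor_Fop by simp
 { assume f: "vl f" "dm f = \<Xi>|>A" "cd f = B"
  show "vl (Fop F A B \<Xi> f)" "dm (Fop F A B \<Xi> f) = \<Xi>|>fob F A" "cd (Fop F A B \<Xi> f) = fob F B"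
   using natop_tys[OF n f] by simp_all
  show "\<lbrakk>vl g; dm g = \<Delta>|>B; cd g = C\<rbrakk> \<Longrightarrow>
   Fop F A C (\<Delta> @ \<Xi>) (g ** \<Delta>\<rhd>f) = Fop F B C \<Delta> g ** \<Delta>\<rhd>Fop F A B \<Xi> f" by (rule c[OF f])
  show "\<lbrakk>vl g; dm g = B; cd g = C\<rbrakk> \<Longrightarrow> Fop F A C \<Xi> (g ** f) = Fop F B C [] g ** Fop F A B \<Xi> f"
   using c[OF f, of g "[]" C] by simp }
qed

lemma Fop_nat: "\<lbrakk>endo F; ctx \<Xi> \<Delta> u; vl f; dm f = \<Delta>|>A; cd f = B\<rbrakk> \<Longrightarrow>
  Fop F A B \<Xi> (f ** u A) = Fop F A B \<Delta> f ** u (fob F A)"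
 using natop_nat[OF FopD(2)] by simp

lemma fh_compop:
 assumes G: "endo G" and F: "vl (fa C VV F a b)"
 shows "fh C (vfun_comp V G F) a b = Fop G (fob F a) (fob F b) [vhom C a b] (fh C F a b)"
proof -
 have "fh C (vfun_comp V G F) a b = Fop G (fob F a) (fob F b) [hm (fob F a) (fob F b)] (ev (fob F a) (fob F b)) ** (fa C VV F a b\<lhd>(fob G (fob F a)))"
  unfolding Fop_natop(2)[OF FopD(1)[OF G]] using F by (rule fh_comp) (rule FopD(1)[OF G])
 also have "\<dots> = Fop G (fob F a) (fob F b) [vhom C a b] (fh C F a b)"
  unfolding fh_def using Fop_nat[OF G ctx_arr, of "fa C VV F a b" "vhom C a b" "hm (fob F a) (fob F b)" "ev (fob F a) (fob F b)" "fob F a" "fob F b"] F by simp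
 finally show ?thesis .
qed

lemma fa_comp_vl:
 assumes "endo G" "vl (fa C VV F a b)"
 shows "vl (fa C VV (vfun_comp V G F) a b)"
 using FopD(1)[OF assms(1)] assms(2) by (simp add: fa_comp[where D = "VV"])

lemma natop_Fop:
 assumes G: "endo G" and n: "natop U A B A' B' \<phi>" and U: "U = []"
 shows "natop [] A B (fob G A') (fob G B') (\<lambda>\<Xi> f. Fop G A' B' \<Xi> (\<phi> \<Xi> f))"
 by (rule natopI) (use natop_tys[OF n] natop_nat[OF n] U FopD(3-5)[OF G] Fop_nat[OF G] in simp_all)

text \<open>A transformation into the base, evaluated on all arrows instead of on the hom objects.\<close>

lemma vnat_op:
 assumes F: "\<And>a b. vl (fa C VV F a b)" and G: "\<And>a b. vl (fa C VV G a b)"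
  and r: "\<And>a b. repr (vhom C a b) (K a) (S b) (e a b)"
  and \<phi>: "\<And>a b. natop [] (K a) (S b) (fob F a) (fob F b) (\<phi> a b)" "\<And>a b. \<phi> a b [vhom C a b] (e a b) = fh C F a b"
  and \<psi>: "\<And>a b. natop [] (K a) (S b) (fob G a) (fob G b) (\<psi> a b)" "\<And>a b. \<psi> a b [vhom C a b] (e a b) = fh C G a b"
 shows "vnat V C VV F G \<alpha> \<longleftrightarrow> (\<forall>a. \<alpha> a \<in> Hom UV (fob F a) (fob G a)) \<and>
  (\<forall>a b \<Xi> f. f \<in> \<Xi>|>K a \<leadsto> S b \<longrightarrow> una (\<alpha> b) ** \<phi> a b \<Xi> f = \<psi> a b \<Xi> f ** \<Xi>\<rhd>una (\<alpha> a))"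
proof (cases "\<forall>a. \<alpha> a \<in> Hom UV (fob F a) (fob G a)")
 case True
 have u: "vl (una (\<alpha> a))" "dm (una (\<alpha> a)) = fob F a" "cd (una (\<alpha> a)) = fob G a" for a
  using una_ty[OF True[rule_format, of a]] by simp_all
 have "una (\<alpha> b) ** fh C F a b = fh C G a b ** [vhom C a b]\<rhd>una (\<alpha> a) \<longleftrightarrow>
  (\<forall>\<Xi> f. f \<in> \<Xi>|>K a \<leadsto> S b \<longrightarrow> una (\<alpha> b) ** \<phi> a b \<Xi> f = \<psi> a b \<Xi> f ** \<Xi>\<rhd>una (\<alpha> a))" (is "?l \<longleftrightarrow> ?r") for a b
 proof
  assume ?r
  then have "una (\<alpha> b) ** \<phi> a b [vhom C a b] (e a b) = \<psi> a b [vhom C a b] (e a b) ** [vhom C a b]\<rhd>una (\<alpha> a)"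
   using repr_ty[OF r[of a b]] by (elim allE impE) auto
  then show ?l unfolding \<phi>(2) \<psi>(2) .
 next
  assume l: ?l
  show ?r
  proof (intro allI impI)
   fix \<Xi> f assume f: "f \<in> \<Xi>|>K a \<leadsto> S b"
   show "una (\<alpha> b) ** \<phi> a b \<Xi> f = \<psi> a b \<Xi> f ** \<Xi>\<rhd>una (\<alpha> a)"
   proof (rule natop_eqI[OF _ _ r _ f])
    show "natop [] (K a) (S b) (fob F a) (fob G b) (\<lambda>\<Xi> f. una (\<alpha> b) ** \<phi> a b \<Xi> f)"
     by (rule natopI) (use u natop_tys[OF \<phi>(1)] natop_nat[OF \<phi>(1)] in simp_all)
    show "natop [] (K a) (S b) (fob F a) (fob G b) (\<lambda>\<Xi> f. \<psi> a b \<Xi> f ** \<Xi>\<rhd>una (\<alpha> a))"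
     by (rule natop_cong[THEN iffD1, rotated, OF natop_postpre[OF \<psi>(1)[of a b], where h = "idt (fob G b)" and B'' = "fob G b" and k = "una (\<alpha> a)" and A'' = "fob F a"]])
      (use u natop_tys[OF \<psi>(1)] in simp_all)
    show "una (\<alpha> b) ** \<phi> a b [vhom C a b] (e a b) = \<psi> a b [vhom C a b] (e a b) ** [vhom C a b]\<rhd>una (\<alpha> a)"
     unfolding \<phi>(2) \<psi>(2) by (rule l)
   qed
  qed
 qed
 then show ?thesis unfolding vnat_iff[where C = C, OF F G] by blast
next
 case False
 then show ?thesis unfolding vnat_iff[where C = C, OF F G] by blast
qed

lemma vnat_Fop:
 assumes F: "endo F" and G: "endo G"
  and \<phi>: "\<And>A B. natop [] A B (fob F A) (fob F B) (\<phi> A B)" "\<And>A B. \<phi> A B [hm A B] (ev A B) = fh VV F A B"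
  and \<psi>: "\<And>A B. natop [] A B (fob G A) (fob G B) (\<psi> A B)" "\<And>A B. \<psi> A B [hm A B] (ev A B) = fh VV G A B"
 shows "vnat V VV VV F G \<alpha> \<longleftrightarrow> (\<forall>A. \<alpha> A \<in> Hom UV (fob F A) (fob G A)) \<and>
  (\<forall>A B \<Xi> f. f \<in> \<Xi>|>A \<leadsto> B \<longrightarrow> una (\<alpha> B) ** \<phi> A B \<Xi> f = \<psi> A B \<Xi> f ** \<Xi>\<rhd>una (\<alpha> A))"
 by (rule vnat_op[where K = "\<lambda>A. A" and S = "\<lambda>A. A" and e = ev]) (use FopD(1)[OF F] FopD(1)[OF G] \<phi> \<psi> repr_ev in simp_all)

lemma umap_una:
 assumes F: "endo F" and a: "\<alpha> \<in> Hom UV A B"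
 shows "umap V F \<alpha> \<in> Hom UV (fob F A) (fob F B)" "una (umap V F \<alpha>) = Fop F A B [] (una \<alpha>)"
proof -
 note h = a[unfolded UV_Hom]
 obtain m where m: "\<alpha> = (A, m, B)" using h by (cases \<alpha>) auto
 note v = FopD(1)[OF F, of A B]
 have e: "elA (umap V F \<alpha>) = fa VV VV F A B ** elA \<alpha>"
  using v h by (simp add: m umap_def elA_def elt_def fa_def cmp_mk)
 then have ve: "vl (elA (umap V F \<alpha>))" using v h by simp
 have fs: "fst (umap V F \<alpha>) = fob F A" "snd (snd (umap V F \<alpha>)) = fob F B" by (simp_all add: m umap_def)
 show "umap V F \<alpha> \<in> Hom UV (fob F A) (fob F B)" using ve fs by (simp add: UV_Hom)
 have "una (umap V F \<alpha>) = (fh VV F A B ** (elA \<alpha>\<lhd>(fob F A))) ** lui (fob F A)"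
  using v h by (simp add: una_eq[OF ve] fs e fh_def)
 also have "fh VV F A B ** (elA \<alpha>\<lhd>(fob F A)) = Fop F A B [\<one>] (ev A B ** (elA \<alpha>\<lhd>A))"
  using Fop_nat[OF F ctx_arr, of "elA \<alpha>" \<one> "hm A B" "ev A B" A B] Fop_natop(2)[OF v] h by simp
 also have "ev A B ** (elA \<alpha>\<lhd>A) = una \<alpha> ** lu A" using una_ev[of \<alpha>] h by simp
 also have "Fop F A B [\<one>] (una \<alpha> ** lu A) = Fop F A B [] (una \<alpha>) ** lu (fob F A)"
  using Fop_nat[OF F ctx_lu, of "una \<alpha>" A B] una_ty[OF a] by simp
 finally show "una (umap V F \<alpha>) = Fop F A B [] (una \<alpha>)"
  using FopD(3-5)[OF F, of "una \<alpha>" "[]" A B] una_ty[OF a] by simp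
qed

lemma Fop_id: "\<lbrakk>vl f; dm f = \<Xi>|>A; cd f = B\<rbrakk> \<Longrightarrow> Fop (vfun_id V VV) A B \<Xi> f = f"
proof -
 have v: "vl (fa VV VV (vfun_id V VV) A B)" by (simp add: fa_id)
 have e: "fh VV (vfun_id V VV) A B = ev A B" by (simp add: fh_def fa_id)
 have n: "natop [] A B A B (Fop (vfun_id V VV) A B)" using Fop_natop(1)[OF v] by simp
 assume "vl f" "dm f = \<Xi>|>A" "cd f = B"
 then have f: "f \<in> \<Xi>|>A \<leadsto> B" by simp
 show "Fop (vfun_id V VV) A B \<Xi> f = f"
  by (rule natop_eqI[OF n natop_id repr_ev _ f]) (simp only: Fop_natop(2)[OF v] e)
qed

text \<open>The Kleisli extension \<open>f\<^sup>* = \<mu> \<cdot> T f\<close> of a monad, for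
arrows in a context.\<close>

definition Mex :: "('o, 'm) vmonad \<Rightarrow> 'o \<Rightarrow> 'o \<Rightarrow> ('o, 'm) oper" where
 "Mex M A B \<Xi> f = una (mmult M B) ** Fop (mfun M) A (fob (mfun M) B) \<Xi> f"
definition Meta :: "('o, 'm) vmonad \<Rightarrow> 'o \<Rightarrow> ('o, 'm) tarr" where
 "Meta M A = una (munit M A)"

lemma is_vmonad_iff:
 assumes F: "endo T"
 shows "monad \<lparr>mfun = T, munit = \<eta>, mmult = \<mu>\<rparr> \<longleftrightarrow>
  (\<forall>A. \<eta> A \<in> Hom UV A (fob T A)) \<and> (\<forall>A. \<mu> A \<in> Hom UV (fob T (fob T A)) (fob T A)) \<and>
  (\<forall>A B \<Xi> f. f \<in> \<Xi>|>A \<leadsto> B \<longrightarrow> una (\<eta> B) ** f = Fop T A B \<Xi> f ** \<Xi>\<rhd>una (\<eta> A)) \<and>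
  (\<forall>A B \<Xi> f. f \<in> \<Xi>|>A \<leadsto> B \<longrightarrow> una (\<mu> B) ** Fop T (fob T A) (fob T B) \<Xi> (Fop T A B \<Xi> f) = Fop T A B \<Xi> f ** \<Xi>\<rhd>una (\<mu> A)) \<and>
  (\<forall>A. una (\<mu> A) ** Fop T (fob T (fob T A)) (fob T A) [] (una (\<mu> A)) = una (\<mu> A) ** una (\<mu> (fob T A))) \<and>
  (\<forall>A. una (\<mu> A) ** Fop T A (fob T A) [] (una (\<eta> A)) = idt (fob T A)) \<and>
  (\<forall>A. una (\<mu> A) ** una (\<eta> (fob T A)) = idt (fob T A))" (is "?L \<longleftrightarrow> ?R1 \<and> ?R2 \<and> ?N1 \<and> ?N2 \<and> ?A \<and> ?U1 \<and> ?U2")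
proof -
 note n = FopD(2)[OF F] and g = Fop_natop(2)[OF FopD(1)[OF F]]
 have n1: "vnat V VV VV (vfun_id V VV) T \<eta> \<longleftrightarrow> ?R1 \<and> ?N1"
  by (subst vnat_Fop[OF vfunctor_id[OF vcat_vself] F, where \<phi> = "\<lambda>A B \<Xi> f. f" and \<psi> = "Fop T"])
   (simp_all add: natop_id n g, simp add: fh_def fa_id)
 have n2: "vnat V VV VV (vfun_comp V T T) T \<mu> \<longleftrightarrow> ?R2 \<and> ?N2"
  by (subst vnat_Fop[OF vfunctor_comp[OF F F vcat_vself vcat_vself vcat_vself] F, where \<phi> = "\<lambda>A B \<Xi> f. Fop T (fob T A) (fob T B) \<Xi> (Fop T A B \<Xi> f)" and \<psi> = "Fop T"])
   (simp_all add: natop_Fop[OF F n] n g fh_compop[OF F FopD(1)[OF F]])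
 show ?thesis
 proof (cases "?R1 \<and> ?R2")
  case True
  then have e: "\<eta> A \<in> Hom UV A (fob T A)" and m: "\<mu> A \<in> Hom UV (fob T (fob T A)) (fob T A)" for A by auto
  note ue = umap_una[OF F e] and um = umap_una[OF F m]
  have i: "uar (idt X) \<in> Hom UV X X" "una (uar (idt X)) = idt X" for X
   using uar_ty[of "idt X" X X] una_uar[of "idt X" X X] by simp_all
  have eq: "\<alpha> = \<beta> \<longleftrightarrow> una \<alpha> = una \<beta>" if "\<alpha> \<in> Hom UV A B" "\<beta> \<in> Hom UV A B" for \<alpha> \<beta> A B
   using uarr_eqI[OF that] by auto
  have a: "\<mu> A \<cdot>\<^bsub>UV\<^esub> umap V T (\<mu> A) = \<mu> A \<cdot>\<^bsub>UV\<^esub> \<mu> (fob T A) \<longleftrightarrow> una (\<mu> A) ** Fop T (fob T (fob T A)) (fob T A) [] (una (\<mu> A)) = una (\<mu> A) ** una (\<mu> (fob T A))" for A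
   by (subst eq[OF UV_Comp(1)[OF m um(1)] UV_Comp(1)[OF m m]]) (simp add: UV_Comp(2)[OF m um(1)] UV_Comp(2)[OF m m] um)
  have u1: "\<mu> A \<cdot>\<^bsub>UV\<^esub> umap V T (\<eta> A) = Idn UV (fob T A) \<longleftrightarrow> una (\<mu> A) ** Fop T A (fob T A) [] (una (\<eta> A)) = idt (fob T A)" for A
   unfolding UV_Idn by (subst eq[OF UV_Comp(1)[OF m ue(1)] i(1)]) (simp add: UV_Comp(2)[OF m ue(1)] ue i)
  have u2: "\<mu> A \<cdot>\<^bsub>UV\<^esub> \<eta> (fob T A) = Idn UV (fob T A) \<longleftrightarrow> una (\<mu> A) ** una (\<eta> (fob T A)) = idt (fob T A)" for A
   unfolding UV_Idn by (subst eq[OF UV_Comp(1)[OF m e] i(1)]) (simp add: UV_Comp(2)[OF m e] i)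
  show ?thesis
   unfolding is_vmonad_def Let_def vmonad.simps n1 n2 a u1 u2 using F by blast
 next
  case False
  then show ?thesis unfolding is_vmonad_def Let_def vmonad.simps n1 n2 by blast
 qed
qed

text \<open>The usual passage from a monad to its Kleisli triple; it works in the presence of
contexts because \<open>T\<close> acts on arrows in contexts, which is its strength.\<close>

lemma vmonad_relmon:
 assumes M: "monad M"
 shows "relmon (\<lambda>A. A) (fob (mfun M)) (Meta M) (Mex M)" "endo (mfun M)"
  "munit M A \<in> Hom UV A (fob (mfun M) A)" "mmult M A \<in> Hom UV (fob (mfun M) (fob (mfun M) A)) (fob (mfun M) A)"
  "\<lbrakk>vl f; dm f = \<Xi>|>A; cd f = B\<rbrakk> \<Longrightarrow> Mex M A B \<Xi> (Meta M B ** f) = Fop (mfun M) A B \<Xi> f"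
  "Mex M (fob (mfun M) A) A [] (idt (fob (mfun M) A)) = una (mmult M A)"
proof -
 obtain T \<eta> \<mu> where M': "M = \<lparr>mfun = T, munit = \<eta>, mmult = \<mu>\<rparr>" by (cases M)
 show F: "endo (mfun M)" using M unfolding is_vmonad_def Let_def by blast
 have F': "endo T" using F M' by simp
 note l = M[unfolded M' is_vmonad_iff[OF F']]
 have e: "\<eta> A \<in> Hom UV A (fob T A)" and m: "\<mu> A \<in> Hom UV (fob T (fob T A)) (fob T A)"
  and U1: "una (\<mu> A) ** Fop T A (fob T A) [] (una (\<eta> A)) = idt (fob T A)"
  and U2: "una (\<mu> A) ** una (\<eta> (fob T A)) = idt (fob T A)"
  and As: "una (\<mu> A) ** Fop T (fob T (fob T A)) (fob T A) [] (una (\<mu> A)) = una (\<mu> A) ** una (\<mu> (fob T A))" for A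
  using l by simp_all
 have N1: "una (\<eta> B) ** f = Fop T A B \<Xi> f ** \<Xi>\<rhd>una (\<eta> A)"
  and N2: "una (\<mu> B) ** Fop T (fob T A) (fob T B) \<Xi> (Fop T A B \<Xi> f) = Fop T A B \<Xi> f ** \<Xi>\<rhd>una (\<mu> A)"
  if f: "vl f" "dm f = \<Xi>|>A" "cd f = B" for A B \<Xi> f
 proof -
  have "f \<in> \<Xi>|>A \<leadsto> B" using f by simp
  then show "una (\<eta> B) ** f = Fop T A B \<Xi> f ** \<Xi>\<rhd>una (\<eta> A)"
   "una (\<mu> B) ** Fop T (fob T A) (fob T B) \<Xi> (Fop T A B \<Xi> f) = Fop T A B \<Xi> f ** \<Xi>\<rhd>una (\<mu> A)"
   using l by blast+
 qed
 note ar = As[THEN cmp_re, unfolded cmp_assoc] and U1r = U1[THEN cmp_re, unfolded cmp_assoc] and U2r = U2[THEN cmp_re, unfolded cmp_assoc]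
  and N2r = N2[THEN cmp_re, unfolded cmp_assoc]
 have t [simp]: "vl (una (\<eta> A))" "dm (una (\<eta> A)) = A" "cd (una (\<eta> A)) = fob T A"
  "vl (una (\<mu> A))" "dm (una (\<mu> A)) = fob T (fob T A)" "cd (una (\<mu> A)) = fob T A" for A
  using una_ty[OF e[of A]] una_ty[OF m[of A]] by simp_all
 note [simp] = FopD(3-6)[OF F']
 show "munit M A \<in> Hom UV A (fob (mfun M) A)" "mmult M A \<in> Hom UV (fob (mfun M) (fob (mfun M) A)) (fob (mfun M) A)"
  unfolding M' using e m by simp_all
 have comp: "Fop T A C (\<Delta> @ \<Xi>) (g ** \<Delta>\<rhd>f) = Fop T B C \<Delta> g ** \<Delta>\<rhd>Fop T A B \<Xi> f"
  if "vl f" "dm f = \<Xi>|>A" "cd f = B" "vl g" "dm g = \<Delta>|>B" "cd g = C" for f \<Xi> A B g \<Delta> C by (rule FopD(7)[OF F' that])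
 have comp0: "Fop T A C \<Xi> (g ** f) = Fop T B C [] g ** Fop T A B \<Xi> f"
  if "vl f" "dm f = \<Xi>|>A" "cd f = B" "vl g" "dm g = B" "cd g = C" for f \<Xi> A B g C by (rule FopD(8)[OF F' that])
 show "relmon (\<lambda>A. A) (fob (mfun M)) (Meta M) (Mex M)"
  unfolding M' Meta_def[abs_def] Mex_def[abs_def] vmonad.simps
 proof (rule relmonI)
  show "natop [] A (fob T B) (fob T A) (fob T B) (\<lambda>\<Xi> f. una (\<mu> B) ** Fop T A (fob T B) \<Xi> f)" for A B
   by (rule natopI) (simp_all add: Fop_nat[OF F'])
 next
  fix A B \<Xi> f assume f: "vl f" "dm f = \<Xi>|>A" "cd f = fob T B"
  show "(una (\<mu> B) ** Fop T A (fob T B) \<Xi> f) ** \<Xi>\<rhd>una (\<eta> A) = f"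
   using N1[OF f, symmetric] f by (simp add: U2r)
 next
  fix A B C \<Xi> \<Delta> f g assume a: "vl f" "dm f = \<Xi>|>A" "cd f = fob T B" "vl g" "dm g = \<Delta>|>B" "cd g = fob T C"
  have "Fop T A (fob T C) (\<Delta> @ \<Xi>) (una (\<mu> C) ** Fop T B (fob T C) \<Delta> g ** \<Delta>\<rhd>f) = Fop T (fob T (fob T C)) (fob T C) [] (una (\<mu> C)) ** Fop T A (fob T (fob T C)) (\<Delta> @ \<Xi>) (Fop T B (fob T C) \<Delta> g ** \<Delta>\<rhd>f)"
   by (rule comp0) (use a in simp_all)
  also have "Fop T A (fob T (fob T C)) (\<Delta> @ \<Xi>) (Fop T B (fob T C) \<Delta> g ** \<Delta>\<rhd>f) = Fop T (fob T B) (fob T (fob T C)) \<Delta> (Fop T B (fob T C) \<Delta> g) ** \<Delta>\<rhd>Fop T A (fob T B) \<Xi> f"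
   by (rule comp) (use a in simp_all)
  finally have "una (\<mu> C) ** Fop T A (fob T C) (\<Delta> @ \<Xi>) (una (\<mu> C) ** Fop T B (fob T C) \<Delta> g ** \<Delta>\<rhd>f) = una (\<mu> C) ** una (\<mu> (fob T C)) ** Fop T (fob T B) (fob T (fob T C)) \<Delta> (Fop T B (fob T C) \<Delta> g) ** \<Delta>\<rhd>Fop T A (fob T B) \<Xi> f"
   by (simp add: ar)
  also have "\<dots> = (una (\<mu> C) ** Fop T B (fob T C) \<Delta> g) ** \<Delta>\<rhd>(una (\<mu> B) ** Fop T A (fob T B) \<Xi> f)"
   using a by (simp add: N2r)
  finally show "una (\<mu> C) ** Fop T A (fob T C) (\<Delta> @ \<Xi>) ((una (\<mu> C) ** Fop T B (fob T C) \<Delta> g) ** \<Delta>\<rhd>f) = (una (\<mu> C) ** Fop T B (fob T C) \<Delta> g) ** \<Delta>\<rhd>(una (\<mu> B) ** Fop T A (fob T B) \<Xi> f)"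
   by simp
 qed (simp_all add: U1)
 { assume f: "vl f" "dm f = \<Xi>|>A" "cd f = B"
  show "Mex M A B \<Xi> (Meta M B ** f) = Fop (mfun M) A B \<Xi> f"
   unfolding M' Mex_def Meta_def vmonad.simps using f comp0[of f \<Xi> A B "una (\<eta> B)" "fob T B"] by (simp add: U1r) }
 show "Mex M (fob (mfun M) A) A [] (idt (fob (mfun M) A)) = una (mmult M A)"
  unfolding M' Mex_def vmonad.simps by simp
qed

text \<open>Conversely \<open>T f = (\<eta> f)\<^sup>*\<close> and \<open>\<mu> =
(id)\<^sup>*\<close>.\<close>

definition mkmonad :: "('o \<Rightarrow> 'o) \<Rightarrow> ('o \<Rightarrow> ('o, 'm) tarr) \<Rightarrow> ('o \<Rightarrow> 'o \<Rightarrow> ('o, 'm) oper) \<Rightarrow> ('o, 'm) vmonad" where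
 "mkmonad T \<eta> bd = \<lparr>mfun = \<lparr>fob = T, fmap = (\<lambda>A B. raw (cur (hm A B) (T A) (bd A B [hm A B] (\<eta> B ** ev A B))))\<rparr>,
  munit = (\<lambda>A. uar (\<eta> A)), mmult = (\<lambda>A. uar (bd (T A) A [] (idt (T A))))\<rparr>"

lemma mkmonad:
 assumes rm: "relmon (\<lambda>A. A) T \<eta> bd"
 shows "monad (mkmonad T \<eta> bd)" "fob (mfun (mkmonad T \<eta> bd)) = T" "Meta (mkmonad T \<eta> bd) A = \<eta> A"
  "\<lbrakk>vl f; dm f = \<Xi>|>A; cd f = B\<rbrakk> \<Longrightarrow> Fop (mfun (mkmonad T \<eta> bd)) A B \<Xi> f = bd A B \<Xi> (\<eta> B ** f)"
  "\<lbrakk>vl f; dm f = \<Xi>|>A; cd f = T B\<rbrakk> \<Longrightarrow> Mex (mkmonad T \<eta> bd) A B \<Xi> f = bd A B \<Xi> f"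
proof -
 note [simp] = relmonD(1-3,5-10)[OF rm]
 let ?M = "mkmonad T \<eta> bd"
 let ?F = "\<lparr>fob = T, fmap = (\<lambda>A B. raw (cur (hm A B) (T A) (bd A B [hm A B] (\<eta> B ** ev A B))))\<rparr>"
 have ba: "bd A C (\<Delta> @ \<Xi>) (bd B C \<Delta> g ** \<Delta>\<rhd>f) = bd B C \<Delta> g ** \<Delta>\<rhd>bd A B \<Xi> f"
  if "vl f" "dm f = \<Xi>|>A" "cd f = T B" "vl g" "dm g = \<Delta>|>B" "cd g = T C" for A B C \<Xi> \<Delta> f g
  by (rule relmonD(11)[OF rm that])
 have ba0: "bd A C \<Xi> (bd B C [] g ** f) = bd B C [] g ** bd A B \<Xi> f"
  if "vl f" "dm f = \<Xi>|>A" "cd f = T B" "vl g" "dm g = B" "cd g = T C" for A B C \<Xi> f g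
  using ba[of f \<Xi> A B g "[]" C] that by simp
 have be: "bd B C [] g ** \<eta> B ** x = g ** x" if "vl g" "dm g = B" "cd g = T C" for B C g x
  using relmonD(9)[OF rm, of g "[]" B C x] that by simp
 show T: "fob (mfun ?M) = T" by (simp add: mkmonad_def)
 have c: "vl (bd A B [hm A B] (\<eta> B ** ev A B))" "dm (bd A B [hm A B] (\<eta> B ** ev A B)) = hm A B \<otimes> T A" "cd (bd A B [hm A B] (\<eta> B ** ev A B)) = T B" for A B
  by simp_all
 have fe: "fa VV VV ?F A B = cur (hm A B) (T A) (bd A B [hm A B] (\<eta> B ** ev A B))" for A B
  using c[of A B] by (simp add: fa_def cur_def)
 have v: "vl (fa VV VV ?F A B)" for A B unfolding fe by (rule cur(1)[OF c])
 have fhe: "fh VV ?F A B = bd A B [hm A B] (\<eta> B ** ev A B)" for A B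
  unfolding fh_def fe using cur(4)[OF c, of A B] by simp
 have bn: "natop [] A B (T A) (T B) (\<lambda>\<Xi> f. bd A B \<Xi> (\<eta> B ** f))" for A B
  by (rule natopI) (simp_all add: natop_nat[OF relmonD(4)[OF rm], where f = "\<eta> B ** f" for f, simplified])
 have fo: "Fop ?F A B \<Xi> f = bd A B \<Xi> (\<eta> B ** f)" if "vl f" "dm f = \<Xi>|>A" "cd f = B" for A B \<Xi> f
  by (rule natop_eqI[OF Fop_natop(1)[OF v, simplified] bn repr_ev]) (use that Fop_natop(2)[OF v] fhe in simp_all)
 have vf: "endo ?F"
  unfolding vfunctor_Fop
 proof (intro conjI allI impI v)
  fix A B C \<Xi> \<Delta> f g assume "f \<in> \<Xi>|>A \<leadsto> B" "g \<in> \<Delta>|>B \<leadsto> C"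
  then show "Fop ?F A C (\<Delta> @ \<Xi>) (g ** \<Delta>\<rhd>f) = Fop ?F B C \<Delta> g ** \<Delta>\<rhd>Fop ?F A B \<Xi> f"
   using ba[of "\<eta> B ** f" \<Xi> A B "\<eta> C ** g" \<Delta> C] by (simp add: fo)
 qed (simp add: fo)
 let ?mu = "\<lambda>A. bd (T A) A [] (idt (T A))"
 have ue: "uar (\<eta> A) \<in> Hom UV A (T A)" "una (uar (\<eta> A)) = \<eta> A" "uar (?mu A) \<in> Hom UV (T (T A)) (T A)" "una (uar (?mu A)) = ?mu A" for A
  using uar_ty[of "\<eta> A"] una_uar[of "\<eta> A"] uar_ty[of "?mu A"] una_uar[of "?mu A"] by simp_all
 have mT: "?mu B ** bd A (T B) \<Xi> (\<eta> (T B) ** f) = bd A B \<Xi> f" if "vl f" "dm f = \<Xi>|>A" "cd f = T B" for A B \<Xi> f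
  using ba0[of "\<eta> (T B) ** f" \<Xi> A "T B" "idt (T B)" B] be[of "idt (T B)" "T B" B f] that by simp
 show "monad ?M"
  unfolding mkmonad_def is_vmonad_iff[OF vf] vfun.simps ue(2,4)
 proof (intro conjI allI impI ue(1,3))
  fix A B \<Xi> f assume "f \<in> \<Xi>|>A \<leadsto> B"
  then have f: "vl f" "dm f = \<Xi>|>A" "cd f = B" by simp_all
  show "\<eta> B ** f = Fop ?F A B \<Xi> f ** \<Xi>\<rhd>\<eta> A" using f by (simp add: fo)
  have "bd (T A) B \<Xi> (bd A B \<Xi> (\<eta> B ** f)) = bd A B \<Xi> (\<eta> B ** f) ** \<Xi>\<rhd>?mu A"
   using ba[of "idt (T A)" "[]" "T A" A "\<eta> B ** f" \<Xi> B] f by simp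
  then show "?mu B ** Fop ?F (T A) (T B) \<Xi> (Fop ?F A B \<Xi> f) = Fop ?F A B \<Xi> f ** \<Xi>\<rhd>?mu A"
   using f by (simp add: fo mT)
 next
  fix A
  show "?mu A ** Fop ?F (T (T A)) (T A) [] (?mu A) = ?mu A ** ?mu (T A)"
   using ba0[of "idt (T (T A))" "[]" "T (T A)" "T A" "idt (T A)" A] by (simp add: fo mT)
  show "?mu A ** Fop ?F A (T A) [] (\<eta> A) = idt (T A)" by (simp add: fo mT)
  show "?mu A ** \<eta> (T A) = idt (T A)" using relmonD(8)[OF rm, of "idt (T A)" "[]" "T A" A] by simp
 qed
 show "Meta ?M A = \<eta> A" by (simp add: Meta_def mkmonad_def ue)
 show "\<lbrakk>vl f; dm f = \<Xi>|>A; cd f = B\<rbrakk> \<Longrightarrow> Fop (mfun ?M) A B \<Xi> f = bd A B \<Xi> (\<eta> B ** f)"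
  by (simp add: mkmonad_def fo)
 show "\<lbrakk>vl f; dm f = \<Xi>|>A; cd f = T B\<rbrakk> \<Longrightarrow> Mex ?M A B \<Xi> f = bd A B \<Xi> f"
  by (simp add: Mex_def mkmonad_def ue fo mT)
qed

text \<open>Compatibility with the functors and multiplications amounts to compatibility with
Kleisli extension.\<close>

lemma vmonad_morphism_iff:
 assumes M: "monad M" and N: "monad N"
 shows "mmor M N \<alpha> \<longleftrightarrow> (\<forall>A. \<alpha> A \<in> Hom UV (fob (mfun M) A) (fob (mfun N) A)) \<and>
  (\<forall>A. una (\<alpha> A) ** Meta M A = Meta N A) \<and>
  (\<forall>A B \<Xi> f. f \<in> \<Xi>|>A \<leadsto> fob (mfun M) B \<longrightarrow> una (\<alpha> B) ** Mex M A B \<Xi> f = Mex N A B \<Xi> (una (\<alpha> B) ** f) ** \<Xi>\<rhd>una (\<alpha> A))"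
  (is "_ \<longleftrightarrow> ?T \<and> ?U \<and> ?E")
proof -
 let ?S = "fob (mfun M)" and ?T = "fob (mfun N)"
 note FM = vmonad_relmon(2)[OF M] and FN = vmonad_relmon(2)[OF N]
 note rM = vmonad_relmon(1)[OF M] and rN = vmonad_relmon(1)[OF N]
 note [simp] = relmonD(1-3,5-10)[OF rM] relmonD(1-3,5-10)[OF rN] FopD(3-6)[OF FM] FopD(3-6)[OF FN]
 have vn: "vnat V VV VV (mfun M) (mfun N) \<alpha> \<longleftrightarrow> (\<forall>A. \<alpha> A \<in> Hom UV (?S A) (?T A)) \<and>
  (\<forall>A B \<Xi> f. f \<in> \<Xi>|>A \<leadsto> B \<longrightarrow> una (\<alpha> B) ** Fop (mfun M) A B \<Xi> f = Fop (mfun N) A B \<Xi> f ** \<Xi>\<rhd>una (\<alpha> A))"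
  by (rule vnat_Fop[OF FM FN]) (simp_all add: FopD(2)[OF FM] FopD(2)[OF FN] Fop_natop(2)[OF FopD(1)[OF FM]] Fop_natop(2)[OF FopD(1)[OF FN]])
 show ?thesis
 proof (cases "\<forall>A. \<alpha> A \<in> Hom UV (?S A) (?T A)")
  case True
  then have h: "\<alpha> A \<in> Hom UV (?S A) (?T A)" for A by blast
  have u [simp]: "vl (una (\<alpha> A))" "dm (una (\<alpha> A)) = ?S A" "cd (una (\<alpha> A)) = ?T A" for A
   using una_ty[OF h[of A]] by simp_all
  note uM = vmonad_relmon(3,4)[OF M] and uN = vmonad_relmon(3,4)[OF N]
  have mt [simp]: "vl (una (mmult M A))" "dm (una (mmult M A)) = ?S (?S A)" "cd (una (mmult M A)) = ?S A"
   "vl (una (mmult N A))" "dm (una (mmult N A)) = ?T (?T A)" "cd (una (mmult N A)) = ?T A" for A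
   using una_ty[OF uM(2)[of A]] una_ty[OF uN(2)[of A]] by simp_all
  have eq: "\<beta> = \<gamma> \<longleftrightarrow> una \<beta> = una \<gamma>" if "\<beta> \<in> Hom UV A B" "\<gamma> \<in> Hom UV A B" for \<beta> \<gamma> A B
   using uarr_eqI[OF that] by auto
  have 1: "\<alpha> A \<cdot>\<^bsub>UV\<^esub> munit M A = munit N A \<longleftrightarrow> una (\<alpha> A) ** Meta M A = Meta N A" for A
   by (subst eq[OF UV_Comp(1)[OF h uM(1)] uN(1)]) (simp add: UV_Comp(2)[OF h uM(1)] Meta_def)
  note um = umap_una[OF FM h]
  have 2: "\<alpha> A \<cdot>\<^bsub>UV\<^esub> mmult M A = mmult N A \<cdot>\<^bsub>UV\<^esub> \<alpha> (?T A) \<cdot>\<^bsub>UV\<^esub> umap V (mfun M) (\<alpha> A) \<longleftrightarrow>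
   una (\<alpha> A) ** una (mmult M A) = una (mmult N A) ** una (\<alpha> (?T A)) ** Fop (mfun M) (?S A) (?T A) [] (una (\<alpha> A))" for A
   by (subst eq[OF UV_Comp(1)[OF h uM(2)] UV_Comp(1)[OF uN(2) UV_Comp(1)[OF h um(1)]]])
    (simp add: UV_Comp(2)[OF h uM(2)] UV_Comp(2)[OF uN(2) UV_Comp(1)[OF h um(1)]] UV_Comp(2)[OF h um(1)] um(2))
  have "mmor M N \<alpha> \<longleftrightarrow> (\<forall>A B \<Xi> f. f \<in> \<Xi>|>A \<leadsto> B \<longrightarrow> una (\<alpha> B) ** Fop (mfun M) A B \<Xi> f = Fop (mfun N) A B \<Xi> f ** \<Xi>\<rhd>una (\<alpha> A)) \<and>
   ?U \<and> (\<forall>A. una (\<alpha> A) ** una (mmult M A) = una (mmult N A) ** una (\<alpha> (?T A)) ** Fop (mfun M) (?S A) (?T A) [] (una (\<alpha> A)))"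
   (is "_ \<longleftrightarrow> ?N \<and> ?U \<and> ?m")
   unfolding vmonad_morphism_def Let_def vn 1 2 using True by blast
  also have "\<dots> \<longleftrightarrow> ?U \<and> ?E"
  proof (intro iffI conjI)
   assume a: "?N \<and> ?U \<and> ?m"
   then show ?U by blast
   have n: "una (\<alpha> B) ** Fop (mfun M) A B \<Xi> f = Fop (mfun N) A B \<Xi> f ** \<Xi>\<rhd>una (\<alpha> A)" if "vl f" "dm f = \<Xi>|>A" "cd f = B" for A B \<Xi> f
   proof -
    have "f \<in> \<Xi>|>A \<leadsto> B" using that by simp
    then show ?thesis using a by blast
   qed
   have m: "una (\<alpha> A) ** una (mmult M A) = una (mmult N A) ** una (\<alpha> (?T A)) ** Fop (mfun M) (?S A) (?T A) [] (una (\<alpha> A))" for A using a by blast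
   show ?E
   proof (intro allI impI)
    fix A B \<Xi> f assume f: "f \<in> \<Xi>|>A \<leadsto> ?S B"
    have "una (\<alpha> B) ** Mex M A B \<Xi> f = una (mmult N B) ** una (\<alpha> (?T B)) ** Fop (mfun M) (?S B) (?T B) [] (una (\<alpha> B)) ** Fop (mfun M) A (?S B) \<Xi> f"
     unfolding Mex_def using m[of B, THEN cmp_re] by simp
    also have "\<dots> = una (mmult N B) ** una (\<alpha> (?T B)) ** Fop (mfun M) A (?T B) \<Xi> (una (\<alpha> B) ** f)"
     using FopD(8)[OF FM, of f \<Xi> A "?S B" "una (\<alpha> B)" "?T B"] f by simp
    also have "\<dots> = Mex N A B \<Xi> (una (\<alpha> B) ** f) ** \<Xi>\<rhd>una (\<alpha> A)"
     using n[of "una (\<alpha> B) ** f" \<Xi> A "?T B"] f by (simp add: Mex_def)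
    finally show "una (\<alpha> B) ** Mex M A B \<Xi> f = Mex N A B \<Xi> (una (\<alpha> B) ** f) ** \<Xi>\<rhd>una (\<alpha> A)" .
   qed
  next
   assume a: "?U \<and> ?E"
   then show ?U by blast
   have e: "una (\<alpha> B) ** Mex M A B \<Xi> f = Mex N A B \<Xi> (una (\<alpha> B) ** f) ** \<Xi>\<rhd>una (\<alpha> A)" if "vl f" "dm f = \<Xi>|>A" "cd f = ?S B" for A B \<Xi> f
   proof -
    have "f \<in> \<Xi>|>A \<leadsto> ?S B" using that by simp
    then show ?thesis using a by blast
   qed
   have ua: "una (\<alpha> A) ** Meta M A ** x = Meta N A ** x" for A x using a by (metis cmp_assoc)
   show n: ?N
   proof (intro allI impI)
    fix A B \<Xi> f assume f: "f \<in> \<Xi>|>A \<leadsto> B"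
    show "una (\<alpha> B) ** Fop (mfun M) A B \<Xi> f = Fop (mfun N) A B \<Xi> f ** \<Xi>\<rhd>una (\<alpha> A)"
     using e[of "Meta M B ** f" \<Xi> A B] f by (simp add: vmonad_relmon(5)[OF M] vmonad_relmon(5)[OF N] ua)
   qed
   show ?m
   proof
    fix A
    have "una (\<alpha> A) ** una (mmult M A) = Mex N (?S A) A [] (una (\<alpha> A)) ** una (\<alpha> (?S A))"
     using e[of "idt (?S A)" "[]" "?S A" A] by (simp add: vmonad_relmon(6)[OF M])
    also have "\<dots> = una (mmult N A) ** una (\<alpha> (?T A)) ** Fop (mfun M) (?S A) (?T A) [] (una (\<alpha> A))"
     using n[rule_format, of "una (\<alpha> A)" "[]" "?S A" "?T A"] by (simp add: Mex_def)
    finally show "una (\<alpha> A) ** una (mmult M A) = una (mmult N A) ** una (\<alpha> (?T A)) ** Fop (mfun M) (?S A) (?T A) [] (una (\<alpha> A))" .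
   qed
  qed
  finally show ?thesis using True by blast
 next
  case False
  then show ?thesis unfolding vmonad_morphism_def Let_def vn by blast
 qed
qed

end

context arity
begin

section \<open>Left Kan extensions along the arities\<close>

lemma Rop_fh: "vfunctor V J VV R \<Longrightarrow> vl (fa J VV R a b)"
 unfolding jfun_Rop by blast

lemma jfun_R: "vfunctor V J VV R \<Longrightarrow> jfun (fob R) (Rop R)"
 unfolding jfun_Rop by blast

text \<open>The pointwise formula: the value of a left Kan extension at \<open>Y\<close> is the
colimit weighted by \<open>V(j-, Y)\<close>, with the cocone built from
\<open>\<gamma>\<close>.\<close>

lemma left_kan_iff:
 fixes R :: "('j, 'o, 'm) vfun"
 assumes R: "vfunctor V J VV R" and L: "endo L"
 shows "left_kan V J VV VV j R L \<gamma> \<longleftrightarrow> (\<forall>a. \<gamma> a \<in> Hom UV (fob R a) (fob L (K a))) \<and>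
  (\<forall>a b \<Xi> f. f \<in> \<Xi>|>K a \<leadsto> K b \<longrightarrow> una (\<gamma> b) ** Rop R a b \<Xi> f = Fop L (K a) (K b) \<Xi> f ** \<Xi>\<rhd>una (\<gamma> a)) \<and>
  (\<forall>Y. colim Y (fob R) (Rop R) (fob L Y) (\<lambda>a \<Xi> f. Fop L (K a) Y \<Xi> f ** \<Xi>\<rhd>una (\<gamma> a)))"
proof -
 note Rv = Rop_fh[OF R] and Lv = FopD(1)[OF L]
 note [simp] = FopD(3-5)[OF L]
 have Ljv: "vl (fa J VV (vfun_comp V L j) a b)" for a b by (rule fa_comp_vl[OF L]) simp
 have Ljn: "natop [] (K a) (K b) (fob L (K a)) (fob L (K b)) (Fop L (K a) (K b))" for a b by (rule FopD(2)[OF L])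
 have Lje: "Fop L (K a) (K b) [vhom J a b] (eJ a b) = fh J (vfun_comp V L j) a b" for a b
  using fh_compop[OF L, of J j a b] by (simp add: eJ_def)
 have vn: "vnat V J VV R (vfun_comp V L j) \<gamma> \<longleftrightarrow> (\<forall>a. \<gamma> a \<in> Hom UV (fob R a) (fob L (K a))) \<and>
  (\<forall>a b \<Xi> f. f \<in> \<Xi>|>K a \<leadsto> K b \<longrightarrow> una (\<gamma> b) ** Rop R a b \<Xi> f = Fop L (K a) (K b) \<Xi> f ** \<Xi>\<rhd>una (\<gamma> a))"
  using vnat_op[OF Rv Ljv repr_eJ Rop(1)[OF Rv] Rop(2)[OF Rv], of "\<lambda>a b. Fop L (K a) (K b)" \<gamma>] Ljn Lje by simp
 show ?thesis
 proof (cases "\<forall>a. \<gamma> a \<in> Hom UV (fob R a) (fob L (K a))")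
  case True
  then have g: "\<gamma> a \<in> Hom UV (fob R a) (fob L (K a))" for a by blast
  have gt [simp]: "vl (una (\<gamma> a))" "dm (una (\<gamma> a)) = fob R a" "cd (una (\<gamma> a)) = fob L (K a)" for a
   using una_ty[OF g[of a]] by simp_all
  have ge: "vl (elA (\<gamma> a))" "fst (\<gamma> a) = fob R a" "snd (snd (\<gamma> a)) = fob L (K a)" for a
   using g[of a] unfolding UV_Hom by auto
  have w: "weighted_colimit V J VV (vrep_along V VV j Y) R (fob L Y)
    (\<lambda>a. uname V (vhom VV (K a) Y) (vhom VV (fob R a) (fob L Y))
     (vcomp VV (fob R a) (fob L (K a)) (fob L Y) \<cdot> (fmap L (K a) Y \<odot> elt (\<gamma> a)) \<cdot> run_inv V (vhom VV (K a) Y)))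
   \<longleftrightarrow> colim Y (fob R) (Rop R) (fob L Y) (\<lambda>a \<Xi> f. Fop L (K a) Y \<Xi> f ** \<Xi>\<rhd>una (\<gamma> a))" (is "weighted_colimit _ _ _ _ _ _ ?cyl \<longleftrightarrow> _") for Y
  proof (rule wcolim_iff[OF Rv])
   fix a
   let ?P = "hm (K a) Y"
   let ?t = "cc VV (fob R a) (fob L (K a)) (fob L Y) ** (fa VV VV L (K a) Y \<boxtimes> elA (\<gamma> a)) ** rui ?P"
   have t: "vl ?t" "dm ?t = ?P" "cd ?t = hm (fob R a) (fob L Y)" using ge Lv by simp_all
   have ti: "?t \<in> ?P \<leadsto> hm (fob R a) (fob L Y)" by (simp only: Ar_iff t)
   have c: "?cyl a = uar ?t"
   proof -
    have "raw (elA (\<gamma> a)) = elt (\<gamma> a)" "raw (rui ?P) = run_inv V ?P" by (simp_all add: elA_def raw_struct)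
    then show ?thesis using t ge Lv by (simp add: uar_def raw_cmp raw_tns)
   qed
   show "natop [] (K a) Y (fob R a) (fob L Y) (\<lambda>\<Xi> f. Fop L (K a) Y \<Xi> f ** \<Xi>\<rhd>una (\<gamma> a))"
    by (rule natop_cong[THEN iffD1, rotated, OF natop_postpre[OF FopD(2)[OF L, of "K a" Y], where h = "idt (fob L Y)" and B'' = "fob L Y" and k = "una (\<gamma> a)" and A'' = "fob R a"]])
     simp_all
   show "?cyl a \<in> Hom UV (hm (K a) Y) (hm (fob R a) (fob L Y))"
    unfolding c by (rule uar_ty[OF ti])
   have u: "una (?cyl a) = ?t" unfolding c by (rule una_uar[OF ti])
   have "ev (fob R a) (fob L Y) ** (?t\<lhd>(fob R a)) =
    (ev (fob R a) (fob L Y) ** ((cc VV (fob R a) (fob L (K a)) (fob L Y) ** (fa VV VV L (K a) Y \<boxtimes> elA (\<gamma> a)))\<lhd>(fob R a))) ** (rui ?P\<lhd>(fob R a))"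
    using ge Lv by simp
   also have "\<dots> = fh VV L (K a) Y ** [?P]\<rhd>una (\<gamma> a) ** ([?P]\<rhd>lu (fob R a) ** alp ?P \<one> (fob R a)) ** (rui ?P\<lhd>(fob R a))"
    using una_ev[of "\<gamma> a"] by (subst ev_cc_tns) (simp_all add: ge Lv fh_def[symmetric] fh_simps)
   also have "\<dots> = fh VV L (K a) Y ** [?P]\<rhd>una (\<gamma> a)"
    using triangle[of ?P "fob R a"] by (simp add: tns_cmp fh_simps Lv)
   finally show "Fop L (K a) Y [?P] (ev (K a) Y) ** [?P]\<rhd>una (\<gamma> a) = ev (fob R a) (fob L Y) ** (una (?cyl a)\<lhd>(fob R a))"
    unfolding u Fop_natop(2)[OF Lv] by simp
  qed
  show ?thesis unfolding left_kan_def vn w using L by blast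
 next
  case False
  then show ?thesis unfolding left_kan_def vn by blast
 qed
qed

lemma colim_lam_cong:
 assumes "\<And>b \<Xi> f. \<lbrakk>vl f; dm f = \<Xi>|>K b; cd f = Y\<rbrakk> \<Longrightarrow> lam b \<Xi> f = lam' b \<Xi> f"
 shows "colim Y R Rm L lam \<longleftrightarrow> colim Y R Rm L lam'"
proof -
 have n: "natop [] (K b) Y (R b) L (lam b) \<longleftrightarrow> natop [] (K b) Y (R b) L (lam' b)" for b
  by (rule natop_cong) (use assms in simp)
 have "cocone [] Y R Rm L lam \<longleftrightarrow> cocone [] Y R Rm L lam'"
  unfolding cocone_def n using assms by simp
 moreover have "(f \<in> \<Xi>|>K b \<leadsto> Y \<longrightarrow> \<beta> b \<Xi> f = h ** U\<rhd>lam b \<Xi> f) \<longleftrightarrow> (f \<in> \<Xi>|>K b \<leadsto> Y \<longrightarrow> \<beta> b \<Xi> f = h ** U\<rhd>lam' b \<Xi> f)" for b \<Xi> f \<beta> h U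
  using assms[of f \<Xi> b] by auto
 ultimately show ?thesis unfolding colim_def by simp
qed

lemma jfun_K: "jfun K (\<lambda>a b \<Xi> f. f)"
 by (simp add: jfun_def natop_id)

text \<open>The arities are dense: every object is the colimit of the arities weighted by its
points. Already the unit arity suffices to recover an arrow out of \<open>Y\<close> from a
cocone.\<close>

lemma dense: "colim Y K (\<lambda>a b \<Xi> f. f) Y (\<lambda>b \<Xi> f. f)"
 unfolding colim_def
proof (intro conjI allI impI)
 show "cocone [] Y K (\<lambda>a b \<Xi> f. f) Y (\<lambda>b \<Xi> f. f)" by (rule coconeI) (simp_all add: natop_id)
 fix U Z \<beta> assume c: "cocone U Y K (\<lambda>a b \<Xi> f. f) Z \<beta>"
 note [simp] = coconeD(2-4)[OF c]
 let ?h = "\<beta> i0 [Y] (rr Y) ** U\<rhd>rri Y"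
 have e: "\<beta> b \<Xi> f = ?h ** U\<rhd>f" if f: "vl f" "dm f = \<Xi>|>K b" "cd f = Y" for b \<Xi> f
 proof -
  have "\<beta> b \<Xi> f ** U\<rhd>\<Xi>\<rhd>rr (K b) = \<beta> i0 (\<Xi> @ [K b]) (f ** \<Xi>\<rhd>rr (K b))"
   using coconeD(5)[OF c, of "rr (K b)" "[K b]" i0 b f \<Xi>] f by simp
  also have "f ** \<Xi>\<rhd>rr (K b) = rr Y ** rw \<Xi> (K b) f (K i0)" by (rule rr_nat[symmetric]) (use f in simp_all)
  also have "\<beta> i0 (\<Xi> @ [K b]) (rr Y ** rw \<Xi> (K b) f (K i0)) = \<beta> i0 [Y] (rr Y) ** U\<rhd>rw \<Xi> (K b) f (K i0)"
   using natop_nat[OF coconeD(1)[OF c] ctx_rw, of f \<Xi> "K b" Y "rr Y" i0] f by simp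
  also have "\<dots> = \<beta> i0 [Y] (rr Y) ** U\<rhd>(rri Y ** rr Y ** rw \<Xi> (K b) f (K i0))" using f by (simp del: wa_cmp)
  also have "\<dots> = (?h ** U\<rhd>f) ** U\<rhd>\<Xi>\<rhd>rr (K b)" unfolding rr_nat[OF f] using f by simp
  finally have e: "\<beta> b \<Xi> f ** (U @ \<Xi>)\<rhd>rr (K b) = (?h ** U\<rhd>f) ** (U @ \<Xi>)\<rhd>rr (K b)" by simp
  show ?thesis by (rule iso_epi[OF e wa_inv[OF rr_simps(7)]]) (use f in simp_all)
 qed
 show "\<exists>!h. h \<in> U|>Y \<leadsto> Z \<and> (\<forall>b \<Xi> f. f \<in> \<Xi>|>K b \<leadsto> Y \<longrightarrow> \<beta> b \<Xi> f = h ** U\<rhd>f)"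
 proof (rule ex1I[of _ ?h])
  show "?h \<in> U|>Y \<leadsto> Z \<and> (\<forall>b \<Xi> f. f \<in> \<Xi>|>K b \<leadsto> Y \<longrightarrow> \<beta> b \<Xi> f = ?h ** U\<rhd>f)"
   by (intro conjI allI impI, simp) (rule e, simp_all)
  fix h assume h: "h \<in> U|>Y \<leadsto> Z \<and> (\<forall>b \<Xi> f. f \<in> \<Xi>|>K b \<leadsto> Y \<longrightarrow> \<beta> b \<Xi> f = h ** U\<rhd>f)"
  have "rr Y \<in> [Y]|>K i0 \<leadsto> Y" by simp
  then have "\<beta> i0 [Y] (rr Y) = h ** U\<rhd>rr Y" using h by blast
  then show "h = ?h" using h wa_inv[OF rr_simps(7), of Y U] by simp
 qed
qed

text \<open>The identity functor is the left Kan extension of \<open>j\<close> along itself by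
density. A \<open>\<J>\<close>-ary functor preserves this, so that its values are colimits of its
values at arities.\<close>

lemma ary_colim:
 assumes F: "ary F"
 shows "colim Y (\<lambda>b. fob F (K b)) (\<lambda>a b. Fop F (K a) (K b)) (fob F Y) (\<lambda>b. Fop F (K b) Y)"
proof -
 have Fv: "endo F" and p: "preserves_left_kan V J VV VV VV j F"
  using F unfolding J_ary_def by auto
 note [simp] = FopD(3-6)[OF Fv]
 let ?K = "Rv K (\<lambda>a b \<Xi> f. f)" and ?I = "vfun_id V VV" and ?g = "\<lambda>a. uar (idt (K a))"
 note Kv = Rv[OF jfun_K]
 have I: "endo ?I" by (rule vfunctor_id[OF vcat_vself])
 have g: "?g a \<in> Hom UV (K a) (K a)" "una (?g a) = idt (K a)" for a
  using uar_ty[of "idt (K a)"] una_uar[of "idt (K a)"] by simp_all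
 have "left_kan V J VV VV j ?K ?I ?g"
  unfolding left_kan_iff[OF Kv(5) I] Kv(2) vfun_id_fob g(2)
 proof (intro conjI allI impI g(1))
  fix a b \<Xi> f assume "f \<in> \<Xi>|>K a \<leadsto> K b"
  then show "idt (K b) ** Rop ?K a b \<Xi> f = Fop ?I (K a) (K b) \<Xi> f ** \<Xi>\<rhd>idt (K a)"
   by (simp add: Kv(4) Fop_id)
 next
  fix Y
  have "colim Y K (\<lambda>a b \<Xi> f. f) Y (\<lambda>a \<Xi> f. Fop ?I (K a) Y \<Xi> f ** \<Xi>\<rhd>idt (K a))"
   using dense[of Y] by (subst (asm) colim_lam_cong) (simp_all add: Fop_id)
  then show "colim Y K (Rop ?K) Y (\<lambda>a \<Xi> f. Fop ?I (K a) Y \<Xi> f ** \<Xi>\<rhd>idt (K a))"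
   by (subst colim_cong[where Rm' = "\<lambda>a b \<Xi> f. f"]) (simp_all add: Kv(4))
 qed
 then have l: "left_kan V J VV VV j (vfun_comp V F ?K) (vfun_comp V F ?I) (\<lambda>a. umap V F (?g a))"
  using p Kv(5) unfolding preserves_left_kan_def by blast
 have FK: "vfunctor V J VV (vfun_comp V F ?K)" by (rule vfunctor_comp[OF Kv(5) Fv vcat_J vcat_vself vcat_vself])
 have FI: "endo (vfun_comp V F ?I)" by (rule vfunctor_comp[OF I Fv vcat_vself vcat_vself vcat_vself])
 note um = umap_una[OF Fv g(1)]
 have c: "colim Y (\<lambda>b. fob F (K b)) (Rop (vfun_comp V F ?K)) (fob F Y) (\<lambda>a \<Xi> f. Fop (vfun_comp V F ?I) (K a) Y \<Xi> f ** \<Xi>\<rhd>una (umap V F (?g a)))"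
  using l unfolding left_kan_iff[OF FK FI] by (simp add: Kv(2))
 have r: "Rop (vfun_comp V F ?K) a b \<Xi> f = Fop F (K a) (K b) \<Xi> f" if f: "vl f" "dm f = \<Xi>|>K a" "cd f = K b" for a b \<Xi> f
 proof -
  have v: "vl (fa J VV (vfun_comp V F ?K) a b)" by (rule fa_comp_vl[OF Fv Kv(1)])
  show ?thesis
   by (rule natop_eqI[OF Rop(1)[OF v, unfolded vfun_comp_fob Kv(2)] FopD(2)[OF Fv] repr_eJ])
    (use f in \<open>simp_all add: Rop(2)[OF v] fh_compop[OF Fv Kv(1)] Kv(2,3)\<close>)
 qed
 have i: "Fop (vfun_comp V F ?I) A B \<Xi> f = Fop F A B \<Xi> f" if f: "vl f" "dm f = \<Xi>|>A" "cd f = B" for A B \<Xi> f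
 proof -
  have v: "vl (fa VV VV (vfun_comp V F ?I) A B)" by (rule FopD(1)[OF FI])
  have e: "fh VV ?I A B = ev A B" by (simp add: fh_def fa_id)
  show ?thesis
   by (rule natop_eqI[OF Fop_natop(1)[OF v, unfolded vfun_comp_fob vfun_id_fob] FopD(2)[OF Fv] repr_ev])
    (use f in \<open>simp_all add: Fop_natop(2)[OF v] fh_compop[OF Fv FopD(1)[OF I]] e\<close>)
 qed
 have "colim Y (\<lambda>b. fob F (K b)) (Rop (vfun_comp V F ?K)) (fob F Y) (\<lambda>a. Fop F (K a) Y)"
  using c by (subst (asm) colim_lam_cong[where lam' = "\<lambda>a. Fop F (K a) Y"]) (simp_all add: i um(2) g(2))
 then show ?thesis
  by (subst (asm) colim_cong[where Rm' = "\<lambda>a b. Fop F (K a) (K b)"]) (simp_all add: r)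
qed

lemma ary_jfun:
 assumes F: "endo F"
 shows "jfun (\<lambda>b. fob F (K b)) (\<lambda>a b. Fop F (K a) (K b))"
 unfolding jfun_def using FopD(2,6,7)[OF F] by simp

end

context relext
begin

text \<open>Preservation of Kan extensions is preservation of the colimits in
\<open>left_kan_iff\<close>.\<close>

lemma J_ary_T: "ary (mfun (mkmonad T etaT bnd))"
proof -
 note mk = mkmonad[OF relmon_T]
 let ?F = "mfun (mkmonad T etaT bnd)"
 have Fv: "endo ?F" by (rule vmonad_relmon(2)[OF mk(1)])
 have fo: "Fop ?F A B \<Xi> f = Tm A B \<Xi> f" if "vl f" "dm f = \<Xi>|>A" "cd f = B" for A B \<Xi> f
  unfolding Tm_def by (rule mk(4)[OF that])
 have "left_kan V J VV VV j (vfun_comp V ?F R) (vfun_comp V ?F L) (\<lambda>a. umap V ?F (\<gamma> a))"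
  if R: "vfunctor V J VV R" and k: "left_kan V J VV VV j R L \<gamma>" for R L \<gamma>
 proof -
  have L: "endo L" using k unfolding left_kan_def by blast
  note Rv = Rop_fh[OF R]
  note kk = k[unfolded left_kan_iff[OF R L]]
  have g: "\<gamma> a \<in> Hom UV (fob R a) (fob L (K a))" for a using kk by blast
  have gt [simp]: "vl (una (\<gamma> a))" "dm (una (\<gamma> a)) = fob R a" "cd (una (\<gamma> a)) = fob L (K a)" for a
   using una_ty[OF g[of a]] by simp_all
  have gn: "una (\<gamma> b) ** Rop R a b \<Xi> f = Fop L (K a) (K b) \<Xi> f ** \<Xi>\<rhd>una (\<gamma> a)" if "f \<in> \<Xi>|>K a \<leadsto> K b" for a b \<Xi> f
   using kk that by blast
  note jR = jfun_R[OF R]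
  note [simp] = FopD(3-6)[OF L] jfunD(2-4)[OF jR]
  note um = umap_una[OF Fv g, unfolded mk(2)]
  have FR: "vfunctor V J VV (vfun_comp V ?F R)" by (rule vfunctor_comp[OF R Fv vcat_J vcat_vself vcat_vself])
  have FL: "endo (vfun_comp V ?F L)" by (rule vfunctor_comp[OF L Fv vcat_vself vcat_vself vcat_vself])
  have oR: "fob (vfun_comp V ?F R) = (\<lambda>b. T (fob R b))" "fob (vfun_comp V ?F L) = (\<lambda>b. T (fob L b))" by (simp_all add: mk(2))
  have r: "Rop (vfun_comp V ?F R) a b \<Xi> f = Tm (fob R a) (fob R b) \<Xi> (Rop R a b \<Xi> f)" if f: "vl f" "dm f = \<Xi>|>K a" "cd f = K b" for a b \<Xi> f
  proof -
   have v: "vl (fa J VV (vfun_comp V ?F R) a b)" by (rule fa_comp_vl[OF Fv Rv])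
   have "Rop (vfun_comp V ?F R) a b \<Xi> f = Fop ?F (fob R a) (fob R b) \<Xi> (Rop R a b \<Xi> f)"
    by (rule natop_eqI[OF Rop(1)[OF v, unfolded vfun_comp_fob] natop_Fop[OF Fv jfunD(1)[OF jR] refl] repr_eJ])
     (use f in \<open>simp_all add: Rop(2)[OF v] fh_compop[OF Fv Rv] Rop(2)[OF Rv]\<close>)
   then show ?thesis using fo[of "Rop R a b \<Xi> f" \<Xi> "fob R a" "fob R b"] f by simp
  qed
  have l: "Fop (vfun_comp V ?F L) A B \<Xi> f = Tm (fob L A) (fob L B) \<Xi> (Fop L A B \<Xi> f)" if f: "vl f" "dm f = \<Xi>|>A" "cd f = B" for A B \<Xi> f
  proof -
   have v: "vl (fa VV VV (vfun_comp V ?F L) A B)" by (rule FopD(1)[OF FL])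
   have "Fop (vfun_comp V ?F L) A B \<Xi> f = Fop ?F (fob L A) (fob L B) \<Xi> (Fop L A B \<Xi> f)"
    by (rule natop_eqI[OF Fop_natop(1)[OF v, unfolded vfun_comp_fob] natop_Fop[OF Fv FopD(2)[OF L] refl] repr_ev])
     (use f in \<open>simp_all add: Fop_natop(2)[OF v] fh_compop[OF Fv FopD(1)[OF L]] Fop_natop(2)[OF FopD(1)[OF L]]\<close>)
   then show ?thesis using fo[of "Fop L A B \<Xi> f" \<Xi> "fob L A" "fob L B"] f by simp
  qed
  have ug: "una (umap V ?F (\<gamma> a)) = Tm (fob R a) (fob L (K a)) [] (una (\<gamma> a))" for a
   using um(2)[of a] fo[of "una (\<gamma> a)" "[]" "fob R a" "fob L (K a)"] by simp
  have TL: "Tm (fob L A) (fob L B) \<Xi> f ** \<Xi>\<rhd>Tm C (fob L A) [] h = Tm C (fob L B) \<Xi> (f ** \<Xi>\<rhd>h)"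
   if "vl f" "dm f = \<Xi>|>fob L A" "cd f = fob L B" "vl h" "dm h = C" "cd h = fob L A" for A B C \<Xi> f h
   using Tm_cmp[of h "[]" C "fob L A" f \<Xi> "fob L B"] that by simp
  show ?thesis
   unfolding left_kan_iff[OF FR FL] oR ug
  proof (intro conjI allI impI um(1))
   fix a b \<Xi> f assume f: "f \<in> \<Xi>|>K a \<leadsto> K b"
   have "Tm (fob R b) (fob L (K b)) [] (una (\<gamma> b)) ** Tm (fob R a) (fob R b) \<Xi> (Rop R a b \<Xi> f) = Tm (fob R a) (fob L (K b)) \<Xi> (una (\<gamma> b) ** Rop R a b \<Xi> f)"
    using Tm_cmp[of "Rop R a b \<Xi> f" \<Xi> "fob R a" "fob R b" "una (\<gamma> b)" "[]" "fob L (K b)"] f by simp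
   also have "\<dots> = Tm (fob L (K a)) (fob L (K b)) \<Xi> (Fop L (K a) (K b) \<Xi> f) ** \<Xi>\<rhd>Tm (fob R a) (fob L (K a)) [] (una (\<gamma> a))"
    unfolding gn[OF f] by (rule TL[symmetric]) (use f in simp_all)
   finally show "Tm (fob R b) (fob L (K b)) [] (una (\<gamma> b)) ** Rop (vfun_comp V ?F R) a b \<Xi> f = Fop (vfun_comp V ?F L) (K a) (K b) \<Xi> f ** \<Xi>\<rhd>Tm (fob R a) (fob L (K a)) [] (una (\<gamma> a))"
    using f by (simp add: r l)
  next
   fix Y
   have "colim Y (fob R) (Rop R) (fob L Y) (\<lambda>a \<Xi> f. Fop L (K a) Y \<Xi> f ** \<Xi>\<rhd>una (\<gamma> a))" using kk by blast
   from T_ary[OF jR this]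
   have "colim Y (\<lambda>b. T (fob R b)) (\<lambda>a b \<Xi> f. Tm (fob R a) (fob R b) \<Xi> (Rop R a b \<Xi> f)) (T (fob L Y))
    (\<lambda>a \<Xi> f. Fop (vfun_comp V ?F L) (K a) Y \<Xi> f ** \<Xi>\<rhd>Tm (fob R a) (fob L (K a)) [] (una (\<gamma> a)))"
    by (subst (asm) colim_lam_cong) (simp_all add: l TL)
   then show "colim Y (\<lambda>b. T (fob R b)) (Rop (vfun_comp V ?F R)) (T (fob L Y))
    (\<lambda>a \<Xi> f. Fop (vfun_comp V ?F L) (K a) Y \<Xi> f ** \<Xi>\<rhd>Tm (fob R a) (fob L (K a)) [] (una (\<gamma> a)))"
    by (subst colim_cong[where Rm' = "\<lambda>a b \<Xi> f. Tm (fob R a) (fob R b) \<Xi> (Rop R a b \<Xi> f)"]) (simp_all add: r)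
  qed
 qed
 then show ?thesis unfolding J_ary_def preserves_left_kan_def using Fv by blast
qed

end

context arity
begin

section \<open>Morphisms of relative monads and of monads\<close>

text \<open>A family of operations compatible with units and Kleisli composition is composition with
a morphism: its value at the arity \<open>i0\<close>, in a context consisting of \<open>S b\<close>,
is that morphism. This is Yoneda with the unit arity as test object.\<close>

lemma relmon_morphism:
 assumes rm: "relmon K S \<eta> ex" and rm': "relmon K S' \<eta>' ex'"
  and n: "\<And>a b. natop [] (K a) (S b) (K a) (S' b) (\<phi> a b)"
  and e: "\<And>a b \<Xi> f. \<lbrakk>vl f; dm f = \<Xi>|>K a; cd f = K b\<rbrakk> \<Longrightarrow> \<phi> a b \<Xi> (\<eta> b ** f) = \<eta>' b ** f"
  and c: "\<And>a b d \<Xi> \<Delta> f g. \<lbrakk>vl f; dm f = \<Xi>|>K a; cd f = S b; vl g; dm g = \<Delta>|>K b; cd g = S d\<rbrakk> \<Longrightarrow>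
   \<phi> a d (\<Delta> @ \<Xi>) (ex b d \<Delta> g ** \<Delta>\<rhd>f) = ex' b d \<Delta> (\<phi> b d \<Delta> g) ** \<Delta>\<rhd>\<phi> a b \<Xi> f"
 shows "\<exists>\<alpha>. (\<forall>b. \<alpha> b \<in> S b \<leadsto> S' b) \<and> (\<forall>a b \<Xi> f. f \<in> \<Xi>|>K a \<leadsto> S b \<longrightarrow> \<phi> a b \<Xi> f = \<alpha> b ** f) \<and>
  (\<forall>b. \<alpha> b ** \<eta> b = \<eta>' b) \<and> (\<forall>a b \<Xi> f. f \<in> \<Xi>|>K a \<leadsto> S b \<longrightarrow> \<alpha> b ** ex a b \<Xi> f = ex' a b \<Xi> (\<alpha> b ** f) ** \<Xi>\<rhd>\<alpha> a)"
proof -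
 note [simp] = relmonD(1-3,5-10)[OF rm] relmonD(1-3,5-10)[OF rm'] natop_tys[OF n, simplified]
 define \<alpha> where "\<alpha> b = \<phi> i0 b [S b] (rr (S b)) ** rri (S b)" for b
 have \<alpha> [simp]: "vl (\<alpha> b)" "dm (\<alpha> b) = S b" "cd (\<alpha> b) = S' b" for b by (simp_all add: \<alpha>_def)
 have \<alpha>r: "\<phi> i0 b [S b] (rr (S b)) = \<alpha> b ** rr (S b)" for b by (simp add: \<alpha>_def)
 have p: "\<phi> a b \<Xi> f = \<alpha> b ** f" if f: "vl f" "dm f = \<Xi>|>K a" "cd f = S b" for a b \<Xi> f
 proof -
  have "\<phi> a b \<Xi> f ** \<Xi>\<rhd>rr (K a) = ex' a b \<Xi> (\<phi> a b \<Xi> f) ** \<Xi>\<rhd>\<phi> i0 a [K a] (\<eta> a ** rr (K a))"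
   using e[of "rr (K a)" "[K a]" i0 a] f by simp
  also have "\<dots> = \<phi> i0 b (\<Xi> @ [K a]) (ex a b \<Xi> f ** \<Xi>\<rhd>(\<eta> a ** rr (K a)))"
   by (rule c[symmetric]) (use f in simp_all)
  also have "ex a b \<Xi> f ** \<Xi>\<rhd>(\<eta> a ** rr (K a)) = rr (S b) ** rw \<Xi> (K a) f (K i0)"
   using rr_nat[OF f] f by simp
  also have "\<phi> i0 b (\<Xi> @ [K a]) (rr (S b) ** rw \<Xi> (K a) f (K i0)) = \<phi> i0 b [S b] (rr (S b)) ** rw \<Xi> (K a) f (K i0)"
   using natop_nat[OF n ctx_rw, of f \<Xi> "K a" "S b" "rr (S b)" i0 b] f by simp
  also have "\<dots> = (\<alpha> b ** f) ** \<Xi>\<rhd>rr (K a)"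
   unfolding \<alpha>r using rr_nat[OF f] by simp
  finally show ?thesis
   by (rule iso_epi[OF _ wa_inv[OF rr_simps(7)]]) (use f in simp_all)
 qed
 have u: "\<alpha> b ** \<eta> b = \<eta>' b" for b
  using p[of "\<eta> b" "[]" b b] e[of "idt (K b)" "[]" b b] by simp
 have x: "\<alpha> b ** ex a b \<Xi> f = ex' a b \<Xi> (\<alpha> b ** f) ** \<Xi>\<rhd>\<alpha> a" if f: "vl f" "dm f = \<Xi>|>K a" "cd f = S b" for a b \<Xi> f
 proof -
  have "\<alpha> b ** ex a b \<Xi> f ** \<Xi>\<rhd>rr (S a) = \<phi> i0 b (\<Xi> @ [S a]) (ex a b \<Xi> f ** \<Xi>\<rhd>rr (S a))"
   using p[of "ex a b \<Xi> f ** \<Xi>\<rhd>rr (S a)" "\<Xi> @ [S a]" i0 b] f by simp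
  also have "\<dots> = ex' a b \<Xi> (\<phi> a b \<Xi> f) ** \<Xi>\<rhd>\<phi> i0 a [S a] (rr (S a))"
   by (rule c) (use f in simp_all)
  finally have e: "(\<alpha> b ** ex a b \<Xi> f) ** \<Xi>\<rhd>rr (S a) = (ex' a b \<Xi> (\<alpha> b ** f) ** \<Xi>\<rhd>\<alpha> a) ** \<Xi>\<rhd>rr (S a)"
   unfolding \<alpha>r p[OF f] using f by simp
  show ?thesis by (rule iso_epi[OF e wa_inv[OF rr_simps(7)]]) (use f in simp_all)
 qed
 show ?thesis using \<alpha> p u x by (intro exI[of _ \<alpha>]) simp
qed

lemma relmon_restrict:
 assumes "relmon (\<lambda>A. A) T \<eta> ex"
 shows "relmon K (\<lambda>a. T (K a)) (\<lambda>a. \<eta> (K a)) (\<lambda>a b. ex (K a) (K b))"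
 by (rule relmonI) (use relmonD[OF assms] in simp_all)

end

context earity
begin

text \<open>The components of a morphism at arities determine it, because \<open>T Y\<close> is a
colimit of the \<open>T (K b)\<close>.\<close>

lemma morphism_eq:
 assumes M: "monad M" "ary (mfun M)" and N: "monad N"
  and a: "mmor M N \<alpha>" and b: "mmor M N \<beta>"
  and e: "\<And>x. una (\<alpha> (K x)) = una (\<beta> (K x))"
 shows "\<alpha> = \<beta>"
proof
 fix Y
 note FM = vmonad_relmon(2)[OF M(1)] and FN = vmonad_relmon(2)[OF N]
 note [simp] = relmonD(1-3,5-10)[OF vmonad_relmon(1)[OF M(1)]] relmonD(1-3,5-10)[OF vmonad_relmon(1)[OF N]] FopD(3-6)[OF FM] FopD(3-6)[OF FN]
 have t: "\<alpha> A \<in> Hom UV (fob (mfun M) A) (fob (mfun N) A)" and nt: "\<lbrakk>vl f; dm f = \<Xi>|>A; cd f = B\<rbrakk> \<Longrightarrow> una (\<alpha> B) ** Fop (mfun M) A B \<Xi> f = Fop (mfun N) A B \<Xi> f ** \<Xi>\<rhd>una (\<alpha> A)"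
  if m: "mmor M N \<alpha>" for \<alpha> A B \<Xi> f
 proof -
  note mm = m[unfolded vmonad_morphism_iff[OF M(1) N]]
  show "\<alpha> A \<in> Hom UV (fob (mfun M) A) (fob (mfun N) A)" for A using mm by blast
  then have u [simp]: "vl (una (\<alpha> A))" "dm (una (\<alpha> A)) = fob (mfun M) A" "cd (una (\<alpha> A)) = fob (mfun N) A" for A
   using una_ty[of "\<alpha> A"] by auto
  assume f: "vl f" "dm f = \<Xi>|>A" "cd f = B"
  then have "Meta M B ** f \<in> \<Xi>|>A \<leadsto> fob (mfun M) B" by simp
  then have "una (\<alpha> B) ** Mex M A B \<Xi> (Meta M B ** f) = Mex N A B \<Xi> (una (\<alpha> B) ** Meta M B ** f) ** \<Xi>\<rhd>una (\<alpha> A)" using mm by blast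
  moreover have "una (\<alpha> B) ** Meta M B ** f = Meta N B ** f" using mm by (metis cmp_assoc)
  ultimately show "una (\<alpha> B) ** Fop (mfun M) A B \<Xi> f = Fop (mfun N) A B \<Xi> f ** \<Xi>\<rhd>una (\<alpha> A)"
   using f by (simp add: vmonad_relmon(5)[OF M(1)] vmonad_relmon(5)[OF N])
 qed
 have "una (\<alpha> Y) = una (\<beta> Y)"
 proof (rule colim_eq[OF ary_colim[OF M(2)] ary_jfun[OF FM], where U = "[]"])
  fix b \<Xi> f assume f: "vl f" "dm f = \<Xi>|>K b" "cd f = Y"
  show "una (\<alpha> Y) ** []\<rhd>Fop (mfun M) (K b) Y \<Xi> f = una (\<beta> Y) ** []\<rhd>Fop (mfun M) (K b) Y \<Xi> f"
   using nt[OF a f] nt[OF b f] e[of b] by simp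
 qed (use una_ty[OF t[OF a, of Y]] una_ty[OF t[OF b, of Y]] in simp_all)
 then show "\<alpha> Y = \<beta> Y" by (rule uarr_eqI[OF t[OF a] t[OF b]])
qed

text \<open>The components at arities induce \<open>h Y : T Y \<rightarrow> T' Y\<close> by the same
colimit. Compatibility with extensions is proved first for arrows out of arities, where flatness
reduces it to arrows that factor through some \<open>T (K c)\<close>, and then for all arrows by the
universal property of \<open>T A\<close>.\<close>

lemma morphism_ext:
 assumes M: "monad M" "ary (mfun M)" and N: "monad N"
  and \<alpha>: "\<And>b. \<alpha> b \<in> fob (mfun M) (K b) \<leadsto> fob (mfun N) (K b)" "\<And>b. \<alpha> b ** Meta M (K b) = Meta N (K b)"
  and \<alpha>x: "\<And>a b \<Xi> f. f \<in> \<Xi>|>K a \<leadsto> fob (mfun M) (K b) \<Longrightarrow> \<alpha> b ** Mex M (K a) (K b) \<Xi> f = Mex N (K a) (K b) \<Xi> (\<alpha> b ** f) ** \<Xi>\<rhd>\<alpha> a"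
 shows "\<exists>\<beta>. mmor M N \<beta> \<and> (\<forall>b. una (\<beta> (K b)) = \<alpha> b)"
proof -
 let ?T = "fob (mfun M)" and ?T' = "fob (mfun N)"
 let ?t = "Fop (mfun M)" and ?t' = "Fop (mfun N)" and ?x = "Mex M" and ?x' = "Mex N" and ?e = "Meta M" and ?e' = "Meta N"
 note FM = vmonad_relmon(2)[OF M(1)] and FN = vmonad_relmon(2)[OF N]
 note rM = vmonad_relmon(1)[OF M(1)] and rN = vmonad_relmon(1)[OF N]
 note [simp] = relmonD(1-3,5-10)[OF rM] relmonD(1-3,5-10)[OF rN] FopD(3-6)[OF FM] FopD(3-6)[OF FN]
 have at [simp]: "vl (\<alpha> b)" "dm (\<alpha> b) = ?T (K b)" "cd (\<alpha> b) = ?T' (K b)" for b using \<alpha>(1)[of b] by simp_all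
 note tx = vmonad_relmon(5)[OF M(1)] and tx' = vmonad_relmon(5)[OF N]
 have xt: "?x A C (\<Delta> @ \<Xi>) (?t B C \<Delta> g ** \<Delta>\<rhd>f) = ?t B C \<Delta> g ** \<Delta>\<rhd>?x A B \<Xi> f"
  if "vl f" "dm f = \<Xi>|>A" "cd f = ?T B" "vl g" "dm g = \<Delta>|>B" "cd g = C" for A B C \<Xi> \<Delta> f g
  using relmonD(11)[OF rM, of f \<Xi> A B "?e C ** g" \<Delta> C] that by (simp add: tx)
 have xt': "?x' A C (\<Delta> @ \<Xi>) (?t' B C \<Delta> g ** \<Delta>\<rhd>f) = ?t' B C \<Delta> g ** \<Delta>\<rhd>?x' A B \<Xi> f"
  if "vl f" "dm f = \<Xi>|>A" "cd f = ?T' B" "vl g" "dm g = \<Delta>|>B" "cd g = C" for A B C \<Xi> \<Delta> f g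
  using relmonD(11)[OF rN, of f \<Xi> A B "?e' C ** g" \<Delta> C] that by (simp add: tx')
 have xp: "?x A C (\<Delta> @ \<Xi>) (g ** \<Delta>\<rhd>f) = ?x B C \<Delta> g ** \<Delta>\<rhd>?t A B \<Xi> f"
  if "vl f" "dm f = \<Xi>|>A" "cd f = B" "vl g" "dm g = \<Delta>|>B" "cd g = ?T C" for A B C \<Xi> \<Delta> f g
  using relmonD(11)[OF rM, of "?e B ** f" \<Xi> A B g \<Delta> C] that by (simp add: tx)
 have xp': "?x' A C (\<Delta> @ \<Xi>) (g ** \<Delta>\<rhd>f) = ?x' B C \<Delta> g ** \<Delta>\<rhd>?t' A B \<Xi> f"
  if "vl f" "dm f = \<Xi>|>A" "cd f = B" "vl g" "dm g = \<Delta>|>B" "cd g = ?T' C" for A B C \<Xi> \<Delta> f g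
  using relmonD(11)[OF rN, of "?e' B ** f" \<Xi> A B g \<Delta> C] that by (simp add: tx')
 have te: "?t A B \<Xi> f ** \<Xi>\<rhd>?e A = ?e B ** f" "?t' A B \<Xi> f ** \<Xi>\<rhd>?e' A = ?e' B ** f"
  if "vl f" "dm f = \<Xi>|>A" "cd f = B" for A B \<Xi> f
  using relmonD(8)[OF rM, of "?e B ** f" \<Xi> A B] relmonD(8)[OF rN, of "?e' B ** f" \<Xi> A B] that by (simp_all add: tx tx')
 have \<alpha>u: "\<alpha> b ** ?e (K b) ** z = ?e' (K b) ** z" for b z using \<alpha>(2)[of b] by (metis cmp_assoc)
 have \<alpha>t: "\<alpha> b ** ?t (K a) (K b) \<Xi> f = ?t' (K a) (K b) \<Xi> f ** \<Xi>\<rhd>\<alpha> a" if f: "vl f" "dm f = \<Xi>|>K a" "cd f = K b" for a b \<Xi> f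
  using \<alpha>x[of "?e (K b) ** f" \<Xi> a b] f by (simp add: tx tx' \<alpha>u)
 note cM = ary_colim[OF M(2)] and jM = ary_jfun[OF FM]
 have "\<exists>h. vl h \<and> dm h = ?T Y \<and> cd h = ?T' Y \<and> (\<forall>b \<Xi> f. vl f \<longrightarrow> dm f = \<Xi>|>K b \<longrightarrow> cd f = Y \<longrightarrow> ?t' (K b) Y \<Xi> f ** \<Xi>\<rhd>\<alpha> b = h ** ?t (K b) Y \<Xi> f)" for Y
 proof -
  have "cocone [] Y (\<lambda>b. ?T (K b)) (\<lambda>a b. ?t (K a) (K b)) (?T' Y) (\<lambda>b \<Xi> f. ?t' (K b) Y \<Xi> f ** \<Xi>\<rhd>\<alpha> b)"
  proof (rule coconeI)
   fix b show "natop [] (K b) Y (?T (K b)) (?T' Y) (\<lambda>\<Xi> f. ?t' (K b) Y \<Xi> f ** \<Xi>\<rhd>\<alpha> b)"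
    by (rule natop_cong[THEN iffD1, rotated, OF natop_postpre[OF FopD(2)[OF FN, of "K b" Y], where h = "idt (?T' Y)" and B'' = "?T' Y" and k = "\<alpha> b" and A'' = "?T (K b)"]])
     simp_all
  next
   fix a b \<Xi> \<Delta> f g assume "vl f" "dm f = \<Xi>|>K b" "cd f = K a" "vl g" "dm g = \<Delta>|>K a" "cd g = Y"
   then show "?t' (K b) Y (\<Delta> @ \<Xi>) (g ** \<Delta>\<rhd>f) ** (\<Delta> @ \<Xi>)\<rhd>\<alpha> b = (?t' (K a) Y \<Delta> g ** \<Delta>\<rhd>\<alpha> a) ** []\<rhd>\<Delta>\<rhd>?t (K b) (K a) \<Xi> f"
    using FopD(7)[OF FN, of f \<Xi> "K b" "K a" g \<Delta> Y] \<alpha>t[of f \<Xi> b a] wa_cmp[of "\<alpha> a" "?t (K b) (K a) \<Xi> f" \<Delta>] by simp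
  qed
  from colim_ex[OF cM this] show ?thesis by simp
 qed
 then have "\<exists>h. \<forall>Y. vl (h Y) \<and> dm (h Y) = ?T Y \<and> cd (h Y) = ?T' Y \<and> (\<forall>b \<Xi> f. vl f \<longrightarrow> dm f = \<Xi>|>K b \<longrightarrow> cd f = Y \<longrightarrow> ?t' (K b) Y \<Xi> f ** \<Xi>\<rhd>\<alpha> b = h Y ** ?t (K b) Y \<Xi> f)"
  by (intro choice) blast
 then obtain h where h [simp]: "\<And>Y. vl (h Y)" "\<And>Y. dm (h Y) = ?T Y" "\<And>Y. cd (h Y) = ?T' Y"
  and he: "\<And>b \<Xi> f Y. \<lbrakk>vl f; dm f = \<Xi>|>K b; cd f = Y\<rbrakk> \<Longrightarrow> h Y ** ?t (K b) Y \<Xi> f = ?t' (K b) Y \<Xi> f ** \<Xi>\<rhd>\<alpha> b"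
  by metis
 have her: "h Y ** ?t (K b) Y \<Xi> f ** z = ?t' (K b) Y \<Xi> f ** \<Xi>\<rhd>\<alpha> b ** z" if "vl f" "dm f = \<Xi>|>K b" "cd f = Y" for b \<Xi> f Y z
  using he[OF that, THEN cmp_re, of z] by simp
 have hK: "h (K b) = \<alpha> b" for b using he[of "idt (K b)" "[]" b "K b"] by simp
 have hu: "h Y ** ?e Y = ?e' Y" for Y
 proof -
  have "(h Y ** ?e Y) ** rr Y = h Y ** ?t (K i0) Y [Y] (rr Y) ** [Y]\<rhd>?e (K i0)"
   using te(1)[of "rr Y" "[Y]" "K i0" Y] by simp
  also have "\<dots> = ?t' (K i0) Y [Y] (rr Y) ** [Y]\<rhd>(\<alpha> i0 ** ?e (K i0))" by (simp add: her)
  also have "\<dots> = ?e' Y ** rr Y" unfolding \<alpha>(2) using te(2)[of "rr Y" "[Y]" "K i0" Y] by simp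
  finally show ?thesis by (rule iso_epi[OF _ rr_simps(7)]) simp_all
 qed
 have hxK: "h B ** ?x (K b) B \<Xi> f = ?x' (K b) B \<Xi> (h B ** f) ** \<Xi>\<rhd>\<alpha> b" if f: "vl f" "dm f = \<Xi>|>K b" "cd f = ?T B" for b B \<Xi> f
 proof (rule flat_eq[OF jM cM _ _ _ f, where U = "[]" and \<omega> = "\<lambda>\<Xi> f. h B ** ?x (K b) B \<Xi> f" and \<omega>' = "\<lambda>\<Xi> f. ?x' (K b) B \<Xi> (h B ** f) ** \<Xi>\<rhd>\<alpha> b"])
  show "natop [] (K b) (?T B) (?T (K b)) (?T' B) (\<lambda>\<Xi> f. h B ** ?x (K b) B \<Xi> f)"
   by (rule natopI) (simp_all add: natop_nat[OF relmonD(4)[OF rM]])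
  show "natop [] (K b) (?T B) (?T (K b)) (?T' B) (\<lambda>\<Xi> f. ?x' (K b) B \<Xi> (h B ** f) ** \<Xi>\<rhd>\<alpha> b)"
  proof (rule natopI)
   fix \<Xi> \<Delta> u f assume u: "ctx \<Xi> \<Delta> u" and q: "\<And>A. vl (u A)" "\<And>A. dm (u A) = \<Xi>|>A" "\<And>A. cd (u A) = \<Delta>|>A" "vl f" "dm f = \<Delta>|>K b" "cd f = ?T B"
   show "?x' (K b) B \<Xi> (h B ** f ** u (K b)) ** \<Xi>\<rhd>\<alpha> b = (?x' (K b) B \<Delta> (h B ** f) ** \<Delta>\<rhd>\<alpha> b) ** []\<rhd>u (?T (K b))"
    using natop_nat[OF relmonD(4)[OF rN] u, of "h B ** f" "K b" B] ctx_nat[OF u, of "\<alpha> b"] q by simp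
  qed simp
 next
  fix c \<Xi> \<Delta> g f assume q: "vl g" "dm g = \<Xi>|>K c" "cd g = B" "vl f" "dm f = \<Delta>|>K b" "cd f = ?T (K c)"
  have "h B ** ?x (K b) B (\<Xi> @ \<Delta>) (?t (K c) B \<Xi> g ** \<Xi>\<rhd>f) = ?t' (K c) B \<Xi> g ** \<Xi>\<rhd>(\<alpha> c ** ?x (K b) (K c) \<Delta> f)"
   using q by (simp add: xt her)
  also have "\<dots> = ?t' (K c) B \<Xi> g ** \<Xi>\<rhd>(?x' (K b) (K c) \<Delta> (\<alpha> c ** f) ** \<Delta>\<rhd>\<alpha> b)"
   using \<alpha>x[of f \<Delta> b c] q by simp
  also have "\<dots> = ?x' (K b) B (\<Xi> @ \<Delta>) (?t' (K c) B \<Xi> g ** \<Xi>\<rhd>(\<alpha> c ** f)) ** (\<Xi> @ \<Delta>)\<rhd>\<alpha> b"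
   using q by (subst xt') simp_all
  also have "?t' (K c) B \<Xi> g ** \<Xi>\<rhd>(\<alpha> c ** f) = h B ** ?t (K c) B \<Xi> g ** \<Xi>\<rhd>f"
   using q by (simp add: her)
  finally show "h B ** ?x (K b) B (\<Xi> @ \<Delta>) (?t (K c) B \<Xi> g ** \<Xi>\<rhd>f) = ?x' (K b) B (\<Xi> @ \<Delta>) (h B ** ?t (K c) B \<Xi> g ** \<Xi>\<rhd>f) ** (\<Xi> @ \<Delta>)\<rhd>\<alpha> b" .
 qed
 have hx: "h B ** ?x A B \<Xi> f = ?x' A B \<Xi> (h B ** f) ** \<Xi>\<rhd>h A" if f: "vl f" "dm f = \<Xi>|>A" "cd f = ?T B" for A B \<Xi> f
 proof (rule colim_eq[OF cM jM])
  fix b \<Delta> g assume g: "vl g" "dm g = \<Delta>|>K b" "cd g = A"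
  have "(h B ** ?x A B \<Xi> f) ** \<Xi>\<rhd>?t (K b) A \<Delta> g = h B ** ?x (K b) B (\<Xi> @ \<Delta>) (f ** \<Xi>\<rhd>g)"
   using f g by (simp add: xp)
  also have "\<dots> = ?x' (K b) B (\<Xi> @ \<Delta>) ((h B ** f) ** \<Xi>\<rhd>g) ** (\<Xi> @ \<Delta>)\<rhd>\<alpha> b"
   using hxK[of "f ** \<Xi>\<rhd>g" "\<Xi> @ \<Delta>" b B] f g by simp
  also have "\<dots> = ?x' A B \<Xi> (h B ** f) ** \<Xi>\<rhd>(?t' (K b) A \<Delta> g ** \<Delta>\<rhd>\<alpha> b)"
   using f g by (subst xp') simp_all
  also have "\<dots> = (?x' A B \<Xi> (h B ** f) ** \<Xi>\<rhd>h A) ** \<Xi>\<rhd>?t (K b) A \<Delta> g"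
   unfolding he[OF g, symmetric] using f g by simp
  finally show "(h B ** ?x A B \<Xi> f) ** \<Xi>\<rhd>?t (K b) A \<Delta> g = (?x' A B \<Xi> (h B ** f) ** \<Xi>\<rhd>h A) ** \<Xi>\<rhd>?t (K b) A \<Delta> g" .
 qed (use f in simp_all)
 have hu': "uar (h A) \<in> Hom UV (?T A) (?T' A)" "una (uar (h A)) = h A" for A
  using uar_ty[of "h A"] una_uar[of "h A"] by simp_all
 have "mmor M N (\<lambda>A. uar (h A))"
  unfolding vmonad_morphism_iff[OF M(1) N] hu'(2) using hu'(1) hu hx by simp
 moreover have "\<forall>b. una (uar (h (K b))) = \<alpha> b" unfolding hu'(2) unfolding hK by simp
 ultimately show ?thesis by blast
qed

end

context smclosed
begin

section \<open>Tensors of representable hom-objects\<close>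

text \<open>If \<open>P\<close> is the tensor product of \<open>X\<close> and \<open>A\<close>, then
\<open>[P, Z] = [X, [A, Z]]\<close>, for any objects representing these homs.\<close>

lemma repr_tensor:
 assumes r': "repr H' P Z e'" and r'': "repr H'' A Z e''" and m: "m \<in> X \<otimes> A \<leadsto> P" "q \<in> P \<leadsto> X \<otimes> A" "q ** m = idt (X \<otimes> A)" "m ** q = idt P"
  and c: "c \<in> H' \<otimes> X \<leadsto> H''" and e: "e'' ** (c\<lhd>A) = e' ** [H']\<rhd>m ** alp H' X A"
 shows "repr H' X H'' c"
proof -
 have [simp]: "vl e'" "dm e' = H' \<otimes> P" "cd e' = Z" "vl e''" "dm e'' = H'' \<otimes> A" "cd e'' = Z"
  using repr_ty[OF r'] repr_ty[OF r''] by simp_all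
 have [simp]: "vl m" "dm m = X \<otimes> A" "cd m = P" "vl q" "dm q = P" "cd q = X \<otimes> A" "vl c" "dm c = H' \<otimes> X" "cd c = H''"
  using m(1,2) c by simp_all
 have key: "e'' ** ((c ** (g\<lhd>X))\<lhd>A) = (e' ** (g\<lhd>P)) ** [Y]\<rhd>m ** alp Y X A"
  if g: "vl g" "dm g = Y" "cd g = H'" for g Y
  using e[THEN cmp_re, of "(g\<lhd>X)\<lhd>A"] g by simp
 show ?thesis
  unfolding repr_def
 proof (intro conjI allI impI c)
  fix Y f assume f: "f \<in> Y \<otimes> X \<leadsto> H''"
  then have "e'' ** (f\<lhd>A) ** alpi Y X A ** [Y]\<rhd>q \<in> Y \<otimes> P \<leadsto> Z" by simp
  from repr_ex[OF r' this] obtain g where g: "g \<in> Y \<leadsto> H'" and ge: "e' ** (g\<lhd>P) = e'' ** (f\<lhd>A) ** alpi Y X A ** [Y]\<rhd>q" by metis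
  have "e'' ** ((c ** (g\<lhd>X))\<lhd>A) = e'' ** (f\<lhd>A) ** alpi Y X A ** [Y]\<rhd>q ** [Y]\<rhd>m ** alp Y X A"
   using key[of g Y] g unfolding ge by simp
  also have "\<dots> = e'' ** (f\<lhd>A)"
   using f wa_inv_re[OF m(3), of "alp Y X A" "[Y]"] by simp
  finally have "c ** (g\<lhd>X) = f" by (rule repr_eq[OF r'']) (use f g in simp_all)
  moreover have "h = g" if h: "h \<in> Y \<leadsto> H' \<and> c ** (h\<lhd>X) = f" for h
  proof -
   have "(e' ** (h\<lhd>P)) ** ([Y]\<rhd>m ** alp Y X A) = (e' ** (g\<lhd>P)) ** ([Y]\<rhd>m ** alp Y X A)"
   proof -
    have "(e' ** (h\<lhd>P)) ** ([Y]\<rhd>m ** alp Y X A) = e'' ** ((c ** (h\<lhd>X))\<lhd>A)"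
     by (rule key[symmetric]) (use h in simp_all)
    also have "\<dots> = e'' ** ((c ** (g\<lhd>X))\<lhd>A)" using h \<open>c ** (g\<lhd>X) = f\<close> by metis
    also have "\<dots> = (e' ** (g\<lhd>P)) ** ([Y]\<rhd>m ** alp Y X A)"
     by (rule key) (use g in simp_all)
    finally show ?thesis .
   qed
   then have "e' ** (h\<lhd>P) = e' ** (g\<lhd>P)"
    by (rule iso_epi[of _ _ _ "alpi Y X A ** [Y]\<rhd>q" "Y \<otimes> P"]) (use h g wa_inv[OF m(4), of "[Y]"] in simp_all)
   then show ?thesis by (rule repr_eq[OF r']) (use h g in simp_all)
  qed
  ultimately show "\<exists>!g. g \<in> Y \<leadsto> H' \<and> c ** (g\<lhd>X) = f" using g by blast
 qed
qed

section \<open>The Kleisli category of a relative monad\<close>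

lemma mk_raw_cur: "\<lbrakk>vl f; dm f = X \<otimes> A; cd f = B\<rbrakk> \<Longrightarrow> mk X (raw (cur X A f)) (hm A B) = cur X A f"
 using mk_raw[of "cur X A f"] cur[of f X A B] by simp

definition mkkl :: "('a \<Rightarrow> 'o) \<Rightarrow> ('a \<Rightarrow> 'o) \<Rightarrow> ('a \<Rightarrow> ('o, 'm) tarr) \<Rightarrow> ('a \<Rightarrow> 'a \<Rightarrow> ('o, 'm) oper) \<Rightarrow> ('a, 'o, 'm) vcat" where
 "mkkl K S \<eta> ex = \<lparr>vhom = (\<lambda>a b. hm (K a) (S b)),
  vid = (\<lambda>a. raw (cur \<one> (K a) (\<eta> a ** lu (K a)))),
  vcomp = (\<lambda>a b d. raw (cur (hm (K b) (S d) \<otimes> hm (K a) (S b)) (K a)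
   (ex b d [hm (K b) (S d)] (ev (K b) (S d)) ** [hm (K b) (S d)]\<rhd>ev (K a) (S b) ** alp (hm (K b) (S d)) (hm (K a) (S b)) (K a))))\<rparr>"

lemma klc_mkkl:
 assumes rm: "relmon K S \<eta> ex"
 shows "klc (mkkl K S \<eta> ex) K S (\<lambda>a b. ev (K a) (S b)) \<eta> ex"
proof -
 note [simp] = relmonD(1-3,5-9)[OF rm]
 let ?C = "mkkl K S \<eta> ex"
 have h: "vhom ?C a b = hm (K a) (S b)" for a b by (simp add: mkkl_def)
 have i: "cid ?C a = cur \<one> (K a) (\<eta> a ** lu (K a))" for a
  using mk_raw_cur[of "\<eta> a ** lu (K a)" \<one> "K a" "S a"] by (simp add: cid_def mkkl_def)
 have c: "cc ?C a b d = cur (hm (K b) (S d) \<otimes> hm (K a) (S b)) (K a)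
   (ex b d [hm (K b) (S d)] (ev (K b) (S d)) ** [hm (K b) (S d)]\<rhd>ev (K a) (S b) ** alp (hm (K b) (S d)) (hm (K a) (S b)) (K a))" for a b d
  unfolding cc_def mkkl_def vcat.simps by (rule mk_raw_cur) simp_all
 show ?thesis
  by (rule klcI[OF rm]) (simp_all add: h i c cur repr_ev)
qed

end

context arity
begin

section \<open>Theories as Kleisli categories\<close>

text \<open>Tensors in \<open>J\<close> are tensor products in the base. Some arity \<open>K
c\<close> is isomorphic to \<open>K x \<otimes> K A\<close>; the universal property of the tensor,
tested on \<open>c\<close>, gives a retraction of the canonical arrow \<open>K x \<otimes> K A
\<rightarrow> K P\<close>, and tested on \<open>P\<close> shows that the retraction is an
inverse.\<close>

lemma tensorp_arity_iso:
 assumes t: "tensorp J (K x) A P u"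
 shows "\<exists>q. q \<in> K P \<leadsto> K x \<otimes> K A \<and> q ** eJ A P ** (u\<lhd>(K A)) = idt (K x \<otimes> K A) \<and> (eJ A P ** (u\<lhd>(K A))) ** q = idt (K P)"
proof -
 let ?X = "K x" and ?m = "eJ A P ** (u\<lhd>(K A))"
 have u [simp]: "vl u" "dm u = ?X" "cd u = vhom J A P" and r: "repr (vhom J P B) ?X (vhom J A B) (cc J A P B ** [vhom J P B]\<rhd>u)" for B
  using t unfolding tensorp_def by auto
 have S: "eJ A B ** (((cc J A P B ** [vhom J P B]\<rhd>u) ** (g\<lhd>?X))\<lhd>(K A)) = (G ** ?m) ** (lu ?X\<lhd>(K A))"
  if g: "vl g" "dm g = \<one>" "cd g = vhom J P B" and ge: "eJ P B ** (g\<lhd>(K P)) = G ** lu (K P)" and G: "vl G" "dm G = K P" for g G B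
 proof -
  have "eJ A B ** (((cc J A P B ** [vhom J P B]\<rhd>u) ** (g\<lhd>?X))\<lhd>(K A)) = (eJ P B ** (g\<lhd>(K P))) ** [\<one>]\<rhd>?m ** alp \<one> ?X (K A)"
   using klcD(4)[OF klc_J, of A B P, THEN cmp_re] g by simp
  also have "\<dots> = (G ** ?m) ** (lu ?X\<lhd>(K A))"
   unfolding ge using lu_tns[of ?X "K A"] G lu_nat'[of ?m "K P"] by simp
  finally show ?thesis .
 qed
 have ex: "\<exists>g. g \<in> \<one> \<leadsto> vhom J P B \<and> eJ P B ** (g\<lhd>(K P)) = G ** lu (K P)" if "G \<in> K P \<leadsto> K B" for G B
  by (rule repr_ex[OF repr_eJ]) (use that in simp)
 have un: "G = G'" if G: "G \<in> K P \<leadsto> K B" "G' \<in> K P \<leadsto> K B" and e: "G ** ?m = G' ** ?m" for G G' B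
 proof -
  obtain g where g: "g \<in> \<one> \<leadsto> vhom J P B" "eJ P B ** (g\<lhd>(K P)) = G ** lu (K P)" using ex[OF G(1)] by blast
  obtain g' where g': "g' \<in> \<one> \<leadsto> vhom J P B" "eJ P B ** (g'\<lhd>(K P)) = G' ** lu (K P)" using ex[OF G(2)] by blast
  have "eJ A B ** (((cc J A P B ** [vhom J P B]\<rhd>u) ** (g\<lhd>?X))\<lhd>(K A)) = eJ A B ** (((cc J A P B ** [vhom J P B]\<rhd>u) ** (g'\<lhd>?X))\<lhd>(K A))"
   by (rule trans[OF S[OF _ _ _ g(2)] trans[OF arg_cong[where f = "\<lambda>z. z ** (lu ?X\<lhd>(K A))", OF e] S[OF _ _ _ g'(2), symmetric]]])
    (use G g(1) g'(1) in simp_all)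
  then have "(cc J A P B ** [vhom J P B]\<rhd>u) ** (g\<lhd>?X) = (cc J A P B ** [vhom J P B]\<rhd>u) ** (g'\<lhd>?X)"
   by (rule repr_eq[OF repr_eJ, where X = "\<one> \<otimes> ?X"]) (use g(1) g'(1) in simp_all)
  then have "g = g'" by (rule repr_eq[OF r]) (use g(1) g'(1) in simp_all)
  then have "G ** lu (K P) = G' ** lu (K P)" using g(2) g'(2) by simp
  then show ?thesis by (rule iso_epi[where q = "lui (K P)"]) (use G in simp_all)
 qed
 obtain c p q where p: "p \<in> ?X \<otimes> K A \<leadsto> K c" and q: "q \<in> K c \<leadsto> ?X \<otimes> K A" "q ** p = idt (?X \<otimes> K A)"
  using tensor_iso[of x A] by blast
 have "p ** (lu ?X\<lhd>(K A)) \<in> (\<one> \<otimes> ?X) \<otimes> K A \<leadsto> K c" using p by simp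
 from repr_ex[OF repr_eJ this] obtain h where h: "h \<in> \<one> \<otimes> ?X \<leadsto> vhom J A c" "eJ A c ** (h\<lhd>(K A)) = p ** (lu ?X\<lhd>(K A))" by blast
 from repr_ex[OF r h(1)] obtain g where g: "g \<in> \<one> \<leadsto> vhom J P c" "(cc J A P c ** [vhom J P c]\<rhd>u) ** (g\<lhd>?X) = h" by blast
 let ?n = "eJ P c ** (g\<lhd>(K P)) ** lui (K P)"
 have n: "?n \<in> K P \<leadsto> K c" using g(1) by simp
 have "eJ P c ** (g\<lhd>(K P)) = ?n ** lu (K P)" using g(1) by simp
 from S[OF _ _ _ this] g(1) have "(?n ** ?m) ** (lu ?X\<lhd>(K A)) = p ** (lu ?X\<lhd>(K A))"
  unfolding g(2) h(2) by simp
 then have nm: "?n ** ?m = p"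
  by (rule iso_epi[where q = "lui ?X\<lhd>(K A)"]) (use g(1) p in \<open>simp_all add: tns_cmp\<close>)
 have 1: "(q ** ?n) ** ?m = idt (?X \<otimes> K A)" unfolding cmp_assoc using nm q(2) by simp
 have 2: "?m ** (q ** ?n) = idt (K P)"
 proof (rule un)
  have "(?m ** (q ** ?n)) ** ?m = ?m ** (q ** ?n) ** ?m" by simp
  also have "\<dots> = idt (K P) ** ?m" using 1 by simp
  finally show "(?m ** (q ** ?n)) ** ?m = idt (K P) ** ?m" .
 qed (use n q in simp_all)
 show ?thesis using 1 2 n q(1) by (intro exI[of _ "q ** ?n"]) simp
qed

text \<open>The opposite of the theory \<open>t\<close> is, by means of the representing arrows
\<open>e\<close>, the Kleisli category of the relative monad, and the structure functor of
\<open>t\<close> is \<open>f \<mapsto> \<eta> \<cdot> f\<close>.\<close>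

definition presents :: "('j, 'o, 'm) jtheory \<Rightarrow> ('j \<Rightarrow> 'o) \<Rightarrow> ('j \<Rightarrow> 'j \<Rightarrow> ('o, 'm) tarr) \<Rightarrow>
  ('j \<Rightarrow> ('o, 'm) tarr) \<Rightarrow> ('j \<Rightarrow> 'j \<Rightarrow> ('o, 'm) oper) \<Rightarrow> bool" where
 "presents t S e \<eta> ex \<longleftrightarrow> vcategory V (thcat t) \<and> klc (vop V (thcat t)) K S e \<eta> ex \<and> fob (thfun t) = (\<lambda>a. a) \<and>
  (\<forall>a b. vl (fa J (vop V (thcat t)) (vfun_op (thfun t)) a b)) \<and>
  (\<forall>a b. e a b ** (fa J (vop V (thcat t)) (vfun_op (thfun t)) a b\<lhd>(K a)) = \<eta> b ** eJ a b)"

lemma vfunctor_J_Kleisli: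
 assumes D: "klc D K S e \<eta> ex" and F: "\<And>a b. vl (fa J D F a b)" "fob F = (\<lambda>a. a)"
  and c: "\<And>a b. e a b ** (fa J D F a b\<lhd>(K a)) = \<eta> b ** eJ a b"
 shows "vfunctor V J D F"
proof -
 note [simp] = relmonD(1-3,5-10)[OF klcD(2)[OF D]]
 have n: "natop [] (K a) (K b) (K a) (S b) (\<lambda>\<Xi> f. \<eta> b ** f)" for a b
  by (rule natopI) simp_all
 show ?thesis
  by (subst vfunctor_iff[OF klc_J D F(1), where \<phi> = "\<lambda>a b \<Xi> f. \<eta> b ** f"]) (simp_all add: F(2) c n)
qed

text \<open>The functor from \<open>J\<close> to a Kleisli category preserves tensors by arities,
these being tensor products in the base.\<close>

lemma tensorp_Kleisli:
 assumes D: "klc D K S e \<eta> ex" and F [simp]: "\<And>a b. vl (fa J D F a b)" "fob F = (\<lambda>a. a)"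
  and c: "\<And>a b. e a b ** (fa J D F a b\<lhd>(K a)) = \<eta> b ** eJ a b"
  and t: "tensorp J (K x) A P u"
 shows "tensorp D (K x) A P (fa J D F A P ** u)"
proof -
 note [simp] = relmonD(1-3,5-10)[OF klcD(2)[OF D]] klcD(6-10)[OF D]
 have u [simp]: "vl u" "dm u = K x" "cd u = vhom J A P" using t unfolding tensorp_def by auto
 obtain q where q: "q \<in> K P \<leadsto> K x \<otimes> K A" "q ** eJ A P ** (u\<lhd>(K A)) = idt (K x \<otimes> K A)" "(eJ A P ** (u\<lhd>(K A))) ** q = idt (K P)"
  using tensorp_arity_iso[OF t] by blast
 have "repr (vhom D P B) (K x) (vhom D A B) (cc D A P B ** [vhom D P B]\<rhd>(fa J D F A P ** u))" for B
 proof (rule repr_tensor[OF klcD(3)[OF D] klcD(3)[OF D] _ q(1,2,3)])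
  have "e A B ** ((cc D A P B ** [vhom D P B]\<rhd>(fa J D F A P ** u))\<lhd>(K A)) = ex P B [vhom D P B] (e P B) ** [vhom D P B]\<rhd>((e A P ** (fa J D F A P\<lhd>(K A))) ** (u\<lhd>(K A))) ** alp (vhom D P B) (K x) (K A)"
   using klcD(4)[OF D, of A B P, THEN cmp_re] by simp
  also have "\<dots> = e P B ** [vhom D P B]\<rhd>(eJ A P ** (u\<lhd>(K A))) ** alp (vhom D P B) (K x) (K A)"
   unfolding c by simp
  finally show "e A B ** ((cc D A P B ** [vhom D P B]\<rhd>(fa J D F A P ** u))\<lhd>(K A)) = e P B ** [vhom D P B]\<rhd>(eJ A P ** (u\<lhd>(K A))) ** alp (vhom D P B) (K x) (K A)" .
 qed simp_all
 then show ?thesis unfolding tensorp_def by simp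
qed

lemma tensorp_vop_vop: "vcategory V C \<Longrightarrow> tensorp (vop V (vop V C)) X A P u \<longleftrightarrow> tensorp C X A P u"
 by (simp add: vop_vop tensorp_def cc_def)

lemma vfunctor_vop_vop: "vcategory V C \<Longrightarrow> vfunctor V (vop V (vop V C)) D F \<longleftrightarrow> vfunctor V C D F"
 by (simp add: vop_vop vfunctor_def)

lemma vfunctor_vop_vop2: "vcategory V D \<Longrightarrow> vfunctor V C (vop V (vop V D)) F \<longleftrightarrow> vfunctor V C D F"
 by (simp add: vop_vop vfunctor_def)

lemma vfun_op_op [simp]: "vfun_op (vfun_op F) = (F :: ('p, 'q, 'r) vfun)"
 by (simp add: vfun_op_def)

text \<open>The theory of a relative monad.\<close>

definition klthy :: "('j \<Rightarrow> 'o) \<Rightarrow> ('j \<Rightarrow> ('o, 'm) tarr) \<Rightarrow> ('j \<Rightarrow> 'j \<Rightarrow> ('o, 'm) oper) \<Rightarrow> ('j, 'o, 'm) jtheory" where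
 "klthy S \<eta> ex = \<lparr>thcat = vop V (mkkl K S \<eta> ex),
  thfun = vfun_op \<lparr>fob = (\<lambda>a. a), fmap = (\<lambda>a b. raw (cur (vhom J a b) (K a) (\<eta> b ** eJ a b)))\<rparr>\<rparr>"

lemma klthy:
 assumes rm: "relmon K S \<eta> ex"
 shows "is_jtheory V J j (klthy S \<eta> ex)" "presents (klthy S \<eta> ex) S (\<lambda>a b. ev (K a) (S b)) \<eta> ex"
proof -
 note [simp] = relmonD(1-3,5-10)[OF rm]
 let ?C = "mkkl K S \<eta> ex"
 let ?F = "\<lparr>fob = (\<lambda>a. a), fmap = (\<lambda>a b. raw (cur (vhom J a b) (K a) (\<eta> b ** eJ a b)))\<rparr> :: ('j, 'j, 'm) vfun"
 note k = klc_mkkl[OF rm] and C = klcD(1)[OF klc_mkkl[OF rm]]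
 note Cop = vcategory_vop[OF C] and Jop = vcategory_vop[OF vcat_J]
 have vv: "vop V (vop V ?C) = ?C" by (simp add: vop_vop[OF C])
 have F: "fa J ?C ?F a b = cur (vhom J a b) (K a) (\<eta> b ** eJ a b)" for a b
  using mk_raw_cur[of "\<eta> b ** eJ a b" "vhom J a b" "K a" "S b"] by (simp add: fa_def mkkl_def)
 have Fv: "vl (fa J ?C ?F a b)" for a b unfolding F by (rule cur) simp_all
 have Fe: "ev (K a) (S b) ** (fa J ?C ?F a b\<lhd>(K a)) = \<eta> b ** eJ a b" for a b
  unfolding F by (rule cur) simp_all
 have vF: "vfunctor V J ?C ?F" by (rule vfunctor_J_Kleisli[OF k Fv _ Fe]) simp
 have "preserves_cotensors V (vop V J) (vop V ?C) (K x) (vfun_op ?F)" for x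
  by (subst preserves_cotensors_iff[OF Jop Cop]) (use tensorp_Kleisli[OF k Fv _ Fe] in \<open>simp_all add: Fv tensorp_vop_vop[OF C] tensorp_vop_vop[OF vcat_J]\<close>)
 then show "is_jtheory V J j (klthy S \<eta> ex)"
  unfolding is_jtheory_def klthy_def using Cop vfunctor_op[OF vcat_J C vF] by simp
 show "presents (klthy S \<eta> ex) S (\<lambda>a b. ev (K a) (S b)) \<eta> ex"
  unfolding presents_def klthy_def using Cop k Fv Fe by (simp add: vv)
qed

text \<open>In \<open>J\<close> the arity \<open>b\<close> is the tensor of \<open>i0\<close> by
\<open>K b\<close>, hence so it is in the opposite \<open>D\<close> of the theory. With \<open>S c =
D(i0, c)\<close> the universal element \<open>v b : K b \<rightarrow> S b\<close> is the unit,
evaluation is composition with it, and the extension of an arrow \<open>K a \<rightarrow> S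
b\<close> is composition with the arrow \<open>a \<rightarrow> b\<close> of \<open>D\<close> that it
represents. The laws are the category axioms of \<open>D\<close>.\<close>

lemma theory_presented:
 assumes t: "is_jtheory V J j t"
 shows "\<exists>S e \<eta> ex. presents t S e \<eta> ex"
proof -
 define D where "D = vop V (thcat t)"
 define F where "F = vfun_op (thfun t)"
 note Jop = vcategory_vop[OF vcat_J]
 have C: "vcategory V (thcat t)" and T: "vfunctor V (vop V J) (thcat t) (thfun t)" and ob: "fob (thfun t) = (\<lambda>a. a)"
  and pc: "preserves_cotensors V (vop V J) (thcat t) (K x) (thfun t)" for x
  using t unfolding is_jtheory_def by auto
 have D: "vcategory V D" unfolding D_def by (rule vcategory_vop[OF C])
 have F: "vfunctor V J D F"
  using vfunctor_op[OF Jop C T] unfolding D_def F_def vfunctor_vop_vop[OF vcat_J] .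
 have Fo [simp]: "fob F = (\<lambda>a. a)" by (simp add: F_def ob)
 have ff: "fa (vop V J) (thcat t) (thfun t) a b = fa J D F b a" for a b
  by (simp add: fa_def D_def F_def vfun_op_def ob)
 note Ft = F[unfolded vfunctor_typed[OF vcat_J D]]
 have Fv [simp]: "vl (fa J D F a b)" for a b using Ft by blast
 have Fc: "fa J D F a d ** cc J a b d = cc D a b d ** (fa J D F b d \<boxtimes> fa J D F a b)" for a b d
  using Ft by simp
 note Dc = D[unfolded vcategory_iff]
 have [simp]: "vl (cc D a b d)" "vl (cid D a)" for a b d using Dc by blast+
 have Das: "cc D a b f ** (cc D b d f\<lhd>(vhom D a b)) = cc D a d f ** [vhom D d f]\<rhd>cc D a b d ** alp (vhom D d f) (vhom D b d) (vhom D a b)" for a b d f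
  using Dc by blast
 have Did: "cc D a b b ** (cid D b\<lhd>(vhom D a b)) = lu (vhom D a b)" for a b using Dc by blast
 have tens: "tensorp D (K x) A P (fa J D F A P ** u)" if "tensorp J (K x) A P u" for x A P u
  using pc[of x, unfolded preserves_cotensors_iff[OF Jop C, of "thfun t" "K x", unfolded ff, OF Fv] tensorp_vop_vop[OF vcat_J]] that
  unfolding ob D_def[symmetric] by blast
 have "\<exists>u. u \<in> K b \<leadsto> vhom J i0 b \<and> eJ i0 b ** (u\<lhd>(K i0)) = rr (K b)" for b
  by (rule repr_ex[OF repr_eJ]) simp
 then obtain u where ut: "u b \<in> K b \<leadsto> vhom J i0 b" and ue: "eJ i0 b ** (u b\<lhd>(K i0)) = rr (K b)" for b
  by metis
 have u [simp]: "vl (u b)" "dm (u b) = K b" "cd (u b) = vhom J i0 b" for b using ut[of b] by simp_all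
 have uJ: "tensorp J (K b) i0 b (u b)" for b
 proof -
  have "repr (vhom J b B) (K b) (vhom J i0 B) (cc J i0 b B ** [vhom J b B]\<rhd>u b)" for B
  proof (rule repr_tensor[OF repr_eJ repr_eJ, where m = "rr (K b)" and q = "rri (K b)"])
   show "eJ i0 B ** ((cc J i0 b B ** [vhom J b B]\<rhd>u b)\<lhd>(K i0)) = eJ b B ** [vhom J b B]\<rhd>rr (K b) ** alp (vhom J b B) (K b) (K i0)"
    using klcD(4)[OF klc_J, of i0 B b, THEN cmp_re] ue[of b, symmetric] by simp
  qed simp_all
  then show ?thesis unfolding tensorp_def by simp
 qed
 define S where "S c = vhom D i0 c" for c
 define v where "v b = fa J D F i0 b ** u b" for b
 define e where "e b c = cc D i0 b c ** [vhom D b c]\<rhd>v b" for b c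
 define ex where "ex a b = natof (vhom D a b) (K a) (e a b) [] (S a) (cc D i0 a b)" for a b
 have v [simp]: "vl (v b)" "dm (v b) = K b" "cd (v b) = S b" for b by (simp_all add: v_def S_def)
 have r: "repr (vhom D a b) (K a) (S b) (e a b)" for a b
  using tens[OF uJ[of a]] unfolding tensorp_def e_def v_def S_def by blast
 have et [simp]: "vl (e a b)" "dm (e a b) = vhom D a b \<otimes> K a" "cd (e a b) = S b" for a b
  using repr_ty[OF r[of a b]] by simp_all
 have xn: "natop [] (K a) (S b) (S a) (S b) (ex a b)" and xe: "ex a b [vhom D a b] (e a b) = cc D i0 a b" for a b
  unfolding ex_def by (rule natof[OF r]; simp add: S_def)+
 note xt [simp] = natop_tys[OF xn, simplified]
 have e1: "e a d ** (cc D a b d\<lhd>(K a)) = cc D i0 b d ** [vhom D b d]\<rhd>e a b ** alp (vhom D b d) (vhom D a b) (K a)" for a b d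
 proof -
  have "e a d ** (cc D a b d\<lhd>(K a)) = (cc D i0 a d ** (cc D a b d\<lhd>(S a))) ** [vhom D b d \<otimes> vhom D a b]\<rhd>v a"
   by (simp add: e_def S_def)
  also have "\<dots> = cc D i0 b d ** [vhom D b d]\<rhd>e a b ** alp (vhom D b d) (vhom D a b) (K a)"
   unfolding S_def Das by (simp add: e_def S_def)
  finally show ?thesis .
 qed
 have e2: "e a a ** (cid D a\<lhd>(K a)) = v a ** lu (K a)" for a
 proof -
  have "e a a ** (cid D a\<lhd>(K a)) = (cc D i0 a a ** (cid D a\<lhd>(S a))) ** [\<one>]\<rhd>v a"
   by (simp add: e_def S_def)
  also have "\<dots> = v a ** lu (K a)" unfolding S_def Did using lu_nat'[of "v a" "S a"] by (simp add: S_def)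
  finally show ?thesis .
 qed
 have x1: "ex a b \<Xi> f ** \<Xi>\<rhd>v a = f" if f: "vl f" "dm f = \<Xi>|>K a" "cd f = S b" for a b \<Xi> f
 proof (rule natop_eqI[OF _ natop_id r])
  show "natop [] (K a) (S b) (K a) (S b) (\<lambda>\<Xi> f. ex a b \<Xi> f ** \<Xi>\<rhd>v a)"
   by (rule natop_cong[THEN iffD1, rotated, OF natop_postpre[OF xn[of a b], where h = "idt (S b)" and B'' = "S b" and k = "v a" and A'' = "K a"]])
    simp_all
  show "ex a b [vhom D a b] (e a b) ** [vhom D a b]\<rhd>v a = e a b" unfolding xe by (simp add: e_def)
  show "f \<in> \<Xi>|>K a \<leadsto> S b" using f by simp
 qed
 have x2: "ex a a [] (v a) = idt (S a)" for a
 proof -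
  have "ex a a [] (v a) ** lu (S a) = ex a a [\<one>] (v a ** lu (K a))"
   using natop_nat[OF xn ctx_lu, of "v a" a a] by simp
  also have "\<dots> = ex a a [vhom D a a] (e a a) ** (cid D a\<lhd>(S a))"
   unfolding e2[symmetric] using natop_nat[OF xn ctx_arr, of "cid D a" \<one> "vhom D a a" "e a a" a a] by simp
  also have "\<dots> = idt (S a) ** lu (S a)" unfolding xe using Did[of i0 a] by (simp add: S_def)
  finally show ?thesis by (rule iso_epi[of _ _ _ "lui (S a)"]) simp_all
 qed
 have x3: "ex a c (\<Delta> @ \<Xi>) (ex b c \<Delta> g ** \<Delta>\<rhd>f) = ex b c \<Delta> g ** \<Delta>\<rhd>ex a b \<Xi> f"
  if f: "vl f" "dm f = \<Xi>|>K a" "cd f = S b" and g: "vl g" "dm g = \<Delta>|>K b" "cd g = S c" for a b c \<Xi> \<Delta> f g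
 proof (rule natop2_eqI[OF r r, where U = "[]" and C = "S a"
      and F = "\<lambda>\<Delta> g \<Xi> f. ex a c (\<Delta> @ \<Xi>) (ex b c \<Delta> g ** \<Delta>\<rhd>f)"
      and G = "\<lambda>\<Delta> g \<Xi> f. ex b c \<Delta> g ** \<Delta>\<rhd>ex a b \<Xi> f"])
  show "g \<in> \<Delta>|>K b \<leadsto> S c" "f \<in> \<Xi>|>K a \<leadsto> S b" using f g by simp_all
 next
  fix \<Delta> \<Delta>' w g \<Xi> f assume w: "ctx \<Delta> \<Delta>' w" and ws [simp]: "\<And>A. vl (w A)" "\<And>A. dm (w A) = \<Delta>|>A" "\<And>A. cd (w A) = \<Delta>'|>A"
   and a: "g \<in> \<Delta>'|>K b \<leadsto> S c" "f \<in> \<Xi>|>K a \<leadsto> S b"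
  have "ex a c (\<Delta> @ \<Xi>) (ex b c \<Delta> (g ** w (K b)) ** \<Delta>\<rhd>f) = ex a c (\<Delta> @ \<Xi>) ((ex b c \<Delta>' g ** \<Delta>'\<rhd>f) ** w (\<Xi>|>K a))"
   using natop_nat[OF xn w, of g b c] ctx_nat[OF w, of f] a by simp
  also have "\<dots> = ex a c (\<Delta>' @ \<Xi>) (ex b c \<Delta>' g ** \<Delta>'\<rhd>f) ** []\<rhd>w (\<Xi>|>S a)"
   using natop_nat[OF xn ctx_right[OF w], of "ex b c \<Delta>' g ** \<Delta>'\<rhd>f" \<Xi> a c] a by simp
  finally show "ex a c (\<Delta> @ \<Xi>) (ex b c \<Delta> (g ** w (K b)) ** \<Delta>\<rhd>f) = ex a c (\<Delta>' @ \<Xi>) (ex b c \<Delta>' g ** \<Delta>'\<rhd>f) ** []\<rhd>w (\<Xi>|>S a)" .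
  show "ex b c \<Delta> (g ** w (K b)) ** \<Delta>\<rhd>ex a b \<Xi> f = (ex b c \<Delta>' g ** \<Delta>'\<rhd>ex a b \<Xi> f) ** []\<rhd>w (\<Xi>|>S a)"
   using natop_nat[OF xn w, of g b c] ctx_nat[OF w, of "ex a b \<Xi> f"] a by simp
 next
  fix \<Delta> w g \<Xi> \<Xi>' f assume w: "ctx \<Xi> \<Xi>' w" and ws [simp]: "\<And>A. vl (w A)" "\<And>A. dm (w A) = \<Xi>|>A" "\<And>A. cd (w A) = \<Xi>'|>A"
   and a: "g \<in> \<Delta>|>K b \<leadsto> S c" "f \<in> \<Xi>'|>K a \<leadsto> S b"
  show "ex a c (\<Delta> @ \<Xi>) (ex b c \<Delta> g ** \<Delta>\<rhd>(f ** w (K a))) = ex a c (\<Delta> @ \<Xi>') (ex b c \<Delta> g ** \<Delta>\<rhd>f) ** []\<rhd>\<Delta>\<rhd>w (S a)"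
   using natop_nat[OF xn ctx_left[OF w], of "ex b c \<Delta> g ** \<Delta>\<rhd>f" \<Delta> a c] a by simp
  show "ex b c \<Delta> g ** \<Delta>\<rhd>ex a b \<Xi> (f ** w (K a)) = (ex b c \<Delta> g ** \<Delta>\<rhd>ex a b \<Xi>' f) ** []\<rhd>\<Delta>\<rhd>w (S a)"
   using natop_nat[OF xn w, of f a b] a by simp
 next
  let ?P = "vhom D b c" and ?Q = "vhom D a b"
  have "ex a c [?P, ?Q] (ex b c [?P] (e b c) ** [?P]\<rhd>e a b) ** alp ?P ?Q (S a) = ex a c [?P \<otimes> ?Q] (e a c ** (cc D a b c\<lhd>(K a)))"
   unfolding e1 using natop_nat[OF xn ctx_alp, of "cc D i0 b c ** [?P]\<rhd>e a b" ?P ?Q a c] by (simp add: xe S_def)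
  also have "\<dots> = cc D i0 a c ** (cc D a b c\<lhd>(S a))"
   using natop_nat[OF xn ctx_arr, of "cc D a b c" "?P \<otimes> ?Q" "vhom D a c" "e a c" a c] by (simp add: xe)
  also have "\<dots> = (ex b c [?P] (e b c) ** [?P]\<rhd>ex a b [?Q] (e a b)) ** alp ?P ?Q (S a)"
   using Das[of i0 a c b] by (simp add: xe S_def)
  finally have "ex a c [?P, ?Q] (ex b c [?P] (e b c) ** [?P]\<rhd>e a b) = ex b c [?P] (e b c) ** [?P]\<rhd>ex a b [?Q] (e a b)"
   by (rule iso_epi[where q = "alpi ?P ?Q (S a)" and A = "?P \<otimes> ?Q \<otimes> S a"]) simp_all
  then show "ex a c ([?P] @ [?Q]) (ex b c [?P] (e b c) ** [?P]\<rhd>e a b) = ex b c [?P] (e b c) ** [?P]\<rhd>ex a b [?Q] (e a b)"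
   by simp
 qed
 have rm: "relmon K S v ex" by (rule relmonI) (simp_all add: xn x1 x2 x3)
 have klc: "klc D K S e v ex"
  unfolding klc_def using D rm r e1 e2 by (simp add: xe)
 have uu: "cc J i0 a b ** [vhom J a b]\<rhd>u a = u b ** eJ a b" for a b
 proof (rule repr_eq[OF repr_eJ])
  have "eJ i0 b ** ((cc J i0 a b ** [vhom J a b]\<rhd>u a)\<lhd>(K i0)) = eJ a b ** [vhom J a b]\<rhd>(eJ i0 a ** (u a\<lhd>(K i0))) ** alp (vhom J a b) (K a) (K i0)"
   using klcD(4)[OF klc_J, of i0 b a, THEN cmp_re] by simp
  also have "\<dots> = rr (K b) ** rw [vhom J a b] (K a) (eJ a b) (K i0) ** alp (vhom J a b) (K a) (K i0)"
   unfolding ue using rr_nat[of "eJ a b" "[vhom J a b]" "K a" "K b", THEN cmp_re] by simp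
  also have "\<dots> = (eJ i0 b ** (u b\<lhd>(K i0))) ** (eJ a b\<lhd>(K i0))"
   unfolding ue by (simp add: rw_def)
  finally show "eJ i0 b ** ((cc J i0 a b ** [vhom J a b]\<rhd>u a)\<lhd>(K i0)) = eJ i0 b ** ((u b ** eJ a b)\<lhd>(K i0))" by simp
 qed simp_all
 have "e a b ** (fa J D F a b\<lhd>(K a)) = v b ** eJ a b" for a b
 proof -
  have "e a b ** (fa J D F a b\<lhd>(K a)) = (cc D i0 a b ** (fa J D F a b \<boxtimes> fa J D F i0 a)) ** [vhom J a b]\<rhd>u a"
   using tns_split[of "fa J D F a b" "fa J D F i0 a"] by (simp add: e_def v_def)
  also have "\<dots> = v b ** eJ a b"
   unfolding Fc[symmetric] cmp_assoc uu by (simp add: v_def)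
  finally show ?thesis .
 qed
 then have "presents t S e v ex" unfolding presents_def using C klc Fv ob by (simp add: D_def[symmetric] F_def[symmetric])
 then show ?thesis by blast
qed

end

section \<open>Fully faithful and essentially surjective functors\<close>

lemma categoryD:
 assumes "category C"
 shows "A \<in> Obj C \<Longrightarrow> Idn C A \<in> Hom C A A"
  "\<lbrakk>A \<in> Obj C; B \<in> Obj C; D \<in> Obj C; f \<in> Hom C A B; g \<in> Hom C B D\<rbrakk> \<Longrightarrow> g \<cdot>\<^bsub>C\<^esub> f \<in> Hom C A D"
  "\<lbrakk>A \<in> Obj C; B \<in> Obj C; f \<in> Hom C A B\<rbrakk> \<Longrightarrow> f \<cdot>\<^bsub>C\<^esub> Idn C A = f"
  "\<lbrakk>A \<in> Obj C; B \<in> Obj C; f \<in> Hom C A B\<rbrakk> \<Longrightarrow> Idn C B \<cdot>\<^bsub>C\<^esub> f = f"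
  "\<lbrakk>A \<in> Obj C; B \<in> Obj C; D \<in> Obj C; E \<in> Obj C; f \<in> Hom C A B; g \<in> Hom C B D; h \<in> Hom C D E\<rbrakk> \<Longrightarrow>
   (h \<cdot>\<^bsub>C\<^esub> g) \<cdot>\<^bsub>C\<^esub> f = h \<cdot>\<^bsub>C\<^esub> (g \<cdot>\<^bsub>C\<^esub> f)"
 using assms unfolding category_def by blast+

text \<open>A fully faithful and essentially surjective functor is an equivalence. Preimages of
objects are chosen, and arrows are conjugated by the chosen isomorphisms and lifted along the
functor.\<close>

lemma equivalent_categoriesI:
 assumes H: "ordinary_functor C D H"
  and faithful: "\<And>A B f g. \<lbrakk>A \<in> Obj C; B \<in> Obj C; f \<in> Hom C A B; g \<in> Hom C A B; omap H A B f = omap H A B g\<rbrakk> \<Longrightarrow> f = g"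
  and full: "\<And>A B g. \<lbrakk>A \<in> Obj C; B \<in> Obj C; g \<in> Hom D (oob H A) (oob H B)\<rbrakk> \<Longrightarrow> \<exists>f. f \<in> Hom C A B \<and> omap H A B f = g"
  and surj: "\<And>Y. Y \<in> Obj D \<Longrightarrow> \<exists>A p q. A \<in> Obj C \<and> inverse_arrows D (oob H A) Y p q"
 shows "equivalent_categories D C"
proof -
 have C: "category C" and D: "category D" using H unfolding ordinary_functor_def by auto
 note c = categoryD[OF C] and d = categoryD[OF D]
 have Ho: "A \<in> Obj C \<Longrightarrow> oob H A \<in> Obj D" for A using H unfolding ordinary_functor_def by blast
 have Hm: "\<lbrakk>A \<in> Obj C; B \<in> Obj C; f \<in> Hom C A B\<rbrakk> \<Longrightarrow> omap H A B f \<in> Hom D (oob H A) (oob H B)" for A B f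
  using H unfolding ordinary_functor_def by blast
 have Hi: "A \<in> Obj C \<Longrightarrow> omap H A A (Idn C A) = Idn D (oob H A)" for A using H unfolding ordinary_functor_def by blast
 have Hc: "\<lbrakk>A \<in> Obj C; B \<in> Obj C; E \<in> Obj C; f \<in> Hom C A B; g \<in> Hom C B E\<rbrakk> \<Longrightarrow> omap H A E (g \<cdot>\<^bsub>C\<^esub> f) = omap H B E g \<cdot>\<^bsub>D\<^esub> omap H A B f" for A B E f g
  using H unfolding ordinary_functor_def by blast
 have "\<exists>P p q. \<forall>Y\<in>Obj D. P Y \<in> Obj C \<and> inverse_arrows D (oob H (P Y)) Y (p Y) (q Y)"
  using surj by metis
 then obtain P p q where Pp: "\<And>Y. Y \<in> Obj D \<Longrightarrow> P Y \<in> Obj C \<and> inverse_arrows D (oob H (P Y)) Y (p Y) (q Y)" by metis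
 have P: "Y \<in> Obj D \<Longrightarrow> P Y \<in> Obj C" and pt: "Y \<in> Obj D \<Longrightarrow> p Y \<in> Hom D (oob H (P Y)) Y" and qt: "Y \<in> Obj D \<Longrightarrow> q Y \<in> Hom D Y (oob H (P Y))"
  and qp: "Y \<in> Obj D \<Longrightarrow> q Y \<cdot>\<^bsub>D\<^esub> p Y = Idn D (oob H (P Y))" and pq: "Y \<in> Obj D \<Longrightarrow> p Y \<cdot>\<^bsub>D\<^esub> q Y = Idn D Y" for Y
  using Pp[of Y] unfolding inverse_arrows_def by simp_all
 define L where "L A B g = (SOME f. f \<in> Hom C A B \<and> omap H A B f = g)" for A B g
 have L: "L A B g \<in> Hom C A B" "omap H A B (L A B g) = g" if "A \<in> Obj C" "B \<in> Obj C" "g \<in> Hom D (oob H A) (oob H B)" for A B g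
  using someI_ex[OF full[OF that]] unfolding L_def by auto
 define cj where "cj Y Z f = (q Z \<cdot>\<^bsub>D\<^esub> f) \<cdot>\<^bsub>D\<^esub> p Y" for Y Z f
 have cjt: "cj Y Z f \<in> Hom D (oob H (P Y)) (oob H (P Z))" if "Y \<in> Obj D" "Z \<in> Obj D" "f \<in> Hom D Y Z" for Y Z f
  unfolding cj_def using that by (meson d(2) pt qt Ho P)
 have pcj: "p Z \<cdot>\<^bsub>D\<^esub> cj Y Z f = f \<cdot>\<^bsub>D\<^esub> p Y" if YZ: "Y \<in> Obj D" "Z \<in> Obj D" and f: "f \<in> Hom D Y Z" for Y Z f
 proof -
  note o = Ho[OF P[OF YZ(1)]] Ho[OF P[OF YZ(2)]]
  have "p Z \<cdot>\<^bsub>D\<^esub> cj Y Z f = (p Z \<cdot>\<^bsub>D\<^esub> (q Z \<cdot>\<^bsub>D\<^esub> f)) \<cdot>\<^bsub>D\<^esub> p Y"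
   unfolding cj_def by (rule d(5)[symmetric, OF o(1) YZ(1) o(2) YZ(2) pt[OF YZ(1)] d(2)[OF YZ o(2) f qt[OF YZ(2)]] pt[OF YZ(2)]])
  also have "p Z \<cdot>\<^bsub>D\<^esub> (q Z \<cdot>\<^bsub>D\<^esub> f) = f"
   unfolding d(5)[symmetric, OF YZ o(2) YZ(2) f qt[OF YZ(2)] pt[OF YZ(2)]] pq[OF YZ(2)] by (rule d(4)[OF YZ f])
  finally show ?thesis .
 qed
 have cjq: "cj Y Z f \<cdot>\<^bsub>D\<^esub> q Y = q Z \<cdot>\<^bsub>D\<^esub> f" if YZ: "Y \<in> Obj D" "Z \<in> Obj D" and f: "f \<in> Hom D Y Z" for Y Z f
 proof -
  note o = Ho[OF P[OF YZ(1)]] Ho[OF P[OF YZ(2)]]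
  note qf = d(2)[OF YZ o(2) f qt[OF YZ(2)]]
  have "cj Y Z f \<cdot>\<^bsub>D\<^esub> q Y = (q Z \<cdot>\<^bsub>D\<^esub> f) \<cdot>\<^bsub>D\<^esub> (p Y \<cdot>\<^bsub>D\<^esub> q Y)"
   unfolding cj_def by (rule d(5)[OF YZ(1) o(1) YZ(1) o(2) qt[OF YZ(1)] pt[OF YZ(1)] qf])
  then show ?thesis unfolding pq[OF YZ(1)] using d(3)[OF YZ(1) o(2) qf] by simp
 qed
 \<comment> \<open>\<open>p\<close> is cancellable, so that conjugation by it is functorial\<close>
 have cancel: "f = g" if Y: "Y \<in> Obj D" and A: "A \<in> Obj D" and fg: "f \<in> Hom D A (oob H (P Y))" "g \<in> Hom D A (oob H (P Y))" and e: "p Y \<cdot>\<^bsub>D\<^esub> f = p Y \<cdot>\<^bsub>D\<^esub> g" for f g A Y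
 proof -
  note o = Ho[OF P[OF Y]]
  have "q Y \<cdot>\<^bsub>D\<^esub> (p Y \<cdot>\<^bsub>D\<^esub> f) = f" if "f \<in> Hom D A (oob H (P Y))" for f
   unfolding d(5)[symmetric, OF A o Y o that pt[OF Y] qt[OF Y]] qp[OF Y] by (rule d(4)[OF A o that])
  then show ?thesis using fg e by metis
 qed
 let ?F = "\<lparr>oob = P, omap = (\<lambda>Y Z f. L (P Y) (P Z) (cj Y Z f))\<rparr>"
 have Fm: "L (P Y) (P Z) (cj Y Z f) \<in> Hom C (P Y) (P Z)" "omap H (P Y) (P Z) (L (P Y) (P Z) (cj Y Z f)) = cj Y Z f"
  if "Y \<in> Obj D" "Z \<in> Obj D" "f \<in> Hom D Y Z" for Y Z f
  using L[OF P[OF that(1)] P[OF that(2)] cjt[OF that]] by auto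
 have F: "ordinary_functor D C ?F"
  unfolding ordinary_functor_def ofun.simps
 proof (intro conjI ballI C D P)
  fix Y Z f assume a: "Y \<in> Obj D" "Z \<in> Obj D" "f \<in> Hom D Y Z"
  show "L (P Y) (P Z) (cj Y Z f) \<in> Hom C (P Y) (P Z)" by (rule Fm(1)[OF a])
 next
  fix Y assume Y: "Y \<in> Obj D"
  note o = Ho[OF P[OF Y]]
  show "L (P Y) (P Y) (cj Y Y (Idn D Y)) = Idn C (P Y)"
  proof (rule faithful[OF P[OF Y] P[OF Y] Fm(1)[OF Y Y d(1)[OF Y]] c(1)[OF P[OF Y]]])
   show "omap H (P Y) (P Y) (L (P Y) (P Y) (cj Y Y (Idn D Y))) = omap H (P Y) (P Y) (Idn C (P Y))"
    unfolding Fm(2)[OF Y Y d(1)[OF Y]] Hi[OF P[OF Y]]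
    by (rule cancel[OF Y o cjt[OF Y Y d(1)[OF Y]] d(1)[OF o]])
     (simp add: pcj[OF Y Y d(1)[OF Y]] d(4)[OF o Y pt[OF Y]] d(3)[OF o Y pt[OF Y]])
  qed
 next
  fix X Y Z f g assume o: "X \<in> Obj D" "Y \<in> Obj D" "Z \<in> Obj D" and f: "f \<in> Hom D X Y" and g: "g \<in> Hom D Y Z"
  note gf = d(2)[OF o f g]
  note oP = Ho[OF P[OF o(1)]] Ho[OF P[OF o(2)]] Ho[OF P[OF o(3)]]
  note tf = cjt[OF o(1,2) f] and tg = cjt[OF o(2,3) g]
  show "L (P X) (P Z) (cj X Z (g \<cdot>\<^bsub>D\<^esub> f)) = L (P Y) (P Z) (cj Y Z g) \<cdot>\<^bsub>C\<^esub> L (P X) (P Y) (cj X Y f)"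
  proof (rule faithful[OF P[OF o(1)] P[OF o(3)] Fm(1)[OF o(1,3) gf] c(2)[OF P[OF o(1)] P[OF o(2)] P[OF o(3)] Fm(1)[OF o(1,2) f] Fm(1)[OF o(2,3) g]]])
   have "cj X Z (g \<cdot>\<^bsub>D\<^esub> f) = cj Y Z g \<cdot>\<^bsub>D\<^esub> cj X Y f"
   proof (rule cancel[OF o(3) oP(1) cjt[OF o(1,3) gf] d(2)[OF oP tf tg]])
    have "p Z \<cdot>\<^bsub>D\<^esub> (cj Y Z g \<cdot>\<^bsub>D\<^esub> cj X Y f) = (p Z \<cdot>\<^bsub>D\<^esub> cj Y Z g) \<cdot>\<^bsub>D\<^esub> cj X Y f"
     by (rule d(5)[symmetric, OF oP o(3) tf tg pt[OF o(3)]])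
    also have "\<dots> = g \<cdot>\<^bsub>D\<^esub> (p Y \<cdot>\<^bsub>D\<^esub> cj X Y f)"
     unfolding pcj[OF o(2,3) g] by (rule d(5)[OF oP(1,2) o(2,3) tf pt[OF o(2)] g])
    also have "\<dots> = (g \<cdot>\<^bsub>D\<^esub> f) \<cdot>\<^bsub>D\<^esub> p X"
     unfolding pcj[OF o(1,2) f] by (rule d(5)[symmetric, OF oP(1) o pt[OF o(1)] f g])
    finally show "p Z \<cdot>\<^bsub>D\<^esub> cj X Z (g \<cdot>\<^bsub>D\<^esub> f) = p Z \<cdot>\<^bsub>D\<^esub> (cj Y Z g \<cdot>\<^bsub>D\<^esub> cj X Y f)"
     unfolding pcj[OF o(1,3) gf] ..
   qed
   then show "omap H (P X) (P Z) (L (P X) (P Z) (cj X Z (g \<cdot>\<^bsub>D\<^esub> f))) = omap H (P X) (P Z) (L (P Y) (P Z) (cj Y Z g) \<cdot>\<^bsub>C\<^esub> L (P X) (P Y) (cj X Y f))"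
    unfolding Fm(2)[OF o(1,3) gf] Hc[OF P[OF o(1)] P[OF o(2)] P[OF o(3)] Fm(1)[OF o(1,2) f] Fm(1)[OF o(2,3) g]] Fm(2)[OF o(1,2) f] Fm(2)[OF o(2,3) g] .
  qed
 qed
 have eta: "ordinary_nat_iso D D ofun_id (ofun_comp H ?F) q"
  unfolding ordinary_nat_iso_def ofun_id_def ofun_comp_def ofun.simps
 proof (intro conjI ballI)
  fix Y assume Y: "Y \<in> Obj D"
  then show "iso_arrow D Y (oob H (P Y)) (q Y)"
   unfolding iso_arrow_def inverse_arrows_def using pt qt pq qp by blast
 next
  fix Y Z f assume a: "Y \<in> Obj D" "Z \<in> Obj D" "f \<in> Hom D Y Z"
  show "q Z \<cdot>\<^bsub>D\<^esub> f = omap H (P Y) (P Z) (L (P Y) (P Z) (cj Y Z f)) \<cdot>\<^bsub>D\<^esub> q Y"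
   unfolding Fm(2)[OF a] cjq[OF a] ..
 qed
 let ?e = "\<lambda>A. L (P (oob H A)) A (p (oob H A))"
 have et: "?e A \<in> Hom C (P (oob H A)) A" "omap H (P (oob H A)) A (?e A) = p (oob H A)" if A: "A \<in> Obj C" for A
  using L[OF P[OF Ho[OF A]] A pt[OF Ho[OF A]]] by auto
 have eps: "ordinary_nat_iso C C (ofun_comp ?F H) ofun_id ?e"
  unfolding ordinary_nat_iso_def ofun_id_def ofun_comp_def ofun.simps
 proof (intro conjI ballI)
  fix A assume A: "A \<in> Obj C"
  let ?Y = "oob H A"
  note Y = Ho[OF A] note PY = P[OF Y] note e = et[OF A]
  let ?r = "L A (P ?Y) (q ?Y)"
  have r: "?r \<in> Hom C A (P ?Y)" "omap H A (P ?Y) ?r = q ?Y" using L[OF A PY qt[OF Y]] by auto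
  have "?r \<cdot>\<^bsub>C\<^esub> ?e A = Idn C (P ?Y)"
   by (rule faithful[OF PY PY c(2)[OF PY A PY e(1) r(1)] c(1)[OF PY]])
    (simp add: Hc[OF PY A PY e(1) r(1)] e(2) r(2) Hi[OF PY] qp[OF Y])
  moreover have "?e A \<cdot>\<^bsub>C\<^esub> ?r = Idn C A"
   by (rule faithful[OF A A c(2)[OF A PY A r(1) e(1)] c(1)[OF A]])
    (simp add: Hc[OF A PY A r(1) e(1)] e(2) r(2) Hi[OF A] pq[OF Y])
  ultimately show "iso_arrow C (P ?Y) A (?e A)"
   unfolding iso_arrow_def inverse_arrows_def using e(1) r(1) by blast
 next
  fix A B f assume A: "A \<in> Obj C" and B: "B \<in> Obj C" and f: "f \<in> Hom C A B"
  let ?Y = "oob H A" and ?Z = "oob H B"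
  note Y = Ho[OF A] and Z = Ho[OF B] note PY = P[OF Y] and PZ = P[OF Z]
  note hf = Hm[OF A B f]
  note m = Fm[OF Y Z hf]
  show "?e B \<cdot>\<^bsub>C\<^esub> L (P ?Y) (P ?Z) (cj ?Y ?Z (omap H A B f)) = f \<cdot>\<^bsub>C\<^esub> ?e A"
   by (rule faithful[OF PY B c(2)[OF PY PZ B m(1) et(1)[OF B]] c(2)[OF PY A B et(1)[OF A] f]])
    (simp add: Hc[OF PY PZ B m(1) et(1)[OF B]] Hc[OF PY A B et(1)[OF A] f] m(2) et(2)[OF A] et(2)[OF B] pcj[OF Y Z hf])
 qed
 show ?thesis unfolding equivalent_categories_def using F H eta eps by blast
qed

context smclosed
begin

lemma vfun_eqI:
 fixes F G :: "('a, 'b, 'm) vfun"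
 assumes "fob F = fob G" "\<And>a b. fa C D F a b = fa C D G a b"
 shows "F = G"
proof -
 have "fmap F a b = fmap G a b" for a b using assms(2)[of a b] by (metis c_simps(9))
 then have "fmap F = fmap G" by blast
 then show ?thesis using assms(1) by simp
qed

end

context arity
begin

section \<open>Morphisms of theories\<close>

(* From here on functors between opposites are studied in their own right. *)
declare fa_vop [simp del]

text \<open>Morphisms of relative monads.\<close>

definition relmor :: "('j \<Rightarrow> 'o) \<Rightarrow> ('j \<Rightarrow> ('o, 'm) tarr) \<Rightarrow> ('j \<Rightarrow> 'j \<Rightarrow> ('o, 'm) oper) \<Rightarrow>
  ('j \<Rightarrow> 'o) \<Rightarrow> ('j \<Rightarrow> ('o, 'm) tarr) \<Rightarrow> ('j \<Rightarrow> 'j \<Rightarrow> ('o, 'm) oper) \<Rightarrow> ('j \<Rightarrow> ('o, 'm) tarr) \<Rightarrow> bool" where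
 "relmor S \<eta> ex S' \<eta>' ex' \<alpha> \<longleftrightarrow> (\<forall>b. \<alpha> b \<in> S b \<leadsto> S' b) \<and> (\<forall>b. \<alpha> b ** \<eta> b = \<eta>' b) \<and>
  (\<forall>a b \<Xi> f. f \<in> \<Xi>|>K a \<leadsto> S b \<longrightarrow> \<alpha> b ** ex a b \<Xi> f = ex' a b \<Xi> (\<alpha> b ** f) ** \<Xi>\<rhd>\<alpha> a)"

text \<open>The morphism of theories \<open>M\<close> acts on Kleisli arrows by composition with
\<open>\<alpha>\<close>.\<close>

definition induces :: "('j, 'o, 'm) jtheory \<Rightarrow> ('j, 'o, 'm) jtheory \<Rightarrow> ('j \<Rightarrow> 'j \<Rightarrow> ('o, 'm) tarr) \<Rightarrow> ('j \<Rightarrow> 'j \<Rightarrow> ('o, 'm) tarr) \<Rightarrow>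
  ('j, 'j, 'm) vfun \<Rightarrow> ('j \<Rightarrow> ('o, 'm) tarr) \<Rightarrow> bool" where
 "induces t t' e e' M \<alpha> \<longleftrightarrow> (\<forall>a b. e' a b ** (fa (vop V (thcat t)) (vop V (thcat t')) (vfun_op M) a b\<lhd>(K a)) = \<alpha> b ** e a b)"

abbreviation "opc t \<equiv> vop V (thcat t)"
abbreviation "opf t \<equiv> vfun_op (thfun t)"

lemma presentsD:
 assumes "presents t S e \<eta> ex"
 shows "vcategory V (thcat t)" "klc (opc t) K S e \<eta> ex" "fob (thfun t) = (\<lambda>a. a)" "vl (fa J (opc t) (opf t) a b)"
  "e a b ** (fa J (opc t) (opf t) a b\<lhd>(K a)) = \<eta> b ** eJ a b"
 using assms unfolding presents_def by auto

text \<open>A morphism of theories is a functor between the opposites under \<open>J\<close>; being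
the identity on objects is forced by commutation with the structure functors.\<close>

lemma theory_hom_iff:
 assumes p: "presents t S e \<eta> ex" and p': "presents t' S' e' \<eta>' ex'"
 shows "M \<in> Hom TH t t' \<longleftrightarrow> fob M = (\<lambda>a. a) \<and> vfunctor V (opc t) (opc t') (vfun_op M) \<and>
  (\<forall>a b. fa (opc t) (opc t') (vfun_op M) a b ** fa J (opc t) (opf t) a b = fa J (opc t') (opf t') a b)"
proof -
 note C = presentsD(1)[OF p] and C' = presentsD(1)[OF p']
 note Cop = vcategory_vop[OF C] and C'op = vcategory_vop[OF C']
 have v: "vfunctor V (thcat t) (thcat t') M \<longleftrightarrow> vfunctor V (opc t) (opc t') (vfun_op M)"
  using vfunctor_op[OF C C', of M] vfunctor_op[OF Cop C'op, of "vfun_op M"]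
  by (auto simp: vfunctor_vop_vop[OF C] vfunctor_vop_vop2[OF C'])
 have "vfun_comp V M (thfun t) = thfun t' \<longleftrightarrow> fob M = (\<lambda>a. a) \<and>
  (\<forall>a b. fa (opc t) (opc t') (vfun_op M) a b ** fa J (opc t) (opf t) a b = fa J (opc t') (opf t') a b)"
  if m: "vfunctor V (opc t) (opc t') (vfun_op M)"
 proof -
  have vm: "vl (fa (opc t) (opc t') (vfun_op M) a b)" for a b
   using m[unfolded vfunctor_typed[OF Cop C'op]] by blast
  have op: "vfun_comp V M (thfun t) = thfun t' \<longleftrightarrow> vfun_comp V (vfun_op M) (opf t) = opf t'"
  proof -
   have "vfun_op (vfun_comp V M (thfun t)) = vfun_comp V (vfun_op M) (opf t)"
    by (simp add: vfun_comp_def vfun_op_def)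
   then show ?thesis by (metis vfun_op_op)
  qed
  have fc: "fa J (opc t') (vfun_comp V (vfun_op M) (opf t)) a b = fa (opc t) (opc t') (vfun_op M) a b ** fa J (opc t) (opf t) a b" for a b
   using fa_comp[where C = J and D = "opc t" and E = "opc t'" and F = "opf t" and G = "vfun_op M", OF presentsD(4)[OF p]] vm by (simp add: presentsD(3)[OF p])
  have fo: "fob (vfun_comp V (vfun_op M) (opf t)) = fob (opf t') \<longleftrightarrow> fob M = (\<lambda>a. a)"
   by (simp add: presentsD(3)[OF p] presentsD(3)[OF p'])
  show ?thesis unfolding op
  proof
   assume e: "vfun_comp V (vfun_op M) (opf t) = opf t'"
   show "fob M = (\<lambda>a. a) \<and> (\<forall>a b. fa (opc t) (opc t') (vfun_op M) a b ** fa J (opc t) (opf t) a b = fa J (opc t') (opf t') a b)"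
    using fo fc unfolding e by simp
  next
   assume "fob M = (\<lambda>a. a) \<and> (\<forall>a b. fa (opc t) (opc t') (vfun_op M) a b ** fa J (opc t) (opf t) a b = fa J (opc t') (opf t') a b)"
   then show "vfun_comp V (vfun_op M) (opf t) = opf t'"
    using fo fc by (intro vfun_eqI[of _ _ J "opc t'"]) simp_all
  qed
 qed
 then show ?thesis unfolding Th_def using v by auto
qed

lemma theory_hom_eq:
 assumes p: "presents t S e \<eta> ex" and p': "presents t' S' e' \<eta>' ex'"
  and M: "M \<in> Hom TH t t'" "M' \<in> Hom TH t t'" and r: "induces t t' e e' M \<alpha>" "induces t t' e e' M' \<alpha>"
 shows "M = M'"
proof -
 note h = M[unfolded theory_hom_iff[OF p p']]
 note Cop = vcategory_vop[OF presentsD(1)[OF p]] and C'op = vcategory_vop[OF presentsD(1)[OF p']]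
 have o: "fob M = (\<lambda>a. a)" "fob M' = (\<lambda>a. a)" using h by auto
 have v: "vl (fa (opc t) (opc t') (vfun_op M) a b)" "vl (fa (opc t) (opc t') (vfun_op M') a b)" for a b
  using h unfolding vfunctor_typed[OF Cop C'op] by blast+
 have "fa (opc t) (opc t') (vfun_op M) a b = fa (opc t) (opc t') (vfun_op M') a b" for a b
  by (rule repr_eq[OF klcD(3)[OF presentsD(2)[OF p']]]) (use r v o in \<open>simp_all add: induces_def\<close>)
 then have "vfun_op M = vfun_op M'" by (intro vfun_eqI[of _ _ "opc t" "opc t'"]) (simp_all add: o)
 then show ?thesis by (metis vfun_op_op)
qed

text \<open>Functors between Kleisli categories are families of operations by
\<open>vfunctor_iff\<close>; commutation with the structure functors is compatibility with units, so
that \<open>relmon_morphism\<close> applies.\<close>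

lemma theory_hom_relmor:
 assumes p: "presents t S e \<eta> ex" and p': "presents t' S' e' \<eta>' ex'" and M: "M \<in> Hom TH t t'"
 shows "\<exists>\<alpha>. relmor S \<eta> ex S' \<eta>' ex' \<alpha> \<and> induces t t' e e' M \<alpha>"
proof -
 note h = M[unfolded theory_hom_iff[OF p p']]
 note Cop = vcategory_vop[OF presentsD(1)[OF p]] and C'op = vcategory_vop[OF presentsD(1)[OF p']]
 let ?F = "vfun_op M"
 note k = presentsD(2)[OF p] and k' = presentsD(2)[OF p']
 note rm = klcD(2)[OF k] and rm' = klcD(2)[OF k']
 note [simp] = relmonD(1-3,5-10)[OF rm] relmonD(1-3,5-10)[OF rm'] klcD(6-8)[OF k] klcD(6-8)[OF k'] presentsD(4)[OF p] presentsD(4)[OF p']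
 have o [simp]: "fob M = (\<lambda>a. a)" using h by auto
 have F: "vfunctor V (opc t) (opc t') ?F" and c: "fa (opc t) (opc t') ?F a b ** fa J (opc t) (opf t) a b = fa J (opc t') (opf t') a b" for a b
  using h by auto
 have v [simp]: "vl (fa (opc t) (opc t') ?F a b)" for a b
  using F unfolding vfunctor_typed[OF Cop C'op] by blast
 define \<phi> where "\<phi> a b = natof (vhom (opc t) a b) (K a) (e a b) [] (K a) (e' a b ** (fa (opc t) (opc t') ?F a b\<lhd>(K a)))" for a b
 have n: "natop [] (K a) (S b) (K a) (S' b) (\<phi> a b)" and \<phi>e: "\<phi> a b [vhom (opc t) a b] (e a b) = e' a b ** (fa (opc t) (opc t') ?F a b\<lhd>(K a))" for a b
  unfolding \<phi>_def by (rule natof[OF klcD(3)[OF k]]; simp)+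
 note i = iffD1[OF vfunctor_iff[OF k k' v, of \<phi>], unfolded vfun_op_fob o, OF n \<phi>e F]
 have u: "\<phi> a b \<Xi> (\<eta> b ** f) = \<eta>' b ** f" if f: "vl f" "dm f = \<Xi>|>K a" "cd f = K b" for a b \<Xi> f
 proof (rule natop_eqI[where \<phi> = "\<lambda>\<Xi> f. \<phi> a b \<Xi> (\<eta> b ** f)" and \<psi> = "\<lambda>\<Xi> f. \<eta>' b ** f", OF _ _ repr_eJ])
  show "natop [] (K a) (K b) (K a) (S' b) (\<lambda>\<Xi> f. \<phi> a b \<Xi> (\<eta> b ** f))"
  proof (rule natopI)
   fix \<Xi> \<Delta> w f assume "ctx \<Xi> \<Delta> w" "\<And>A. vl (w A)" "\<And>A. dm (w A) = \<Xi>|>A" "\<And>A. cd (w A) = \<Delta>|>A" "vl f" "dm f = \<Delta>|>K a" "cd f = K b"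
   then show "\<phi> a b \<Xi> (\<eta> b ** f ** w (K a)) = \<phi> a b \<Delta> (\<eta> b ** f) ** []\<rhd>w (K a)"
    using natop_nat[OF n, of \<Xi> \<Delta> w "\<eta> b ** f" a b] by simp
  qed (use natop_tys[OF n] in simp)
  show "natop [] (K a) (K b) (K a) (S' b) (\<lambda>\<Xi> f. \<eta>' b ** f)" by (rule natopI) simp_all
  show "f \<in> \<Xi>|>K a \<leadsto> K b" using f by simp
  let ?f = "fa J (opc t) (opf t) a b"
  have "\<phi> a b [vhom J a b] (\<eta> b ** eJ a b) = \<phi> a b [vhom J a b] (e a b ** (?f\<lhd>(K a)))"
   unfolding presentsD(5)[OF p] ..
  also have "\<dots> = e' a b ** ((fa (opc t) (opc t') ?F a b ** ?f)\<lhd>(K a))"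
   using natop_nat[OF n ctx_arr, of ?f "vhom J a b" "vhom (opc t) a b" "e a b" a b] unfolding \<phi>e by (simp add: presentsD(3)[OF p])
  also have "\<dots> = \<eta>' b ** eJ a b" unfolding c by (rule presentsD(5)[OF p'])
  finally show "\<phi> a b [vhom J a b] (\<eta> b ** eJ a b) = \<eta>' b ** eJ a b" .
 qed
 have x: "\<phi> a d (\<Delta> @ \<Xi>) (ex b d \<Delta> g ** \<Delta>\<rhd>f) = ex' b d \<Delta> (\<phi> b d \<Delta> g) ** \<Delta>\<rhd>\<phi> a b \<Xi> f"
  if "vl f" "dm f = \<Xi>|>K a" "cd f = S b" "vl g" "dm g = \<Delta>|>K b" "cd g = S d" for a b d \<Xi> \<Delta> f g
  by (rule i[THEN conjunct2, rule_format]) (use that in simp_all)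
 obtain \<alpha> where \<alpha>: "\<forall>b. \<alpha> b \<in> S b \<leadsto> S' b" "\<forall>a b \<Xi> f. f \<in> \<Xi>|>K a \<leadsto> S b \<longrightarrow> \<phi> a b \<Xi> f = \<alpha> b ** f"
  "\<forall>b. \<alpha> b ** \<eta> b = \<eta>' b" "\<forall>a b \<Xi> f. f \<in> \<Xi>|>K a \<leadsto> S b \<longrightarrow> \<alpha> b ** ex a b \<Xi> f = ex' a b \<Xi> (\<alpha> b ** f) ** \<Xi>\<rhd>\<alpha> a"
  using relmon_morphism[OF rm rm' n u x] by blast
 have "induces t t' e e' M \<alpha>"
  unfolding induces_def
 proof (intro allI)
  fix a b
  have "e a b \<in> [vhom (opc t) a b]|>K a \<leadsto> S b" by simp
  then show "e' a b ** (fa (opc t) (opc t') ?F a b\<lhd>(K a)) = \<alpha> b ** e a b"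
   unfolding \<phi>e[symmetric] using \<alpha>(2) by blast
 qed
 moreover have "relmor S \<eta> ex S' \<eta>' ex' \<alpha>" unfolding relmor_def using \<alpha>(1,3,4) by blast
 ultimately show ?thesis by blast
qed

lemma relmor_theory_hom:
 assumes p: "presents t S e \<eta> ex" and p': "presents t' S' e' \<eta>' ex'" and g: "relmor S \<eta> ex S' \<eta>' ex' \<alpha>"
 shows "\<exists>M. M \<in> Hom TH t t' \<and> induces t t' e e' M \<alpha>"
proof -
 note Cop = vcategory_vop[OF presentsD(1)[OF p]] and C'op = vcategory_vop[OF presentsD(1)[OF p']]
 note k = presentsD(2)[OF p] and k' = presentsD(2)[OF p']
 note rm = klcD(2)[OF k] and rm' = klcD(2)[OF k']
 note [simp] = relmonD(1-3,5-10)[OF rm] relmonD(1-3,5-10)[OF rm'] klcD(6-8)[OF k] klcD(6-8)[OF k'] presentsD(4)[OF p] presentsD(4)[OF p']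
 have \<alpha> [simp]: "vl (\<alpha> b)" "dm (\<alpha> b) = S b" "cd (\<alpha> b) = S' b" and \<alpha>u: "\<alpha> b ** \<eta> b = \<eta>' b" for b
  using g unfolding relmor_def by auto
 have \<alpha>x: "\<alpha> b ** ex a b \<Xi> f = ex' a b \<Xi> (\<alpha> b ** f) ** \<Xi>\<rhd>\<alpha> a" if "f \<in> \<Xi>|>K a \<leadsto> S b" for a b \<Xi> f
  using g that unfolding relmor_def by blast
 have "\<exists>h. h \<in> vhom (opc t) a b \<leadsto> vhom (opc t') a b \<and> e' a b ** (h\<lhd>(K a)) = \<alpha> b ** e a b" for a b
  by (rule repr_ex[OF klcD(3)[OF k']]) simp
 then obtain h where ht: "h a b \<in> vhom (opc t) a b \<leadsto> vhom (opc t') a b" and he: "e' a b ** (h a b\<lhd>(K a)) = \<alpha> b ** e a b" for a b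
  by metis
 let ?F = "\<lparr>fob = (\<lambda>a. a), fmap = (\<lambda>a b. raw (h a b))\<rparr> :: ('j, 'j, 'm) vfun"
 have h [simp]: "vl (h a b)" "dm (h a b) = vhom (opc t) a b" "cd (h a b) = vhom (opc t') a b" for a b using ht[of a b] by simp_all
 have F: "fa (opc t) (opc t') ?F a b = h a b" for a b
  using mk_raw[OF h(1), of a b] unfolding h(2,3) by (simp add: fa_def)
 have n: "natop [] (K a) (S b) (K a) (S' b) (\<lambda>\<Xi> f. \<alpha> b ** f)" for a b by (rule natopI) simp_all
 have "vfunctor V (opc t) (opc t') ?F"
 proof (subst vfunctor_iff[OF k k', where \<phi> = "\<lambda>a b \<Xi> f. \<alpha> b ** f"])
  show "(\<forall>a. \<alpha> a ** \<eta> a = \<eta>' (fob ?F a)) \<and>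
   (\<forall>a b d \<Xi> \<Delta> f g. f \<in> \<Xi>|>K a \<leadsto> S b \<longrightarrow> g \<in> \<Delta>|>K b \<leadsto> S d \<longrightarrow>
    \<alpha> d ** ex b d \<Delta> g ** \<Delta>\<rhd>f = ex' (fob ?F b) (fob ?F d) \<Delta> (\<alpha> d ** g) ** \<Delta>\<rhd>(\<alpha> b ** f))"
  proof (intro conjI allI impI)
   fix a b d \<Xi> \<Delta> f g assume f: "f \<in> \<Xi>|>K a \<leadsto> S b" and g: "g \<in> \<Delta>|>K b \<leadsto> S d"
   show "\<alpha> d ** ex b d \<Delta> g ** \<Delta>\<rhd>f = ex' (fob ?F b) (fob ?F d) \<Delta> (\<alpha> d ** g) ** \<Delta>\<rhd>(\<alpha> b ** f)"
    using \<alpha>x[OF g, THEN cmp_re, of "\<Delta>\<rhd>f"] f by simp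
  qed (simp add: \<alpha>u)
 qed (simp_all add: F n he)
 moreover have "h a b ** fa J (opc t) (opf t) a b = fa J (opc t') (opf t') a b" for a b
 proof (rule repr_eq[OF klcD(3)[OF k']])
  have "e' a b ** ((h a b ** fa J (opc t) (opf t) a b)\<lhd>(K a)) = (e' a b ** (h a b\<lhd>(K a))) ** (fa J (opc t) (opf t) a b\<lhd>(K a))"
   by (simp add: presentsD(3)[OF p])
  also have "\<dots> = \<alpha> b ** \<eta> b ** eJ a b" unfolding he cmp_assoc presentsD(5)[OF p] ..
  also have "\<dots> = e' a b ** (fa J (opc t') (opf t') a b\<lhd>(K a))"
   unfolding presentsD(5)[OF p'] using \<alpha>u[THEN cmp_re] by simp
  finally show "e' a b ** ((h a b ** fa J (opc t) (opf t) a b)\<lhd>(K a)) = e' a b ** (fa J (opc t') (opf t') a b\<lhd>(K a))" .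
 qed (simp_all add: presentsD(3)[OF p] presentsD(3)[OF p'])
 ultimately have "vfun_op ?F \<in> Hom TH t t'"
  unfolding theory_hom_iff[OF p p'] vfun_op_op F by simp
 moreover have "induces t t' e e' (vfun_op ?F) \<alpha>" unfolding induces_def vfun_op_op F using he by simp
 ultimately show ?thesis by blast
qed

lemma induces_id: "presents t S e \<eta> ex \<Longrightarrow> induces t t e e (Idn TH t) (\<lambda>b. idt (S b))"
 using klcD(6-8)[OF presentsD(2)[of t S e \<eta> ex]]
 by (simp add: induces_def Th_def vfun_id_def vfun_op_def fa_def idt_def[symmetric])

lemma induces_comp:
 assumes p: "presents t S e \<eta> ex" and p': "presents t' S' e' \<eta>' ex'" and p'': "presents t'' S'' e'' \<eta>'' ex''"
  and M: "M \<in> Hom TH t t'" and N: "N \<in> Hom TH t' t''" and r: "induces t t' e e' M \<alpha>" and r': "induces t' t'' e' e'' N \<beta>"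
 shows "induces t t'' e e'' (N \<cdot>\<^bsub>TH\<^esub> M) (\<lambda>b. \<beta> b ** \<alpha> b)"
proof -
 note h = M[unfolded theory_hom_iff[OF p p']] N[unfolded theory_hom_iff[OF p' p'']]
 note Cop = vcategory_vop[OF presentsD(1)[OF p]] and C'op = vcategory_vop[OF presentsD(1)[OF p']] and C''op = vcategory_vop[OF presentsD(1)[OF p'']]
 have o [simp]: "fob M = (\<lambda>a. a)" "fob N = (\<lambda>a. a)" using h by auto
 have v [simp]: "vl (fa (opc t) (opc t') (vfun_op M) a b)" "vl (fa (opc t') (opc t'') (vfun_op N) a b)" for a b
  using h unfolding vfunctor_typed[OF Cop C'op] vfunctor_typed[OF C'op C''op] by blast+
 have op: "vfun_op (N \<cdot>\<^bsub>TH\<^esub> M) = vfun_comp V (vfun_op N) (vfun_op M)"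
  by (simp add: Th_def vfun_op_def vfun_comp_def)
 have c: "fa (opc t) (opc t'') (vfun_comp V (vfun_op N) (vfun_op M)) a b = fa (opc t') (opc t'') (vfun_op N) a b ** fa (opc t) (opc t') (vfun_op M) a b" for a b
  using fa_comp[where C = "opc t" and D = "opc t'" and E = "opc t''" and F = "vfun_op M" and G = "vfun_op N"] by simp
 show ?thesis
  unfolding induces_def op c
 proof (intro allI)
  fix a b
  have "e'' a b ** ((fa (opc t') (opc t'') (vfun_op N) a b ** fa (opc t) (opc t') (vfun_op M) a b)\<lhd>(K a))
   = (e'' a b ** (fa (opc t') (opc t'') (vfun_op N) a b\<lhd>(K a))) ** (fa (opc t) (opc t') (vfun_op M) a b\<lhd>(K a))"
   by simp
  also have "\<dots> = (\<beta> b ** e' a b) ** (fa (opc t) (opc t') (vfun_op M) a b\<lhd>(K a))" using r' unfolding induces_def by simp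
  also have "\<dots> = \<beta> b ** \<alpha> b ** e a b" using r unfolding induces_def cmp_assoc by simp
  finally show "e'' a b ** ((fa (opc t') (opc t'') (vfun_op N) a b ** fa (opc t) (opc t') (vfun_op M) a b)\<lhd>(K a)) = (\<beta> b ** \<alpha> b) ** e a b"
   by simp
 qed
qed

text \<open>\<open>\<alpha>\<close> is recovered from its action on the Kleisli arrow
\<open>rr\<close> out of the arity \<open>i0\<close>.\<close>

lemma induces_unique:
 assumes p: "presents t S e \<eta> ex" and p': "presents t' S' e' \<eta>' ex'" and r: "induces t t' e e' M \<alpha>" "induces t t' e e' M \<beta>"
  and g: "\<And>b. \<alpha> b \<in> S b \<leadsto> S' b" "\<And>b. \<beta> b \<in> S b \<leadsto> S' b"
 shows "\<alpha> = \<beta>"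
proof
 fix b
 note k = presentsD(2)[OF p]
 note [simp] = klcD(6-8)[OF k]
 have e: "\<alpha> b ** e a b = \<beta> b ** e a b" for a using r unfolding induces_def by metis
 obtain h where h: "h \<in> S b \<leadsto> vhom (opc t) i0 b" "e i0 b ** (h\<lhd>(K i0)) = rr (S b)"
  using repr_ex[OF klcD(3)[OF k], of "rr (S b)" "S b" i0 b] by auto
 have "\<alpha> b ** rr (S b) = \<beta> b ** rr (S b)"
  unfolding h(2)[symmetric] using e[of i0, THEN cmp_re, of "h\<lhd>(K i0)"] by simp
 then show "\<alpha> b = \<beta> b" by (rule iso_epi[OF _ rr_simps(7)]) (use g[of b] in simp_all)
qed

lemma relmor_inv:
 assumes rm: "relmon K S \<eta> ex" and rm': "relmon K S' \<eta>' ex'" and g: "relmor S \<eta> ex S' \<eta>' ex' \<alpha>"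
  and \<beta>: "\<And>b. \<beta> b \<in> S' b \<leadsto> S b" "\<And>b. \<beta> b ** \<alpha> b = idt (S b)" "\<And>b. \<alpha> b ** \<beta> b = idt (S' b)"
 shows "relmor S' \<eta>' ex' S \<eta> ex \<beta>"
proof -
 note [simp] = relmonD(1-3,5-10)[OF rm] relmonD(1-3,5-10)[OF rm']
 have \<alpha> [simp]: "vl (\<alpha> b)" "dm (\<alpha> b) = S b" "cd (\<alpha> b) = S' b" and \<alpha>u: "\<alpha> b ** \<eta> b = \<eta>' b" for b
  using g unfolding relmor_def by auto
 have \<alpha>x: "\<alpha> b ** ex a b \<Xi> f = ex' a b \<Xi> (\<alpha> b ** f) ** \<Xi>\<rhd>\<alpha> a" if "f \<in> \<Xi>|>K a \<leadsto> S b" for a b \<Xi> f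
  using g that unfolding relmor_def by blast
 have [simp]: "vl (\<beta> b)" "dm (\<beta> b) = S' b" "cd (\<beta> b) = S b" for b using \<beta>(1)[of b] by simp_all
 note \<beta>r = \<beta>(2,3)[THEN cmp_re]
 show ?thesis
  unfolding relmor_def
 proof (intro conjI allI impI \<beta>(1))
  fix b show "\<beta> b ** \<eta>' b = \<eta> b" unfolding \<alpha>u[symmetric] by (simp add: \<beta>r)
 next
  fix a b \<Xi> f assume f: "f \<in> \<Xi>|>K a \<leadsto> S' b"
  have "\<alpha> b ** ex a b \<Xi> (\<beta> b ** f) = ex' a b \<Xi> f ** \<Xi>\<rhd>\<alpha> a"
   using \<alpha>x[of "\<beta> b ** f" \<Xi> a b] f by (simp add: \<beta>r)
  then have "\<beta> b ** (\<alpha> b ** ex a b \<Xi> (\<beta> b ** f)) ** \<Xi>\<rhd>\<beta> a = \<beta> b ** (ex' a b \<Xi> f ** \<Xi>\<rhd>\<alpha> a) ** \<Xi>\<rhd>\<beta> a"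
   by simp
  then show "\<beta> b ** ex' a b \<Xi> f = ex a b \<Xi> (\<beta> b ** f) ** \<Xi>\<rhd>\<beta> a"
   using f wa_inv[OF \<beta>(3), of a \<Xi>] by (simp add: \<beta>r)
 qed
qed

section \<open>The categories of theories and of monads\<close>

lemma category_Th: "category TH"
proof -
 let ?T = "TH"
 have C: "vcategory V (thcat t)" if "t \<in> Obj ?T" for t using that by (simp add: Th_def is_jtheory_def)
 have T: "vfunctor V (vop V J) (thcat t) (thfun t)" if "t \<in> Obj ?T" for t using that by (simp add: Th_def is_jtheory_def)
 note Jop = vcategory_vop[OF vcat_J]
 have v: "vl (fa C D F a b)" if "vfunctor V C D F" "vcategory V C" "vcategory V D" for C :: "('j, 'o, 'm) vcat" and D :: "('j, 'o, 'm) vcat" and F :: "('j, 'j, 'm) vfun" and a b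
  using that(1)[unfolded vfunctor_typed[OF that(2,3)]] by blast
 have idl: "vfun_comp V (vfun_id V D) F = F" and idr: "vfun_comp V F (vfun_id V C) = F"
  if F: "vfunctor V C D F" and C: "vcategory V C" and D: "vcategory V D" for C :: "('j, 'o, 'm) vcat" and D :: "('j, 'o, 'm) vcat" and F :: "('j, 'j, 'm) vfun"
 proof -
  note vF = v[OF F C D] and vC = v[OF vfunctor_id[OF C] C C] and vD = v[OF vfunctor_id[OF D] D D]
  show "vfun_comp V (vfun_id V D) F = F"
   by (rule vfun_eqI[of _ _ C D]) (simp_all add: fa_comp[where D = D, OF vF vD] fa_id vF)
  show "vfun_comp V F (vfun_id V C) = F"
   by (rule vfun_eqI[of _ _ C D]) (simp_all add: fa_comp[where D = C, OF vC] fa_id vF)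
 qed
 have as: "vfun_comp V (vfun_comp V H G) F = vfun_comp V H (vfun_comp V G F)"
  if F: "vfunctor V A B F" and G: "vfunctor V B C G" and H: "vfunctor V C D H" and c: "vcategory V A" "vcategory V B" "vcategory V C" "vcategory V D"
  for A B C D :: "('j, 'o, 'm) vcat" and F G H :: "('j, 'j, 'm) vfun"
 proof (rule vfun_eqI[of _ _ A D])
  fix a b
  note vF = v[OF F c(1,2)] and vG = v[OF G c(2,3)] and vH = v[OF H c(3,4)]
  note vGF = v[OF vfunctor_comp[OF F G c(1,2,3)] c(1,3)] and vHG = v[OF vfunctor_comp[OF G H c(2,3,4)] c(2,4)]
  have "fa A D (vfun_comp V (vfun_comp V H G) F) a b = fa B D (vfun_comp V H G) (fob F a) (fob F b) ** fa A B F a b"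
   by (rule fa_comp[OF vF vHG])
  also have "\<dots> = fa C D H (fob G (fob F a)) (fob G (fob F b)) ** fa B C G (fob F a) (fob F b) ** fa A B F a b"
   unfolding fa_comp[where D = C, OF vG vH] by simp
  also have "\<dots> = fa A D (vfun_comp V H (vfun_comp V G F)) a b"
   using fa_comp[where D = C and G = H, OF vGF vH] fa_comp[where D = B and G = G, OF vF vG] by simp
  finally show "fa A D (vfun_comp V (vfun_comp V H G) F) a b = fa A D (vfun_comp V H (vfun_comp V G F)) a b" .
 qed simp
 show ?thesis
  unfolding category_def
 proof (intro conjI ballI)
  fix t assume t: "t \<in> Obj ?T"
  show "Idn ?T t \<in> Hom ?T t t"
   using vfunctor_id[OF C[OF t]] idl[OF T[OF t] Jop C[OF t]] by (simp add: Th_def)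
 next
  fix t1 t2 t3 f g assume t: "t1 \<in> Obj ?T" "t2 \<in> Obj ?T" "t3 \<in> Obj ?T" and fg: "f \<in> Hom ?T t1 t2" "g \<in> Hom ?T t2 t3"
  have f: "vfunctor V (thcat t1) (thcat t2) f" "vfun_comp V f (thfun t1) = thfun t2" and g: "vfunctor V (thcat t2) (thcat t3) g" "vfun_comp V g (thfun t2) = thfun t3"
   using fg by (simp_all add: Th_def)
  have "vfun_comp V (vfun_comp V g f) (thfun t1) = thfun t3"
   unfolding as[OF T[OF t(1)] f(1) g(1) Jop C[OF t(1)] C[OF t(2)] C[OF t(3)]] f(2) g(2) ..
  then show "g \<cdot>\<^bsub>?T\<^esub> f \<in> Hom ?T t1 t3"
   using vfunctor_comp[OF f(1) g(1) C[OF t(1)] C[OF t(2)] C[OF t(3)]] by (simp add: Th_def)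
 next
  fix t1 t2 f assume t: "t1 \<in> Obj ?T" "t2 \<in> Obj ?T" and "f \<in> Hom ?T t1 t2"
  then have f: "vfunctor V (thcat t1) (thcat t2) f" by (simp add: Th_def)
  show "f \<cdot>\<^bsub>?T\<^esub> Idn ?T t1 = f" using idr[OF f C[OF t(1)] C[OF t(2)]] by (simp add: Th_def)
  show "Idn ?T t2 \<cdot>\<^bsub>?T\<^esub> f = f" using idl[OF f C[OF t(1)] C[OF t(2)]] by (simp add: Th_def)
 next
  fix t1 t2 t3 t4 f g h assume t: "t1 \<in> Obj ?T" "t2 \<in> Obj ?T" "t3 \<in> Obj ?T" "t4 \<in> Obj ?T" and fgh: "f \<in> Hom ?T t1 t2" "g \<in> Hom ?T t2 t3" "h \<in> Hom ?T t3 t4"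
  have f: "vfunctor V (thcat t1) (thcat t2) f" and g: "vfunctor V (thcat t2) (thcat t3) g" and h: "vfunctor V (thcat t3) (thcat t4) h"
   using fgh by (simp_all add: Th_def)
  show "(h \<cdot>\<^bsub>?T\<^esub> g) \<cdot>\<^bsub>?T\<^esub> f = h \<cdot>\<^bsub>?T\<^esub> (g \<cdot>\<^bsub>?T\<^esub> f)"
   using as[OF f g h C[OF t(1)] C[OF t(2)] C[OF t(3)] C[OF t(4)]] by (simp add: Th_def)
 qed
qed

lemma Mnd_simps:
 "M \<in> Obj MND \<longleftrightarrow> monad M \<and> ary (mfun M)"
 "\<alpha> \<in> Hom MND M N \<longleftrightarrow> mmor M N \<alpha>"
 "Idn MND M = (\<lambda>A. Idn UV (fob (mfun M) A))"
 "\<beta> \<cdot>\<^bsub>MND\<^esub> \<alpha> = (\<lambda>A. \<beta> A \<cdot>\<^bsub>UV\<^esub> \<alpha> A)"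
 by (simp_all add: Mnd_def)

lemma Mnd_HomD:
 assumes M: "monad M" and N: "monad N" and \<alpha>: "mmor M N \<alpha>"
 shows "\<alpha> A \<in> Hom UV (fob (mfun M) A) (fob (mfun N) A)" "una (\<alpha> A) ** Meta M A = Meta N A"
  "f \<in> \<Xi>|>A \<leadsto> fob (mfun M) B \<Longrightarrow> una (\<alpha> B) ** Mex M A B \<Xi> f = Mex N A B \<Xi> (una (\<alpha> B) ** f) ** \<Xi>\<rhd>una (\<alpha> A)"
  "vl (una (\<alpha> A))" "dm (una (\<alpha> A)) = fob (mfun M) A" "cd (una (\<alpha> A)) = fob (mfun N) A"
proof -
 note h = \<alpha>[unfolded vmonad_morphism_iff[OF M N]]
 show t: "\<alpha> A \<in> Hom UV (fob (mfun M) A) (fob (mfun N) A)" for A using h by blast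
 show "una (\<alpha> A) ** Meta M A = Meta N A" using h by blast
 show "f \<in> \<Xi>|>A \<leadsto> fob (mfun M) B \<Longrightarrow> una (\<alpha> B) ** Mex M A B \<Xi> f = Mex N A B \<Xi> (una (\<alpha> B) ** f) ** \<Xi>\<rhd>una (\<alpha> A)"
  using h by blast
 show "vl (una (\<alpha> A))" "dm (una (\<alpha> A)) = fob (mfun M) A" "cd (una (\<alpha> A)) = fob (mfun N) A"
  using una_ty[OF t, of A] by simp_all
qed

lemma una_Idn: "Idn UV A \<in> Hom UV A A" "una (Idn UV A) = idt A"
 unfolding UV_Idn using uar_ty[of "idt A"] una_uar[of "idt A"] by simp_all

lemma category_Mnd: "category MND"
 unfolding category_def
proof (intro conjI ballI)
 fix M assume M: "M \<in> Obj MND"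
 then have m: "monad M" by (simp add: Mnd_simps)
 note [simp] = relmonD(1-3,5-10)[OF vmonad_relmon(1)[OF m]]
 show "Idn MND M \<in> Hom MND M M"
  unfolding Mnd_simps vmonad_morphism_iff[OF m m] una_Idn(2) by (simp add: una_Idn(1))
next
 fix M N P \<alpha> \<beta> assume a: "M \<in> Obj MND" "N \<in> Obj MND" "P \<in> Obj MND" and h: "\<alpha> \<in> Hom MND M N" "\<beta> \<in> Hom MND N P"
 then have m: "monad M" and n: "monad N" and p: "monad P" by (simp_all add: Mnd_simps)
 note h' = h[unfolded Mnd_simps]
 note [simp] = relmonD(1-3,5-10)[OF vmonad_relmon(1)[OF m]] relmonD(1-3,5-10)[OF vmonad_relmon(1)[OF n]]  relmonD(1-3,5-10)[OF vmonad_relmon(1)[OF p]]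
 note [simp] = Mnd_HomD(4-6)[OF m n h'(1)] Mnd_HomD(4-6)[OF n p h'(2)]
 note c = UV_Comp[OF Mnd_HomD(1)[OF n p h'(2)] Mnd_HomD(1)[OF m n h'(1)]]
 show "\<beta> \<cdot>\<^bsub>MND\<^esub> \<alpha> \<in> Hom MND M P"
  unfolding Mnd_simps vmonad_morphism_iff[OF m p] c(2)
 proof (intro conjI allI impI c(1))
  fix A show "(una (\<beta> A) ** una (\<alpha> A)) ** Meta M A = Meta P A"
   unfolding cmp_assoc Mnd_HomD(2)[OF m n h'(1)] Mnd_HomD(2)[OF n p h'(2)] ..
 next
  fix A B \<Xi> f assume f: "f \<in> \<Xi>|>A \<leadsto> fob (mfun M) B"
  then have g: "una (\<alpha> B) ** f \<in> \<Xi>|>A \<leadsto> fob (mfun N) B" by simp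
  show "(una (\<beta> B) ** una (\<alpha> B)) ** Mex M A B \<Xi> f = Mex P A B \<Xi> ((una (\<beta> B) ** una (\<alpha> B)) ** f) ** \<Xi>\<rhd>(una (\<beta> A) ** una (\<alpha> A))"
   unfolding cmp_assoc Mnd_HomD(3)[OF m n h'(1) f]
   using Mnd_HomD(3)[OF n p h'(2) g, THEN cmp_re, of "\<Xi>\<rhd>una (\<alpha> A)"] by simp
 qed
next
 fix M N \<alpha> assume a: "M \<in> Obj MND" "N \<in> Obj MND" and h: "\<alpha> \<in> Hom MND M N"
 then have m: "monad M" and n: "monad N" by (simp_all add: Mnd_simps)
 note h' = h[unfolded Mnd_simps]
 note t = Mnd_HomD(1)[OF m n h'] and [simp] = Mnd_HomD(4-6)[OF m n h']
 have "\<alpha> A \<cdot>\<^bsub>UV\<^esub> Idn UV (fob (mfun M) A) = \<alpha> A" for A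
  by (rule uarr_eqI[OF UV_Comp(1)[OF t una_Idn(1)] t]) (simp add: UV_Comp(2)[OF t una_Idn(1)] una_Idn(2))
 then show "\<alpha> \<cdot>\<^bsub>MND\<^esub> Idn MND M = \<alpha>" unfolding Mnd_simps by blast
 have "Idn UV (fob (mfun N) A) \<cdot>\<^bsub>UV\<^esub> \<alpha> A = \<alpha> A" for A
  by (rule uarr_eqI[OF UV_Comp(1)[OF una_Idn(1) t] t]) (simp add: UV_Comp(2)[OF una_Idn(1) t] una_Idn(2))
 then show "Idn MND N \<cdot>\<^bsub>MND\<^esub> \<alpha> = \<alpha>" unfolding Mnd_simps by blast
next
 fix M N P Q \<alpha> \<beta> \<gamma> assume "M \<in> Obj MND" "N \<in> Obj MND" "P \<in> Obj MND" "Q \<in> Obj MND"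
  and h: "\<alpha> \<in> Hom MND M N" "\<beta> \<in> Hom MND N P" "\<gamma> \<in> Hom MND P Q"
 then have m: "monad M" and n: "monad N" and p: "monad P" and q: "monad Q"
  by (simp_all add: Mnd_simps)
 note h' = h[unfolded Mnd_simps]
 note a = Mnd_HomD(1)[OF m n h'(1)] and b = Mnd_HomD(1)[OF n p h'(2)] and c = Mnd_HomD(1)[OF p q h'(3)]
 have "(\<gamma> A \<cdot>\<^bsub>UV\<^esub> \<beta> A) \<cdot>\<^bsub>UV\<^esub> \<alpha> A = \<gamma> A \<cdot>\<^bsub>UV\<^esub> (\<beta> A \<cdot>\<^bsub>UV\<^esub> \<alpha> A)" for A
  by (rule uarr_eqI[OF UV_Comp(1)[OF UV_Comp(1)[OF c b] a] UV_Comp(1)[OF c UV_Comp(1)[OF b a]]])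
   (simp add: UV_Comp(2)[OF UV_Comp(1)[OF c b] a] UV_Comp(2)[OF c UV_Comp(1)[OF b a]] UV_Comp(2)[OF c b] UV_Comp(2)[OF b a])
 then show "(\<gamma> \<cdot>\<^bsub>MND\<^esub> \<beta>) \<cdot>\<^bsub>MND\<^esub> \<alpha> = \<gamma> \<cdot>\<^bsub>MND\<^esub> (\<beta> \<cdot>\<^bsub>MND\<^esub> \<alpha>)"
  unfolding Mnd_simps by blast
qed

section \<open>The theory of a monad\<close>

definition theory_of :: "('o, 'm) vmonad \<Rightarrow> ('j, 'o, 'm) jtheory" where
 "theory_of M = klthy (\<lambda>a. fob (mfun M) (K a)) (\<lambda>a. Meta M (K a)) (\<lambda>a b. Mex M (K a) (K b))"

abbreviation "evM M \<equiv> (\<lambda>a b. ev (K a) (fob (mfun M) (K b)))"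

text \<open>Determined by \<open>relmor_theory_hom\<close> and \<open>theory_hom_eq\<close>;
functoriality follows from this uniqueness.\<close>

definition theory_of_hom :: "('o, 'm) vmonad \<Rightarrow> ('o, 'm) vmonad \<Rightarrow> ('o \<Rightarrow> ('o, 'm) uarr) \<Rightarrow> ('j, 'j, 'm) vfun" where
 "theory_of_hom M N \<alpha> = (SOME F. F \<in> Hom TH (theory_of M) (theory_of N) \<and> induces (theory_of M) (theory_of N) (evM M) (evM N) F (\<lambda>b. una (\<alpha> (K b))))"

lemma theory_of:
 assumes M: "monad M"
 shows "is_jtheory V J j (theory_of M)" "presents (theory_of M) (\<lambda>a. fob (mfun M) (K a)) (evM M) (\<lambda>a. Meta M (K a)) (\<lambda>a b. Mex M (K a) (K b))"
  "relmon K (\<lambda>a. fob (mfun M) (K a)) (\<lambda>a. Meta M (K a)) (\<lambda>a b. Mex M (K a) (K b))"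
proof -
 show r: "relmon K (\<lambda>a. fob (mfun M) (K a)) (\<lambda>a. Meta M (K a)) (\<lambda>a b. Mex M (K a) (K b))"
  by (rule relmon_restrict[OF vmonad_relmon(1)[OF M]])
 show "is_jtheory V J j (theory_of M)" "presents (theory_of M) (\<lambda>a. fob (mfun M) (K a)) (evM M) (\<lambda>a. Meta M (K a)) (\<lambda>a b. Mex M (K a) (K b))"
  unfolding theory_of_def by (rule klthy[OF r])+
qed

lemma theory_of_hom:
 assumes M: "monad M" and N: "monad N" and \<alpha>: "mmor M N \<alpha>"
 shows "theory_of_hom M N \<alpha> \<in> Hom TH (theory_of M) (theory_of N)" "induces (theory_of M) (theory_of N) (evM M) (evM N) (theory_of_hom M N \<alpha>) (\<lambda>b. una (\<alpha> (K b)))"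
proof -
 have "relmor (\<lambda>a. fob (mfun M) (K a)) (\<lambda>a. Meta M (K a)) (\<lambda>a b. Mex M (K a) (K b))
  (\<lambda>a. fob (mfun N) (K a)) (\<lambda>a. Meta N (K a)) (\<lambda>a b. Mex N (K a) (K b)) (\<lambda>b. una (\<alpha> (K b)))"
  unfolding relmor_def using Mnd_HomD[OF M N \<alpha>] by simp
 from someI_ex[OF relmor_theory_hom[OF theory_of(2)[OF M] theory_of(2)[OF N] this]]
 show "theory_of_hom M N \<alpha> \<in> Hom TH (theory_of M) (theory_of N)" "induces (theory_of M) (theory_of N) (evM M) (evM N) (theory_of_hom M N \<alpha>) (\<lambda>b. una (\<alpha> (K b)))"
  unfolding theory_of_hom_def by auto
qed

abbreviation "theory_functor \<equiv> \<lparr>oob = theory_of, omap = theory_of_hom\<rparr>"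

lemma theory_functor: "ordinary_functor MND TH theory_functor"
 unfolding ordinary_functor_def ofun.simps
proof (intro conjI ballI category_Mnd category_Th)
 fix M assume "M \<in> Obj MND"
 then have m: "monad M" by (simp add: Mnd_simps)
 then show t: "theory_of M \<in> Obj TH" using theory_of(1) by (simp add: Th_def)
 have i: "mmor M M (Idn MND M)"
  using categoryD(1)[OF category_Mnd \<open>M \<in> Obj MND\<close>] by (simp only: Mnd_simps)
 show "theory_of_hom M M (Idn MND M) = Idn TH (theory_of M)"
  by (rule theory_hom_eq[OF theory_of(2)[OF m] theory_of(2)[OF m] theory_of_hom(1)[OF m m i] categoryD(1)[OF category_Th t] theory_of_hom(2)[OF m m i]])
   (simp add: Mnd_simps una_Idn(2) induces_id[OF theory_of(2)[OF m]])
next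
 fix M N \<alpha> assume "M \<in> Obj MND" "N \<in> Obj MND" "\<alpha> \<in> Hom MND M N"
 then show "theory_of_hom M N \<alpha> \<in> Hom TH (theory_of M) (theory_of N)" by (intro theory_of_hom(1)) (simp_all add: Mnd_simps)
next
 fix M N P \<alpha> \<beta> assume a: "M \<in> Obj MND" "N \<in> Obj MND" "P \<in> Obj MND" and h: "\<alpha> \<in> Hom MND M N" "\<beta> \<in> Hom MND N P"
 then have m: "monad M" and n: "monad N" and p: "monad P" by (simp_all add: Mnd_simps)
 note h' = h[unfolded Mnd_simps(2)]
 note c = UV_Comp(2)[OF Mnd_HomD(1)[OF n p h'(2)] Mnd_HomD(1)[OF m n h'(1)]]
 have i: "mmor M P (\<beta> \<cdot>\<^bsub>MND\<^esub> \<alpha>)"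
  using categoryD(2)[OF category_Mnd a h] by (simp only: Mnd_simps(2))
 have t: "theory_of M \<in> Obj TH" "theory_of N \<in> Obj TH" "theory_of P \<in> Obj TH" using theory_of(1) m n p by (simp_all add: Th_def)
 show "theory_of_hom M P (\<beta> \<cdot>\<^bsub>MND\<^esub> \<alpha>) = theory_of_hom N P \<beta> \<cdot>\<^bsub>TH\<^esub> theory_of_hom M N \<alpha>"
 proof (rule theory_hom_eq[OF theory_of(2)[OF m] theory_of(2)[OF p] theory_of_hom(1)[OF m p i] categoryD(2)[OF category_Th t theory_of_hom(1)[OF m n h'(1)] theory_of_hom(1)[OF n p h'(2)]] theory_of_hom(2)[OF m p i]])
  show "induces (theory_of M) (theory_of P) (evM M) (evM P) (theory_of_hom N P \<beta> \<cdot>\<^bsub>TH\<^esub> theory_of_hom M N \<alpha>) (\<lambda>b. una ((\<beta> \<cdot>\<^bsub>MND\<^esub> \<alpha>) (K b)))"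
   unfolding Mnd_simps(4) c
   by (rule induces_comp[OF theory_of(2)[OF m] theory_of(2)[OF n] theory_of(2)[OF p] theory_of_hom(1)[OF m n h'(1)] theory_of_hom(1)[OF n p h'(2)] theory_of_hom(2)[OF m n h'(1)] theory_of_hom(2)[OF n p h'(2)]])
 qed
qed

end

context earity
begin

text \<open>A theory comes from a relative monad, whose extension \<open>T\<close> to the base is a
\<open>\<J>\<close>-ary monad. The comparison \<open>theta\<close> of \<open>S\<close> with the
restriction of \<open>T\<close> is an isomorphism of relative monads and hence induces one of
theories.\<close>

lemma theory_from_monad:
 assumes t: "is_jtheory V J j t"
 shows "\<exists>M p q. M \<in> Obj MND \<and> inverse_arrows TH (theory_of M) t p q"
proof -
 obtain S e \<eta> ex where p: "presents t S e \<eta> ex" using theory_presented[OF t] by blast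
 note rm = klcD(2)[OF presentsD(2)[OF p]]
 interpret R: relext V J j S \<eta> ex by unfold_locales (rule rm)
 let ?M = "mkmonad R.T R.etaT R.bnd"
 note mk = mkmonad[OF R.relmon_T]
 have M: "?M \<in> Obj MND" using mk(1) R.J_ary_T by (simp add: Mnd_simps)
 note k = theory_of[OF mk(1)]
 note kr = k(3)[unfolded mk(2,3)] and kp = k(2)[unfolded mk(2,3)]
 have g: "relmor S \<eta> ex (\<lambda>a. R.T (K a)) (\<lambda>a. R.etaT (K a)) (\<lambda>a b. Mex ?M (K a) (K b)) R.theta"
  unfolding relmor_def
 proof (intro conjI allI impI)
  fix a b \<Xi> f assume f: "f \<in> \<Xi>|>K a \<leadsto> S b"
  then show "R.theta b ** ex a b \<Xi> f = Mex ?M (K a) (K b) \<Xi> (R.theta b ** f) ** \<Xi>\<rhd>R.theta a"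
   using mk(5)[of "R.theta b ** f" \<Xi> "K a" "K b"] R.theta_ex[of f \<Xi> a b] by simp
 qed (simp_all add: R.theta_unit)
 have "\<exists>q. \<forall>b. vl (q b) \<and> dm (q b) = R.T (K b) \<and> cd (q b) = S b \<and> q b ** R.theta b = idt (S b) \<and> R.theta b ** q b = idt (R.T (K b))"
  by (rule choice) (use R.theta_iso in blast)
 then obtain q where q: "vl (q b)" "dm (q b) = R.T (K b)" "cd (q b) = S b" "q b ** R.theta b = idt (S b)" "R.theta b ** q b = idt (R.T (K b))" for b
  by blast
 have gq: "relmor (\<lambda>a. R.T (K a)) (\<lambda>a. R.etaT (K a)) (\<lambda>a b. Mex ?M (K a) (K b)) S \<eta> ex q"
  by (rule relmor_inv[OF rm kr g]) (use q in simp_all)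
 obtain F where F: "F \<in> Hom TH t (theory_of ?M)" "induces t (theory_of ?M) e (\<lambda>a b. ev (K a) (R.T (K b))) F R.theta"
  using relmor_theory_hom[OF p kp g] by blast
 obtain G where G: "G \<in> Hom TH (theory_of ?M) t" "induces (theory_of ?M) t (\<lambda>a b. ev (K a) (R.T (K b))) e G q"
  using relmor_theory_hom[OF kp p gq] by blast
 have ob: "t \<in> Obj TH" "theory_of ?M \<in> Obj TH" using t k(1) by (simp_all add: Th_def)
 have "G \<cdot>\<^bsub>TH\<^esub> F = Idn TH t"
 proof (rule theory_hom_eq[OF p p categoryD(2)[OF category_Th ob(1,2,1) F(1) G(1)] categoryD(1)[OF category_Th ob(1)] _ induces_id[OF p]])
  show "induces t t e e (G \<cdot>\<^bsub>TH\<^esub> F) (\<lambda>b. idt (S b))" using induces_comp[OF p kp p F(1) G(1) F(2) G(2)] by (simp add: q)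
 qed
 moreover have "F \<cdot>\<^bsub>TH\<^esub> G = Idn TH (theory_of ?M)"
 proof (rule theory_hom_eq[OF kp kp categoryD(2)[OF category_Th ob(2,1,2) G(1) F(1)] categoryD(1)[OF category_Th ob(2)] _ induces_id[OF kp]])
  show "induces (theory_of ?M) (theory_of ?M) (\<lambda>a b. ev (K a) (R.T (K b))) (\<lambda>a b. ev (K a) (R.T (K b))) (F \<cdot>\<^bsub>TH\<^esub> G) (\<lambda>b. idt (R.T (K b)))"
   using induces_comp[OF kp p kp G(1) F(1) G(2) F(2)] by (simp add: q)
 qed
 ultimately have "inverse_arrows TH (theory_of ?M) t G F" unfolding inverse_arrows_def using F(1) G(1) by simp
 then show ?thesis using M by blast
qed

lemma Th_equivalent_Mnd: "equivalent_categories TH MND"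
proof (rule equivalent_categoriesI[OF theory_functor])
 fix M N \<alpha> \<beta> assume a: "M \<in> Obj MND" "N \<in> Obj MND" and h: "\<alpha> \<in> Hom MND M N" "\<beta> \<in> Hom MND M N"
  and e: "omap theory_functor M N \<alpha> = omap theory_functor M N \<beta>"
 have m: "monad M" "ary (mfun M)" and n: "monad N" using a by (simp_all add: Mnd_simps)
 note h' = h[unfolded Mnd_simps(2)]
 have "(\<lambda>b. una (\<alpha> (K b))) = (\<lambda>b. una (\<beta> (K b)))"
 proof (rule induces_unique[OF theory_of(2)[OF m(1)] theory_of(2)[OF n] theory_of_hom(2)[OF m(1) n h'(1)]])
  show "induces (theory_of M) (theory_of N) (evM M) (evM N) (theory_of_hom M N \<alpha>) (\<lambda>b. una (\<beta> (K b)))"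
   using theory_of_hom(2)[OF m(1) n h'(2)] e by simp
 qed (use Mnd_HomD(4-6)[OF m(1) n h'(1)] Mnd_HomD(4-6)[OF m(1) n h'(2)] in simp_all)
 then have "una (\<alpha> (K b)) = una (\<beta> (K b))" for b by (rule fun_cong)
 then show "\<alpha> = \<beta>" by (rule morphism_eq[OF m n h'])
next
 fix M N F assume a: "M \<in> Obj MND" "N \<in> Obj MND" and "F \<in> Hom TH (oob theory_functor M) (oob theory_functor N)"
 then have F: "F \<in> Hom TH (theory_of M) (theory_of N)" by simp
 have m: "monad M" "ary (mfun M)" and n: "monad N" using a by (simp_all add: Mnd_simps)
 obtain \<alpha> where g: "relmor (\<lambda>a. fob (mfun M) (K a)) (\<lambda>a. Meta M (K a)) (\<lambda>a b. Mex M (K a) (K b))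
  (\<lambda>a. fob (mfun N) (K a)) (\<lambda>a. Meta N (K a)) (\<lambda>a b. Mex N (K a) (K b)) \<alpha>" and r: "induces (theory_of M) (theory_of N) (evM M) (evM N) F \<alpha>"
  using theory_hom_relmor[OF theory_of(2)[OF m(1)] theory_of(2)[OF n] F] by blast
 obtain \<beta> where \<beta>: "mmor M N \<beta>" "\<And>b. una (\<beta> (K b)) = \<alpha> b"
  using morphism_ext[OF m n, of \<alpha>] g unfolding relmor_def by blast
 have "theory_of_hom M N \<beta> = F"
  by (rule theory_hom_eq[OF theory_of(2)[OF m(1)] theory_of(2)[OF n] theory_of_hom(1)[OF m(1) n \<beta>(1)] F _ r])
   (use theory_of_hom(2)[OF m(1) n \<beta>(1)] \<beta>(2) in simp)
 then show "\<exists>\<beta>. \<beta> \<in> Hom MND M N \<and> omap theory_functor M N \<beta> = F"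
  using \<beta>(1) by (auto simp: Mnd_simps)
next
 fix t assume "t \<in> Obj TH"
 then show "\<exists>M p q. M \<in> Obj MND \<and> inverse_arrows TH (oob theory_functor M) t p q"
  using theory_from_monad by (simp add: Th_def)
qed

end

theorem theorem11p8:
 fixes V :: "('o, 'm) smcc"
  and J :: "('j, 'o, 'm) smvcat"
  and j :: "('j, 'o, 'm) smvfun"
 assumes "symmetric_monoidal_closed V"
  and "system_of_arities V J j"
  and "eleutheric V J j"
 shows "equivalent_categories (Th V J j) (Mnd V J j)"
proof -
 interpret earity V J j by unfold_locales (rule assms)+
 show ?thesis by (rule Th_equivalent_Mnd)
qed

end
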